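(* Let $\lambda_1,\lambda_2\in\mathbb{R}\setminus\{0\}$. There exists $\delta>0$ such that if $\psi_0\in H$ satisfies $\|\psi_0\|<\delta$, then the solution $\psi(t)$ of $$i\partial_t\psi=-\tfrac12\Delta\psi+\lambda_1|\psi|^2\psi+\lambda_2(K\star|\psi|^2)\psi,\qquad x\in\mathbb{R}^3,\qquad \psi(0)=\psi_0,$$ scatters in $H$. More precisely, there exist $\psi_{\pm}\in H$ such that $$\lim_{t\to\pm\infty}\|\psi(t)-e^{it\frac{\Delta}{2}}\psi_\pm\|=0.$$
   Context: $H=H^1(\mathbb{R}^3,\mathbb{C})$ with its usual norm $\|\cdot\|$. $f\mapsto K\star f$ is the Fourier multiplier with symbol $\hat K(\xi)=\frac43\pi\,\frac{2\xi_3^2-\xi_1^2-\xi_2^2}{|\xi|^2}$ (convolution with the dipolar kernel $K(x)=\frac{1-3\cos^2\theta}{|x|^3}$, $\theta$ the angle between $x$ and $(0,0,1)$); it is bounded on $L^p(\mathbb{R}^3)$, $1<p<\infty$. Solutions are the unique (maximal) solutions of the Duhamel formulation, continuous in time with values in $H$ and with $\psi,\nabla\psi\in L^{8/3}_{loc}$ in time with values in $L^4(\mathbb{R}^3)$; local existence and uniqueness in this class is known. *)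

theory Defs
  imports "HOL-Analysis.Analysis"
begin

section \<open>The Hilbert space of square-integrable functions\<close>

definition sq_integrable :: "(real^3 \<Rightarrow> complex) \<Rightarrow> bool" where
  "sq_integrable f \<longleftrightarrow> f \<in> borel_measurable lborel \<and> integrable lborel (\<lambda>x. (cmod (f x))\<^sup>2)"

lemma sq_integrable_measurable[measurable_dest]:
  "sq_integrable f \<Longrightarrow> f \<in> borel_measurable lborel"
  by (simp add: sq_integrable_def)

lemma sq_integrable_zero: "sq_integrable (\<lambda>x. 0)"
  by (simp add: sq_integrable_def)

lemma sq_integrable_bound:
  assumes "sq_integrable f" "sq_integrable g" "h \<in> borel_measurable lborel"
    and "\<And>x. (cmod (h x))\<^sup>2 \<le> C * ((cmod (f x))\<^sup>2 + (cmod (g x))\<^sup>2)"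
  shows "sq_integrable h"
  unfolding sq_integrable_def
proof
  show "integrable lborel (\<lambda>x. (cmod (h x))\<^sup>2)"
  proof (rule Bochner_Integration.integrable_bound)
    show "integrable lborel (\<lambda>x. C * ((cmod (f x))\<^sup>2 + (cmod (g x))\<^sup>2))"
      using assms(1,2) by (auto simp: sq_integrable_def)
    show "AE x in lborel. norm ((cmod (h x))\<^sup>2) \<le> norm (C * ((cmod (f x))\<^sup>2 + (cmod (g x))\<^sup>2))"
      using assms(4) by (auto intro!: order_trans[OF _ abs_ge_self])
  qed (use assms(3) in measurable)
qed (fact assms(3))

lemma cmod_add_sq_le: "(cmod (a + b))\<^sup>2 \<le> 2 * ((cmod a)\<^sup>2 + (cmod b)\<^sup>2)"
proof -
  have "(cmod (a + b))\<^sup>2 \<le> (cmod a + cmod b)\<^sup>2"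
    by (intro power_mono norm_triangle_ineq) auto
  also have "\<dots> \<le> 2 * ((cmod a)\<^sup>2 + (cmod b)\<^sup>2)"
    using sum_squares_bound[of "cmod a" "cmod b"] by (simp add: power2_sum)
  finally show ?thesis .
qed

lemma sq_integrable_add:
  assumes f: "sq_integrable f" and g: "sq_integrable g"
  shows "sq_integrable (\<lambda>x. f x + g x)"
  by (rule sq_integrable_bound[OF f g _ cmod_add_sq_le]) (use f g in measurable)

lemma sq_integrable_cmult:
  assumes f: "sq_integrable f"
  shows "sq_integrable (\<lambda>x. c * f x)"
  by (rule sq_integrable_bound[OF f sq_integrable_zero, where C = "(cmod c)\<^sup>2"])
     (use f in \<open>measurable, auto simp: norm_mult power_mult_distrib\<close>)

lemma sq_integrable_scaleR: "sq_integrable f \<Longrightarrow> sq_integrable (\<lambda>x. r *\<^sub>R f x)"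
  using sq_integrable_cmult[of f "complex_of_real r"] by (simp add: scaleR_conv_of_real)

lemma sq_integrable_uminus: "sq_integrable f \<Longrightarrow> sq_integrable (\<lambda>x. - f x)"
  using sq_integrable_cmult[of f "-1"] by simp

lemma sq_integrable_diff:
  "sq_integrable f \<Longrightarrow> sq_integrable g \<Longrightarrow> sq_integrable (\<lambda>x. f x - g x)"
  using sq_integrable_add[of f "\<lambda>x. - g x"] sq_integrable_uminus[of g] by simp

lemma sq_integrable_inner:
  assumes f: "sq_integrable f" and g: "sq_integrable g"
  shows "integrable lborel (\<lambda>x. f x \<bullet> g x)"
proof (rule Bochner_Integration.integrable_bound)
  show "integrable lborel (\<lambda>x. (cmod (f x))\<^sup>2 + (cmod (g x))\<^sup>2)"
    using f g by (auto simp: sq_integrable_def)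
  show "(\<lambda>x. f x \<bullet> g x) \<in> borel_measurable lborel"
    using f g by measurable
  show "AE x in lborel. norm (f x \<bullet> g x) \<le> norm ((cmod (f x))\<^sup>2 + (cmod (g x))\<^sup>2)"
  proof (rule AE_I2)
    fix x
    have "\<bar>f x \<bullet> g x\<bar> \<le> cmod (f x) * cmod (g x)"
      by (rule Cauchy_Schwarz_ineq2)
    also have "\<dots> \<le> (cmod (f x))\<^sup>2 + (cmod (g x))\<^sup>2"
      using sum_squares_bound[of "cmod (f x)" "cmod (g x)"]
        mult_nonneg_nonneg[OF norm_ge_zero[of "f x"] norm_ge_zero[of "g x"]] by linarith
    finally show "norm (f x \<bullet> g x) \<le> norm ((cmod (f x))\<^sup>2 + (cmod (g x))\<^sup>2)"
      by simp
  qed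
qed

quotient_type L2 = "real^3 \<Rightarrow> complex" / partial:
  "\<lambda>f g. sq_integrable f \<and> sq_integrable g \<and> (AE x in lborel. f x = g x)"
proof (rule part_equivpI)
  show "\<exists>f. sq_integrable f \<and> sq_integrable f \<and> (AE x in lborel. f x = f x)"
    using sq_integrable_zero by auto
qed (auto simp: symp_def transp_def)

instantiation L2 :: real_inner
begin

lift_definition zero_L2 :: L2 is "\<lambda>x. 0"
  by (simp add: sq_integrable_zero)

lift_definition plus_L2 :: "L2 \<Rightarrow> L2 \<Rightarrow> L2" is "\<lambda>f g x. f x + g x"
  by (auto intro: sq_integrable_add)

lift_definition minus_L2 :: "L2 \<Rightarrow> L2 \<Rightarrow> L2" is "\<lambda>f g x. f x - g x"
  by (auto intro: sq_integrable_diff)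

lift_definition uminus_L2 :: "L2 \<Rightarrow> L2" is "\<lambda>f x. - f x"
  by (auto intro: sq_integrable_uminus)

lift_definition scaleR_L2 :: "real \<Rightarrow> L2 \<Rightarrow> L2" is "\<lambda>r f x. r *\<^sub>R f x"
  by (auto intro: sq_integrable_scaleR)

lift_definition inner_L2 :: "L2 \<Rightarrow> L2 \<Rightarrow> real" is "\<lambda>f g. \<integral>x. f x \<bullet> g x \<partial>lborel"
  by (rule integral_cong_AE) (auto intro!: borel_measurable_inner dest: sq_integrable_measurable)

definition norm_L2 :: "L2 \<Rightarrow> real" where "norm_L2 f = sqrt (f \<bullet> f)"
definition sgn_L2 :: "L2 \<Rightarrow> L2" where "sgn_L2 f = inverse (norm f) *\<^sub>R f"
definition dist_L2 :: "L2 \<Rightarrow> L2 \<Rightarrow> real" where "dist_L2 f g = norm (f - g)"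
definition uniformity_L2 :: "(L2 \<times> L2) filter" where
  "uniformity_L2 = (INF e\<in>{0 <..}. principal {(x, y). dist x y < e})"
definition open_L2 :: "L2 set \<Rightarrow> bool" where
  "open_L2 U \<longleftrightarrow> (\<forall>x\<in>U. eventually (\<lambda>(x', y). x' = x \<longrightarrow> y \<in> U) uniformity)"

instance
proof
  fix f g h :: L2 and r s :: real
  show "f + g + h = f + (g + h)"
    by transfer (auto intro!: sq_integrable_add simp: add.assoc)
  show "f + g = g + f"
    by transfer (auto intro!: sq_integrable_add simp: add.commute)
  show "0 + f = f"
    by transfer auto
  show "- f + f = 0"
    by transfer (auto intro!: sq_integrable_zero)
  show "f - g = f + - g"
    by transfer (auto intro!: sq_integrable_diff)
  show "r *\<^sub>R (f + g) = r *\<^sub>R f + r *\<^sub>R g"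
    by transfer (auto intro!: sq_integrable_scaleR sq_integrable_add simp: scaleR_add_right)
  show "(r + s) *\<^sub>R f = r *\<^sub>R f + s *\<^sub>R f"
    by transfer (auto intro!: sq_integrable_scaleR sq_integrable_add simp: scaleR_add_left)
  show "r *\<^sub>R s *\<^sub>R f = (r * s) *\<^sub>R f"
    by transfer (auto intro!: sq_integrable_scaleR)
  show "1 *\<^sub>R f = f"
    by transfer auto
  show "f \<bullet> g = g \<bullet> f"
    by transfer (simp add: inner_commute)
  show "(f + g) \<bullet> h = f \<bullet> h + g \<bullet> h"
    by transfer (simp add: inner_add_left sq_integrable_inner)
  show "(r *\<^sub>R f) \<bullet> g = r * (f \<bullet> g)"
    by transfer simp
  show "0 \<le> f \<bullet> f"
    by transfer simp
  show "f \<bullet> f = 0 \<longleftrightarrow> f = 0"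
  proof (transfer)
    fix f :: "real^3 \<Rightarrow> complex"
    assume f: "sq_integrable f \<and> sq_integrable f \<and> (AE x in lborel. f x = f x)"
    then have "(\<integral>x. f x \<bullet> f x \<partial>lborel) = 0 \<longleftrightarrow> (AE x in lborel. f x \<bullet> f x = 0)"
      by (intro integral_nonneg_eq_0_iff_AE sq_integrable_inner) auto
    with f show "(\<integral>x. f x \<bullet> f x \<partial>lborel) = 0 \<longleftrightarrow>
        (sq_integrable f \<and> sq_integrable (\<lambda>x. 0) \<and> (AE x in lborel. f x = 0))"
      by (simp add: sq_integrable_zero)
  qed
qed (rule norm_L2_def sgn_L2_def dist_L2_def uniformity_L2_def open_L2_def)+

end

text \<open>
  \<open>rep_L2 f\<close> is some Borel measurable representative of \<open>f\<close>, and \<open>L2_of\<close> sends a function to its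
  class; functions that are not square-integrable are sent to the junk value \<open>0\<close>.
\<close>

definition L2_of :: "(real^3 \<Rightarrow> complex) \<Rightarrow> L2" where
  "L2_of f = (if sq_integrable f then abs_L2 f else 0)"

lemma sq_integrable_rep[simp, intro]: "sq_integrable (rep_L2 f)"
  using Quotient3_rep_reflp[OF Quotient3_L2, of f] by auto

lemma L2_of_rep[simp]: "L2_of (rep_L2 f) = f"
  using Quotient3_abs_rep[OF Quotient3_L2, of f] by (simp add: L2_of_def)

lemma L2_of_eq_iff:
  "sq_integrable f \<Longrightarrow> sq_integrable g \<Longrightarrow> L2_of f = L2_of g \<longleftrightarrow> (AE x in lborel. f x = g x)"
  using Quotient3_rel[OF Quotient3_L2, of f g] by (auto simp: L2_of_def)

lemma rep_L2_of:
  assumes "sq_integrable f" shows "AE x in lborel. rep_L2 (L2_of f) x = f x"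
  using L2_of_eq_iff[of "rep_L2 (L2_of f)" f] assms by simp

lemma L2_of_add:
  "sq_integrable f \<Longrightarrow> sq_integrable g \<Longrightarrow> L2_of (\<lambda>x. f x + g x) = L2_of f + L2_of g"
  by (simp add: L2_of_def sq_integrable_add plus_L2.abs_eq)

lemma L2_of_diff:
  "sq_integrable f \<Longrightarrow> sq_integrable g \<Longrightarrow> L2_of (\<lambda>x. f x - g x) = L2_of f - L2_of g"
  by (simp add: L2_of_def sq_integrable_diff minus_L2.abs_eq)

lemma L2_of_scaleR:
  "sq_integrable f \<Longrightarrow> L2_of (\<lambda>x. r *\<^sub>R f x) = r *\<^sub>R L2_of f"
  by (simp add: L2_of_def sq_integrable_scaleR scaleR_L2.abs_eq)

lemma norm_L2_of:
  assumes "sq_integrable f"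
  shows "(norm (L2_of f))\<^sup>2 = (\<integral>x. (cmod (f x))\<^sup>2 \<partial>lborel)"
proof -
  have "(norm (L2_of f))\<^sup>2 = L2_of f \<bullet> L2_of f"
    by (rule power2_norm_eq_inner)
  also have "\<dots> = (\<integral>x. f x \<bullet> f x \<partial>lborel)"
    using assms by (simp only: L2_of_def if_True inner_L2.abs_eq simp_thms AE_I2)
  finally show ?thesis
    by (simp only: dot_square_norm)
qed

lemma L2_cases: obtains g where "sq_integrable g" "f = L2_of g"
  by (metis L2_of_rep sq_integrable_rep)

lemma tendsto_L2I:
  assumes F: "\<And>n. sq_integrable (F n)" and f: "sq_integrable f"
    and lim: "(\<lambda>n. \<integral>x. (cmod (F n x - f x))\<^sup>2 \<partial>lborel) \<longlonglongrightarrow> 0"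
  shows "(\<lambda>n. L2_of (F n)) \<longlonglongrightarrow> L2_of f"
proof -
  have "(\<lambda>n. sqrt ((norm (L2_of (F n) - L2_of f))\<^sup>2)) \<longlonglongrightarrow> sqrt 0"
    using lim F f
    by (intro tendsto_real_sqrt)
       (simp add: norm_L2_of sq_integrable_diff flip: L2_of_diff)
  then show ?thesis
    by (simp add: tendsto_norm_zero_iff LIM_zero_iff)
qed

lemma nn_integral_L2:
  assumes "sq_integrable f"
  shows "(\<integral>\<^sup>+x. ennreal ((cmod (f x))\<^sup>2) \<partial>lborel) = ennreal ((norm (L2_of f))\<^sup>2)"
  using assms unfolding norm_L2_of[OF assms]
  by (intro nn_integral_eq_integral) (auto simp: sq_integrable_def)

lemma sq_integrableI_nn:
  assumes [measurable]: "f \<in> borel_measurable lborel"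
    and "(\<integral>\<^sup>+x. ennreal ((cmod (f x))\<^sup>2) \<partial>lborel) < \<infinity>"
  shows "sq_integrable f"
  using assms unfolding sq_integrable_def by (auto intro!: integrableI_bounded)

subsection \<open>Completeness\<close>

lemma L2_fast_Cauchy_convergent:
  fixes X :: "nat \<Rightarrow> L2"
  assumes X: "\<And>k m. k \<le> m \<Longrightarrow> norm (X m - X k) \<le> (1/4)^k"
  shows "convergent X"
proof -
  define F where "F k = rep_L2 (X k)" for k
  have F[simp]: "sq_integrable (F k)" for k
    by (simp add: F_def)
  have [measurable]: "F k \<in> borel_measurable lborel" for k
    using F by (rule sq_integrable_measurable)
  have dF: "(\<integral>\<^sup>+x. ennreal ((cmod (F m x - F k x))\<^sup>2) \<partial>lborel) \<le> ennreal ((1/16)^k)" if "k \<le> m" for k m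
  proof -
    have "(\<integral>\<^sup>+x. ennreal ((cmod (F m x - F k x))\<^sup>2) \<partial>lborel) = ennreal ((norm (X m - X k))\<^sup>2)"
      by (subst nn_integral_L2) (simp_all add: sq_integrable_diff L2_of_diff, simp add: F_def)
    also have "(norm (X m - X k))\<^sup>2 \<le> ((1/4)^k)\<^sup>2"
      using X[OF that] by (intro power_mono) auto
    also have "((1/4)^k)\<^sup>2 = (1/16::real)^k"
      by (simp add: power2_eq_square flip: power_mult_distrib)
    finally show ?thesis
      by (simp add: ennreal_leI)
  qed
  have "(\<integral>\<^sup>+x. (\<Sum>k. ennreal (4^k * (cmod (F (Suc k) x - F k x))\<^sup>2)) \<partial>lborel) =
      (\<Sum>k. \<integral>\<^sup>+x. ennreal (4^k * (cmod (F (Suc k) x - F k x))\<^sup>2) \<partial>lborel)"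
    by (rule nn_integral_suminf) measurable
  also have "\<dots> \<le> (\<Sum>k. ennreal ((1/4)^k))"
  proof (rule suminf_le)
    fix k
    have "(\<integral>\<^sup>+x. ennreal (4^k * (cmod (F (Suc k) x - F k x))\<^sup>2) \<partial>lborel) =
        ennreal (4^k) * (\<integral>\<^sup>+x. ennreal ((cmod (F (Suc k) x - F k x))\<^sup>2) \<partial>lborel)"
      by (subst nn_integral_cmult[symmetric]) (auto simp: ennreal_mult)
    also have "\<dots> \<le> ennreal (4^k) * ennreal ((1/16)^k)"
      by (intro mult_left_mono dF) auto
    also have "\<dots> = ennreal ((1/4)^k)"
      by (simp add: ennreal_mult[symmetric] flip: power_mult_distrib)
    finally show "(\<integral>\<^sup>+x. ennreal (4^k * (cmod (F (Suc k) x - F k x))\<^sup>2) \<partial>lborel) \<le> ennreal ((1/4)^k)" .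
  qed auto
  also have "\<dots> < \<infinity>"
    by (subst suminf_ennreal2) (auto intro: summable_geometric)
  finally have fin: "AE x in lborel. (\<Sum>k. ennreal (4^k * (cmod (F (Suc k) x - F k x))\<^sup>2)) \<noteq> \<infinity>"
    by (intro nn_integral_PInf_AE) auto
  have pointwise: "convergent (\<lambda>k. F k x)"
    if elim: "(\<Sum>k. ennreal (4^k * (cmod (F (Suc k) x - F k x))\<^sup>2)) \<noteq> \<infinity>" for x
  proof -
    define C where "C = enn2real (\<Sum>k. ennreal (4^k * (cmod (F (Suc k) x - F k x))\<^sup>2))"
    have C: "4^k * (cmod (F (Suc k) x - F k x))\<^sup>2 \<le> C" for k
    proof -
      have "ennreal (4^k * (cmod (F (Suc k) x - F k x))\<^sup>2)
          \<le> (\<Sum>k. ennreal (4^k * (cmod (F (Suc k) x - F k x))\<^sup>2))"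
        by (rule order_trans[OF _ sum_le_suminf[OF summableI, of "{k}"]]) simp_all
      also have "\<dots> = ennreal C"
        using elim by (simp add: C_def less_top)
      finally show ?thesis
        by (subst (asm) ennreal_le_iff) (auto simp: C_def)
    qed
    have "norm (F (Suc k) x - F k x) \<le> sqrt C * (1/2)^k" for k
    proof -
      have *: "((2::real)^k)\<^sup>2 = 4^k"
        by (simp add: power2_eq_square flip: power_mult_distrib)
      have "(2^k * cmod (F (Suc k) x - F k x))\<^sup>2 \<le> C"
        using C[of k] by (simp only: power_mult_distrib *)
      then have "2^k * cmod (F (Suc k) x - F k x) \<le> sqrt C"
        by (rule real_le_rsqrt)
      then show ?thesis
        by (simp add: power_one_over pos_le_divide_eq mult.commute)
    qed
    note bound = this
    have "summable (\<lambda>k. sqrt C * (1/2)^k)"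
      by (rule summable_mult, rule summable_geometric) simp
    then have "summable (\<lambda>k. F (Suc k) x - F k x)"
      by (rule summable_comparison_test') (rule bound)
    then have "convergent (\<lambda>n. \<Sum>k<n. F (Suc k) x - F k x)"
      by (simp add: summable_iff_convergent)
    then have "convergent (\<lambda>n. F n x - F 0 x)"
      by (simp only: sum_lessThan_telescope[of "\<lambda>k. F k x"])
    then show ?thesis
      by (simp add: convergent_diff_const_right_iff)
  qed
  have conv: "AE x in lborel. convergent (\<lambda>k. F k x)"
    using fin by (rule eventually_mono) (rule pointwise)
  define f where "f x = lim (\<lambda>k. F k x)" for x
  have [measurable]: "f \<in> borel_measurable lborel"
    unfolding f_def by measurable
  have fF: "(\<integral>\<^sup>+x. ennreal ((cmod (f x - F k x))\<^sup>2) \<partial>lborel) \<le> ennreal ((1/16)^k)" for k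
  proof -
    have "(\<integral>\<^sup>+x. ennreal ((cmod (f x - F k x))\<^sup>2) \<partial>lborel)
        = (\<integral>\<^sup>+x. liminf (\<lambda>m. ennreal ((cmod (F m x - F k x))\<^sup>2)) \<partial>lborel)"
    proof (rule nn_integral_cong_AE, rule eventually_mono[OF conv])
      fix x assume "convergent (\<lambda>k. F k x)"
      then have "(\<lambda>m. F m x) \<longlonglongrightarrow> f x"
        by (simp add: f_def convergent_LIMSEQ_iff)
      then have "(\<lambda>m. ennreal ((cmod (F m x - F k x))\<^sup>2)) \<longlonglongrightarrow> ennreal ((cmod (f x - F k x))\<^sup>2)"
        by (intro tendsto_intros)
      then show "ennreal ((cmod (f x - F k x))\<^sup>2) = liminf (\<lambda>m. ennreal ((cmod (F m x - F k x))\<^sup>2))"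
        by (intro lim_imp_Liminf[symmetric]) auto
    qed
    also have "\<dots> \<le> liminf (\<lambda>m. \<integral>\<^sup>+x. ennreal ((cmod (F m x - F k x))\<^sup>2) \<partial>lborel)"
      by (rule nn_integral_liminf) measurable
    also have "\<dots> \<le> liminf (\<lambda>m. ennreal ((1/16)^k))"
      by (rule Liminf_mono) (use dF in \<open>auto simp: eventually_sequentially\<close>)
    finally show ?thesis
      by (simp add: Liminf_const)
  qed
  have diff: "sq_integrable (\<lambda>x. f x - F k x)" for k
    by (rule sq_integrableI_nn) (auto intro: le_less_trans[OF fF])
  have f: "sq_integrable f"
    using sq_integrable_add[OF diff[of 0] F[of 0]] by simp
  have "X \<longlonglongrightarrow> L2_of f"
  proof (rule LIM_zero_cancel, rule tendsto_norm_zero_cancel)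
    show "(\<lambda>k. norm (X k - L2_of f)) \<longlonglongrightarrow> 0"
    proof (rule tendsto_sandwich[of "\<lambda>_. 0" _ _ "\<lambda>k. (1/4)^k"])
      have "norm (X k - L2_of f) \<le> (1/4)^k" for k
      proof -
        have "ennreal ((norm (L2_of f - X k))\<^sup>2) \<le> ennreal ((1/16)^k)"
          using fF[of k] nn_integral_L2[OF diff, of k] by (simp add: L2_of_diff f F_def)
        then have "(norm (L2_of f - X k))\<^sup>2 \<le> (1/16)^k"
          by (subst (asm) ennreal_le_iff) auto
        also have "(1/16::real)^k = ((1/4)^k)\<^sup>2"
          by (simp add: power2_eq_square flip: power_mult_distrib)
        finally have "norm (L2_of f - X k) \<le> (1/4)^k"
          by (rule power2_le_imp_le) simp
        then show ?thesis
          by (simp add: norm_minus_commute)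
      qed
      then show "\<forall>\<^sub>F k in sequentially. norm (X k - L2_of f) \<le> (1/4)^k"
        by simp
      show "(\<lambda>k. (1/4::real)^k) \<longlonglongrightarrow> 0"
        by (rule LIMSEQ_realpow_zero) auto
    qed auto
  qed
  then show ?thesis
    by (auto simp: convergent_def)
qed

instance L2 :: banach
proof
  fix X :: "nat \<Rightarrow> L2" assume X: "Cauchy X"
  have "\<exists>N. \<forall>m\<ge>N. \<forall>n\<ge>N. norm (X m - X n) < (1/4)^k" for k
    using X by (intro CauchyD) auto
  then obtain N where N: "\<And>k m n. N k \<le> m \<Longrightarrow> N k \<le> n \<Longrightarrow> norm (X m - X n) < (1/4)^k"
    by metis
  define r where "r k = (\<Sum>i\<le>k. N i) + k" for k
  have r: "strict_mono r"
    by (simp add: strict_mono_Suc_iff r_def)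
  have Nr: "N k \<le> r k" for k
    unfolding r_def by (intro trans_le_add1 member_le_sum) auto
  have "convergent (X \<circ> r)"
  proof (rule L2_fast_Cauchy_convergent)
    fix k m :: nat assume "k \<le> m"
    then have "N k \<le> r m"
      using Nr[of k] strict_mono_less_eq[OF r, of k m] by linarith
    then show "norm ((X \<circ> r) m - (X \<circ> r) k) \<le> (1/4)^k"
      using N[of k "r m" "r k"] Nr[of k] by simp
  qed
  then obtain L where "(X \<circ> r) \<longlonglongrightarrow> L"
    by (auto simp: convergent_def)
  have "X \<longlonglongrightarrow> L"
  proof (rule metric_LIMSEQ_I)
    fix e :: real assume e: "0 < e"
    obtain M where M: "\<And>m n. M \<le> m \<Longrightarrow> M \<le> n \<Longrightarrow> dist (X m) (X n) < e/2"
      using metric_CauchyD[OF X, of "e/2"] e by auto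
    obtain K where K: "\<And>k. K \<le> k \<Longrightarrow> dist (X (r k)) L < e/2"
      using metric_LIMSEQ_D[OF \<open>(X \<circ> r) \<longlonglongrightarrow> L\<close>, of "e/2"] e by auto
    show "\<exists>no. \<forall>n\<ge>no. dist (X n) L < e"
    proof (intro exI[of _ M] allI impI)
      fix n assume "M \<le> n"
      moreover have "M \<le> r (max M K)"
        using seq_suble[OF r, of "max M K"] by linarith
      ultimately show "dist (X n) L < e"
        using M[of n "r (max M K)"] K[of "max M K"] dist_triangle[of "X n" L "X (r (max M K))"]
        by simp
    qed
  qed
  then show "convergent X"
    by (auto simp: convergent_def)
qed

subsection \<open>Separability\<close>

lemma tendsto_L2_dominated:
  assumes F[measurable]: "\<And>n. F n \<in> borel_measurable lborel"
    and f[measurable]: "f \<in> borel_measurable lborel"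
    and w: "integrable lborel (\<lambda>x. (w x)\<^sup>2)"
    and bound: "\<And>n x. cmod (F n x) \<le> w x" "\<And>x. cmod (f x) \<le> w x"
    and lim: "\<And>x. (\<lambda>n. F n x) \<longlonglongrightarrow> f x"
  shows "(\<lambda>n. L2_of (F n)) \<longlonglongrightarrow> L2_of f"
proof -
  have sq: "sq_integrable g" if "g \<in> borel_measurable lborel" "\<And>x. cmod (g x) \<le> w x" for g
    unfolding sq_integrable_def
  proof
    show "integrable lborel (\<lambda>x. (cmod (g x))\<^sup>2)"
    proof (rule Bochner_Integration.integrable_bound[OF w])
      show "AE x in lborel. norm ((cmod (g x))\<^sup>2) \<le> norm ((w x)\<^sup>2)"
        using that(2) by (intro AE_I2) (simp add: power_mono)
    qed (use that(1) in measurable)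
  qed (fact that)
  have "(\<lambda>n. \<integral>x. (cmod (F n x - f x))\<^sup>2 \<partial>lborel) \<longlonglongrightarrow> (\<integral>x. 0 \<partial>(lborel :: (real^3) measure))"
  proof (rule integral_dominated_convergence[where w = "\<lambda>x. 4 * (w x)\<^sup>2"])
    show "integrable lborel (\<lambda>x. 4 * (w x)\<^sup>2)"
      using w by simp
    show "AE x in lborel. (\<lambda>n. (cmod (F n x - f x))\<^sup>2) \<longlonglongrightarrow> 0"
    proof (rule AE_I2)
      fix x
      have "(\<lambda>n. (cmod (F n x - f x))\<^sup>2) \<longlonglongrightarrow> (cmod (f x - f x))\<^sup>2"
        by (intro tendsto_intros lim)
      then show "(\<lambda>n. (cmod (F n x - f x))\<^sup>2) \<longlonglongrightarrow> 0"
        by simp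
    qed
    show "AE x in lborel. norm ((cmod (F n x - f x))\<^sup>2) \<le> 4 * (w x)\<^sup>2" for n
    proof (rule AE_I2)
      fix x
      have "cmod (F n x - f x) \<le> 2 * w x"
        using norm_triangle_ineq4[of "F n x" "f x"] bound(1)[of n x] bound(2)[of x] by linarith
      then have "(cmod (F n x - f x))\<^sup>2 \<le> (2 * w x)\<^sup>2"
        by (intro power_mono) auto
      then show "norm ((cmod (F n x - f x))\<^sup>2) \<le> 4 * (w x)\<^sup>2"
        by (simp add: power_mult_distrib)
    qed
  qed measurable
  then show ?thesis
    by (intro tendsto_L2I) (simp_all add: sq F f bound)
qed

lemma sq_integrable_indicator:
  assumes [measurable]: "A \<in> sets borel" and fin: "emeasure lborel A < \<infinity>"
  shows "sq_integrable (\<lambda>x. c * indicator A x)"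
    and "integrable lborel (\<lambda>x. (r * indicator A x :: real)\<^sup>2)"
proof -
  have "integrable lborel (\<lambda>x. indicator A x :: real)"
    using fin by (intro integrable_real_indicator) auto
  then have *: "integrable lborel (\<lambda>x. r\<^sup>2 * indicator A x :: real)" for r
    by (rule integrable_mult_right)
  have "(r * indicator A x)\<^sup>2 = r\<^sup>2 * indicator A x" for r :: real and x
    by (simp split: split_indicator)
  then show "integrable lborel (\<lambda>x. (r * indicator A x :: real)\<^sup>2)"
    using *[of r] by simp
  have "(cmod (c * indicator A x))\<^sup>2 = (cmod c)\<^sup>2 * indicator A x" for x
    by (simp split: split_indicator)
  then show "sq_integrable (\<lambda>x. c * indicator A x)"
    using *[of "cmod c"] by (simp add: sq_integrable_def)
qed

lemma cmod_mult_indicator: "cmod (c * indicator A x) = cmod c * indicator A x"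
  by (simp split: split_indicator)

lemma L2_separable: "\<exists>D::L2 set. countable D \<and> closure D = UNIV"
proof -
  obtain B :: "(real^3) set set" where B: "countable B" "topological_basis B"
    using ex_countable_basis by auto
  obtain C :: "complex set" where C: "countable C" "\<And>X. open X \<Longrightarrow> X \<noteq> {} \<Longrightarrow> \<exists>d\<in>C. d \<in> X"
    by (rule countable_dense_setE) blast
  define E where "E = (\<lambda>(c, G). L2_of (\<lambda>x. c * indicator (\<Union>G) x)) ` (C \<times> {G. finite G \<and> G \<subseteq> B})"
  define D where "D = sum_list ` lists E"
  define S where "S = closure D"
  have "countable {G. finite G \<and> G \<subseteq> B}"
    using B(1) by (intro countable_Collect_finite_subset)
  then have "countable E"
    unfolding E_def using C(1) by (intro countable_image countable_SIGMA) auto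
  then have "countable D"
    unfolding D_def by (intro countable_image countable_lists)
  have lim: "l \<in> S" if "\<And>n. X n \<in> S" "X \<longlonglongrightarrow> l" for X l
    using that closed_sequentially[of S X l] by (simp add: S_def)
  have DS: "f \<in> S" if "f \<in> D" for f
    using that closure_subset[of D] by (auto simp: S_def)
  have zero: "0 \<in> S"
    by (rule DS) (auto simp: D_def intro!: image_eqI[of _ _ "[]"])
  have ES: "f \<in> S" if "f \<in> E" for f
    using that by (intro DS) (auto simp: D_def intro!: image_eqI[of _ _ "[f]"])
  have addD: "f + g \<in> D" if fg: "f \<in> D" "g \<in> D" for f g
  proof -
    obtain xs where "xs \<in> lists E" "f = sum_list xs"
      using fg(1) unfolding D_def by (rule imageE)
    moreover obtain ys where "ys \<in> lists E" "g = sum_list ys"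
      using fg(2) unfolding D_def by (rule imageE)
    ultimately have "xs @ ys \<in> lists E" "f + g = sum_list (xs @ ys)"
      by simp_all
    then show ?thesis
      unfolding D_def by (rule image_eqI[rotated])
  qed
  have add: "f + g \<in> S" if fg: "f \<in> S" "g \<in> S" for f g
  proof -
    obtain X where X: "\<And>n. X n \<in> D" "X \<longlonglongrightarrow> f"
      using fg(1) unfolding S_def closure_sequential by auto
    obtain Y where Y: "\<And>n. Y n \<in> D" "Y \<longlonglongrightarrow> g"
      using fg(2) unfolding S_def closure_sequential by auto
    show ?thesis
      by (rule lim[of "\<lambda>n. X n + Y n"]) (intro DS addD X Y tendsto_add)+
  qed

  have op: "L2_of (\<lambda>x. c * indicator U x) \<in> S"
    if c: "c \<in> C" and U: "open U" "emeasure lborel U < \<infinity>" for c U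
  proof -
    obtain B' where B': "B' \<subseteq> B" "U = \<Union>B'"
      using topological_basis_imp_subbasis B(2) U(1) unfolding topological_basis_def by metis
    define b where "b n = (if B' = {} then {} else from_nat_into B' n)" for n
    have range_b: "U = (\<Union>n. b n)"
      using B' B(1) countable_subset[OF B'(1) B(1)]
      by (auto simp: b_def from_nat_into dest: from_nat_into_surj)
    have b_open: "open (b n)" for n
      using B' topological_basis_open[OF B(2)] from_nat_into[of B' n] by (auto simp: b_def)
    define V where "V n = (\<Union>i<n. b i)" for n
    have V[measurable]: "V n \<in> sets borel" for n
      unfolding V_def using b_open by (intro borel_open open_UN) auto
    have [measurable]: "U \<in> sets borel"
      using U by simp
    have VU: "V n \<subseteq> U" for n
      by (auto simp: V_def range_b)
    show ?thesis
    proof (rule lim[of "\<lambda>n. L2_of (\<lambda>x. c * indicator (V n) x)"])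
      fix n
      have "V n = \<Union>(if B' = {} then {} else b ` {..<n})"
        by (auto simp: V_def b_def)
      moreover have "(if B' = {} then {} else b ` {..<n}) \<subseteq> B"
        using B'(1) from_nat_into[of B'] by (auto simp: b_def)
      ultimately show "L2_of (\<lambda>x. c * indicator (V n) x) \<in> S"
        using c by (intro ES) (force simp: E_def)
    next
      show "(\<lambda>n. L2_of (\<lambda>x. c * indicator (V n) x)) \<longlonglongrightarrow> L2_of (\<lambda>x. c * indicator U x)"
      proof (rule tendsto_L2_dominated[where w = "\<lambda>x. cmod c * indicator U x"])
        show "integrable lborel (\<lambda>x. (cmod c * indicator U x)\<^sup>2)"
          using U by (intro sq_integrable_indicator(2)) auto
        show "cmod (c * indicator (V n) x) \<le> cmod c * indicator U x" for n x
          using VU[of n] by (auto simp: cmod_mult_indicator split: split_indicator)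
        show "(\<lambda>n. c * indicator (V n) x) \<longlonglongrightarrow> c * indicator U x" for x
        proof (intro tendsto_mult tendsto_const)
          have "indicator (V n) x = (indicator U x :: complex)" if "x \<in> b k" "k < n" for n k
            using that VU[of n] by (auto simp: V_def split: split_indicator)
          then show "(\<lambda>n. indicator (V n) x :: complex) \<longlonglongrightarrow> indicator U x"
          proof (cases "x \<in> U")
            case True
            then obtain k where "x \<in> b k"
              by (auto simp: range_b)
            then have "\<forall>\<^sub>F n in sequentially. indicator (V n) x = (indicator U x :: complex)"
              using \<open>\<And>n k. x \<in> b k \<Longrightarrow> k < n \<Longrightarrow> indicator (V n) x = (indicator U x :: complex)\<close>
              by (auto simp: eventually_sequentially intro!: exI[of _ "Suc k"])
            then show ?thesis
              by (rule tendsto_eventually)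
          next
            case False
            then have "indicator (V n) x = (indicator U x :: complex)" for n
              using VU[of n] by (auto split: split_indicator)
            then show ?thesis
              by simp
          qed
        qed
      qed (auto simp: cmod_mult_indicator)
    qed
  qed

  have meas_C: "L2_of (\<lambda>x. c * indicator A x) \<in> S"
    if c: "c \<in> C" and A[measurable]: "A \<in> sets borel" and fin: "emeasure lborel A < \<infinity>" for c A
  proof -
    have "\<exists>U. open U \<and> A \<subseteq> U \<and> emeasure lborel (U - A) < ennreal (1 / real (Suc n))" for n
      by (rule outer_regular_lborel[OF A, of "1 / real (Suc n)"]) auto
    then obtain U where U: "\<And>n. open (U n)" "\<And>n. A \<subseteq> U n"
      "\<And>n. emeasure lborel (U n - A) < ennreal (1 / real (Suc n))"
      by metis
    have [measurable]: "U n \<in> sets borel" for n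
      using U(1) by simp
    have finU: "emeasure lborel (U n) < \<infinity>" for n
    proof -
      have "emeasure lborel (U n) \<le> emeasure lborel A + emeasure lborel (U n - A)"
        using emeasure_subadditive[of A lborel "U n - A"] U(2)[of n] by (simp add: Un_absorb1)
      also have "\<dots> < \<infinity>"
        using fin less_trans[OF U(3)[of n] ennreal_less_top] by simp
      finally show ?thesis .
    qed
    have diff_fin: "emeasure lborel (U n - A) < \<infinity>" for n
      using less_trans[OF U(3)[of n] ennreal_less_top] by simp
    show ?thesis
    proof (rule lim[of "\<lambda>n. L2_of (\<lambda>x. c * indicator (U n) x)"])
      show "L2_of (\<lambda>x. c * indicator (U n) x) \<in> S" for n
        by (intro op c U finU)
      show "(\<lambda>n. L2_of (\<lambda>x. c * indicator (U n) x)) \<longlonglongrightarrow> L2_of (\<lambda>x. c * indicator A x)"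
      proof (rule tendsto_L2I)
        have "(\<integral>x. (cmod (c * indicator (U n) x - c * indicator A x))\<^sup>2 \<partial>lborel)
            = (cmod c)\<^sup>2 * measure lborel (U n - A)" for n
        proof -
          have "(cmod (c * indicator (U n) x - c * indicator A x))\<^sup>2 = (cmod c)\<^sup>2 * indicator (U n - A) x" for x
            using U(2)[of n] by (auto split: split_indicator)
          then show ?thesis
            using diff_fin[of n] by simp
        qed
        moreover have "(\<lambda>n. (cmod c)\<^sup>2 * measure lborel (U n - A)) \<longlonglongrightarrow> (cmod c)\<^sup>2 * 0"
        proof (intro tendsto_mult tendsto_const)
          have "measure lborel (U n - A) \<le> inverse (real (Suc n))" for n
            using U(3)[of n] diff_fin[of n]
            by (subst (asm) emeasure_eq_ennreal_measure) (auto simp: ennreal_less_iff inverse_eq_divide)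
          then show "(\<lambda>n. measure lborel (U n - A)) \<longlonglongrightarrow> 0"
            by (intro tendsto_sandwich[OF _ _ tendsto_const LIMSEQ_inverse_real_of_nat]) auto
        qed
        ultimately show "(\<lambda>n. \<integral>x. (cmod (c * indicator (U n) x - c * indicator A x))\<^sup>2 \<partial>lborel) \<longlonglongrightarrow> 0"
          by simp
      qed (use finU fin in \<open>auto intro!: sq_integrable_indicator\<close>)
    qed
  qed

  have meas: "L2_of (\<lambda>x. c * indicator A x) \<in> S"
    if A[measurable]: "A \<in> sets borel" and fin: "emeasure lborel A < \<infinity>" for c A
  proof -
    have "\<exists>d. d \<in> C \<and> dist c d < inverse (real (Suc n))" for n
      using C(2)[of "ball c (inverse (real (Suc n)))"] by (auto simp: ball_eq_empty)
    then obtain d where d: "\<And>n. d n \<in> C" "\<And>n. dist c (d n) < inverse (real (Suc n))"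
      by metis
    have lim_d: "d \<longlonglongrightarrow> c"
    proof (rule metric_LIMSEQ_I)
      fix e :: real assume "e > 0"
      then obtain N where N: "inverse (real (Suc N)) < e"
        using reals_Archimedean by blast
      have "dist (d n) c < e" if "N \<le> n" for n
      proof -
        have "inverse (real (Suc n)) \<le> inverse (real (Suc N))"
          using that by (intro le_imp_inverse_le) auto
        with d(2)[of n] N show ?thesis
          by (simp only: dist_commute[of "d n" c])
      qed
      then show "\<exists>no. \<forall>n\<ge>no. dist (d n) c < e"
        by blast
    qed
    have bd: "cmod (d n) \<le> cmod c + 1" for n
    proof -
      have "cmod (d n - c) < inverse (real (Suc n))"
        using d(2)[of n] by (simp add: dist_norm norm_minus_commute)
      also have "\<dots> \<le> 1"
        by (simp add: field_simps)
      finally show ?thesis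
        using norm_triangle_ineq2[of "d n" c] by linarith
    qed
    show ?thesis
    proof (rule lim[of "\<lambda>n. L2_of (\<lambda>x. d n * indicator A x)"])
      show "L2_of (\<lambda>x. d n * indicator A x) \<in> S" for n
        by (intro meas_C d A fin)
      show "(\<lambda>n. L2_of (\<lambda>x. d n * indicator A x)) \<longlonglongrightarrow> L2_of (\<lambda>x. c * indicator A x)"
      proof (rule tendsto_L2_dominated[where w = "\<lambda>x. (cmod c + 1) * indicator A x"])
        show "integrable lborel (\<lambda>x. ((cmod c + 1) * indicator A x)\<^sup>2)"
          using fin by (intro sq_integrable_indicator(2)) auto
        show "cmod (d n * indicator A x) \<le> (cmod c + 1) * indicator A x" for n x
          unfolding cmod_mult_indicator using bd[of n] by (intro mult_right_mono) auto
        show "cmod (c * indicator A x) \<le> (cmod c + 1) * indicator A x" for x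
          unfolding cmod_mult_indicator by (intro mult_right_mono) auto
        show "(\<lambda>n. d n * indicator A x) \<longlonglongrightarrow> c * indicator A x" for x
          by (intro tendsto_intros lim_d)
      qed measurable
    qed
  qed

  have sums: "sq_integrable (\<lambda>x. \<Sum>y\<in>Y. y * indicator (A y) x) \<and>
      L2_of (\<lambda>x. \<Sum>y\<in>Y. y * indicator (A y) x) \<in> S"
    if "finite Y" "\<And>y. y \<in> Y \<Longrightarrow> A y \<in> sets borel \<and> emeasure lborel (A y) < \<infinity>" for Y and A
    using that
  proof (induction Y)
    case empty
    have "L2_of (\<lambda>x. 0) = 0"
      by (simp add: L2_of_def zero_L2_def sq_integrable_zero)
    then show ?case
      by (simp add: sq_integrable_zero zero)
  next
    case (insert y Y)
    then have "sq_integrable (\<lambda>x. y * indicator (A y) x)" "L2_of (\<lambda>x. y * indicator (A y) x) \<in> S"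
      by (auto intro!: sq_integrable_indicator meas)
    moreover have "sq_integrable (\<lambda>x. \<Sum>y\<in>Y. y * indicator (A y) x)"
        "L2_of (\<lambda>x. \<Sum>y\<in>Y. y * indicator (A y) x) \<in> S"
      using insert by blast+
    ultimately show ?case
      unfolding sum.insert[OF insert.hyps] by (simp only: sq_integrable_add L2_of_add add simp_thms)
  qed

  have "f \<in> S" for f
  proof -
    obtain g where g: "sq_integrable g" "f = L2_of g"
      by (rule L2_cases)
    have [measurable]: "g \<in> borel_measurable lborel"
      using g(1) by (rule sq_integrable_measurable)
    obtain s where s: "\<And>i. simple_function lborel (s i)" "\<And>x. (\<lambda>i. s i x) \<longlonglongrightarrow> g x"
        "\<And>i x. cmod (s i x) \<le> 2 * cmod (g x)"
      using borel_measurable_implies_sequence_metric[of g lborel 0] g(1)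
      by (auto simp: sq_integrable_def)
    have sm[measurable]: "s i \<in> borel_measurable lborel" for i
      using s(1) by (rule borel_measurable_simple_function)
    have w: "integrable lborel (\<lambda>x. (2 * cmod (g x))\<^sup>2)"
      using g(1) by (simp add: power_mult_distrib sq_integrable_def)
    have gw: "cmod (g x) \<le> 2 * cmod (g x)" for x
      by simp
    show ?thesis
      unfolding g(2)
    proof (rule lim[of "\<lambda>i. L2_of (s i)"])
      show "(\<lambda>i. L2_of (s i)) \<longlonglongrightarrow> L2_of g"
        by (rule tendsto_L2_dominated[OF _ _ w s(3) gw s(2)]) measurable
    next
      fix i
      have sqs: "sq_integrable (s i)"
        by (rule sq_integrable_bound[OF g(1) sq_integrable_zero sm, where C = 4])
           (use power_mono[OF s(3), where n = 2] in \<open>auto simp: power_mult_distrib\<close>)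
      define Y where "Y = range (s i) - {0}"
      define A where "A y = s i -` {y}" for y
      have Y: "finite Y"
        using s(1)[of i] by (simp add: Y_def simple_function_def)
      have A: "A y \<in> sets borel" for y
        using measurable_sets[OF sm, of "{y}" i] by (simp add: A_def)
      have finA: "emeasure lborel (A y) < \<infinity>" if "y \<in> Y" for y
      proof -
        have "ennreal ((cmod y)\<^sup>2) * emeasure lborel (A y)
            = (\<integral>\<^sup>+x. ennreal ((cmod y)\<^sup>2) * indicator (A y) x \<partial>lborel)"
          using A[of y] by (simp add: nn_integral_cmult_indicator)
        also have "\<dots> \<le> (\<integral>\<^sup>+x. ennreal ((cmod (s i x))\<^sup>2) \<partial>lborel)"
          by (intro nn_integral_mono) (auto simp: A_def split: split_indicator)
        also have "\<dots> < \<infinity>"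
          by (simp add: nn_integral_L2 sqs)
        finally show ?thesis
          using that by (auto simp: ennreal_mult_less_top Y_def)
      qed
      have "s i x = (\<Sum>y\<in>Y. y * indicator (A y) x)" for x
      proof (cases "s i x = 0")
        case True
        then show ?thesis
          by (auto simp: A_def Y_def intro!: sum.neutral[symmetric] split: split_indicator)
      next
        case False
        have "(\<Sum>y\<in>Y. y * indicator (A y) x) = (\<Sum>y\<in>{s i x}. y * indicator (A y) x)"
          by (rule sum.mono_neutral_right) (use Y False in \<open>auto simp: A_def Y_def\<close>)
        then show ?thesis
          by (simp add: A_def)
      qed
      then have "s i = (\<lambda>x. \<Sum>y\<in>Y. y * indicator (A y) x)"
        by (rule ext)
      then show "L2_of (s i) \<in> S"
        using sums[OF Y, of A] A finA by simp
    qed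
  qed
  then have "closure D = UNIV"
    unfolding S_def by auto
  with \<open>countable D\<close> show ?thesis
    by blast
qed

instance L2 :: second_countable_topology
proof
  obtain D :: "L2 set" where D: "countable D" "closure D = UNIV"
    using L2_separable by auto
  define B where "B = (\<lambda>(d, n). ball d (inverse (real (Suc n)))) ` (D \<times> UNIV)"
  have "topological_basis B"
  proof (rule topological_basisI)
    fix U :: "L2 set" and x assume "open U" "x \<in> U"
    then obtain e where e: "e > 0" "ball x e \<subseteq> U"
      by (auto simp: open_contains_ball)
    obtain n where n: "inverse (real (Suc n)) < e / 2"
      using reals_Archimedean[of "e / 2"] e(1) by auto
    have "x \<in> closure D"
      using D(2) by simp
    then obtain d where d: "d \<in> D" "dist d x < inverse (real (Suc n))"
      unfolding closure_approachable by (metis inverse_positive_iff_positive of_nat_0_less_iff zero_less_Suc)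
    have "ball d (inverse (real (Suc n))) \<subseteq> ball x e"
    proof
      fix y assume "y \<in> ball d (inverse (real (Suc n)))"
      then show "y \<in> ball x e"
        using d(2) n dist_triangle[of x y d] by (simp add: dist_commute)
    qed
    then show "\<exists>V\<in>B. x \<in> V \<and> V \<subseteq> U"
      using d e(2) by (intro bexI[of _ "ball d (inverse (real (Suc n)))"]) (auto simp: B_def)
  qed (auto simp: B_def)
  moreover have "countable B"
    unfolding B_def using D(1) by (intro countable_image countable_SIGMA) auto
  ultimately show "\<exists>B::L2 set set. countable B \<and> open = generate_topology B"
    using topological_basis_imp_subbasis by blast
qed

definition L2_mult :: "(real^3 \<Rightarrow> complex) \<Rightarrow> L2 \<Rightarrow> L2" where
  "L2_mult m f = L2_of (\<lambda>x. m x * rep_L2 f x)"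


section \<open>Weak derivatives and the Sobolev space \<open>H\<^sup>1\<close>\<close>

definition partial_deriv :: "3 \<Rightarrow> (real^3 \<Rightarrow> complex) \<Rightarrow> real^3 \<Rightarrow> complex" where
  "partial_deriv j f x = frechet_derivative f (at x) (axis j 1)"

primrec C_k :: "nat \<Rightarrow> (real^3 \<Rightarrow> complex) \<Rightarrow> bool" where
  "C_k 0 f \<longleftrightarrow> continuous_on UNIV f"
| "C_k (Suc k) f \<longleftrightarrow> (\<forall>x. f differentiable (at x)) \<and> (\<forall>j. C_k k (partial_deriv j f))"

definition test_function :: "(real^3 \<Rightarrow> complex) \<Rightarrow> bool" where
  "test_function \<phi> \<longleftrightarrow> (\<forall>k. C_k k \<phi>) \<and> compact (closure {x. \<phi> x \<noteq> 0})"

definition has_weak_deriv :: "3 \<Rightarrow> L2 \<Rightarrow> L2 \<Rightarrow> bool" where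
  "has_weak_deriv j f g \<longleftrightarrow> (\<forall>\<phi>. test_function \<phi> \<longrightarrow>
     (\<integral>x. rep_L2 f x * partial_deriv j \<phi> x \<partial>lborel) = - (\<integral>x. rep_L2 g x * \<phi> x \<partial>lborel))"

definition weak_deriv :: "3 \<Rightarrow> L2 \<Rightarrow> L2" where
  "weak_deriv j f = (THE g. has_weak_deriv j f g)"

definition H1 :: "L2 set" where
  "H1 = {f. \<forall>j. \<exists>g. has_weak_deriv j f g}"

definition H1_norm :: "L2 \<Rightarrow> real" where
  "H1_norm f = sqrt ((norm f)\<^sup>2 + (\<Sum>j\<in>UNIV. (norm (weak_deriv j f))\<^sup>2))"


section \<open>Fourier multipliers\<close>

text \<open>
  Plancherel's definition of the Fourier transform on \<open>L\<^sup>2\<close>: the \<open>L\<^sup>2\<close>-limit of the transforms of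
  the truncations of \<open>f\<close> to balls, which are integrable. It is a unitary bijection, so that
  \<^term>\<open>inv\<close> is the inverse Fourier transform; the normalisation cancels in multipliers.
\<close>

definition fourier_L2 :: "L2 \<Rightarrow> L2" where
  "fourier_L2 f = lim (\<lambda>n::nat. L2_of (\<lambda>\<xi>. complex_of_real ((2 * pi) powr (- 3 / 2)) *
     (LINT x:cball 0 (real n)|lborel. cis (- (\<xi> \<bullet> x)) * rep_L2 f x)))"

definition fourier_multiplier :: "(real^3 \<Rightarrow> complex) \<Rightarrow> L2 \<Rightarrow> L2" where
  "fourier_multiplier m f = inv fourier_L2 (L2_mult m (fourier_L2 f))"

text \<open>The group \<open>e\<^sup>i\<^sup>t\<^sup>\<Delta>\<^sup>/\<^sup>2\<close>.\<close>

definition schroedinger :: "real \<Rightarrow> L2 \<Rightarrow> L2" where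
  "schroedinger t = fourier_multiplier (\<lambda>\<xi>. cis (- (t * (norm \<xi>)\<^sup>2 / 2)))"

text \<open>The value at \<open>\<xi> = 0\<close>, which is \<open>0\<close> here, is irrelevant.\<close>

definition dipole_symbol :: "real^3 \<Rightarrow> complex" where
  "dipole_symbol \<xi> = complex_of_real
     (4 / 3 * pi * ((2 * (\<xi> $ 3)\<^sup>2 - (\<xi> $ 1)\<^sup>2 - (\<xi> $ 2)\<^sup>2) / (norm \<xi>)\<^sup>2))"

definition dipole_conv :: "L2 \<Rightarrow> L2" where
  "dipole_conv = fourier_multiplier dipole_symbol"


section \<open>The dipolar Gross-Pitaevskii equation\<close>

definition density :: "L2 \<Rightarrow> L2" where
  "density \<psi> = L2_of (\<lambda>x. complex_of_real ((cmod (rep_L2 \<psi> x))\<^sup>2))"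

text \<open>
  For \<open>\<psi> \<in> H\<^sup>1\<close> neither use of \<^term>\<open>L2_of\<close> here produces junk: \<open>H\<^sup>1\<close> embeds in \<open>L\<^sup>2 \<inter> L\<^sup>6\<close>, so
  \<open>|\<psi>|\<^sup>2\<close> lies in \<open>L\<^sup>1 \<inter> L\<^sup>3\<close>, and as the convolution is bounded on \<open>L\<^sup>3\<close> both summands of the
  nonlinearity lie in \<open>L\<^sup>2\<close>.
\<close>

definition nonlinearity :: "real \<Rightarrow> real \<Rightarrow> L2 \<Rightarrow> L2" where
  "nonlinearity lam1 lam2 \<psi> = L2_of (\<lambda>x.
     complex_of_real lam1 * complex_of_real ((cmod (rep_L2 \<psi> x))\<^sup>2) * rep_L2 \<psi> x +
     complex_of_real lam2 * rep_L2 (dipole_conv (density \<psi>)) x * rep_L2 \<psi> x)"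

definition in_Lp :: "real \<Rightarrow> (real^3 \<Rightarrow> complex) \<Rightarrow> bool" where
  "in_Lp p f \<longleftrightarrow> f \<in> borel_measurable lborel \<and> integrable lborel (\<lambda>x. cmod (f x) powr p)"

definition Lp_norm :: "real \<Rightarrow> (real^3 \<Rightarrow> complex) \<Rightarrow> real" where
  "Lp_norm p f = (\<integral>x. cmod (f x) powr p \<partial>lborel) powr (1 / p)"

text \<open>
  \<open>u\<close> is in \<open>L\<^sup>q\<close>, locally in time on the interval \<open>I\<close>, with values in \<open>L\<^sup>p\<close>. Strong measurability
  of \<open>u\<close> in time is not demanded, as this is only used for \<open>u\<close> that are continuous into \<open>L\<^sup>2\<close>.
\<close>

definition in_Lq_loc_Lp :: "real set \<Rightarrow> real \<Rightarrow> real \<Rightarrow> (real \<Rightarrow> L2) \<Rightarrow> bool" where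
  "in_Lq_loc_Lp I q p u \<longleftrightarrow> (\<forall>a b. {a..b} \<subseteq> I \<longrightarrow>
     (AE t in lborel. t \<in> {a..b} \<longrightarrow> in_Lp p (rep_L2 (u t))) \<and>
     set_integrable lborel {a..b} (\<lambda>t. Lp_norm p (rep_L2 (u t)) powr q))"

definition solution :: "real \<Rightarrow> real \<Rightarrow> L2 \<Rightarrow> real set \<Rightarrow> (real \<Rightarrow> L2) \<Rightarrow> bool" where
  "solution lam1 lam2 \<psi>0 I \<psi> \<longleftrightarrow>
     is_interval I \<and> open I \<and> 0 \<in> I \<and>
     (\<forall>t\<in>I. \<psi> t \<in> H1) \<and>
     (\<forall>t\<in>I. ((\<lambda>s. H1_norm (\<psi> s - \<psi> t)) \<longlongrightarrow> 0) (at t within I)) \<and>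
     in_Lq_loc_Lp I (8 / 3) 4 \<psi> \<and>
     (\<forall>j. in_Lq_loc_Lp I (8 / 3) 4 (\<lambda>t. weak_deriv j (\<psi> t))) \<and>
     (\<forall>t\<in>I. interval_lebesgue_integrable lborel 0 (ereal t)
              (\<lambda>s. schroedinger (t - s) (nonlinearity lam1 lam2 (\<psi> s))) \<and>
            \<psi> t = schroedinger t \<psi>0 - L2_mult (\<lambda>_. \<i>)
              (LBINT s=0..ereal t. schroedinger (t - s) (nonlinearity lam1 lam2 (\<psi> s))))"

definition maximal_solution :: "real \<Rightarrow> real \<Rightarrow> L2 \<Rightarrow> real set \<Rightarrow> (real \<Rightarrow> L2) \<Rightarrow> bool" where
  "maximal_solution lam1 lam2 \<psi>0 I \<psi> \<longleftrightarrow> solution lam1 lam2 \<psi>0 I \<psi> \<and>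
     (\<forall>J \<phi>. solution lam1 lam2 \<psi>0 J \<phi> \<and> I \<subseteq> J \<and> (\<forall>t\<in>I. \<phi> t = \<psi> t) \<longrightarrow> J = I)"

end

theory Submission imports Defs "HOL-Probability.Probability"
begin

text \<open>
 Difference quotients \<open>dq j h f\<close> take the place of the gradient throughout: they commute with the
 group and with the dipolar convolution, so that every estimate for \<open>\<psi>\<close> applies to them, and
 bounds that are uniform in \<open>h\<close> characterise \<open>H\<^sup>1\<close>.

 The dispersive estimate from \<open>L\<^sup>4\<^sup>/\<^sup>3\<close> to \<open>L\<^sup>4\<close> comes from the density: by Galilean invariance the
 Fourier transform of \<open>\<bar>S t f\<bar>\<^sup>2\<close> at \<open>\<eta>\<close> is, up to a phase, a correlation of \<open>f\<close> with its translate by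
 \<open>t \<eta>\<close>, and Young's inequality bounds it in \<open>L\<^sup>2\<close> in \<open>\<eta>\<close>. With the Hardy-Littlewood-Sobolev inequality in
 time and a \<open>T T\<^sup>*\<close> argument this yields the Strichartz estimates in \<open>L\<^sup>8\<^sup>/\<^sup>3\<close> in time with values in \<open>L\<^sup>4\<close>.

 As \<open>\<parallel>\<bar>\<psi>\<bar>\<^sup>2\<parallel>\<^sub>2 = \<parallel>\<psi>\<parallel>\<^sub>4\<^sup>2\<close> and the dipolar convolution is bounded on \<open>L\<^sup>2\<close>, the nonlinearity is cubic from \<open>L\<^sup>4\<close> to
 \<open>L\<^sup>4\<^sup>/\<^sup>3\<close>, and small data give a contraction whose fixed point is global. The Duhamel integral up to time
 \<open>t\<close>, brought back to time \<open>0\<close>, is then Cauchy in \<open>H\<^sup>1\<close> as \<open>t\<close> tends to \<open>\<plusminus>\<infinity>\<close>, which is scattering. Two solutions differ by a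
 function whose \<open>L\<^sup>4\<close> norm satisfies a Gronwall inequality with kernel \<open>\<bar>t - s\<bar>\<^sup>-\<^sup>3\<^sup>/\<^sup>4\<close>, so it vanishes;
 hence every maximal solution is the global one.
\<close>

section \<open>The space \<open>L\<^sup>2\<close>\<close>

text \<open>The time exponents dictate the function space. The dual Strichartz estimate asks for the
  nonlinearity in L^(8/5) in time with values in L^(4/3), and 5/8 = 1/4 + 3/8: one factor is taken
  in L^(8/3), so the other two must together lie in L^4, each in L^8. Strichartz yields only
  L^(8/3); the gap up to L^8 is filled by the uniform bound on the L^4 norm that the Sobolev
  embedding of H^1 provides. Hence even the estimates without derivatives live on an H^1 ball. The
  contraction itself is measured without derivatives, and the bounds that define the ball survive
  its limits by lower semicontinuity.

  The second obstacle is the encoding. The nonlinearity goes through \<open>L2_of\<close>, which is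
  0 off L^2, and Duhamel's formula uses a Bochner integral in L^2. So the set \<open>good\<close> on
  which the nonlinearity is genuine has to be isolated, junk values have to be made harmless in
  every estimate, and the nonlinearity has to be shown Borel on L^2 and locally integrable along the
  flow. The last point is where the L^4 bounds on difference quotients enter a second time.\<close>

abbreviation lb :: "(real^3) measure" where "lb \<equiv> lborel"

abbreviation mag :: "L2 \<Rightarrow> real^3 \<Rightarrow> real" where "mag f x \<equiv> cmod (rep_L2 f x)"

lemma rep_measurable [measurable]: "rep_L2 f \<in> borel_measurable borel"
 using sq_integrable_measurable[OF sq_integrable_rep] by simp

lemma integrable_rep_sq: "integrable lb (\<lambda>x. (mag f x)\<^sup>2)"
 using sq_integrable_rep[of f] by (simp add: sq_integrable_def)

lemma L2_eqI: "(AE x in lborel. rep_L2 f x = rep_L2 g x) \<Longrightarrow> f = g"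
 using L2_of_eq_iff[of "rep_L2 f" "rep_L2 g"] by simp

lemma sq_integrable_cong_AE:
 assumes f: "sq_integrable f" and g: "g \<in> borel_measurable lborel"
  and eq: "AE x in lborel. f x = g x"
 shows "sq_integrable g"
proof -
 have "integrable lborel (\<lambda>x. (cmod (f x))\<^sup>2) \<longleftrightarrow> integrable lborel (\<lambda>x. (cmod (g x))\<^sup>2)"
  by (rule integrable_cong_AE) (use f g eq in \<open>auto intro: borel_measurable_power borel_measurable_norm dest: sq_integrable_measurable\<close>)
 thus ?thesis using f g by (simp add: sq_integrable_def)
qed

lemma L2_of_cong_AE:
 assumes "sq_integrable f" "g \<in> borel_measurable lborel" "AE x in lborel. f x = g x"
 shows "L2_of f = L2_of g"
 using L2_of_eq_iff[OF assms(1) sq_integrable_cong_AE[OF assms]] assms(3) by simp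

lemma L2_of_eqI:
 assumes "g \<in> borel_measurable lborel" "AE x in lborel. rep_L2 f x = g x"
 shows "L2_of g = f"
 using L2_of_cong_AE[OF sq_integrable_rep assms] by simp

lemma L2_of_zero [simp]: "L2_of (\<lambda>x. 0) = 0"
 by (simp add: L2_of_def zero_L2_def sq_integrable_zero)

lemma rep_zero: "AE x in lborel. rep_L2 0 x = 0"
 using rep_L2_of[OF sq_integrable_zero] by simp

lemma rep_add: "AE x in lborel. rep_L2 (f + g) x = rep_L2 f x + rep_L2 g x"
 using rep_L2_of[OF sq_integrable_add[OF sq_integrable_rep[of f] sq_integrable_rep[of g]]]
 by (simp add: L2_of_add)

lemma rep_diff: "AE x in lborel. rep_L2 (f - g) x = rep_L2 f x - rep_L2 g x"
 using rep_L2_of[OF sq_integrable_diff[OF sq_integrable_rep[of f] sq_integrable_rep[of g]]]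
 by (simp add: L2_of_diff)

lemma rep_scaleR: "AE x in lborel. rep_L2 (r *\<^sub>R f) x = r *\<^sub>R rep_L2 f x"
 using rep_L2_of[OF sq_integrable_scaleR[OF sq_integrable_rep[of f]], of r]
 by (simp add: L2_of_scaleR)

lemma norm_L2_sq: "(norm f)\<^sup>2 = (\<integral>x. (mag f x)\<^sup>2 \<partial>lborel)"
 using norm_L2_of[OF sq_integrable_rep[of f]] by simp

lemma nn_norm_L2: "(\<integral>\<^sup>+x. ennreal ((mag f x)\<^sup>2) \<partial>lborel) = ennreal ((norm f)\<^sup>2)"
 using nn_integral_L2[OF sq_integrable_rep[of f]] by simp

lemma inner_L2_rep: "f \<bullet> g = (\<integral>x. rep_L2 f x \<bullet> rep_L2 g x \<partial>lborel)"
proof -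
 have "f \<bullet> g = abs_L2 (rep_L2 f) \<bullet> abs_L2 (rep_L2 g)"
  using L2_of_rep[of f] L2_of_rep[of g] by (simp add: L2_of_def)
 also have "\<dots> = (\<integral>x. rep_L2 f x \<bullet> rep_L2 g x \<partial>lborel)"
  by (rule inner_L2.abs_eq) auto
 finally show ?thesis .
qed

lemma norm_L2_le_iff:
 assumes "0 \<le> C"
 shows "norm f \<le> C \<longleftrightarrow> (\<integral>\<^sup>+x. ennreal ((mag f x)\<^sup>2) \<partial>lborel) \<le> ennreal (C\<^sup>2)"
 unfolding nn_norm_L2 using assms by (auto simp: ennreal_le_iff intro: power_mono power2_le_imp_le)

lemma sq_integrable_dom:
 assumes g: "g \<in> borel_measurable lborel" and b: "AE x in lborel. cmod (g x) \<le> C * mag f x"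
 shows "sq_integrable g"
proof (rule sq_integrableI_nn[OF g])
 have "(\<integral>\<^sup>+x. ennreal ((cmod (g x))\<^sup>2) \<partial>lborel) \<le> (\<integral>\<^sup>+x. ennreal (C\<^sup>2) * ennreal ((mag f x)\<^sup>2) \<partial>lborel)"
 proof (rule nn_integral_mono_AE, rule eventually_mono[OF b])
  fix x assume "cmod (g x) \<le> C * mag f x"
  hence "(cmod (g x))\<^sup>2 \<le> (C * mag f x)\<^sup>2" by (intro power_mono) auto
  thus "ennreal ((cmod (g x))\<^sup>2) \<le> ennreal (C\<^sup>2) * ennreal ((mag f x)\<^sup>2)"
   by (simp add: power_mult_distrib ennreal_mult[symmetric] ennreal_leI)
 qed
 also have "\<dots> = ennreal (C\<^sup>2) * ennreal ((norm f)\<^sup>2)"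
  by (subst nn_integral_cmult) (auto simp: nn_norm_L2)
 also have "\<dots> < \<infinity>" by (simp add: ennreal_mult_less_top)
 finally show "(\<integral>\<^sup>+x. ennreal ((cmod (g x))\<^sup>2) \<partial>lborel) < \<infinity>" .
qed

lemma norm_L2_of_le:
 assumes g: "g \<in> borel_measurable lborel" and b: "AE x in lborel. cmod (g x) \<le> C * mag f x"
  and C: "0 \<le> C"
 shows "norm (L2_of g) \<le> C * norm f"
proof -
 have s: "sq_integrable g" by (rule sq_integrable_dom[OF g b])
 have "(norm (L2_of g))\<^sup>2 \<le> (\<integral>x. C\<^sup>2 * (mag f x)\<^sup>2 \<partial>lborel)"
  unfolding norm_L2_of[OF s]
 proof (rule integral_mono_AE)
  show "integrable lb (\<lambda>x. (cmod (g x))\<^sup>2)" using s by (simp add: sq_integrable_def)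
  show "integrable lb (\<lambda>x. C\<^sup>2 * (mag f x)\<^sup>2)" using integrable_rep_sq by simp
  show "AE x in lb. (cmod (g x))\<^sup>2 \<le> C\<^sup>2 * (mag f x)\<^sup>2"
   using b by eventually_elim (metis norm_ge_zero power_mono power_mult_distrib)
 qed
 hence "(norm (L2_of g))\<^sup>2 \<le> (C * norm f)\<^sup>2"
  by (simp add: norm_L2_sq power_mult_distrib)
 thus ?thesis by (rule power2_le_imp_le) (simp add: C)
qed

lemma sq_integrable_nn_le:
 assumes "g \<in> borel_measurable lborel" "(\<integral>\<^sup>+x. ennreal ((cmod (g x))\<^sup>2) \<partial>lborel) \<le> ennreal (C\<^sup>2)" "0 \<le> C"
 shows "sq_integrable g" "norm (L2_of g) \<le> C"
proof -
 show s: "sq_integrable g" by (rule sq_integrableI_nn[OF assms(1)]) (use assms(2) in \<open>auto intro: le_less_trans\<close>)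
 show "norm (L2_of g) \<le> C"
  using assms(2) unfolding nn_integral_L2[OF s]
  by (intro power2_le_imp_le[OF _ assms(3)]) (simp add: ennreal_le_iff)
qed

text \<open>The squared moduli of the differences tend to 0 in L^1, and L^1 convergence has an
  almost everywhere convergent subsequence. This carries bounds in other L^p norms over to L^2
  limits.\<close>

lemma L2_subseq_AE:
 assumes "X \<longlonglongrightarrow> f"
 shows "\<exists>r::nat\<Rightarrow>nat. strict_mono r \<and> (AE x in lborel. (\<lambda>n. rep_L2 (X (r n)) x) \<longlonglongrightarrow> rep_L2 f x)"
proof -
 let ?u = "\<lambda>n x. (mag (X n - f) x)\<^sup>2"
 have "(\<lambda>n. (norm (X n - f))\<^sup>2) \<longlonglongrightarrow> 0\<^sup>2"
  using assms by (intro tendsto_power tendsto_norm_zero) (simp add: LIM_zero_iff)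
 hence lim: "(\<lambda>n. \<integral>x. norm (?u n x) \<partial>lb) \<longlonglongrightarrow> 0"
  by (simp add: norm_L2_sq)
 obtain r :: "nat \<Rightarrow> nat" where r: "strict_mono r" "AE x in lb. (\<lambda>n. ?u (r n) x) \<longlonglongrightarrow> 0"
  using tendsto_L1_AE_subseq[OF integrable_rep_sq lim] by blast
 have "AE x in lb. \<forall>n. rep_L2 (X n - f) x = rep_L2 (X n) x - rep_L2 f x"
  by (subst AE_all_countable) (simp add: rep_diff)
 with r(2) have "AE x in lborel. (\<lambda>n. rep_L2 (X (r n)) x) \<longlonglongrightarrow> rep_L2 f x"
 proof eventually_elim
  case (elim x)
  have "(\<lambda>n. sqrt (?u (r n) x)) \<longlonglongrightarrow> sqrt 0"
   by (rule tendsto_real_sqrt[OF elim(1)])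
  hence "(\<lambda>n. rep_L2 (X (r n) - f) x) \<longlonglongrightarrow> 0"
   by (simp add: tendsto_norm_zero_iff)
  thus ?case
   by (simp only: elim(2)[rule_format] LIM_zero_iff)
 qed
 with r(1) show ?thesis by blast
qed

subsection \<open>Multiplication operators\<close>

text \<open>For bounded measurable symbols \<open>L2_mult\<close> is true multiplication: the junk
  branch of \<open>L2_of\<close> does not occur.\<close>

locale bdd_mult =
 fixes m :: "real^3 \<Rightarrow> complex" and B :: real
 assumes meas [measurable]: "m \<in> borel_measurable borel" and bound: "\<And>x. cmod (m x) \<le> B"
begin

lemma B_nonneg: "0 \<le> B" using order_trans[OF norm_ge_zero bound] .

lemma sq: "sq_integrable (\<lambda>x. m x * rep_L2 f x)"
 by (rule sq_integrable_dom[where C = B and f = f]) (auto simp: norm_mult intro!: mult_right_mono bound)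

lemma rep: "AE x in lborel. rep_L2 (L2_mult m f) x = m x * rep_L2 f x"
 unfolding L2_mult_def by (rule rep_L2_of[OF sq])

lemma norm_le: "norm (L2_mult m f) \<le> B * norm f"
 unfolding L2_mult_def
 by (rule norm_L2_of_le) (auto simp: norm_mult B_nonneg intro!: mult_right_mono bound)

lemma add: "L2_mult m (f + g) = L2_mult m f + L2_mult m g"
 by (rule L2_eqI) (use rep[of "f + g"] rep_add[of "L2_mult m f" "L2_mult m g"] rep[of f] rep[of g] rep_add[of f g] in
  \<open>eventually_elim, simp add: algebra_simps\<close>)

lemma scaleR: "L2_mult m (r *\<^sub>R f) = r *\<^sub>R L2_mult m f"
 by (rule L2_eqI) (use rep[of "r *\<^sub>R f"] rep_scaleR[of r "L2_mult m f"] rep[of f] rep_scaleR[of r f] in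
  \<open>eventually_elim, simp add: algebra_simps\<close>)

lemma bounded_linear: "bounded_linear (L2_mult m)"
 by (rule bounded_linear_intro[where K = B]) (auto simp: add scaleR norm_le mult.commute)

end

lemma bdd_multI: "m \<in> borel_measurable borel \<Longrightarrow> (\<And>x. cmod (m x) \<le> B) \<Longrightarrow> bdd_mult m B"
 by (simp add: bdd_mult_def)

lemma bdd_mult_const: "bdd_mult (\<lambda>_. c) (cmod c)"
 by (rule bdd_multI) auto

lemma bdd_mult_times:
 assumes "bdd_mult m B" "bdd_mult k C"
 shows "bdd_mult (\<lambda>x. m x * k x) (B * C)"
proof -
 interpret m: bdd_mult m B by fact
 interpret k: bdd_mult k C by fact
 show ?thesis
  by (rule bdd_multI) (auto simp: norm_mult m.B_nonneg intro!: mult_mono m.bound k.bound)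
qed

lemma L2_mult_mult:
 assumes "bdd_mult m B" "bdd_mult k C"
 shows "L2_mult m (L2_mult k f) = L2_mult (\<lambda>x. m x * k x) f"
 by (rule L2_eqI)
   (use bdd_mult.rep[OF assms(1), of "L2_mult k f"] bdd_mult.rep[OF assms(2), of f]
    bdd_mult.rep[OF bdd_mult_times[OF assms], of f] in \<open>eventually_elim, simp\<close>)

lemma L2_mult_one: "L2_mult (\<lambda>_. 1) f = f"
 by (simp add: L2_mult_def)

lemma L2_mult_of_real: "L2_mult (\<lambda>_. complex_of_real r) f = r *\<^sub>R f"
 by (rule L2_eqI) (use bdd_mult.rep[OF bdd_mult_const, of "complex_of_real r" f] rep_scaleR[of r f] in
  \<open>eventually_elim, simp add: scaleR_conv_of_real\<close>)

lemma norm_L2_mult_unimodular: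
 assumes [measurable]: "m \<in> borel_measurable borel" and "\<And>x. cmod (m x) = 1"
 shows "norm (L2_mult m f) = norm f"
proof -
 interpret bdd_mult m 1 using assms by (intro bdd_multI) auto
 have "(norm (L2_mult m f))\<^sup>2 = (\<integral>x. (cmod (m x * rep_L2 f x))\<^sup>2 \<partial>lborel)"
  unfolding L2_mult_def by (rule norm_L2_of[OF sq])
 thus ?thesis by (simp add: norm_mult assms(2) flip: norm_L2_sq)
qed

subsection \<open>A density principle\<close>

lemma sq_integrable_indicator_box: "sq_integrable (\<lambda>x. c * indicator (box a b) x)"
 using emeasure_lborel_box_finite[of a b] by (intro sq_integrable_indicator(1)) auto

lemma L2_of_indicator_tendsto:
 assumes [measurable]: "\<And>k. U k \<in> sets borel" "V \<in> sets borel" "W \<in> sets borel"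
  and sub: "\<And>k. U k \<subseteq> W" "V \<subseteq> W" and fin: "emeasure lborel W < \<infinity>"
  and ev: "\<And>x. \<forall>\<^sub>F k in sequentially. (x \<in> U k) = (x \<in> V)"
 shows "(\<lambda>k. L2_of (\<lambda>x. c * indicator (U k) x)) \<longlonglongrightarrow> L2_of (\<lambda>x. c * indicator V x)"
proof (rule tendsto_L2_dominated[where w = "\<lambda>x. cmod c * indicator W x"])
 show "integrable lborel (\<lambda>x. (cmod c * indicator W x)\<^sup>2)"
  by (intro sq_integrable_indicator(2) fin assms(3))
 have "cmod (c * indicator X x) \<le> cmod c * indicator W x" if "X \<subseteq> W" for X x
  using that by (cases "x \<in> X") (auto simp: cmod_mult_indicator)
 thus "cmod (c * indicator (U k) x) \<le> cmod c * indicator W x"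
  "cmod (c * indicator V x) \<le> cmod c * indicator W x" for k x
  using sub by blast+
 show "(\<lambda>k. c * indicator (U k) x) \<longlonglongrightarrow> c * indicator V x" for x
  by (rule tendsto_eventually, rule eventually_mono[OF ev[of x]]) (simp add: indicator_def)
qed measurable

text \<open>Density of box indicators in the form of an induction rule. Boxes are stable under
  intersection and generate the Borel sets, so Dynkin's lemma reaches all Borel sets inside a
  bounded window; exhaustion then gives sets of finite measure, and simple functions give the
  rest.\<close>

theorem L2_box_induct [consumes 0, case_names lim add mult box]:
 fixes P :: "L2 \<Rightarrow> bool"
 assumes lim: "\<And>X l. (\<And>n. P (X n)) \<Longrightarrow> X \<longlonglongrightarrow> l \<Longrightarrow> P l"
  and add: "\<And>f g. P f \<Longrightarrow> P g \<Longrightarrow> P (f + g)"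
  and mult: "\<And>c f. P f \<Longrightarrow> P (L2_mult (\<lambda>_. c) f)"
  and box: "\<And>a b. P (L2_of (indicator (box a b)))"
 shows "P f"
proof -
 define B :: "nat \<Rightarrow> (real^3) set" where "B n = box (\<chi> i. - real n) (\<chi> i. real n)" for n
 have B[measurable]: "B n \<in> sets borel" for n by (simp add: B_def)
 have finB: "emeasure lborel (B n) < \<infinity>" for n
  unfolding B_def by (rule emeasure_lborel_box_finite)
 have B_ev: "\<exists>k. \<forall>n\<ge>k. x \<in> B n" for x
 proof -
  obtain k :: nat where k: "norm x < real k" using reals_Archimedean2 by blast
  have "- real n < x $ i \<and> x $ i < real n" if "k \<le> n" for n i
   using component_le_norm_cart[of x i] k that by linarith
  hence "\<forall>n\<ge>k. x \<in> B n" by (simp add: B_def mem_box_cart)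
  thus ?thesis ..
 qed
 have mult_of: "L2_mult (\<lambda>_. c) (L2_of g) = L2_of (\<lambda>x. c * g x)" if "sq_integrable g" for c g
  unfolding L2_mult_def by (rule L2_of_cong_AE)
   (use that rep_L2_of[OF that] in \<open>auto intro!: sq_integrable_cmult borel_measurable_times dest: sq_integrable_measurable\<close>)
 have zero: "P 0"
  using mult[OF box[of 0 0], of 0] by (simp add: L2_mult_def)
 \<comment> \<open>Everything is intersected with the window \<open>B n\<close>, because complements
   of sets of finite measure have infinite measure and their indicators would be junk.\<close>
 have ind: "P (L2_of (indicator (A \<inter> B n)))" if A: "A \<in> sets borel" for A n
 proof -
  have si: "sq_integrable (indicator (A \<inter> B n) :: _ \<Rightarrow> complex)" if [measurable]: "A \<in> sets borel" for A
   using sq_integrable_indicator(1)[of "A \<inter> B n" 1] le_less_trans[OF emeasure_mono finB, of "A \<inter> B n" n] by simp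
  have Int: "Int_stable (range (\<lambda>(a, b). box a (b::real^3)))"
   by (auto simp: Int_stable_def box_Int_box)
  have sub: "range (\<lambda>(a, b). box a (b::real^3)) \<subseteq> Pow UNIV" by simp
  have "A \<in> sigma_sets UNIV (range (\<lambda>(a, b). box a b))"
   using A by (subst (asm) borel_eq_box) (simp add: sets_measure_of)
  from Int sub this show ?thesis
  proof (induction rule: sigma_sets_induct_disjoint)
   case (basic A)
   then obtain a b where "A = box a b" by auto
   hence "A \<inter> B n \<in> range (\<lambda>(a, b). box a b)"
    by (auto simp: B_def box_Int_box)
   thus ?case using box by auto
  next
   case empty
   have "indicator {} = (\<lambda>x::real^3. 0::complex)" by auto
   thus ?case using zero by simp
  next
   case (compl A)
   hence [measurable]: "A \<in> sets borel"
    by (subst borel_eq_box) (simp add: sets_measure_of)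
   have "P (L2_of (indicator (B n)) + L2_mult (\<lambda>_. -1) (L2_of (indicator (A \<inter> B n))))"
    using compl(2) by (intro add mult) (auto simp: B_def box)
   also have "L2_mult (\<lambda>_. -1) (L2_of (indicator (A \<inter> B n))) = L2_of (\<lambda>x. -1 * indicator (A \<inter> B n) x)"
    by (intro mult_of si) measurable
   also have "L2_of (indicator (B n)) + \<dots> = L2_of (\<lambda>x. indicator (B n) x + -1 * indicator (A \<inter> B n) x)"
    using si[of UNIV] by (intro L2_of_add[symmetric] sq_integrable_cmult si) auto
   also have "(\<lambda>x. indicator (B n) x + -1 * indicator (A \<inter> B n) x) = (indicator ((UNIV - A) \<inter> B n) :: _ \<Rightarrow> complex)"
    by (auto split: split_indicator)
   finally show ?case .
  next
   case (union A)
   have A[measurable]: "A i \<in> sets borel" for i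
    using union(2) by (subst borel_eq_box) (auto simp: sets_measure_of)
   define U where "U k = (\<Union>i<k. A i)" for k :: nat
   have U[measurable]: "U k \<in> sets borel" for k unfolding U_def by measurable
   have PU: "P (L2_of (indicator (U k \<inter> B n)))" for k
   proof (induction k)
    case 0
    have "indicator {} = (\<lambda>x::real^3. 0::complex)" by auto
    thus ?case using zero by (simp add: U_def)
   next
    case (Suc k)
    have "A i \<inter> A k = {}" if "i < k" for i
     using union(1) that by (intro disjoint_family_onD[of A UNIV]) auto
    hence "U k \<inter> A k = {}"
     unfolding U_def by blast
    hence "(indicator (U (Suc k) \<inter> B n) :: _ \<Rightarrow> complex) = (\<lambda>x. indicator (U k \<inter> B n) x + indicator (A k \<inter> B n) x)"
     by (auto simp: U_def lessThan_Suc fun_eq_iff split: split_indicator)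
    moreover have "P (L2_of (indicator (U k \<inter> B n)) + L2_of (indicator (A k \<inter> B n)))"
     using Suc union(3) by (rule add)
    ultimately show ?case by (simp add: L2_of_add si)
   qed
   show ?case
   proof (rule lim[OF PU])
    have ev: "\<forall>\<^sub>F k in sequentially. (x \<in> U k \<inter> B n) = (x \<in> \<Union> (range A) \<inter> B n)" for x
    proof (cases "x \<in> \<Union> (range A)")
     case True
     then obtain i where "x \<in> A i" by auto
     hence "x \<in> U k" if "Suc i \<le> k" for k
      using that unfolding U_def by (intro UN_I[of i]) auto
     thus ?thesis
      using True by (intro eventually_sequentiallyI[of "Suc i"]) blast
    qed (auto simp: U_def)
    show "(\<lambda>k. L2_of (indicator (U k \<inter> B n))) \<longlonglongrightarrow> L2_of (indicator (\<Union> (range A) \<inter> B n))"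
     using L2_of_indicator_tendsto[of "\<lambda>k. U k \<inter> B n" "\<Union> (range A) \<inter> B n" "B n" 1, OF _ _ B _ _ finB ev]
     by auto
   qed
  qed
 qed
 have fin: "P (L2_of (\<lambda>x. c * indicator A x))"
  if A[measurable]: "A \<in> sets borel" and f: "emeasure lborel A < \<infinity>" for A c
 proof (rule lim[where X = "\<lambda>n. L2_of (\<lambda>x. c * indicator (A \<inter> B n) x)"])
  fix n
  have "sq_integrable (indicator (A \<inter> B n) :: _ \<Rightarrow> complex)"
   using sq_integrable_indicator(1)[of "A \<inter> B n" 1] le_less_trans[OF emeasure_mono finB, of "A \<inter> B n" n] by simp
  thus "P (L2_of (\<lambda>x. c * indicator (A \<inter> B n) x))"
   using mult[OF ind[OF A, of n], of c] by (simp add: mult_of)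
 next
  have "\<forall>\<^sub>F n in sequentially. (x \<in> A \<inter> B n) = (x \<in> A)" for x
   using B_ev[of x] by (auto simp: eventually_sequentially)
  thus "(\<lambda>n. L2_of (\<lambda>x. c * indicator (A \<inter> B n) x)) \<longlonglongrightarrow> L2_of (\<lambda>x. c * indicator A x)"
   using f by (intro L2_of_indicator_tendsto[of _ _ A]) auto
 qed
 have sums: "sq_integrable (\<lambda>x. \<Sum>y\<in>Y. y * indicator (A y) x) \<and>
   P (L2_of (\<lambda>x. \<Sum>y\<in>Y. y * indicator (A y) x))"
  if "finite Y" "\<And>y. y \<in> Y \<Longrightarrow> A y \<in> sets borel \<and> emeasure lborel (A y) < \<infinity>"
  for Y :: "complex set" and A :: "complex \<Rightarrow> (real^3) set"
  using that
 proof (induction Y)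
  case empty
  thus ?case by (simp add: sq_integrable_zero zero)
 next
  case (insert y Y)
  hence "sq_integrable (\<lambda>x. y * indicator (A y) x)" "P (L2_of (\<lambda>x. y * indicator (A y) x))"
   by (auto intro!: sq_integrable_indicator fin)
  thus ?case
   unfolding sum.insert[OF insert.hyps] using insert by (simp add: sq_integrable_add L2_of_add add)
 qed
 define g where "g = rep_L2 f"
 have g: "sq_integrable g" by (simp add: g_def)
 hence gm[measurable]: "g \<in> borel_measurable borel"
  using sq_integrable_measurable by fastforce
 obtain s where s: "\<And>i. simple_function lborel (s i)" "\<And>x. (\<lambda>i. s i x) \<longlonglongrightarrow> g x"
   "\<And>i x. cmod (s i x) \<le> 2 * cmod (g x)"
  using borel_measurable_implies_sequence_metric[of g lborel 0] by auto
 have sm: "s i \<in> borel_measurable lborel" for i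
  using s(1) by (rule borel_measurable_simple_function)
 have "P (L2_of g)"
 proof (rule lim[of "\<lambda>i. L2_of (s i)"])
  show "(\<lambda>i. L2_of (s i)) \<longlonglongrightarrow> L2_of g"
  proof (rule tendsto_L2_dominated[where w = "\<lambda>x. 2 * cmod (g x)"])
   show "integrable lborel (\<lambda>x. (2 * cmod (g x))\<^sup>2)"
    using g by (simp add: power_mult_distrib sq_integrable_def)
   show "g \<in> borel_measurable lborel" "\<And>x. cmod (g x) \<le> 2 * cmod (g x)" by simp_all
  qed (fact sm s)+
 next
  fix i
  have sqs: "sq_integrable (s i)"
   by (rule sq_integrable_dom[where C = 2 and f = f]) (use sm s(3) in \<open>auto simp: g_def\<close>)
  define Y where "Y = range (s i) - {0}"
  define A where "A y = s i -` {y}" for y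
  have Y: "finite Y"
   using s(1)[of i] by (simp add: Y_def simple_function_def)
  have A: "A y \<in> sets borel" for y
   using measurable_sets[OF sm, of "{y}" i] by (simp add: A_def)
  have finA: "emeasure lborel (A y) < \<infinity>" if "y \<in> Y" for y
  proof -
   have "ennreal ((cmod y)\<^sup>2) * emeasure lborel (A y)
     = (\<integral>\<^sup>+x. ennreal ((cmod y)\<^sup>2) * indicator (A y) x \<partial>lborel)"
    using A[of y] by (simp add: nn_integral_cmult_indicator)
   also have "\<dots> \<le> (\<integral>\<^sup>+x. ennreal ((cmod (s i x))\<^sup>2) \<partial>lborel)"
    by (intro nn_integral_mono) (auto simp: A_def split: split_indicator)
   also have "\<dots> < \<infinity>"
    by (simp add: nn_integral_L2 sqs)
   finally show ?thesis
    using that by (auto simp: ennreal_mult_less_top Y_def)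
  qed
  have "s i x = (\<Sum>y\<in>Y. y * indicator (A y) x)" for x
  proof (cases "s i x = 0")
   case True
   thus ?thesis
    by (auto simp: A_def Y_def intro!: sum.neutral[symmetric] split: split_indicator)
  next
   case False
   have "(\<Sum>y\<in>Y. y * indicator (A y) x) = (\<Sum>y\<in>{s i x}. y * indicator (A y) x)"
    by (rule sum.mono_neutral_right) (use Y False in \<open>auto simp: A_def Y_def\<close>)
   thus ?thesis
    by (simp add: A_def)
  qed
  hence "s i = (\<lambda>x. \<Sum>y\<in>Y. y * indicator (A y) x)"
   by (rule ext)
  thus "P (L2_of (s i))"
   using sums[OF Y, of A] A finA by simp
 qed
 thus ?thesis by (simp add: g_def)
qed

section \<open>Translation invariance of Lebesgue measure, and criteria for convergence in
  L^2\<close>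

lemma AE_translate:
 fixes P :: "'a::euclidean_space \<Rightarrow> bool"
 assumes "AE x in lborel. P x" shows "AE x in lborel. P (x + y)"
proof -
 have "AE x in distr lborel borel ((+) y). P x" using assms by (simp only: lborel_distr_plus)
 hence "AE x in lborel. P (y + x)" by (rule AE_distrD[rotated]) simp
 thus ?thesis by (simp add: add.commute)
qed

lemma nn_integral_translate:
 fixes f :: "'a::euclidean_space \<Rightarrow> ennreal"
 assumes [measurable]: "f \<in> borel_measurable borel"
 shows "(\<integral>\<^sup>+x. f (x + y) \<partial>lborel) = (\<integral>\<^sup>+x. f x \<partial>lborel)"
proof -
 have "(\<integral>\<^sup>+x. f x \<partial>distr lborel borel ((+) y)) = (\<integral>\<^sup>+x. f (y + x) \<partial>lborel)"
  by (rule nn_integral_distr) auto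
 thus ?thesis by (simp add: lborel_distr_plus add.commute)
qed

lemma integral_translate:
 fixes f :: "'a::euclidean_space \<Rightarrow> 'b::{banach, second_countable_topology}"
 assumes [measurable]: "f \<in> borel_measurable borel"
 shows "(\<integral>x. f (x + y) \<partial>lborel) = (\<integral>x. f x \<partial>lborel)"
proof -
 have "(\<integral>x. f x \<partial>distr lborel borel ((+) y)) = (\<integral>x. f (y + x) \<partial>lborel)"
  by (rule integral_distr) auto
 thus ?thesis by (simp add: lborel_distr_plus add.commute)
qed

lemma integrable_translate:
 fixes f :: "'a::euclidean_space \<Rightarrow> 'b::{banach, second_countable_topology}"
 assumes [measurable]: "f \<in> borel_measurable borel" and f: "integrable lborel f"
 shows "integrable lborel (\<lambda>x. f (x + y))"
proof -
 have "integrable (distr lborel borel ((+) y)) f \<longleftrightarrow> integrable lborel (\<lambda>x. f (y + x))"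
  by (rule integrable_distr_eq) auto
 thus ?thesis using f by (simp add: lborel_distr_plus add.commute)
qed

text \<open>Like \<open>tendsto_L2_dominated\<close>, but with hypotheses that hold almost
  everywhere only, which is all one can ask of representatives.\<close>

lemma L2_dominated:
 assumes w: "integrable lborel (\<lambda>x. (w x)\<^sup>2)"
  and b: "\<And>n. AE x in lborel. mag (X n) x \<le> w x"
  and lim: "AE x in lborel. (\<lambda>n. rep_L2 (X n) x) \<longlonglongrightarrow> rep_L2 f x"
 shows "X \<longlonglongrightarrow> f"
proof -
 have bAE: "AE x in lb. \<forall>n. mag (X n) x \<le> w x"
  using b by (simp add: AE_all_countable)
 have d: "AE x in lb. \<forall>n. rep_L2 (X n - f) x = rep_L2 (X n) x - rep_L2 f x"
  by (subst AE_all_countable) (simp add: rep_diff)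
 have "(\<lambda>n. \<integral>x. (mag (X n - f) x)\<^sup>2 \<partial>lborel) \<longlonglongrightarrow> (\<integral>x. 0 \<partial>lb)"
 proof (rule integral_dominated_convergence[where w = "\<lambda>x. 4 * (w x)\<^sup>2"])
  show "integrable lb (\<lambda>x. 4 * (w x)\<^sup>2)" using w by simp
  show "AE x in lb. (\<lambda>n. (mag (X n - f) x)\<^sup>2) \<longlonglongrightarrow> 0"
   using d lim
  proof eventually_elim
   case (elim x)
   have "(\<lambda>n. (cmod (rep_L2 (X n) x - rep_L2 f x))\<^sup>2) \<longlonglongrightarrow> (cmod (rep_L2 f x - rep_L2 f x))\<^sup>2"
    by (intro tendsto_intros elim(2))
   thus ?case by (simp add: elim(1))
  qed
  show "AE x in lb. norm ((mag (X n - f) x)\<^sup>2) \<le> 4 * (w x)\<^sup>2" for n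
   using d lim bAE
  proof eventually_elim
   case (elim x)
   have "mag f x \<le> w x"
    by (rule tendsto_upperbound[OF tendsto_norm[OF elim(2)]]) (use elim(3) in auto)
   hence "cmod (rep_L2 (X n) x - rep_L2 f x) \<le> 2 * w x"
    using norm_triangle_ineq4[of "rep_L2 (X n) x" "rep_L2 f x"] elim(3)[rule_format, of n] by linarith
   hence "(cmod (rep_L2 (X n) x - rep_L2 f x))\<^sup>2 \<le> (2 * w x)\<^sup>2"
    by (intro power_mono) auto
   thus ?case by (simp add: elim(1) power_mult_distrib)
  qed
 qed measurable
 hence "(\<lambda>n. sqrt ((norm (X n - f))\<^sup>2)) \<longlonglongrightarrow> sqrt 0"
  by (intro tendsto_real_sqrt) (simp add: norm_L2_sq)
 thus ?thesis
  by (simp add: tendsto_norm_zero_iff LIM_zero_iff)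
qed

text \<open>The usual three-epsilon argument. It settles the limit case when strong convergence of
  operators is proved by \<open>L2_box_induct\<close>.\<close>

lemma strong_limit_closed:
 fixes T :: "nat \<Rightarrow> 'a::real_normed_vector \<Rightarrow> 'b::real_normed_vector"
 assumes T: "\<And>n. bounded_linear (T n)" "\<And>n f. norm (T n f) \<le> C * norm f"
  and S: "bounded_linear S" "\<And>f. norm (S f) \<le> C * norm f"
  and X: "\<And>k::nat. (\<lambda>n. T n (X k)) \<longlonglongrightarrow> S (X k)" "X \<longlonglongrightarrow> l"
 shows "(\<lambda>n. T n l) \<longlonglongrightarrow> S l"
proof (rule metric_LIMSEQ_I)
 fix e :: real assume e: "e > 0"
 \<comment> \<open>Enlarging the constant makes it positive, so that one can divide by it.\<close>
 define C' where "C' = \<bar>C\<bar> + 1"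
 have C': "C' > 0" "norm (T n f) \<le> C' * norm f" "norm (S f) \<le> C' * norm f" for n f
 proof -
  have "C * norm f \<le> C' * norm f" by (intro mult_right_mono) (auto simp: C'_def)
  thus "norm (T n f) \<le> C' * norm f" "norm (S f) \<le> C' * norm f"
   using T(2)[of n f] S(2)[of f] by linarith+
 qed (simp add: C'_def)
 obtain k where k: "norm (X k - l) < e / (4 * C')"
  using LIMSEQ_D[OF X(2), of "e / (4 * C')"] e C'(1) by auto
 obtain N where N: "\<And>n. n \<ge> N \<Longrightarrow> norm (T n (X k) - S (X k)) < e / 2"
  using LIMSEQ_D[OF X(1)[of k], of "e / 2"] e by auto
 have k': "C' * norm (X k - l) < e / 4"
  using k C'(1) by (simp add: field_simps)
 have "norm (T n l - S l) < e" if "n \<ge> N" for n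
 proof -
  have "T n l - S l = (T n (X k) - S (X k)) - T n (X k - l) + S (X k - l)"
   by (simp add: bounded_linear.linear[OF T(1)] bounded_linear.linear[OF S(1)] linear_diff)
  also have "norm \<dots> \<le> norm (T n (X k) - S (X k)) + norm (T n (X k - l)) + norm (S (X k - l))"
   using norm_triangle_ineq[of "(T n (X k) - S (X k)) - T n (X k - l)" "S (X k - l)"]
    norm_triangle_ineq4[of "T n (X k) - S (X k)" "T n (X k - l)"] by linarith
  also have "\<dots> < e" using N[OF that] C'(2)[of n "X k - l"] C'(3)[of "X k - l"] k' e by linarith
  finally show ?thesis .
 qed
 thus "\<exists>no. \<forall>n\<ge>no. dist (T n l) (S l) < e" by (auto simp: dist_norm)
qed

subsection \<open>Translations\<close>

definition tr :: "real^3 \<Rightarrow> L2 \<Rightarrow> L2" where "tr y f = L2_of (\<lambda>x. rep_L2 f (x + y))"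

lemma sq_integrable_translate:
 assumes "sq_integrable f" shows "sq_integrable (\<lambda>x. f (x + y))"
proof -
 have [measurable]: "f \<in> borel_measurable borel" using assms by (simp add: sq_integrable_def)
 have "integrable lborel (\<lambda>x. (cmod (f x))\<^sup>2)" using assms by (simp add: sq_integrable_def)
 hence "integrable lborel (\<lambda>x. (cmod (f (x + y)))\<^sup>2)"
  using integrable_translate[of "\<lambda>x. (cmod (f x))\<^sup>2" y] by simp
 thus ?thesis by (simp add: sq_integrable_def)
qed

lemma rep_tr: "AE x in lborel. rep_L2 (tr y f) x = rep_L2 f (x + y)"
 unfolding tr_def by (intro rep_L2_of sq_integrable_translate sq_integrable_rep)

lemma tr_L2_of:
 assumes "sq_integrable g" shows "tr y (L2_of g) = L2_of (\<lambda>x. g (x + y))"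
 unfolding tr_def
proof (rule L2_of_cong_AE)
 show "AE x in lborel. rep_L2 (L2_of g) (x + y) = g (x + y)"
  by (rule AE_translate[OF rep_L2_of[OF assms]])
 show "(\<lambda>x. g (x + y)) \<in> borel_measurable lborel"
  using sq_integrable_translate[OF assms, of y] by (rule sq_integrable_measurable)
qed (intro sq_integrable_translate sq_integrable_rep)

lemma norm_tr [simp]: "norm (tr y f) = norm f"
proof -
 have "(norm (tr y f))\<^sup>2 = (\<integral>x. (cmod (rep_L2 f (x + y)))\<^sup>2 \<partial>lborel)"
  unfolding tr_def by (intro norm_L2_of sq_integrable_translate sq_integrable_rep)
 also have "\<dots> = (norm f)\<^sup>2"
  using integral_translate[of "\<lambda>x. (mag f x)\<^sup>2" y] by (simp add: norm_L2_sq)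
 finally show ?thesis by simp
qed

lemma tr_add: "tr y (f + g) = tr y f + tr y g"
 by (rule L2_eqI) (use rep_tr[of y "f + g"] rep_tr[of y f] rep_tr[of y g] rep_add[of "tr y f" "tr y g"]
   AE_translate[OF rep_add[of f g], of y] in \<open>eventually_elim, simp\<close>)

lemma tr_scaleR: "tr y (r *\<^sub>R f) = r *\<^sub>R tr y f"
 by (rule L2_eqI) (use rep_tr[of y "r *\<^sub>R f"] rep_tr[of y f] rep_scaleR[of r "tr y f"]
   AE_translate[OF rep_scaleR[of r f], of y] in \<open>eventually_elim, simp\<close>)

lemma bounded_linear_tr: "bounded_linear (tr y)"
 by (rule bounded_linear_intro[where K = 1]) (auto simp: tr_add tr_scaleR)

lemma tr_diff: "tr y (f - g) = tr y f - tr y g"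
 by (simp add: linear_diff bounded_linear.linear[OF bounded_linear_tr])

lemma tr_0 [simp]: "tr 0 f = f"
 by (simp add: tr_def)

lemma tr_tr: "tr y (tr z f) = tr (y + z) f"
 by (rule L2_eqI) (use rep_tr[of y "tr z f"] rep_tr[of "y + z" f] AE_translate[OF rep_tr[of z f], of y] in
   \<open>eventually_elim, simp add: add_ac\<close>)

lemma tr_mult:
 assumes "bdd_mult m B"
 shows "tr y (L2_mult m f) = L2_mult (\<lambda>x. m (x + y)) (tr y f)"
proof -
 interpret bdd_mult m B by fact
 interpret s: bdd_mult "\<lambda>x. m (x + y)" B by (rule bdd_multI) (auto intro: bound)
 show ?thesis
  by (rule L2_eqI) (use rep_tr[of y "L2_mult m f"] AE_translate[OF rep[of f], of y] s.rep[of "tr y f"] rep_tr[of y f] in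
   \<open>eventually_elim, simp\<close>)
qed

text \<open>The boundary of a box is a null set, and at every other point the indicator is locally
  constant. The shifts are bounded, so all translates live in one ball, which gives the
  majorant.\<close>

lemma tr_tendsto_box:
 assumes Y: "Y \<longlonglongrightarrow> 0"
 shows "(\<lambda>n. tr (Y n) (L2_of (indicator (box a b)))) \<longlonglongrightarrow> L2_of (indicator (box a b))"
proof -
 let ?g = "indicator (box a b) :: real^3 \<Rightarrow> complex"
 have g: "sq_integrable ?g" using sq_integrable_indicator_box[of 1 a b] by simp
 obtain K where K: "\<And>n. norm (Y n) \<le> K"
  using convergent_imp_Bseq[OF convergentI[OF Y]] by (auto simp: Bseq_def)
 obtain R where R: "\<And>x. x \<in> box a b \<Longrightarrow> norm x \<le> R"
  using bounded_box[of a b] by (auto simp: bounded_iff)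
 show ?thesis
 proof (rule L2_dominated[where w = "indicator (cball 0 (R + K))"])
  have "emeasure lborel (cball 0 (R + K) :: (real^3) set) < \<infinity>"
   by (rule emeasure_lborel_cball_finite)
  thus "integrable lb (\<lambda>x. (indicator (cball 0 (R + K)) x :: real)\<^sup>2)"
   using sq_integrable_indicator(2)[of "cball 0 (R + K)" 1] by simp
  show "AE x in lb. cmod (rep_L2 (tr (Y n) (L2_of ?g)) x) \<le> indicator (cball 0 (R + K)) x" for n
   unfolding tr_L2_of[OF g]
  proof (rule eventually_mono[OF rep_L2_of[OF sq_integrable_translate[OF g]]])
   fix x assume "rep_L2 (L2_of (\<lambda>x. ?g (x + Y n))) x = ?g (x + Y n)"
   moreover have "norm x \<le> R + K" if "x + Y n \<in> box a b"
    using R[OF that] K[of n] norm_triangle_ineq4[of "x + Y n" "Y n"] by simp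
   ultimately show "cmod (rep_L2 (L2_of (\<lambda>x. ?g (x + Y n))) x) \<le> indicator (cball 0 (R + K)) x"
    by (cases "x + Y n \<in> box a b") auto
  qed
  have "AE x in lb. \<forall>n. rep_L2 (tr (Y n) (L2_of ?g)) x = ?g (x + Y n)"
   unfolding tr_L2_of[OF g] by (subst AE_all_countable) (auto intro!: rep_L2_of sq_integrable_translate g)
  moreover have "AE x in lb. x \<notin> cbox a b - box a b"
  proof (rule AE_not_in)
   have "emeasure lb (cbox a b - box a b) = emeasure lb (cbox a b) - emeasure lb (box a b)"
    by (rule emeasure_Diff) (use emeasure_lborel_box_finite[of a b] box_subset_cbox[of a b] in auto)
   also have "\<dots> = 0" by (simp add: emeasure_lborel_cbox_eq emeasure_lborel_box_eq)
   finally show "cbox a b - box a b \<in> null_sets lb" by (auto simp: null_sets_def)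
  qed
  ultimately show "AE x in lb. (\<lambda>n. rep_L2 (tr (Y n) (L2_of ?g)) x) \<longlonglongrightarrow> rep_L2 (L2_of ?g) x"
   using rep_L2_of[OF g]
  proof eventually_elim
   case (elim x)
   have c: "(\<lambda>n. x + Y n) \<longlonglongrightarrow> x" using tendsto_add[OF tendsto_const Y, of x] by simp
   have "\<forall>\<^sub>F n in sequentially. ?g (x + Y n) = ?g x"
   proof (cases "x \<in> box a b")
    case True
    show ?thesis
     by (rule eventually_mono[OF topological_tendstoD[OF c open_box True]]) (use True in simp)
   next
    case False
    hence x: "x \<in> - cbox a b" using elim(2) by auto
    have "open (- cbox a b)" by (simp add: open_Compl closed_cbox)
    from topological_tendstoD[OF c this x] show ?thesis
     by (rule eventually_mono) (use False box_subset_cbox[of a b] in \<open>auto simp: indicator_def\<close>)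
   qed
   thus ?case by (simp add: elim tendsto_eventually)
  qed
 qed
qed

text \<open>Translations are isometries, so strong continuity has to be checked on boxes
  only.\<close>

lemma tr_tendsto:
 assumes Y: "Y \<longlonglongrightarrow> 0"
 shows "(\<lambda>n. tr (Y n) f) \<longlonglongrightarrow> f"
proof (induction f rule: L2_box_induct)
 case (lim X l)
 show ?case
  by (rule strong_limit_closed[where C = 1 and S = "\<lambda>x. x", OF bounded_linear_tr _ bounded_linear_ident _ lim]) auto
next
 case (add f g)
 thus ?case by (simp add: tr_add tendsto_add)
next
 case (mult c f)
 interpret bdd_mult "\<lambda>_. c" "cmod c" by (rule bdd_mult_const)
 have "(\<lambda>n. L2_mult (\<lambda>_. c) (tr (Y n) f)) \<longlonglongrightarrow> L2_mult (\<lambda>_. c) f"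
  by (rule bounded_linear.tendsto[OF bounded_linear mult])
 thus ?case by (simp add: tr_mult[OF bdd_mult_const])
next
 case (box a b)
 show ?case by (rule tr_tendsto_box[OF Y])
qed

subsection \<open>Complex inner product and conjugation\<close>

lemma borel_measurable_cnj [measurable]:
 "f \<in> borel_measurable M \<Longrightarrow> (\<lambda>x. cnj (f x)) \<in> borel_measurable M"
 by (rule borel_measurable_continuous_on[OF continuous_on_cnj[OF continuous_on_id]])

lemma integrable_L2_prod:
 "integrable lb (\<lambda>x. rep_L2 f x * cnj (rep_L2 g x))" "integrable lb (\<lambda>x. rep_L2 f x * rep_L2 g x)"
 "integrable lb (\<lambda>x. mag f x * mag g x)"
proof -
 have i: "integrable lb (\<lambda>x. (mag f x)\<^sup>2 + (mag g x)\<^sup>2)"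
  by (intro Bochner_Integration.integrable_add integrable_rep_sq)
 have b: "a * b \<le> a\<^sup>2 + b\<^sup>2" if "0 \<le> a" "0 \<le> b" for a b :: real
  using sum_squares_bound[of a b] mult_nonneg_nonneg[OF that] by linarith
 show "integrable lb (\<lambda>x. rep_L2 f x * cnj (rep_L2 g x))" "integrable lb (\<lambda>x. rep_L2 f x * rep_L2 g x)"
  "integrable lb (\<lambda>x. mag f x * mag g x)"
  by (rule Bochner_Integration.integrable_bound[OF i]; auto simp: norm_mult intro!: AE_I2 b)+
qed

text \<open>The type \<open>L2\<close> is a real inner product space, while Fourier phases act by
  complex scalars. The complex form is recovered from the real one and multiplication by \<i> in
  \<open>cinner_eq\<close>.\<close>

definition cinner :: "L2 \<Rightarrow> L2 \<Rightarrow> complex" where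
 "cinner f g = (\<integral>x. rep_L2 f x * cnj (rep_L2 g x) \<partial>lborel)"

lemma Re_cinner: "Re (cinner f g) = f \<bullet> g"
proof -
 have "Re (cinner f g) = (\<integral>x. Re (rep_L2 f x * cnj (rep_L2 g x)) \<partial>lborel)"
  unfolding cinner_def by (rule integral_Re[symmetric]) (rule integrable_L2_prod)
 thus ?thesis by (simp add: inner_L2_rep inner_complex_def)
qed

lemma cinner_mult_left: "cinner (L2_mult (\<lambda>_. c) f) g = c * cinner f g"
proof -
 have "cinner (L2_mult (\<lambda>_. c) f) g = (\<integral>x. c * (rep_L2 f x * cnj (rep_L2 g x)) \<partial>lborel)"
  unfolding cinner_def
  by (rule integral_cong_AE)
    (use bdd_mult.rep[OF bdd_mult_const, of c f] in \<open>auto intro: borel_measurable_times elim!: eventually_mono\<close>)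
 thus ?thesis by (simp add: cinner_def)
qed

lemma cinner_eq: "cinner f g = Complex (f \<bullet> g) (- (L2_mult (\<lambda>_. \<i>) f \<bullet> g))"
proof (rule complex_eqI)
 show "Im (cinner f g) = Im (Complex (f \<bullet> g) (- (L2_mult (\<lambda>_. \<i>) f \<bullet> g)))"
  using Re_cinner[of "L2_mult (\<lambda>_. \<i>) f" g] by (simp add: cinner_mult_left)
qed (simp add: Re_cinner)

lemma cmod_cinner_le_integral: "cmod (cinner f g) \<le> (\<integral>x. mag f x * mag g x \<partial>lborel)"
 unfolding cinner_def
 using integral_norm_bound[of lb "\<lambda>x. rep_L2 f x * cnj (rep_L2 g x)"] by (simp add: norm_mult)

lemma ennreal_cinner_le:
 "ennreal (cmod (cinner f g)) \<le> (\<integral>\<^sup>+x. ennreal (mag f x * mag g x) \<partial>lborel)"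
 using cmod_cinner_le_integral[of f g] nn_integral_eq_integral[OF integrable_L2_prod(3)[of f g]]
 by (simp add: ennreal_leI)

definition cj :: "L2 \<Rightarrow> L2" where "cj f = L2_of (\<lambda>x. cnj (rep_L2 f x))"

lemma rep_cj: "AE x in lborel. rep_L2 (cj f) x = cnj (rep_L2 f x)"
 unfolding cj_def by (rule rep_L2_of, rule sq_integrable_dom[where C = 1 and f = f]) auto

lemma cj_cj [simp]: "cj (cj f) = f"
 by (rule L2_eqI) (use rep_cj[of f] rep_cj[of "cj f"] in \<open>eventually_elim, simp\<close>)

lemma norm_cj [simp]: "norm (cj f) = norm f"
proof -
 have "sq_integrable (\<lambda>x. cnj (rep_L2 f x))" by (rule sq_integrable_dom[where C = 1 and f = f]) auto
 hence "(norm (cj f))\<^sup>2 = (norm f)\<^sup>2" unfolding cj_def norm_L2_sq[of f] by (simp only: norm_L2_of complex_mod_cnj)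
 thus ?thesis by simp
qed

lemma cinner_cj: "cinner f (cj g) = (\<integral>x. rep_L2 f x * rep_L2 g x \<partial>lborel)"
 unfolding cinner_def
 by (rule integral_cong_AE) (use rep_cj[of g] in \<open>auto elim!: eventually_mono\<close>)

section \<open>Bounds on \<open>L\<^sup>p\<close> norms\<close>

text \<open>A bound predicate instead of a norm: it carries measurability and finiteness along, and
  phrased with nonnegative integrals it raises no integrability side conditions.\<close>

definition Lp_le :: "'a measure \<Rightarrow> real \<Rightarrow> ('a \<Rightarrow> real) \<Rightarrow> real \<Rightarrow> bool" where
 "Lp_le M p f A \<longleftrightarrow> f \<in> borel_measurable M \<and> 0 \<le> A \<and>
   (\<integral>\<^sup>+x. ennreal (\<bar>f x\<bar> powr p) \<partial>M) \<le> ennreal (A powr p)"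

abbreviation L83 :: "(real \<Rightarrow> real) \<Rightarrow> real \<Rightarrow> bool" where "L83 \<equiv> Lp_le lborel (8 / 3)"

lemma Lp_leD: "Lp_le M p f A \<Longrightarrow> f \<in> borel_measurable M" "Lp_le M p f A \<Longrightarrow> 0 \<le> A"
 "Lp_le M p f A \<Longrightarrow> (\<integral>\<^sup>+x. ennreal (\<bar>f x\<bar> powr p) \<partial>M) \<le> ennreal (A powr p)"
 by (simp_all add: Lp_le_def)

lemma Lp_le_weaken:
 assumes f: "Lp_le M p f A" and "A \<le> B" "0 < p"
 shows "Lp_le M p f B"
proof -
 have "ennreal (A powr p) \<le> ennreal (B powr p)"
  using assms by (intro ennreal_leI powr_mono2) (auto dest: Lp_leD)
 thus ?thesis using assms unfolding Lp_le_def by (auto intro: order_trans)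
qed

lemma Lp_le_mono_AE:
 assumes g: "Lp_le M p g A" and f: "f \<in> borel_measurable M"
  and le: "AE x in M. \<bar>f x\<bar> \<le> \<bar>g x\<bar>" and p: "0 < p"
 shows "Lp_le M p f A"
proof -
 have "(\<integral>\<^sup>+x. ennreal (\<bar>f x\<bar> powr p) \<partial>M) \<le> (\<integral>\<^sup>+x. ennreal (\<bar>g x\<bar> powr p) \<partial>M)"
  by (rule nn_integral_mono_AE, rule eventually_mono[OF le])
    (use p in \<open>auto intro!: ennreal_leI powr_mono2\<close>)
 thus ?thesis using g f unfolding Lp_le_def by (auto intro: order_trans)
qed

text \<open>Bounds are closed under limits of the constant. So Hoelder and Minkowski can be proved
  for positive constants, by which one may divide, and then extended to 0.\<close>

lemma Lp_le_lim:
 assumes f: "\<And>n::nat. Lp_le M p f (A n)" and A: "A \<longlonglongrightarrow> B" and p: "0 < p"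
 shows "Lp_le M p f B"
 unfolding Lp_le_def
proof (intro conjI)
 show "f \<in> borel_measurable M" using f by (rule Lp_leD)
 have nn: "0 \<le> A n" for n using f by (rule Lp_leD)
 show B: "0 \<le> B" by (rule tendsto_lowerbound[OF A]) (use nn in auto)
 have "(\<lambda>n. A n powr p) \<longlonglongrightarrow> B powr p"
  using p nn by (intro tendsto_powr2[OF A tendsto_const]) auto
 hence "(\<lambda>n. ennreal (A n powr p)) \<longlonglongrightarrow> ennreal (B powr p)"
  by (intro tendsto_ennrealI)
 thus "(\<integral>\<^sup>+x. ennreal (\<bar>f x\<bar> powr p) \<partial>M) \<le> ennreal (B powr p)"
  by (rule tendsto_lowerbound) (use Lp_leD(3)[OF f] in auto)
qed

lemma Lp_le_posI:
 assumes "\<And>e. 0 < e \<Longrightarrow> Lp_le M p f (A + e)" "0 < p"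
 shows "Lp_le M p f A"
proof (rule Lp_le_lim[of _ _ _ "\<lambda>n. A + inverse (real (Suc n))"])
 have "(\<lambda>n. A + inverse (real (Suc n))) \<longlonglongrightarrow> A + 0"
  by (intro tendsto_add tendsto_const LIMSEQ_inverse_real_of_nat)
 thus "(\<lambda>n. A + inverse (real (Suc n))) \<longlonglongrightarrow> A" by simp
qed (use assms in auto)

lemma Lp_le_cmult:
 assumes f: "Lp_le M p f A" and p: "0 < p"
 shows "Lp_le M p (\<lambda>x. c * f x) (\<bar>c\<bar> * A)"
 unfolding Lp_le_def
proof (intro conjI)
 have [measurable]: "f \<in> borel_measurable M" and A: "0 \<le> A" using f by (auto dest: Lp_leD)
 show "(\<lambda>x. c * f x) \<in> borel_measurable M" by simp
 show "0 \<le> \<bar>c\<bar> * A" using A by simp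
 have "(\<integral>\<^sup>+x. ennreal (\<bar>c * f x\<bar> powr p) \<partial>M) = (\<integral>\<^sup>+x. ennreal (\<bar>c\<bar> powr p) * ennreal (\<bar>f x\<bar> powr p) \<partial>M)"
  by (intro nn_integral_cong) (simp add: abs_mult powr_mult ennreal_mult)
 also have "\<dots> = ennreal (\<bar>c\<bar> powr p) * (\<integral>\<^sup>+x. ennreal (\<bar>f x\<bar> powr p) \<partial>M)"
  by (rule nn_integral_cmult) simp
 also have "\<dots> \<le> ennreal (\<bar>c\<bar> powr p) * ennreal (A powr p)"
  by (intro mult_left_mono Lp_leD(3)[OF f]) simp
 also have "\<dots> = ennreal ((\<bar>c\<bar> * A) powr p)"
  using A by (simp add: powr_mult ennreal_mult)
 finally show "(\<integral>\<^sup>+x. ennreal (\<bar>c * f x\<bar> powr p) \<partial>M) \<le> ennreal ((\<bar>c\<bar> * A) powr p)" .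
qed

lemma Lp_le_powr:
 assumes f: "Lp_le M p f A" and r: "0 < r"
 shows "Lp_le M (p / r) (\<lambda>x. \<bar>f x\<bar> powr r) (A powr r)"
 using assms unfolding Lp_le_def by (auto simp: powr_powr)

lemma nn_integral_convex_comb:
 assumes [measurable]: "f \<in> borel_measurable M" "g \<in> borel_measurable M"
  and f: "(\<integral>\<^sup>+x. ennreal (f x) \<partial>M) \<le> ennreal A" and g: "(\<integral>\<^sup>+x. ennreal (g x) \<partial>M) \<le> ennreal B"
  and nn: "0 \<le> A" "0 \<le> B" "\<And>x. 0 \<le> f x" "\<And>x. 0 \<le> g x" "0 \<le> s" "0 \<le> t"
 shows "(\<integral>\<^sup>+x. ennreal (s * f x + t * g x) \<partial>M) \<le> ennreal (s * A + t * B)"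
proof -
 have "(\<integral>\<^sup>+x. ennreal (s * f x + t * g x) \<partial>M) = (\<integral>\<^sup>+x. ennreal s * ennreal (f x) + ennreal t * ennreal (g x) \<partial>M)"
  by (intro nn_integral_cong) (simp add: nn ennreal_mult)
 also have "\<dots> = ennreal s * (\<integral>\<^sup>+x. ennreal (f x) \<partial>M) + ennreal t * (\<integral>\<^sup>+x. ennreal (g x) \<partial>M)"
  by (subst nn_integral_add) (auto simp: nn_integral_cmult)
 also have "\<dots> \<le> ennreal s * ennreal A + ennreal t * ennreal B"
  by (intro add_mono mult_left_mono f g) auto
 also have "\<dots> = ennreal (s * A + t * B)" using nn by (simp add: ennreal_mult)
 finally show ?thesis .
qed

lemma weighted_amgm:
 fixes a b s t :: real
 assumes "0 \<le> a" "0 \<le> b" "0 < s" "0 < t" "s + t = 1"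
 shows "a powr s * b powr t \<le> s * a + t * b"
proof (cases "a = 0 \<or> b = 0")
 case True
 thus ?thesis using assms by auto
next
 case False
 thus ?thesis using assms by (intro Youngs_inequality_0) auto
qed

text \<open>Hoelder's inequality. Once both factors are normalised, the weighted
  arithmetic-geometric mean inequality with weights r/p and r/q holds pointwise.\<close>

lemma Lp_le_mult:
 assumes f: "Lp_le M p f A" and g: "Lp_le M q g B"
  and pq: "0 < p" "0 < q" "0 < r" "1 / p + 1 / q = 1 / r"
 shows "Lp_le M r (\<lambda>x. f x * g x) (A * B)"
proof -
 have [measurable]: "f \<in> borel_measurable M" "g \<in> borel_measurable M" using f g by (auto dest: Lp_leD)
 have nn: "0 \<le> A" "0 \<le> B" using f g by (auto dest: Lp_leD)
 have main: "Lp_le M r (\<lambda>x. f x * g x) (A * B)"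
  if f: "Lp_le M p f A" and g: "Lp_le M q g B" and pos: "0 < A" "0 < B" for A B
  unfolding Lp_le_def
 proof (intro conjI)
  show "(\<lambda>x. f x * g x) \<in> borel_measurable M" by simp
  show "0 \<le> A * B" using pos by simp
  define s t where "s = r / p" and "t = r / q"
  have st: "0 < s" "0 < t" "s + t = 1"
  proof -
   have "s + t = r * (1 / p + 1 / q)" by (simp add: s_def t_def algebra_simps)
   also have "\<dots> = 1" using pq by simp
   finally show "s + t = 1" .
  qed (use pq in \<open>auto simp: s_def t_def\<close>)
  define F G where "F x = \<bar>f x\<bar> powr p / A powr p" and "G x = \<bar>g x\<bar> powr q / B powr q" for x
  have [measurable]: "F \<in> borel_measurable M" "G \<in> borel_measurable M"
   unfolding F_def G_def by measurable
  have nF: "0 \<le> F x" "0 \<le> G x" for x by (auto simp: F_def G_def)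
  have iF: "(\<integral>\<^sup>+x. ennreal (h x powr p / A powr p) \<partial>M) \<le> ennreal 1"
   if "(\<integral>\<^sup>+x. ennreal (h x powr p) \<partial>M) \<le> ennreal (A powr p)" "h \<in> borel_measurable M" "A > 0"
   for h and A p :: real
  proof -
   have "(\<integral>\<^sup>+x. ennreal (h x powr p / A powr p) \<partial>M) = (\<integral>\<^sup>+x. ennreal (1 / A powr p) * ennreal (h x powr p) \<partial>M)"
    by (intro nn_integral_cong) (simp add: ennreal_mult[symmetric])
   also have "\<dots> = ennreal (1 / A powr p) * (\<integral>\<^sup>+x. ennreal (h x powr p) \<partial>M)"
    using that by (intro nn_integral_cmult) measurable
   also have "\<dots> \<le> ennreal (1 / A powr p) * ennreal (A powr p)"
    using that by (intro mult_left_mono) auto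
   also have "\<dots> = ennreal 1" using that by (simp add: ennreal_mult[symmetric])
   finally show ?thesis .
  qed
  have pt: "\<bar>f x * g x\<bar> powr r \<le> (A * B) powr r * (s * F x + t * G x)" for x
  proof -
   have "\<bar>f x * g x\<bar> powr r = (A * B) powr r * (F x powr s * G x powr t)"
    using pos pq unfolding F_def G_def s_def t_def
    by (simp add: abs_mult powr_mult powr_divide powr_powr)
   also have "\<dots> \<le> (A * B) powr r * (s * F x + t * G x)"
    by (intro mult_left_mono weighted_amgm nF st) auto
   finally show ?thesis .
  qed
  have "(\<integral>\<^sup>+x. ennreal (\<bar>f x * g x\<bar> powr r) \<partial>M) \<le> (\<integral>\<^sup>+x. ennreal ((A * B) powr r) * ennreal (s * F x + t * G x) \<partial>M)"
  proof (rule nn_integral_mono)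
   fix x
   have "ennreal (\<bar>f x * g x\<bar> powr r) \<le> ennreal ((A * B) powr r * (s * F x + t * G x))"
    by (rule ennreal_leI[OF pt])
   also have "\<dots> = ennreal ((A * B) powr r) * ennreal (s * F x + t * G x)"
    using nF[of x] st by (intro ennreal_mult) simp_all
   finally show "ennreal (\<bar>f x * g x\<bar> powr r) \<le> ennreal ((A * B) powr r) * ennreal (s * F x + t * G x)" .
  qed
  also have "\<dots> = ennreal ((A * B) powr r) * (\<integral>\<^sup>+x. ennreal (s * F x + t * G x) \<partial>M)"
   by (rule nn_integral_cmult) measurable
  also have "\<dots> \<le> ennreal ((A * B) powr r) * ennreal (s * 1 + t * 1)"
  proof (rule mult_left_mono[OF nn_integral_convex_comb])
   show "(\<integral>\<^sup>+x. ennreal (F x) \<partial>M) \<le> ennreal 1" "(\<integral>\<^sup>+x. ennreal (G x) \<partial>M) \<le> ennreal 1"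
    unfolding F_def G_def by (rule iF; use f g pos in \<open>auto dest: Lp_leD\<close>)+
  qed (use nF st in auto)
  also have "\<dots> = ennreal ((A * B) powr r)" using st by simp
  finally show "(\<integral>\<^sup>+x. ennreal (\<bar>f x * g x\<bar> powr r) \<partial>M) \<le> ennreal ((A * B) powr r)" .
 qed
 show ?thesis
 proof (rule Lp_le_lim[of _ _ _ "\<lambda>n. (A + inverse (real (Suc n))) * (B + inverse (real (Suc n)))"])
  show "Lp_le M r (\<lambda>x. f x * g x) ((A + inverse (real (Suc n))) * (B + inverse (real (Suc n))))" for n
  proof (rule main)
   show "Lp_le M p f (A + inverse (real (Suc n)))" by (rule Lp_le_weaken[OF f]) (use pq in auto)
   show "Lp_le M q g (B + inverse (real (Suc n)))" by (rule Lp_le_weaken[OF g]) (use pq in auto)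
  qed (use nn in \<open>auto intro!: add_nonneg_pos\<close>)
  have "(\<lambda>n. (A + inverse (real (Suc n))) * (B + inverse (real (Suc n)))) \<longlonglongrightarrow> (A + 0) * (B + 0)"
   by (intro tendsto_mult tendsto_add tendsto_const LIMSEQ_inverse_real_of_nat)
  thus "(\<lambda>n. (A + inverse (real (Suc n))) * (B + inverse (real (Suc n)))) \<longlonglongrightarrow> A * B" by simp
 qed (use pq in auto)
qed

lemma powr_convex_nonneg:
 fixes u v s t p :: real
 assumes "0 \<le> u" "0 \<le> v" "0 < s" "0 < t" "s + t = 1" "1 \<le> p"
 shows "(s * u + t * v) powr p \<le> s * u powr p + t * v powr p"
proof -
 have small: "s powr p \<le> s" if "0 < s" "s \<le> 1" for s :: real
  using that assms(6) powr_mono'[of 1 p s] by simp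
 consider "u = 0" | "v = 0" | "0 < u" "0 < v" using assms by force
 thus ?thesis
 proof cases
  case 1
  thus ?thesis using assms small[of t] by (simp add: powr_mult mult_right_mono)
 next
  case 2
  thus ?thesis using assms small[of s] by (simp add: powr_mult mult_right_mono)
 next
  case 3
  have s: "s = 1 - t" using assms(5) by simp
  have "((1 - t) *\<^sub>R u + t *\<^sub>R v) powr p \<le> (1 - t) * u powr p + t * v powr p"
   using 3 assms(3,4) s by (intro convex_onD[OF powr_convex[OF assms(6)]]) auto
  thus ?thesis by (simp add: s)
 qed
qed

text \<open>Minkowski's inequality from convexity: with S = A + B, the sum |f| + |g| is S times the
  convex combination of |f|/A and |g|/B with weights A/S and B/S.\<close>

lemma Lp_le_add:
 assumes f: "Lp_le M p f A" and g: "Lp_le M p g B" and p: "1 \<le> p"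
 shows "Lp_le M p (\<lambda>x. f x + g x) (A + B)"
proof -
 have [measurable]: "f \<in> borel_measurable M" "g \<in> borel_measurable M" using f g by (auto dest: Lp_leD)
 have nn: "0 \<le> A" "0 \<le> B" using f g by (auto dest: Lp_leD)
 have main: "Lp_le M p (\<lambda>x. f x + g x) (A + B)"
  if f: "Lp_le M p f A" and g: "Lp_le M p g B" and pos: "0 < A" "0 < B" for A B
  unfolding Lp_le_def
 proof (intro conjI)
  show "(\<lambda>x. f x + g x) \<in> borel_measurable M" by simp
  show "0 \<le> A + B" using pos by simp
  define S where "S = A + B"
  have S: "0 < S" using pos by (simp add: S_def)
  define s t where "s = A / S" and "t = B / S"
  have st: "0 < s" "0 < t" "s + t = 1"
   using pos S by (auto simp: s_def t_def S_def add_divide_distrib[symmetric])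
  have pt: "\<bar>f x + g x\<bar> powr p \<le> (S powr p * s / A powr p) * \<bar>f x\<bar> powr p + (S powr p * t / B powr p) * \<bar>g x\<bar> powr p" for x
  proof -
   have "\<bar>f x + g x\<bar> powr p \<le> (S * (s * (\<bar>f x\<bar> / A) + t * (\<bar>g x\<bar> / B))) powr p"
   proof (rule powr_mono2)
    have "S * (s * (\<bar>f x\<bar> / A) + t * (\<bar>g x\<bar> / B)) = \<bar>f x\<bar> + \<bar>g x\<bar>"
     using pos S by (simp add: s_def t_def field_simps)
    thus "\<bar>f x + g x\<bar> \<le> S * (s * (\<bar>f x\<bar> / A) + t * (\<bar>g x\<bar> / B))" by simp
   qed (use p in auto)
   also have "\<dots> = S powr p * (s * (\<bar>f x\<bar> / A) + t * (\<bar>g x\<bar> / B)) powr p"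
    using S st pos by (simp add: powr_mult)
   also have "\<dots> \<le> S powr p * (s * (\<bar>f x\<bar> / A) powr p + t * (\<bar>g x\<bar> / B) powr p)"
    using st pos p by (intro mult_left_mono powr_convex_nonneg) auto
   also have "\<dots> = (S powr p * s / A powr p) * \<bar>f x\<bar> powr p + (S powr p * t / B powr p) * \<bar>g x\<bar> powr p"
    using pos by (simp add: powr_divide algebra_simps)
   finally show ?thesis .
  qed
  have "(\<integral>\<^sup>+x. ennreal (\<bar>f x + g x\<bar> powr p) \<partial>M)
    \<le> (\<integral>\<^sup>+x. ennreal ((S powr p * s / A powr p) * \<bar>f x\<bar> powr p + (S powr p * t / B powr p) * \<bar>g x\<bar> powr p) \<partial>M)"
   by (intro nn_integral_mono ennreal_leI pt)
  also have "\<dots> \<le> ennreal ((S powr p * s / A powr p) * A powr p + (S powr p * t / B powr p) * B powr p)"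
   using st pos f g by (intro nn_integral_convex_comb) (auto dest: Lp_leD)
  also have "(S powr p * s / A powr p) * A powr p + (S powr p * t / B powr p) * B powr p = S powr p * (s + t)"
   using pos by (simp add: algebra_simps)
  finally show "(\<integral>\<^sup>+x. ennreal (\<bar>f x + g x\<bar> powr p) \<partial>M) \<le> ennreal ((A + B) powr p)"
   using st by (simp add: S_def)
 qed
 show ?thesis
 proof (rule Lp_le_posI)
  fix e :: real assume e: "0 < e"
  have "Lp_le M p (\<lambda>x. f x + g x) ((A + e / 2) + (B + e / 2))"
  proof (rule main)
   show "Lp_le M p f (A + e / 2)" by (rule Lp_le_weaken[OF f]) (use p e in auto)
   show "Lp_le M p g (B + e / 2)" by (rule Lp_le_weaken[OF g]) (use p e in auto)
  qed (use nn e in auto)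
  thus "Lp_le M p (\<lambda>x. f x + g x) (A + B + e)" by (simp add: algebra_simps)
 qed (use p in auto)
qed

lemma Lp_le_liminf:
 assumes f: "\<And>n::nat. Lp_le M p (f n) A" and g[measurable]: "g \<in> borel_measurable M"
  and le: "AE x in M. ennreal (\<bar>g x\<bar> powr p) \<le> liminf (\<lambda>n. ennreal (\<bar>f n x\<bar> powr p))"
 shows "Lp_le M p g A"
proof -
 have [measurable]: "f n \<in> borel_measurable M" for n using f by (rule Lp_leD)
 have "(\<integral>\<^sup>+x. ennreal (\<bar>g x\<bar> powr p) \<partial>M) \<le> (\<integral>\<^sup>+x. liminf (\<lambda>n. ennreal (\<bar>f n x\<bar> powr p)) \<partial>M)"
  by (rule nn_integral_mono_AE[OF le])
 also have "\<dots> \<le> liminf (\<lambda>n. \<integral>\<^sup>+x. ennreal (\<bar>f n x\<bar> powr p) \<partial>M)"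
  by (rule nn_integral_liminf) measurable
 also have "\<dots> \<le> liminf (\<lambda>n. ennreal (A powr p))"
  by (intro Liminf_mono always_eventually allI Lp_leD(3)[OF f])
 finally show ?thesis using f[of 0] by (simp add: Lp_le_def Liminf_const)
qed

lemma Lp_le_Fatou:
 assumes f: "\<And>n::nat. Lp_le M p (f n) A" and g: "g \<in> borel_measurable M"
  and lim: "AE x in M. (\<lambda>n. f n x) \<longlonglongrightarrow> g x" and p: "0 < p"
 shows "Lp_le M p g A"
proof (rule Lp_le_liminf[OF f g], rule eventually_mono[OF lim])
 fix x assume "(\<lambda>n. f n x) \<longlonglongrightarrow> g x"
 hence "(\<lambda>n. ennreal (\<bar>f n x\<bar> powr p)) \<longlonglongrightarrow> ennreal (\<bar>g x\<bar> powr p)"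
  using p by (intro tendsto_ennrealI tendsto_powr2 tendsto_rabs tendsto_const) auto
 thus "ennreal (\<bar>g x\<bar> powr p) \<le> liminf (\<lambda>n. ennreal (\<bar>f n x\<bar> powr p))"
  by (intro eq_refl lim_imp_Liminf[symmetric]) simp
qed

section \<open>The Fourier transform of Gaussians\<close>

text \<open>The characteristic function of the standard normal law, freed of its
  normalisation.\<close>

lemma gauss_1d:
 "integrable lborel (\<lambda>x. complex_of_real (exp (- x\<^sup>2 / 2)) * cis (- (t * x)))"
 "(\<integral>x. complex_of_real (exp (- x\<^sup>2 / 2)) * cis (- (t * x)) \<partial>lborel)
  = complex_of_real (sqrt (2 * pi) * exp (- t\<^sup>2 / 2))"
proof -
 have d: "std_normal_density x = exp (- x\<^sup>2 / 2) / sqrt (2 * pi)" for x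
  by (simp add: std_normal_density_def)
 have ir: "integrable lborel (\<lambda>x. exp (- x\<^sup>2 / 2) :: real)"
  using integrable_mult_right[OF integrable_normal_density[of 1 0], of "sqrt (2 * pi)"]
  by (simp add: d)
 show i: "integrable lborel (\<lambda>x. complex_of_real (exp (- x\<^sup>2 / 2)) * cis (- (t * x)))"
 proof (rule Bochner_Integration.integrable_bound[OF ir])
  show "(\<lambda>x. complex_of_real (exp (- x\<^sup>2 / 2)) * cis (- (t * x))) \<in> borel_measurable lborel"
   unfolding cis_conv_exp by measurable
 qed (auto simp: norm_mult)
 have "char std_normal_distribution (- t) = (\<integral>x. std_normal_density x *\<^sub>R iexp (- t * x) \<partial>lborel)"
  unfolding char_def by (subst integral_density) (auto simp: normal_density_nonneg)
 also have "\<dots> = (\<integral>x. (complex_of_real (exp (- x\<^sup>2 / 2)) * cis (- (t * x))) / complex_of_real (sqrt (2 * pi)) \<partial>lborel)"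
  by (intro Bochner_Integration.integral_cong refl)
    (simp add: d scaleR_conv_of_real cis_conv_exp)
 also have "\<dots> = (\<integral>x. complex_of_real (exp (- x\<^sup>2 / 2)) * cis (- (t * x)) \<partial>lborel) / complex_of_real (sqrt (2 * pi))"
  by (rule integral_divide_zero)
 finally show "(\<integral>x. complex_of_real (exp (- x\<^sup>2 / 2)) * cis (- (t * x)) \<partial>lborel)
  = complex_of_real (sqrt (2 * pi) * exp (- t\<^sup>2 / 2))"
  by (simp add: char_std_normal_distribution field_simps)
qed

text \<open>Reduces products of functions of one coordinate to dimension one; it serves the Gaussian
  and the weight in \<open>weight_L4\<close>.\<close>

lemma lborel_prod_Basis:
 fixes g :: "'a::euclidean_space \<Rightarrow> real \<Rightarrow> 'c::{real_normed_field, banach, second_countable_topology}"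
 assumes i: "\<And>b. b \<in> Basis \<Longrightarrow> integrable lborel (g b)"
 shows "integrable lborel (\<lambda>x::'a. \<Prod>b\<in>Basis. g b (x \<bullet> b))"
  and "(LINT x|(lborel :: 'a measure). (\<Prod>b\<in>Basis. g b (x \<bullet> b))) = (\<Prod>b\<in>Basis. \<integral>x. g b x \<partial>lborel)"
proof -
 interpret product_sigma_finite "\<lambda>_::'a. lborel :: real measure" ..
 let ?T = "\<lambda>f::'a \<Rightarrow> real. \<Sum>b\<in>Basis. f b *\<^sub>R b"
 let ?P = "Pi\<^sub>M Basis (\<lambda>_::'a. lborel :: real measure)"
 have lb: "(lborel :: 'a measure) = distr ?P borel ?T"
  by (simp only: lborel_eq_real[symmetric] lborel_def[where 'a = 'a])
 have [measurable]: "g b \<in> borel_measurable borel" if "b \<in> Basis" for b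
  using i[OF that] by (auto dest: borel_measurable_integrable)
 have T[measurable]: "?T \<in> measurable ?P borel" by measurable
 have gm: "(\<lambda>x::'a. \<Prod>b\<in>Basis. g b (x \<bullet> b)) \<in> borel_measurable borel"
  by (intro borel_measurable_prod) (auto intro: measurable_compose[rotated])
 have c: "(\<Prod>b\<in>Basis. g b (?T f \<bullet> b)) = (\<Prod>b\<in>Basis. g b (f b))" for f
  by (intro prod.cong refl) simp
 show "integrable lborel (\<lambda>x::'a. \<Prod>b\<in>Basis. g b (x \<bullet> b))"
  unfolding lb integrable_distr_eq[OF T gm] c
  by (rule product_integrable_prod) (auto intro: i)
 show "(LINT x|(lborel :: 'a measure). (\<Prod>b\<in>Basis. g b (x \<bullet> b))) = (\<Prod>b\<in>Basis. \<integral>x. g b x \<partial>lborel)"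
  unfolding lb integral_distr[OF T gm] c
  by (rule product_integral_prod) (auto intro: i)
qed

definition gau :: "real^3 \<Rightarrow> real" where "gau x = exp (- (norm x)\<^sup>2 / 2)"

lemma gau_pos: "0 < gau x" and gau_le_1: "gau x \<le> 1" and gau_minus: "gau (- x) = gau x"
 by (auto simp: gau_def)

lemma gau_measurable [measurable]: "gau \<in> borel_measurable borel"
 unfolding gau_def by measurable

lemma cis_sum: "cis (\<Sum>i\<in>A. f i) = (\<Prod>i\<in>A. cis (f i))"
 by (induction A rule: infinite_finite_induct) (auto simp: cis_mult[symmetric])

lemma gauss_fourier:
 "integrable lborel (\<lambda>x. cis (- (t \<bullet> x)) * complex_of_real (gau x))"
 "(\<integral>x. cis (- (t \<bullet> x)) * complex_of_real (gau x) \<partial>lborel) = complex_of_real (sqrt (2 * pi) ^ 3 * gau t)"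
proof -
 let ?g = "\<lambda>b x. complex_of_real (exp (- x\<^sup>2 / 2)) * cis (- ((t \<bullet> b) * x))"
 have n: "(norm x)\<^sup>2 = (\<Sum>b\<in>Basis. (x \<bullet> b)\<^sup>2)" for x :: "real^3"
  unfolding power2_norm_eq_inner by (subst euclidean_inner) (simp add: power2_eq_square)
 have gp: "gau x = (\<Prod>b\<in>Basis. exp (- (x \<bullet> b)\<^sup>2 / 2))" for x
  unfolding gau_def n by (simp add: exp_sum[symmetric] sum_negf sum_divide_distrib)
 have p: "cis (- (t \<bullet> x)) * complex_of_real (gau x) = (\<Prod>b\<in>Basis. ?g b (x \<bullet> b))" for x
 proof -
  have "t \<bullet> x = (\<Sum>b\<in>Basis. (t \<bullet> b) * (x \<bullet> b))" by (rule euclidean_inner)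
  hence "cis (- (t \<bullet> x)) = (\<Prod>b\<in>Basis. cis (- ((t \<bullet> b) * (x \<bullet> b))))"
   by (simp add: cis_sum[symmetric] sum_negf)
  thus ?thesis by (simp add: gp prod.distrib mult.commute)
 qed
 show "integrable lborel (\<lambda>x. cis (- (t \<bullet> x)) * complex_of_real (gau x))"
  unfolding p by (rule lborel_prod_Basis(1)) (rule gauss_1d)
 have "(\<integral>x. cis (- (t \<bullet> x)) * complex_of_real (gau x) \<partial>lborel) = (\<Prod>b\<in>Basis. \<integral>x. ?g b x \<partial>lborel)"
  unfolding p by (rule lborel_prod_Basis(2)) (rule gauss_1d)
 also have "\<dots> = (\<Prod>b\<in>(Basis::(real^3) set). complex_of_real (sqrt (2 * pi) * exp (- (t \<bullet> b)\<^sup>2 / 2)))"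
  by (simp only: gauss_1d)
 also have "\<dots> = complex_of_real (sqrt (2 * pi) ^ 3 * gau t)"
  by (simp add: gp prod.distrib prod_constant)
 finally show "(\<integral>x. cis (- (t \<bullet> x)) * complex_of_real (gau x) \<partial>lborel) = complex_of_real (sqrt (2 * pi) ^ 3 * gau t)" .
qed

lemma integrable_gau: "integrable lborel gau"
 and integral_gau: "(\<integral>x. gau x \<partial>lborel) = sqrt (2 * pi) ^ 3"
proof -
 have i: "integrable lborel (\<lambda>x. complex_of_real (gau x))"
  using gauss_fourier(1)[of 0] by simp
 hence "integrable lborel (\<lambda>x. Re (complex_of_real (gau x)))" by (rule integrable_Re)
 thus "integrable lborel gau" by simp
 have "(\<integral>x. Re (complex_of_real (gau x)) \<partial>lborel) = Re (\<integral>x. complex_of_real (gau x) \<partial>lborel)"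
  by (rule integral_Re[OF i])
 thus "(\<integral>x. gau x \<partial>lborel) = sqrt (2 * pi) ^ 3"
  using arg_cong[OF gauss_fourier(2)[of 0], of Re] by (simp add: gau_def[of 0])
qed

lemma integral_scale:
 fixes f :: "real^3 \<Rightarrow> 'b::{banach, second_countable_topology}"
 assumes [measurable]: "f \<in> borel_measurable borel" and s: "0 < s"
 shows "(\<integral>x. f x \<partial>lborel) = s ^ 3 *\<^sub>R (\<integral>x. f (s *\<^sub>R x) \<partial>lborel)"
proof -
 have "(\<integral>x. f x \<partial>lborel) = (\<integral>x. f x \<partial>Nonnegative_Lebesgue_Integration.density (distr lborel borel (\<lambda>x. 0 + s *\<^sub>R x)) (\<lambda>_. ennreal (\<bar>s\<bar> ^ DIM(real^3))))"
  using s by (subst lborel_affine[of s 0]) auto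
 also have "\<dots> = (\<integral>x. s ^ 3 *\<^sub>R f x \<partial>distr lborel borel (\<lambda>x. 0 + s *\<^sub>R x))"
  using s by (subst integral_density) auto
 also have "\<dots> = (\<integral>x. s ^ 3 *\<^sub>R f (s *\<^sub>R x) \<partial>lborel)"
  by (subst integral_distr) auto
 also have "\<dots> = s ^ 3 *\<^sub>R (\<integral>x. f (s *\<^sub>R x) \<partial>lborel)"
  by (rule integral_scaleR_right)
 finally show ?thesis .
qed

lemma integrable_scale:
 fixes f :: "real^3 \<Rightarrow> 'b::{banach, second_countable_topology}"
 assumes [measurable]: "f \<in> borel_measurable borel" and s: "0 < s" and f: "integrable lborel f"
 shows "integrable lborel (\<lambda>x. f (s *\<^sub>R x))"
proof -
 have "integrable (Nonnegative_Lebesgue_Integration.density (distr lborel borel (\<lambda>x. 0 + s *\<^sub>R x)) (\<lambda>_. ennreal (\<bar>s\<bar> ^ DIM(real^3)))) f"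
  using s f by (subst lborel_affine[of s 0, symmetric]) auto
 hence "integrable (distr lborel borel (\<lambda>x. 0 + s *\<^sub>R x)) (\<lambda>x. s ^ 3 *\<^sub>R f x)"
  using s by (subst (asm) integrable_density) auto
 hence "integrable lborel (\<lambda>x. s ^ 3 *\<^sub>R f (s *\<^sub>R x))"
  by (subst (asm) integrable_distr_eq) auto
 hence "integrable lborel (\<lambda>x. inverse (s ^ 3) *\<^sub>R s ^ 3 *\<^sub>R f (s *\<^sub>R x))"
  by (rule integrable_scaleR_right)
 thus ?thesis using s by simp
qed

section \<open>The Fourier integral\<close>

text \<open>Unnormalised; the constant \<open>cF\<close> comes in only when passing to L^2.\<close>

definition ft :: "(real^3 \<Rightarrow> complex) \<Rightarrow> real^3 \<Rightarrow> complex" where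
 "ft f \<xi> = (\<integral>x. cis (- (\<xi> \<bullet> x)) * f x \<partial>lborel)"

lemma cis_measurable [measurable]: "f \<in> borel_measurable M \<Longrightarrow> (\<lambda>x. cis (f x)) \<in> borel_measurable M"
 by (rule borel_measurable_continuous_on[OF continuous_on_cis[OF continuous_on_id]])

lemma ft_integrable:
 assumes f: "integrable lb f" and [measurable]: "g \<in> borel_measurable borel"
 shows "integrable lb (\<lambda>x. cis (g x) * f x)"
proof (rule Bochner_Integration.integrable_bound[OF f])
 have [measurable]: "f \<in> borel_measurable borel" using f by (auto dest: borel_measurable_integrable)
 show "(\<lambda>x. cis (g x) * f x) \<in> borel_measurable lb" by measurable
qed (auto simp: norm_mult)

lemma ft_measurable [measurable]:
 assumes f: "integrable lb f" shows "ft f \<in> borel_measurable borel"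
proof -
 have [measurable]: "f \<in> borel_measurable borel" using f by (auto dest: borel_measurable_integrable)
 have "(\<lambda>\<xi>. \<integral>x. cis (- (\<xi> \<bullet> x)) * f x \<partial>lborel) \<in> borel_measurable borel" by measurable
 thus ?thesis by (simp add: ft_def[abs_def])
qed

lemma cmod_ft_le:
 assumes f: "integrable lb f" shows "cmod (ft f \<xi>) \<le> (\<integral>x. cmod (f x) \<partial>lborel)"
 unfolding ft_def
 using integral_norm_bound[of lb "\<lambda>x. cis (- (\<xi> \<bullet> x)) * f x"] by (simp add: norm_mult)

lemma ft_translate:
 assumes f: "integrable lb f"
 shows "ft (\<lambda>x. f (x + y)) \<xi> = cis (\<xi> \<bullet> y) * ft f \<xi>"
proof -
 have [measurable]: "f \<in> borel_measurable borel" using f by (auto dest: borel_measurable_integrable)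
 have "ft (\<lambda>x. f (x + y)) \<xi> = (\<integral>x. cis (- (\<xi> \<bullet> ((x + y) - y))) * f (x + y) \<partial>lborel)"
  by (simp add: ft_def)
 also have "\<dots> = (\<integral>x. cis (- (\<xi> \<bullet> (x - y))) * f x \<partial>lborel)"
  by (rule integral_translate[of "\<lambda>x. cis (- (\<xi> \<bullet> (x - y))) * f x" y]) measurable
 also have "\<dots> = (\<integral>x. cis (\<xi> \<bullet> y) * (cis (- (\<xi> \<bullet> x)) * f x) \<partial>lborel)"
  by (simp add: inner_diff_right mult.assoc[symmetric] cis_mult)
 finally show ?thesis by (simp add: ft_def)
qed

lemma ft_modulate: "ft (\<lambda>x. cis (- (\<eta> \<bullet> x)) * f x) \<xi> = ft f (\<xi> + \<eta>)"
 by (simp add: ft_def mult.assoc[symmetric] cis_mult inner_add_left)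

text \<open>Fubini's theorem for a kernel that is symmetric in \<xi> and x. Both the Gaussian
  regularisation and the adjoint of the transform come from it.\<close>

lemma ft_mult_formula:
 assumes f: "integrable lb f" and g: "integrable lb g"
 shows "(\<integral>\<xi>. g \<xi> * ft f \<xi> \<partial>lborel) = (\<integral>x. ft g x * f x \<partial>lborel)"
proof -
 have [measurable]: "f \<in> borel_measurable borel" "g \<in> borel_measurable borel"
  using f g by (auto dest: borel_measurable_integrable)
 have i: "integrable (lb \<Otimes>\<^sub>M lb) (\<lambda>(\<xi>, x). g \<xi> * (cis (- (\<xi> \<bullet> x)) * f x))"
 proof (rule lborel_pair.Fubini_integrable)
  show "(\<lambda>(\<xi>, x). g \<xi> * (cis (- (\<xi> \<bullet> x)) * f x)) \<in> borel_measurable (lb \<Otimes>\<^sub>M lb)" by measurable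
  show "integrable lb (\<lambda>\<xi>. \<integral>x. norm (case (\<xi>, x) of (\<xi>, x) \<Rightarrow> g \<xi> * (cis (- (\<xi> \<bullet> x)) * f x)) \<partial>lb)"
   using g by (simp add: norm_mult integrable_norm)
  show "AE \<xi> in lb. integrable lb (\<lambda>x. case (\<xi>, x) of (\<xi>, x) \<Rightarrow> g \<xi> * (cis (- (\<xi> \<bullet> x)) * f x))"
   by (auto intro!: AE_I2 integrable_mult_right ft_integrable f)
 qed
 have "(\<integral>\<xi>. g \<xi> * ft f \<xi> \<partial>lborel) = (\<integral>\<xi>. (\<integral>x. g \<xi> * (cis (- (\<xi> \<bullet> x)) * f x) \<partial>lb) \<partial>lb)"
  by (simp add: ft_def)
 also have "\<dots> = (\<integral>x. (\<integral>\<xi>. g \<xi> * (cis (- (\<xi> \<bullet> x)) * f x) \<partial>lb) \<partial>lb)"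
  using lborel_pair.Fubini_integral[OF i] by simp
 also have "\<dots> = (\<integral>x. (\<integral>\<xi>. (cis (- (x \<bullet> \<xi>)) * g \<xi>) * f x \<partial>lb) \<partial>lb)"
  by (simp add: inner_commute mult_ac)
 finally show ?thesis by (simp add: ft_def)
qed

text \<open>A modulated Gaussian of width 1/s becomes, up to a constant, an approximate identity of
  width s centred at x.\<close>

lemma ft_gau_scaled:
 assumes s: "0 < s"
 shows "ft (\<lambda>\<xi>. cis (\<xi> \<bullet> x) * complex_of_real (gau (s *\<^sub>R \<xi>))) y
  = complex_of_real (sqrt (2 * pi) ^ 3 / s ^ 3 * gau (inverse s *\<^sub>R (y - x)))"
proof -
 let ?t = "inverse s *\<^sub>R (y - x)"
 have "complex_of_real (sqrt (2 * pi) ^ 3 * gau ?t) = (\<integral>\<xi>. cis (- (?t \<bullet> \<xi>)) * complex_of_real (gau \<xi>) \<partial>lb)"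
  by (simp only: gauss_fourier)
 also have "\<dots> = s ^ 3 *\<^sub>R (\<integral>\<xi>. cis (- (?t \<bullet> (s *\<^sub>R \<xi>))) * complex_of_real (gau (s *\<^sub>R \<xi>)) \<partial>lb)"
  by (rule integral_scale[OF _ s]) measurable
 also have "(\<integral>\<xi>. cis (- (?t \<bullet> (s *\<^sub>R \<xi>))) * complex_of_real (gau (s *\<^sub>R \<xi>)) \<partial>lb)
   = ft (\<lambda>\<xi>. cis (\<xi> \<bullet> x) * complex_of_real (gau (s *\<^sub>R \<xi>))) y"
  unfolding ft_def
 proof (intro Bochner_Integration.integral_cong refl)
  fix \<xi>
  have "cis (- (y \<bullet> \<xi>)) * cis (\<xi> \<bullet> x) = cis (- (?t \<bullet> (s *\<^sub>R \<xi>)))"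
  proof -
   have "?t \<bullet> (s *\<^sub>R \<xi>) = (y - x) \<bullet> \<xi>" using s by simp
   also have "\<dots> = y \<bullet> \<xi> - \<xi> \<bullet> x" by (simp add: inner_diff_left inner_commute[of x])
   finally show ?thesis by (simp add: cis_mult)
  qed
  thus "cis (- (?t \<bullet> (s *\<^sub>R \<xi>))) * complex_of_real (gau (s *\<^sub>R \<xi>))
   = cis (- (y \<bullet> \<xi>)) * (cis (\<xi> \<bullet> x) * complex_of_real (gau (s *\<^sub>R \<xi>)))"
   by (simp only: mult.assoc[symmetric])
 qed
 finally show ?thesis using s
  by (simp add: scaleR_conv_of_real field_simps)
qed

lemma integrable_gau_scaled: "0 < s \<Longrightarrow> integrable lb (\<lambda>\<xi>. gau (s *\<^sub>R \<xi>))"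
 by (rule integrable_scale[OF _ _ integrable_gau]) auto

text \<open>
 The left-hand side increases to \<open>\<parallel>ft f\<parallel>\<^sup>2\<close> as \<open>s\<close> decreases to \<open>0\<close>, while the Gaussian average on the
 right-hand side tends to \<open>f x\<close>.
\<close>

lemma gauss_plancherel:
 assumes f: "integrable lb f" and s: "0 < s"
 shows "integrable lb (\<lambda>\<xi>. (cmod (ft f \<xi>))\<^sup>2 * gau (s *\<^sub>R \<xi>))"
  and "complex_of_real (\<integral>\<xi>. (cmod (ft f \<xi>))\<^sup>2 * gau (s *\<^sub>R \<xi>) \<partial>lborel)
   = complex_of_real (sqrt (2 * pi) ^ 3) * (\<integral>x. cnj (\<integral>z. complex_of_real (gau z) * f (x + s *\<^sub>R z) \<partial>lborel) * f x \<partial>lborel)"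
proof -
 let ?M = "\<integral>x. cmod (f x) \<partial>lborel"
 have [measurable]: "f \<in> borel_measurable borel" "ft f \<in> borel_measurable borel"
  using f ft_measurable[OF f] by (auto dest: borel_measurable_integrable)
 have gi: "integrable lb (\<lambda>\<xi>. gau (s *\<^sub>R \<xi>))" by (rule integrable_gau_scaled[OF s])
 have gi': "integrable lb (\<lambda>\<xi>. complex_of_real (gau (s *\<^sub>R \<xi>)))" using gi by simp
 have M0: "0 \<le> ?M" by simp
 show i: "integrable lb (\<lambda>\<xi>. (cmod (ft f \<xi>))\<^sup>2 * gau (s *\<^sub>R \<xi>))"
 proof (rule Bochner_Integration.integrable_bound[OF integrable_mult_right[OF gi, of "?M\<^sup>2"]])
  show "AE \<xi> in lb. norm ((cmod (ft f \<xi>))\<^sup>2 * gau (s *\<^sub>R \<xi>)) \<le> norm (?M\<^sup>2 * gau (s *\<^sub>R \<xi>))"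
   using cmod_ft_le[OF f] by (intro AE_I2) (auto simp: abs_mult intro!: mult_right_mono power_mono)
 qed measurable
 \<comment> \<open>The multiplication formula moves the transform from f to this damped conjugate,
   whose own transform is the conjugate of a Gaussian mean of f.\<close>
 let ?G = "\<lambda>\<xi>. complex_of_real (gau (s *\<^sub>R \<xi>)) * cnj (ft f \<xi>)"
 have Gi: "integrable lb ?G"
 proof (rule Bochner_Integration.integrable_bound[OF integrable_mult_right[OF gi, of ?M]])
  show "AE \<xi> in lb. norm (?G \<xi>) \<le> norm (?M * gau (s *\<^sub>R \<xi>))"
  proof (rule AE_I2)
   fix \<xi>
   have "norm (?G \<xi>) = cmod (ft f \<xi>) * gau (s *\<^sub>R \<xi>)"
    using gau_pos[of "s *\<^sub>R \<xi>"] by (simp add: norm_mult mult.commute)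
   also have "\<dots> \<le> ?M * gau (s *\<^sub>R \<xi>)"
    using gau_pos[of "s *\<^sub>R \<xi>"] by (intro mult_right_mono cmod_ft_le f) simp
   finally show "norm (?G \<xi>) \<le> norm (?M * gau (s *\<^sub>R \<xi>))" by simp
  qed
  show "?G \<in> borel_measurable lb" by measurable
 qed
 have Gf: "ft ?G x = cnj (complex_of_real (sqrt (2 * pi) ^ 3) * (\<integral>z. complex_of_real (gau z) * f (x + s *\<^sub>R z) \<partial>lborel))" for x
 proof -
  have "ft ?G x = (\<integral>\<xi>. cnj ((cis (\<xi> \<bullet> x) * complex_of_real (gau (s *\<^sub>R \<xi>))) * ft f \<xi>) \<partial>lb)"
   unfolding ft_def[of ?G] by (intro Bochner_Integration.integral_cong refl) (simp add: cis_cnj inner_commute mult_ac)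
  also have "\<dots> = cnj (\<integral>\<xi>. (cis (\<xi> \<bullet> x) * complex_of_real (gau (s *\<^sub>R \<xi>))) * ft f \<xi> \<partial>lb)"
   by (rule integral_bounded_linear'[OF bounded_linear_cnj bounded_linear_cnj]) simp_all
  also have "(\<integral>\<xi>. (cis (\<xi> \<bullet> x) * complex_of_real (gau (s *\<^sub>R \<xi>))) * ft f \<xi> \<partial>lb)
    = (\<integral>y. ft (\<lambda>\<xi>. cis (\<xi> \<bullet> x) * complex_of_real (gau (s *\<^sub>R \<xi>))) y * f y \<partial>lb)"
   by (rule ft_mult_formula[OF f]) (auto intro!: ft_integrable gi')
  also have "\<dots> = (\<integral>y. complex_of_real (sqrt (2 * pi) ^ 3 / s ^ 3 * gau (inverse s *\<^sub>R (y - x))) * f y \<partial>lb)"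
   by (simp only: ft_gau_scaled[OF s])
  also have "\<dots> = (\<integral>y. complex_of_real (sqrt (2 * pi) ^ 3 / s ^ 3 * gau (inverse s *\<^sub>R y)) * f (x + y) \<partial>lb)"
   using integral_translate[of "\<lambda>y. complex_of_real (sqrt (2 * pi) ^ 3 / s ^ 3 * gau (inverse s *\<^sub>R (y - x))) * f y" x, symmetric]
   by (simp add: add.commute)
  also have "\<dots> = s ^ 3 *\<^sub>R (\<integral>y. complex_of_real (sqrt (2 * pi) ^ 3 / s ^ 3 * gau y) * f (x + s *\<^sub>R y) \<partial>lb)"
   by (subst integral_scale[OF _ s]) (use s in auto)
  also have "\<dots> = complex_of_real (sqrt (2 * pi) ^ 3) * (\<integral>z. complex_of_real (gau z) * f (x + s *\<^sub>R z) \<partial>lborel)"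
  proof -
   have "complex_of_real (sqrt (2 * pi) ^ 3 / s ^ 3 * gau y) * f (x + s *\<^sub>R y)
    = complex_of_real (sqrt (2 * pi) ^ 3 / s ^ 3) * (complex_of_real (gau y) * f (x + s *\<^sub>R y))" for y
    by simp
   thus ?thesis using s
    by (simp only: integral_mult_right_zero scaleR_conv_of_real) simp
  qed
  finally show ?thesis .
 qed
 have "complex_of_real (\<integral>\<xi>. (cmod (ft f \<xi>))\<^sup>2 * gau (s *\<^sub>R \<xi>) \<partial>lborel)
   = (\<integral>\<xi>. ?G \<xi> * ft f \<xi> \<partial>lborel)"
  unfolding integral_complex_of_real[symmetric]
  by (intro Bochner_Integration.integral_cong refl)
    (simp add: complex_norm_square[symmetric] mult_ac flip: complex_norm_square)
 also have "\<dots> = (\<integral>x. ft ?G x * f x \<partial>lborel)" by (rule ft_mult_formula[OF f Gi])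
 also have "\<dots> = (\<integral>x. complex_of_real (sqrt (2 * pi) ^ 3) * (cnj (\<integral>z. complex_of_real (gau z) * f (x + s *\<^sub>R z) \<partial>lborel) * f x) \<partial>lborel)"
  by (simp add: Gf mult.assoc del: of_real_power)
 also have "\<dots> = complex_of_real (sqrt (2 * pi) ^ 3) * (\<integral>x. cnj (\<integral>z. complex_of_real (gau z) * f (x + s *\<^sub>R z) \<partial>lborel) * f x \<partial>lborel)"
  by (rule integral_mult_right_zero)
 finally show "complex_of_real (\<integral>\<xi>. (cmod (ft f \<xi>))\<^sup>2 * gau (s *\<^sub>R \<xi>) \<partial>lborel)
   = complex_of_real (sqrt (2 * pi) ^ 3) * (\<integral>x. cnj (\<integral>z. complex_of_real (gau z) * f (x + s *\<^sub>R z) \<partial>lborel) * f x \<partial>lborel)" .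
qed

section \<open>Plancherel's theorem\<close>

lemma lebesgue_integral_cnj: "(\<integral>x. cnj (f x) \<partial>M) = cnj (\<integral>x. f x \<partial>M)"
 by (rule integral_bounded_linear'[OF bounded_linear_cnj bounded_linear_cnj]) simp_all

lemma tendsto_cinner:
 assumes "X \<longlonglongrightarrow> f" "Y \<longlonglongrightarrow> g"
 shows "(\<lambda>n. cinner (X n) (Y n)) \<longlonglongrightarrow> cinner f g"
proof -
 interpret bdd_mult "\<lambda>_. \<i>" "cmod \<i>" by (rule bdd_mult_const)
 have "(\<lambda>n. L2_mult (\<lambda>_. \<i>) (X n)) \<longlonglongrightarrow> L2_mult (\<lambda>_. \<i>) f"
  by (rule bounded_linear.tendsto[OF bounded_linear assms(1)])
 thus ?thesis unfolding cinner_eq by (intro tendsto_Complex tendsto_minus tendsto_inner assms)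
qed

lemma cinner_self: "cinner f f = complex_of_real ((norm f)\<^sup>2)"
proof -
 have "cinner f f = (\<integral>x. complex_of_real ((mag f x)\<^sup>2) \<partial>lborel)"
  unfolding cinner_def by (simp only: complex_norm_square[symmetric])
 thus ?thesis by (simp only: norm_L2_sq integral_complex_of_real)
qed

lemma cmod_cinner_le: "cmod (cinner f g) \<le> norm f * norm g"
proof (cases "cinner f g = 0")
 case False
 \<comment> \<open>This phase rotates the complex pairing onto the positive axis, where the real
   Cauchy-Schwarz inequality applies.\<close>
 define c where "c = cnj (cinner f g) / cmod (cinner f g)"
 have c: "cmod c = 1" using False by (simp add: c_def norm_divide)
 have "cmod (cinner f g) = Re (c * cinner f g)"
 proof -
  have "c * cinner f g = complex_of_real ((cmod (cinner f g))\<^sup>2) / cmod (cinner f g)"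
   unfolding c_def complex_norm_square by (simp add: mult.commute)
  thus ?thesis by (simp add: power2_eq_square)
 qed
 also have "\<dots> = L2_mult (\<lambda>_. c) f \<bullet> g"
  by (simp add: cinner_mult_left[symmetric] Re_cinner)
 also have "\<dots> \<le> norm (L2_mult (\<lambda>_. c) f) * norm g" by (rule norm_cauchy_schwarz)
 also have "norm (L2_mult (\<lambda>_. c) f) = norm f" by (rule norm_L2_mult_unimodular) (auto simp: c)
 finally show ?thesis .
qed auto

lemma mult_bounds: "0 \<le> (a::real) \<Longrightarrow> 0 \<le> b \<Longrightarrow> a * b \<le> a\<^sup>2 + b\<^sup>2"
 using sum_squares_bound[of a b] mult_nonneg_nonneg[of a b] by linarith

text \<open>By Fubini the right-hand side of \<open>gauss_plancherel\<close> is a Gaussian average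
  of the autocorrelation of f at the points s z. Strong continuity of translations makes the
  autocorrelation continuous at 0, where its value is the squared norm.\<close>

lemma ft_norm_limit:
 assumes f: "integrable lb f" and sq: "sq_integrable f" and s: "\<And>n. 0 < s n" and s0: "s \<longlonglongrightarrow> 0"
 shows "(\<lambda>n. \<integral>\<xi>. (cmod (ft f \<xi>))\<^sup>2 * gau (s n *\<^sub>R \<xi>) \<partial>lborel) \<longlonglongrightarrow> (2 * pi) ^ 3 * (norm (L2_of f))\<^sup>2"
proof -
 have [measurable]: "f \<in> borel_measurable borel" using f by (auto dest: borel_measurable_integrable)
 define F where "F = L2_of f"
 have F: "AE x in lb. rep_L2 F x = f x" unfolding F_def by (rule rep_L2_of[OF sq])
 define H where "H y = (\<integral>x. cnj (f (x + y)) * f x \<partial>lborel)" for y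
 have swap: "(\<integral>x. cnj (\<integral>z. complex_of_real (gau z) * f (x + t *\<^sub>R z) \<partial>lborel) * f x \<partial>lborel)
   = (\<integral>z. complex_of_real (gau z) * H (t *\<^sub>R z) \<partial>lborel)" for t
 proof -
  let ?k = "\<lambda>z x. complex_of_real (gau z) * (cnj (f (x + t *\<^sub>R z)) * f x)"
  have b: "integrable lb (\<lambda>x. (cmod (f (x + y)))\<^sup>2 + (cmod (f x))\<^sup>2)" for y
   using sq sq_integrable_translate[OF sq, of y] by (auto simp: sq_integrable_def)
  have inx: "integrable lb (\<lambda>x. cnj (f (x + y)) * f x)" for y
   by (rule Bochner_Integration.integrable_bound[OF b[of y]]) (auto simp: norm_mult intro!: AE_I2 mult_bounds)
  have ibd: "(\<integral>x. cmod (f (x + y)) * cmod (f x) \<partial>lb) \<le> 2 * (norm F)\<^sup>2" for y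
  proof -
   have "(\<integral>x. cmod (f (x + y)) * cmod (f x) \<partial>lb) \<le> (\<integral>x. (cmod (f (x + y)))\<^sup>2 + (cmod (f x))\<^sup>2 \<partial>lb)"
    using integrable_norm[OF inx[of y]] by (intro integral_mono b) (auto simp: norm_mult intro: mult_bounds)
   also have "\<dots> = (\<integral>x. (cmod (f (x + y)))\<^sup>2 \<partial>lb) + (\<integral>x. (cmod (f x))\<^sup>2 \<partial>lb)"
    using sq sq_integrable_translate[OF sq, of y] by (intro Bochner_Integration.integral_add) (auto simp: sq_integrable_def)
   also have "\<dots> = 2 * (norm F)\<^sup>2"
    using integral_translate[of "\<lambda>x. (cmod (f x))\<^sup>2" y] by (simp add: F_def norm_L2_of[OF sq])
   finally show ?thesis .
  qed
  have i: "integrable (lb \<Otimes>\<^sub>M lb) (\<lambda>(z, x). ?k z x)"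
  proof (rule lborel_pair.Fubini_integrable)
   show "(\<lambda>(z, x). ?k z x) \<in> borel_measurable (lb \<Otimes>\<^sub>M lb)" by measurable
   show "AE z in lb. integrable lb (\<lambda>x. case (z, x) of (z, x) \<Rightarrow> ?k z x)"
    by (auto intro!: AE_I2 integrable_mult_right inx)
   show "integrable lb (\<lambda>z. \<integral>x. norm (case (z, x) of (z, x) \<Rightarrow> ?k z x) \<partial>lb)"
   proof (rule Bochner_Integration.integrable_bound[OF integrable_mult_right[OF integrable_gau, of "2 * (norm F)\<^sup>2"]])
    show "(\<lambda>z. \<integral>x. norm (case (z, x) of (z, x) \<Rightarrow> ?k z x) \<partial>lb) \<in> borel_measurable lb" by measurable
    show "AE z in lb. norm (\<integral>x. norm (case (z, x) of (z, x) \<Rightarrow> ?k z x) \<partial>lb) \<le> norm (2 * (norm F)\<^sup>2 * gau z)"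
    proof (rule AE_I2)
     fix z
     have "(\<integral>x. norm (case (z, x) of (z, x) \<Rightarrow> ?k z x) \<partial>lb) = (\<integral>x. gau z * (cmod (f (x + t *\<^sub>R z)) * cmod (f x)) \<partial>lb)"
      using gau_pos[of z] by (simp add: norm_mult)
     also have "\<dots> = gau z * (\<integral>x. cmod (f (x + t *\<^sub>R z)) * cmod (f x) \<partial>lb)"
      by (rule integral_mult_right_zero)
     also have "\<dots> \<le> gau z * (2 * (norm F)\<^sup>2)"
      using gau_pos[of z] by (intro mult_left_mono ibd) simp
     finally have le: "(\<integral>x. norm (case (z, x) of (z, x) \<Rightarrow> ?k z x) \<partial>lb) \<le> 2 * (norm F)\<^sup>2 * gau z"
      by (simp only: mult.commute)
     have nn: "0 \<le> (\<integral>x. norm (case (z, x) of (z, x) \<Rightarrow> ?k z x) \<partial>lb)" by simp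
     show "norm (\<integral>x. norm (case (z, x) of (z, x) \<Rightarrow> ?k z x) \<partial>lb) \<le> norm (2 * (norm F)\<^sup>2 * gau z)"
      unfolding real_norm_def abs_of_nonneg[OF nn] by (rule order_trans[OF le abs_ge_self])
    qed
   qed
  qed
  have "(\<integral>x. cnj (\<integral>z. complex_of_real (gau z) * f (x + t *\<^sub>R z) \<partial>lborel) * f x \<partial>lborel)
    = (\<integral>x. (\<integral>z. ?k z x \<partial>lb) \<partial>lb)"
  proof (intro Bochner_Integration.integral_cong refl)
   fix x
   have "cnj (\<integral>z. complex_of_real (gau z) * f (x + t *\<^sub>R z) \<partial>lborel) * f x
    = (\<integral>z. cnj (complex_of_real (gau z) * f (x + t *\<^sub>R z)) \<partial>lborel) * f x" by (simp only: lebesgue_integral_cnj)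
   also have "\<dots> = (\<integral>z. cnj (complex_of_real (gau z) * f (x + t *\<^sub>R z)) * f x \<partial>lborel)"
    by (rule integral_mult_left_zero[symmetric])
   also have "\<dots> = (\<integral>z. ?k z x \<partial>lb)" by (simp add: mult.assoc)
   finally show "cnj (\<integral>z. complex_of_real (gau z) * f (x + t *\<^sub>R z) \<partial>lborel) * f x = (\<integral>z. ?k z x \<partial>lb)" .
  qed
  also have "\<dots> = (\<integral>z. (\<integral>x. ?k z x \<partial>lb) \<partial>lb)"
   using lborel_pair.Fubini_integral[OF i] by simp
  also have "\<dots> = (\<integral>z. complex_of_real (gau z) * H (t *\<^sub>R z) \<partial>lborel)"
   by (simp only: integral_mult_right_zero H_def)
  finally show ?thesis .
 qed
 have H: "H y = cinner F (tr y F)" for y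
  unfolding cinner_def H_def
 proof (rule integral_cong_AE)
  show "AE x in lb. cnj (f (x + y)) * f x = rep_L2 F x * cnj (rep_L2 (tr y F) x)"
   using F rep_tr[of y F] AE_translate[OF F, of y] by eventually_elim simp
 qed measurable
 have Hb: "cmod (H y) \<le> (norm F)\<^sup>2" for y
  using cmod_cinner_le[of F "tr y F"] by (simp add: H power2_eq_square)
 have [measurable]: "H \<in> borel_measurable borel"
 proof -
  have "(\<lambda>y. \<integral>x. cnj (f (x + y)) * f x \<partial>lborel) \<in> borel_measurable borel" by measurable
  thus ?thesis by (simp add: H_def[abs_def])
 qed
 have "(\<lambda>n. \<integral>z. complex_of_real (gau z) * H (s n *\<^sub>R z) \<partial>lborel) \<longlonglongrightarrow> (\<integral>z. complex_of_real (gau z) * complex_of_real ((norm F)\<^sup>2) \<partial>lborel)"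
 proof (rule integral_dominated_convergence[where w = "\<lambda>z. (norm F)\<^sup>2 * gau z"])
  show "integrable lb (\<lambda>z. (norm F)\<^sup>2 * gau z)" by (intro integrable_mult_right integrable_gau)
  show "AE z in lb. (\<lambda>n. complex_of_real (gau z) * H (s n *\<^sub>R z)) \<longlonglongrightarrow> complex_of_real (gau z) * complex_of_real ((norm F)\<^sup>2)"
  proof (rule AE_I2, rule tendsto_mult[OF tendsto_const])
   fix z :: "real^3"
   have "(\<lambda>n. s n *\<^sub>R z) \<longlonglongrightarrow> 0" using tendsto_scaleR[OF s0 tendsto_const, of z] by simp
   thus "(\<lambda>n. H (s n *\<^sub>R z)) \<longlonglongrightarrow> complex_of_real ((norm F)\<^sup>2)"
    unfolding H cinner_self[symmetric] by (intro tendsto_cinner tendsto_const tr_tendsto)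
  qed
  show "AE z in lb. norm (complex_of_real (gau z) * H (s n *\<^sub>R z)) \<le> (norm F)\<^sup>2 * gau z" for n
  proof (rule AE_I2)
   fix z
   have "norm (complex_of_real (gau z) * H (s n *\<^sub>R z)) = cmod (H (s n *\<^sub>R z)) * gau z"
    using gau_pos[of z] by (simp add: norm_mult mult.commute)
   also have "\<dots> \<le> (norm F)\<^sup>2 * gau z" using gau_pos[of z] by (intro mult_right_mono Hb) simp
   finally show "norm (complex_of_real (gau z) * H (s n *\<^sub>R z)) \<le> (norm F)\<^sup>2 * gau z" .
  qed
 qed measurable
 also have "(\<integral>z. complex_of_real (gau z) * complex_of_real ((norm F)\<^sup>2) \<partial>lborel) = complex_of_real (sqrt (2 * pi) ^ 3 * (norm F)\<^sup>2)"
  by (simp add: integral_gau flip: of_real_mult of_real_power)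
 finally have "(\<lambda>n. complex_of_real (sqrt (2 * pi) ^ 3) * (\<integral>z. complex_of_real (gau z) * H (s n *\<^sub>R z) \<partial>lborel))
   \<longlonglongrightarrow> complex_of_real (sqrt (2 * pi) ^ 3) * complex_of_real (sqrt (2 * pi) ^ 3 * (norm F)\<^sup>2)"
  by (intro tendsto_mult tendsto_const)
 also have "complex_of_real (sqrt (2 * pi) ^ 3) * complex_of_real (sqrt (2 * pi) ^ 3 * (norm F)\<^sup>2)
   = complex_of_real ((2 * pi) ^ 3 * (norm F)\<^sup>2)"
 proof -
  have s: "sqrt (2 * pi) * sqrt (2 * pi) = 2 * pi" by simp
  have e: "sqrt (2 * pi) ^ 3 * (sqrt (2 * pi) ^ 3 * (norm F)\<^sup>2) = (2 * pi) ^ 3 * (norm F)\<^sup>2"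
   by (simp only: mult.assoc[symmetric] power_mult_distrib[symmetric] s)
  show ?thesis by (simp only: of_real_mult[symmetric] e)
 qed
 finally have "(\<lambda>n. complex_of_real (\<integral>\<xi>. (cmod (ft f \<xi>))\<^sup>2 * gau (s n *\<^sub>R \<xi>) \<partial>lborel)) \<longlonglongrightarrow> complex_of_real ((2 * pi) ^ 3 * (norm F)\<^sup>2)"
  unfolding gauss_plancherel(2)[OF f s] swap .
 thus ?thesis unfolding tendsto_of_real_iff F_def .
qed

text \<open>As s decreases to 0 the Gaussian factors increase to 1, so monotone convergence
  evaluates the integral without knowing beforehand that it is finite.\<close>

lemma nn_ft_le_limit:
 assumes f: "integrable lb f" and s: "\<And>n. 0 < s n" and s0: "s \<longlonglongrightarrow> 0"
  and lim: "(\<lambda>n. \<integral>\<xi>. (cmod (ft f \<xi>))\<^sup>2 * gau (s n *\<^sub>R \<xi>) \<partial>lborel) \<longlonglongrightarrow> L" and dec: "decseq s"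
 shows "(\<integral>\<^sup>+\<xi>. ennreal ((cmod (ft f \<xi>))\<^sup>2) \<partial>lborel) = ennreal L"
proof (rule LIMSEQ_unique)
 have [measurable]: "f \<in> borel_measurable borel" "ft f \<in> borel_measurable borel"
  using f ft_measurable[OF f] by (auto dest: borel_measurable_integrable)
 have e: "(\<integral>\<^sup>+\<xi>. ennreal ((cmod (ft f \<xi>))\<^sup>2 * gau (s n *\<^sub>R \<xi>)) \<partial>lborel) = ennreal (\<integral>\<xi>. (cmod (ft f \<xi>))\<^sup>2 * gau (s n *\<^sub>R \<xi>) \<partial>lborel)" for n
  by (rule nn_integral_eq_integral[OF gauss_plancherel(1)[OF f s]]) (auto intro!: AE_I2 mult_nonneg_nonneg less_imp_le[OF gau_pos])
 show "(\<lambda>n. \<integral>\<^sup>+\<xi>. ennreal ((cmod (ft f \<xi>))\<^sup>2 * gau (s n *\<^sub>R \<xi>)) \<partial>lborel) \<longlonglongrightarrow> ennreal L"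
  unfolding e by (intro tendsto_ennrealI lim)
 show "(\<lambda>n. \<integral>\<^sup>+\<xi>. ennreal ((cmod (ft f \<xi>))\<^sup>2 * gau (s n *\<^sub>R \<xi>)) \<partial>lborel) \<longlonglongrightarrow> (\<integral>\<^sup>+\<xi>. ennreal ((cmod (ft f \<xi>))\<^sup>2) \<partial>lborel)"
 proof (rule nn_integral_LIMSEQ)
  show "incseq (\<lambda>n \<xi>. ennreal ((cmod (ft f \<xi>))\<^sup>2 * gau (s n *\<^sub>R \<xi>)))"
  proof (intro incseq_SucI le_funI ennreal_leI mult_left_mono)
   fix n and \<xi> :: "real^3"
   have "norm (s (Suc n) *\<^sub>R \<xi>) \<le> norm (s n *\<^sub>R \<xi>)"
    using decseqD[OF dec, of n "Suc n"] s[of n] s[of "Suc n"] by (auto intro!: mult_right_mono)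
   thus "gau (s n *\<^sub>R \<xi>) \<le> gau (s (Suc n) *\<^sub>R \<xi>)"
    by (simp add: gau_def power_mono)
  qed simp
  fix \<xi>
  have "(\<lambda>n. gau (s n *\<^sub>R \<xi>)) \<longlonglongrightarrow> exp (- (norm (0 *\<^sub>R \<xi>))\<^sup>2 / 2)"
   unfolding gau_def by (intro tendsto_intros s0) simp
  hence "(\<lambda>n. (cmod (ft f \<xi>))\<^sup>2 * gau (s n *\<^sub>R \<xi>)) \<longlonglongrightarrow> (cmod (ft f \<xi>))\<^sup>2 * 1"
   by (intro tendsto_mult tendsto_const) simp
  thus "(\<lambda>n. ennreal ((cmod (ft f \<xi>))\<^sup>2 * gau (s n *\<^sub>R \<xi>))) \<longlonglongrightarrow> ennreal ((cmod (ft f \<xi>))\<^sup>2)"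
   by (intro tendsto_ennrealI) simp
 qed measurable
qed

lemma inverse_Suc_seq:
 "0 < inverse (real (Suc n))" "(\<lambda>n. inverse (real (Suc n))) \<longlonglongrightarrow> 0" "decseq (\<lambda>n. inverse (real (Suc n)))"
 using LIMSEQ_inverse_real_of_nat by (auto intro!: decseq_SucI le_imp_inverse_le)

lemma nn_ft:
 assumes f: "integrable lb f" and sq: "sq_integrable f"
 shows "(\<integral>\<^sup>+\<xi>. ennreal ((cmod (ft f \<xi>))\<^sup>2) \<partial>lborel) = ennreal ((2 * pi) ^ 3 * (norm (L2_of f))\<^sup>2)"
 by (rule nn_ft_le_limit[OF f inverse_Suc_seq(1,2) ft_norm_limit[OF f sq inverse_Suc_seq(1,2)] inverse_Suc_seq(3)])

definition cF :: complex where "cF = complex_of_real ((2 * pi) powr (- 3 / 2))"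

lemma cF_sq: "(cmod cF)\<^sup>2 * (2 * pi) ^ 3 = 1"
proof -
 have "(cmod cF)\<^sup>2 = ((2 * pi) powr (- 3 / 2)) powr 2" unfolding cF_def by simp
 also have "\<dots> = (2 * pi) powr (- 3)" by (subst powr_powr) simp
 also have "\<dots> = inverse ((2 * pi) ^ 3)" by (subst powr_minus) simp
 finally have e: "(cmod cF)\<^sup>2 = inverse ((2 * pi) ^ 3)" .
 show ?thesis unfolding e by (rule left_inverse) simp
qed

definition Fo :: "(real^3 \<Rightarrow> complex) \<Rightarrow> L2" where "Fo f = L2_of (\<lambda>\<xi>. cF * ft f \<xi>)"

definition L12 :: "(real^3 \<Rightarrow> complex) \<Rightarrow> bool" where "L12 f \<longleftrightarrow> integrable lb f \<and> sq_integrable f"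

lemma L12_D: "L12 f \<Longrightarrow> integrable lb f" "L12 f \<Longrightarrow> sq_integrable f" "L12 f \<Longrightarrow> f \<in> borel_measurable borel"
 by (auto simp: L12_def dest: borel_measurable_integrable)

lemma sq_ft:
 assumes "L12 f" shows "sq_integrable (\<lambda>\<xi>. cF * ft f \<xi>)"
proof (rule sq_integrable_cmult, rule sq_integrableI_nn)
 show "ft f \<in> borel_measurable lborel" using ft_measurable[OF L12_D(1)[OF assms]] by simp
 show "(\<integral>\<^sup>+\<xi>. ennreal ((cmod (ft f \<xi>))\<^sup>2) \<partial>lborel) < \<infinity>"
  using nn_ft[OF L12_D(1)[OF assms] L12_D(2)[OF assms]] by simp
qed

lemma norm_Fo:
 assumes f: "L12 f" shows "norm (Fo f) = norm (L2_of f)"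
proof -
 have [measurable]: "ft f \<in> borel_measurable borel" using ft_measurable[OF L12_D(1)[OF f]] by simp
 have "ennreal ((norm (Fo f))\<^sup>2) = (\<integral>\<^sup>+\<xi>. ennreal ((cmod cF)\<^sup>2) * ennreal ((cmod (ft f \<xi>))\<^sup>2) \<partial>lborel)"
  unfolding Fo_def nn_integral_L2[OF sq_ft[OF f], symmetric]
  by (intro nn_integral_cong) (simp add: norm_mult power_mult_distrib ennreal_mult)
 also have "\<dots> = ennreal ((cmod cF)\<^sup>2) * ennreal ((2 * pi) ^ 3 * (norm (L2_of f))\<^sup>2)"
  using nn_ft[OF L12_D(1)[OF f] L12_D(2)[OF f]] by (subst nn_integral_cmult) auto
 also have "\<dots> = ennreal (((cmod cF)\<^sup>2 * (2 * pi) ^ 3) * (norm (L2_of f))\<^sup>2)"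
  by (subst ennreal_mult[symmetric]) (auto simp: mult.assoc)
 finally have "ennreal ((norm (Fo f))\<^sup>2) = ennreal ((norm (L2_of f))\<^sup>2)" by (simp only: cF_sq mult_1)
 thus ?thesis by simp
qed

lemma L12_diff: "L12 f \<Longrightarrow> L12 g \<Longrightarrow> L12 (\<lambda>x. f x - g x)"
 and L12_cmult: "L12 f \<Longrightarrow> L12 (\<lambda>x. c * f x)"
 by (auto simp: L12_def sq_integrable_diff sq_integrable_cmult)

lemma ft_add: "integrable lb f \<Longrightarrow> integrable lb g \<Longrightarrow> ft (\<lambda>x. f x + g x) \<xi> = ft f \<xi> + ft g \<xi>"
 unfolding ft_def distrib_left by (intro Bochner_Integration.integral_add ft_integrable) auto

lemma ft_cmult: "ft (\<lambda>x. c * f x) \<xi> = c * ft f \<xi>"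
 unfolding ft_def by (simp add: mult.left_commute[of _ c])

lemma ft_cong_AE:
 assumes "f \<in> borel_measurable borel" "g \<in> borel_measurable borel" "AE x in lb. f x = g x"
 shows "ft f = ft g"
proof
 fix \<xi>
 note [measurable] = assms(1,2)
 show "ft f \<xi> = ft g \<xi>" unfolding ft_def
  by (rule integral_cong_AE) (use assms(3) in auto)
qed

lemma Fo_add: "L12 f \<Longrightarrow> L12 g \<Longrightarrow> Fo (\<lambda>x. f x + g x) = Fo f + Fo g"
 using L2_of_add[OF sq_ft sq_ft, of f g] by (simp add: Fo_def ft_add L12_def distrib_left)

lemma L2_of_cmult:
 assumes "sq_integrable g" shows "L2_of (\<lambda>x. c * g x) = L2_mult (\<lambda>_. c) (L2_of g)"
 unfolding L2_mult_def
proof (rule L2_of_cong_AE)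
 show "AE x in lb. c * g x = c * rep_L2 (L2_of g) x"
  using rep_L2_of[OF assms] by eventually_elim simp
qed (use assms in \<open>auto intro: sq_integrable_cmult\<close>)

lemma Fo_cmult: "L12 f \<Longrightarrow> Fo (\<lambda>x. c * f x) = L2_mult (\<lambda>_. c) (Fo f)"
 using L2_of_cmult[OF sq_ft, of f c] by (simp add: Fo_def ft_cmult mult.left_commute)

lemma L2_mult_minus_one: "L2_mult (\<lambda>_. - 1) f = - f"
 using L2_mult_of_real[of "-1" f] by simp

lemma Fo_diff:
 assumes "L12 f" "L12 g" shows "Fo (\<lambda>x. f x - g x) = Fo f - Fo g"
 using Fo_add[OF assms(1) L12_cmult[OF assms(2), of "-1"]] Fo_cmult[OF assms(2), of "-1"]
 by (simp add: L2_mult_minus_one)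

text \<open>The truncations to balls whose transforms define \<open>fourier_L2\<close>; they lie in
  both L^1 and L^2.\<close>

definition trunc :: "nat \<Rightarrow> L2 \<Rightarrow> real^3 \<Rightarrow> complex" where
 "trunc n f x = indicator (cball 0 (real n)) x *\<^sub>R rep_L2 f x"

lemma trunc_measurable [measurable]: "trunc n f \<in> borel_measurable borel"
 unfolding trunc_def[abs_def] using rep_measurable[of f]
 by (intro borel_measurable_scaleR borel_measurable_indicator) auto

lemma L12_trunc: "L12 (trunc n f)"
 unfolding L12_def
proof
 have fin: "emeasure lborel (cball 0 (real n) :: (real^3) set) < \<infinity>"
  by (rule emeasure_lborel_cball_finite)
 show "sq_integrable (trunc n f)"
  by (rule sq_integrable_dom[where C = 1 and f = f]) (auto simp: trunc_def split: split_indicator)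
 have "integrable lb (\<lambda>x. indicator (cball 0 (real n)) x + (mag f x)\<^sup>2 :: real)"
  using fin by (intro Bochner_Integration.integrable_add integrable_rep_sq integrable_real_indicator) auto
 thus "integrable lb (trunc n f)"
 proof (rule Bochner_Integration.integrable_bound)
  have "a \<le> 1 + a\<^sup>2" if "0 \<le> a" for a :: real
   using mult_bounds[of 1 a] that by simp
  thus "AE x in lb. norm (trunc n f x) \<le> norm (indicator (cball 0 (real n)) x + (mag f x)\<^sup>2)"
   by (auto simp: trunc_def split: split_indicator intro!: AE_I2)
 qed simp
qed

lemma trunc_tendsto: "(\<lambda>n. L2_of (trunc n f)) \<longlonglongrightarrow> f"
proof (rule L2_dominated[where w = "\<lambda>x. mag f x"])
 have r: "AE x in lb. rep_L2 (L2_of (trunc n f)) x = trunc n f x" for n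
  by (rule rep_L2_of[OF L12_D(2)[OF L12_trunc]])
 show "AE x in lb. cmod (rep_L2 (L2_of (trunc n f)) x) \<le> mag f x" for n
  using r[of n] by eventually_elim (auto simp: trunc_def split: split_indicator)
 have "AE x in lb. \<forall>n. rep_L2 (L2_of (trunc n f)) x = trunc n f x"
  using r by (simp add: AE_all_countable)
 thus "AE x in lb. (\<lambda>n. rep_L2 (L2_of (trunc n f)) x) \<longlonglongrightarrow> rep_L2 f x"
 proof eventually_elim
  case (elim x)
  obtain N :: nat where N: "norm x \<le> real N" using real_arch_simple by blast
  have "\<forall>\<^sub>F n in sequentially. trunc n f x = rep_L2 f x"
   by (rule eventually_sequentiallyI[of N]) (use N in \<open>auto simp: trunc_def\<close>)
  thus ?case by (simp add: elim tendsto_eventually)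
 qed
qed (rule integrable_rep_sq)

lemma norm_Fo_diff:
 assumes "L12 f" "L12 g" shows "norm (Fo f - Fo g) = norm (L2_of f - L2_of g)"
 using norm_Fo[OF L12_diff[OF assms]] assms by (simp add: Fo_diff L2_of_diff L12_D)

lemma fourier_L2_eq: "fourier_L2 f = lim (\<lambda>n. Fo (trunc n f))"
proof -
 have "ft (trunc n f) \<xi> = (LINT x:cball 0 (real n)|lborel. cis (- (\<xi> \<bullet> x)) * rep_L2 f x)" for n \<xi>
  by (simp add: ft_def trunc_def set_lebesgue_integral_def mult_scaleR_right)
 thus ?thesis by (simp add: fourier_L2_def Fo_def cF_def)
qed

text \<open>The \<open>lim\<close> in \<open>fourier_L2\<close> has a meaning only if the sequence
  converges. The truncations are Cauchy and \<open>Fo\<close> preserves distances, so completeness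
  of L^2 gives convergence.\<close>

lemma fourier_tendsto: "(\<lambda>n. Fo (trunc n f)) \<longlonglongrightarrow> fourier_L2 f"
proof -
 have "Cauchy (\<lambda>n. L2_of (trunc n f))" by (rule LIMSEQ_imp_Cauchy[OF trunc_tendsto])
 hence "Cauchy (\<lambda>n. Fo (trunc n f))"
  unfolding Cauchy_def dist_norm by (simp add: norm_Fo_diff L12_trunc)
 thus ?thesis
  unfolding fourier_L2_eq by (simp add: Cauchy_convergent_iff convergent_LIMSEQ_iff)
qed

lemma fourier_L2_of:
 assumes f: "L12 f" shows "fourier_L2 (L2_of f) = Fo f"
proof (rule LIMSEQ_unique[OF fourier_tendsto])
 have "(\<lambda>n. norm (L2_of (trunc n (L2_of f)) - L2_of f)) \<longlonglongrightarrow> 0"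
  using trunc_tendsto[of "L2_of f"] by (intro tendsto_norm_zero) (simp add: LIM_zero_iff)
 hence "(\<lambda>n. norm (Fo (trunc n (L2_of f)) - Fo f)) \<longlonglongrightarrow> 0"
  by (simp add: norm_Fo_diff L12_trunc f)
 thus "(\<lambda>n. Fo (trunc n (L2_of f))) \<longlonglongrightarrow> Fo f"
  by (simp add: tendsto_norm_zero_iff LIM_zero_iff)
qed

lemma norm_fourier [simp]: "norm (fourier_L2 f) = norm f"
proof (rule LIMSEQ_unique)
 show "(\<lambda>n. norm (Fo (trunc n f))) \<longlonglongrightarrow> norm (fourier_L2 f)"
  by (intro tendsto_norm fourier_tendsto)
 show "(\<lambda>n. norm (Fo (trunc n f))) \<longlonglongrightarrow> norm f"
  using tendsto_norm[OF trunc_tendsto[of f]] by (simp add: norm_Fo L12_trunc)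
qed

lemma Fo_cong_AE:
 assumes "f \<in> borel_measurable borel" "g \<in> borel_measurable borel" "AE x in lb. f x = g x"
 shows "Fo f = Fo g"
 using ft_cong_AE[OF assms] by (simp add: Fo_def)

lemma bounded_linear_fourier: "bounded_linear fourier_L2"
proof (rule bounded_linear_intro[where K = 1])
 fix f g :: L2 and r :: real
 have "Fo (trunc n (f + g)) = Fo (trunc n f) + Fo (trunc n g)" for n
  unfolding Fo_add[OF L12_trunc L12_trunc, symmetric]
 proof (rule Fo_cong_AE)
  show "AE x in lb. trunc n (f + g) x = trunc n f x + trunc n g x"
   using rep_add[of f g] by eventually_elim (simp add: trunc_def algebra_simps)
 qed measurable
 thus "fourier_L2 (f + g) = fourier_L2 f + fourier_L2 g"
  by (intro LIMSEQ_unique[OF fourier_tendsto]) (simp add: tendsto_add fourier_tendsto)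
 have "Fo (trunc n (r *\<^sub>R f)) = r *\<^sub>R Fo (trunc n f)" for n
  unfolding L2_mult_of_real[of r "Fo (trunc n f)", symmetric] Fo_cmult[OF L12_trunc, symmetric]
 proof (rule Fo_cong_AE)
  show "AE x in lb. trunc n (r *\<^sub>R f) x = complex_of_real r * trunc n f x"
   using rep_scaleR[of r f] by eventually_elim (simp add: trunc_def scaleR_conv_of_real)
 qed measurable
 thus "fourier_L2 (r *\<^sub>R f) = r *\<^sub>R fourier_L2 f"
  by (intro LIMSEQ_unique[OF fourier_tendsto]) (simp add: tendsto_scaleR fourier_tendsto)
qed simp

text \<open>Truncations are dense, and on them the transform is an integral. This carries identities
  for \<open>ft\<close> over to all of L^2.\<close>

lemma L12_ext:
 assumes "bounded_linear S" "bounded_linear T" "\<And>g. L12 g \<Longrightarrow> S (L2_of g) = T (L2_of g)"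
 shows "S f = T f"
 using bounded_linear.tendsto[OF assms(1) trunc_tendsto[of f]] bounded_linear.tendsto[OF assms(2) trunc_tendsto[of f]]
 by (simp add: assms(3) L12_trunc LIMSEQ_unique)

lemma fourier_const_mult: "fourier_L2 (L2_mult (\<lambda>_. c) f) = L2_mult (\<lambda>_. c) (fourier_L2 f)"
proof (rule L12_ext[where f = f])
 interpret bdd_mult "\<lambda>_. c" "cmod c" by (rule bdd_mult_const)
 show "bounded_linear (\<lambda>f. fourier_L2 (L2_mult (\<lambda>_. c) f))"
  by (rule bounded_linear_compose[OF bounded_linear_fourier bounded_linear])
 show "bounded_linear (\<lambda>f. L2_mult (\<lambda>_. c) (fourier_L2 f))"
  by (rule bounded_linear_compose[OF bounded_linear bounded_linear_fourier])
 show "fourier_L2 (L2_mult (\<lambda>_. c) (L2_of g)) = L2_mult (\<lambda>_. c) (fourier_L2 (L2_of g))" if "L12 g" for g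
  using that by (simp add: L2_of_cmult[symmetric] L12_D fourier_L2_of L12_cmult Fo_cmult)
qed

lemma bdd_mult_cis: "g \<in> borel_measurable borel \<Longrightarrow> bdd_mult (\<lambda>x. cis (g x)) 1"
 by (rule bdd_multI) auto

lemma L2_mult_L2_of:
 assumes "bdd_mult m B" "sq_integrable g"
 shows "L2_mult m (L2_of g) = L2_of (\<lambda>x. m x * g x)"
proof -
 interpret bdd_mult m B by fact
 show ?thesis unfolding L2_mult_def
  by (rule L2_of_cong_AE[OF sq])
    (use rep_L2_of[OF assms(2)] assms(2) in \<open>auto dest: sq_integrable_measurable elim!: eventually_mono\<close>)
qed

lemma fourier_tr: "fourier_L2 (tr y f) = L2_mult (\<lambda>\<xi>. cis (\<xi> \<bullet> y)) (fourier_L2 f)"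
proof (rule L12_ext[where f = f])
 interpret bdd_mult "\<lambda>\<xi>. cis (\<xi> \<bullet> y)" 1 by (rule bdd_mult_cis) measurable
 show "bounded_linear (\<lambda>f. fourier_L2 (tr y f))"
  by (rule bounded_linear_compose[OF bounded_linear_fourier bounded_linear_tr])
 show "bounded_linear (\<lambda>f. L2_mult (\<lambda>\<xi>. cis (\<xi> \<bullet> y)) (fourier_L2 f))"
  by (rule bounded_linear_compose[OF bounded_linear bounded_linear_fourier])
 fix g assume g: "L12 g"
 have "L12 (\<lambda>x. g (x + y))"
  using g L12_D(3)[OF g] by (simp add: L12_def sq_integrable_translate integrable_translate)
 hence "fourier_L2 (tr y (L2_of g)) = Fo (\<lambda>x. g (x + y))"
  by (simp add: tr_L2_of L12_D g fourier_L2_of)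
 also have "\<dots> = L2_mult (\<lambda>\<xi>. cis (\<xi> \<bullet> y)) (fourier_L2 (L2_of g))"
  using L2_mult_L2_of[OF bdd_mult_axioms sq_ft[OF g]]
  by (simp add: fourier_L2_of g Fo_def ft_translate L12_D mult.left_commute)
 finally show "fourier_L2 (tr y (L2_of g)) = L2_mult (\<lambda>\<xi>. cis (\<xi> \<bullet> y)) (fourier_L2 (L2_of g))" .
qed

lemma fourier_modulate: "fourier_L2 (L2_mult (\<lambda>x. cis (- (\<eta> \<bullet> x))) f) = tr \<eta> (fourier_L2 f)"
proof (rule L12_ext[where f = f])
 interpret bdd_mult "\<lambda>x. cis (- (\<eta> \<bullet> x))" 1 by (rule bdd_mult_cis) measurable
 show "bounded_linear (\<lambda>f. fourier_L2 (L2_mult (\<lambda>x. cis (- (\<eta> \<bullet> x))) f))"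
  by (rule bounded_linear_compose[OF bounded_linear_fourier bounded_linear])
 show "bounded_linear (\<lambda>f. tr \<eta> (fourier_L2 f))"
  by (rule bounded_linear_compose[OF bounded_linear_tr bounded_linear_fourier])
 fix g assume g: "L12 g"
 have "L12 (\<lambda>x. cis (- (\<eta> \<bullet> x)) * g x)"
  unfolding L12_def
  by (intro conjI ft_integrable L12_D(1)[OF g] sq_integrable_bound[OF L12_D(2)[OF g] sq_integrable_zero, where C = 1])
    (use L12_D(3)[OF g] in \<open>auto simp: norm_mult\<close>)
 hence "fourier_L2 (L2_mult (\<lambda>x. cis (- (\<eta> \<bullet> x))) (L2_of g)) = Fo (\<lambda>x. cis (- (\<eta> \<bullet> x)) * g x)"
  by (simp add: L2_mult_L2_of[OF bdd_mult_axioms] L12_D g fourier_L2_of)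
 also have "\<dots> = tr \<eta> (fourier_L2 (L2_of g))"
  by (simp add: fourier_L2_of g Fo_def ft_modulate tr_L2_of[OF sq_ft])
 finally show "fourier_L2 (L2_mult (\<lambda>x. cis (- (\<eta> \<bullet> x))) (L2_of g)) = tr \<eta> (fourier_L2 (L2_of g))" .
qed

lemma tendsto_cj: "X \<longlonglongrightarrow> f \<Longrightarrow> (\<lambda>n. cj (X n)) \<longlonglongrightarrow> cj f"
proof -
 assume X: "X \<longlonglongrightarrow> f"
 have "cj f - cj g = cj (f - g)" for f g
  by (rule L2_eqI) (use rep_diff[of "cj f" "cj g"] rep_cj[of f] rep_cj[of g] rep_cj[of "f - g"] rep_diff[of f g] in
    \<open>eventually_elim, simp\<close>)
 hence "norm (cj (X n) - cj f) = norm (X n - f)" for n by simp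
 thus ?thesis using X by (simp only: LIMSEQ_iff)
qed

text \<open>The conjugations turn the sesquilinear form into the bilinear pairing of the
  multiplication formula, which then passes to the limit along truncations.\<close>

lemma fourier_mult_formula: "cinner (fourier_L2 f) (cj g) = cinner f (cj (fourier_L2 g))"
proof -
 have L: "cinner (Fo f) (cj (L2_of g)) = cinner (L2_of f) (cj (Fo g))" if f: "L12 f" and g: "L12 g" for f g
 proof -
  note [measurable] = L12_D(3)[OF f] L12_D(3)[OF g] ft_measurable[OF L12_D(1)[OF f]] ft_measurable[OF L12_D(1)[OF g]]
  have "cinner (Fo f) (cj (L2_of g)) = (\<integral>\<xi>. cF * (g \<xi> * ft f \<xi>) \<partial>lborel)"
   unfolding cinner_cj Fo_def
  proof (rule integral_cong_AE)
   show "AE \<xi> in lb. rep_L2 (L2_of (\<lambda>\<xi>. cF * ft f \<xi>)) \<xi> * rep_L2 (L2_of g) \<xi> = cF * (g \<xi> * ft f \<xi>)"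
    using rep_L2_of[OF sq_ft[OF f]] rep_L2_of[OF L12_D(2)[OF g]] by eventually_elim simp
  qed measurable
  also have "\<dots> = (\<integral>x. cF * (ft g x * f x) \<partial>lborel)"
   using ft_mult_formula[OF L12_D(1)[OF f] L12_D(1)[OF g]] by simp
  also have "\<dots> = cinner (L2_of f) (cj (Fo g))"
   unfolding cinner_cj Fo_def
  proof (rule integral_cong_AE)
   show "AE \<xi> in lb. cF * (ft g \<xi> * f \<xi>) = rep_L2 (L2_of f) \<xi> * rep_L2 (L2_of (\<lambda>\<xi>. cF * ft g \<xi>)) \<xi>"
    using rep_L2_of[OF sq_ft[OF g]] rep_L2_of[OF L12_D(2)[OF f]] by eventually_elim simp
  qed measurable
  finally show ?thesis .
 qed
 show ?thesis
 proof (rule LIMSEQ_unique)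
  show "(\<lambda>n. cinner (Fo (trunc n f)) (cj (L2_of (trunc n g)))) \<longlonglongrightarrow> cinner (fourier_L2 f) (cj g)"
   by (intro tendsto_cinner fourier_tendsto tendsto_cj trunc_tendsto)
  show "(\<lambda>n. cinner (Fo (trunc n f)) (cj (L2_of (trunc n g)))) \<longlonglongrightarrow> cinner f (cj (fourier_L2 g))"
   unfolding L[OF L12_trunc L12_trunc] by (intro tendsto_cinner fourier_tendsto tendsto_cj trunc_tendsto)
 qed
qed

text \<open>By the multiplication formula this is the adjoint of the transform. The adjoint of an
  isometry is a left inverse, and \<open>fourier_Fi\<close> makes it a right inverse as well, so
  that \<open>inv fourier_L2\<close> is identified.\<close>

definition Fi :: "L2 \<Rightarrow> L2" where "Fi h = cj (fourier_L2 (cj h))"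

lemma inner_fourier_adj: "fourier_L2 f \<bullet> h = f \<bullet> Fi h"
 using arg_cong[OF fourier_mult_formula[of f "cj h"], of Re] by (simp add: Re_cinner Fi_def)

lemma norm_Fi [simp]: "norm (Fi h) = norm h"
 by (simp add: Fi_def)

lemma inner_fourier: "fourier_L2 f \<bullet> fourier_L2 g = f \<bullet> g"
 using bounded_linear.linear[OF bounded_linear_fourier]
 by (simp add: dot_norm linear_add[symmetric])

lemma Fi_fourier [simp]: "Fi (fourier_L2 f) = f"
proof -
 have "g \<bullet> Fi (fourier_L2 f) = g \<bullet> f" for g
  by (simp add: inner_fourier_adj[symmetric] inner_fourier)
 hence "(Fi (fourier_L2 f) - f) \<bullet> (Fi (fourier_L2 f) - f) = 0"
  by (simp add: inner_diff_right)
 thus ?thesis by simp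
qed

text \<open>Surjectivity comes for free: \<open>Fi\<close> is the transform conjugated by
  \<open>cj\<close>, so the left inverse identity at \<open>cj h\<close> is the conjugate of the
  right inverse identity at h.\<close>

lemma fourier_Fi [simp]: "fourier_L2 (Fi h) = h"
proof -
 have "cj (fourier_L2 (Fi h)) = cj h"
  using Fi_fourier[of "cj h"] by (simp add: Fi_def)
 thus ?thesis using cj_cj by metis
qed

lemma inv_fourier: "inv fourier_L2 = Fi"
 by (rule inv_equality) simp_all

lemma bounded_linear_Fi: "bounded_linear Fi"
proof (rule bounded_linear_intro[where K = 1])
 have "f + g = fourier_L2 (Fi f + Fi g)" for f g
  by (simp add: linear_add[OF bounded_linear.linear[OF bounded_linear_fourier]])
 thus "Fi (f + g) = Fi f + Fi g" for f g by (metis Fi_fourier)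
 have "r *\<^sub>R f = fourier_L2 (r *\<^sub>R Fi f)" for r f
  by (simp add: linear_scale[OF bounded_linear.linear[OF bounded_linear_fourier]])
 thus "Fi (r *\<^sub>R f) = r *\<^sub>R Fi f" for r f by (metis Fi_fourier)
qed simp

lemma cinner_fourier: "cinner (fourier_L2 f) (fourier_L2 g) = cinner f g"
 unfolding cinner_eq by (simp add: inner_fourier fourier_const_mult[symmetric])

section \<open>Fourier multipliers\<close>

lemma fourier_multiplier_eq: "fourier_multiplier m f = Fi (L2_mult m (fourier_L2 f))"
 by (simp add: fourier_multiplier_def inv_fourier)

lemma fourier_fm [simp]: "fourier_L2 (fourier_multiplier m f) = L2_mult m (fourier_L2 f)"
 by (simp add: fourier_multiplier_eq)

lemma fourier_inj: "fourier_L2 f = fourier_L2 g \<Longrightarrow> f = g"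
 by (metis Fi_fourier)

lemma bounded_linear_fm:
 assumes "bdd_mult m B" shows "bounded_linear (fourier_multiplier m)"
 unfolding fourier_multiplier_eq[abs_def]
 by (intro bounded_linear_compose[OF bounded_linear_Fi] bounded_linear_compose[OF bdd_mult.bounded_linear[OF assms]]
   bounded_linear_fourier)

lemma norm_fm_le:
 assumes "bdd_mult m B" shows "norm (fourier_multiplier m f) \<le> B * norm f"
 using bdd_mult.norm_le[OF assms, of "fourier_L2 f"] by (simp add: fourier_multiplier_eq)

lemma L2_mult_commute:
 assumes "bdd_mult m B" "bdd_mult k C"
 shows "L2_mult m (L2_mult k f) = L2_mult k (L2_mult m f)"
 by (simp add: L2_mult_mult[OF assms] L2_mult_mult[OF assms(2,1)] mult.commute)

lemma fm_tr:
 assumes "bdd_mult m B" shows "fourier_multiplier m (tr y f) = tr y (fourier_multiplier m f)"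
proof (rule fourier_inj)
 have c: "bdd_mult (\<lambda>\<xi>. cis (\<xi> \<bullet> y)) 1" by (rule bdd_mult_cis) measurable
 show "fourier_L2 (fourier_multiplier m (tr y f)) = fourier_L2 (tr y (fourier_multiplier m f))"
  by (simp add: fourier_tr L2_mult_commute[OF assms c])
qed

lemma fm_const_mult:
 assumes "bdd_mult m B"
 shows "fourier_multiplier m (L2_mult (\<lambda>_. c) f) = L2_mult (\<lambda>_. c) (fourier_multiplier m f)"
 by (rule fourier_inj) (simp add: fourier_const_mult L2_mult_commute[OF assms bdd_mult_const])

abbreviation S :: "real \<Rightarrow> L2 \<Rightarrow> L2" where "S \<equiv> schroedinger"

abbreviation ssym :: "real \<Rightarrow> real^3 \<Rightarrow> complex" where
 "ssym t \<equiv> \<lambda>\<xi>. cis (- (t * (norm \<xi>)\<^sup>2 / 2))"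

lemma bdd_ssym: "bdd_mult (ssym t) 1" by (rule bdd_mult_cis) measurable

lemma bounded_linear_S: "bounded_linear (S t)"
 unfolding schroedinger_def by (rule bounded_linear_fm[OF bdd_ssym])

lemmas S_add = linear_add[OF bounded_linear.linear[OF bounded_linear_S]]
lemmas S_diff = linear_diff[OF bounded_linear.linear[OF bounded_linear_S]]
lemmas S_scaleR = linear_scale[OF bounded_linear.linear[OF bounded_linear_S]]
lemmas S_zero [simp] = linear_0[OF bounded_linear.linear[OF bounded_linear_S]]

lemma norm_S [simp]: "norm (S t f) = norm f"
 unfolding schroedinger_def fourier_multiplier_eq
 by (simp add: norm_L2_mult_unimodular)

lemma S_tr: "S t (tr y f) = tr y (S t f)"
 unfolding schroedinger_def by (rule fm_tr[OF bdd_ssym])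

lemma S_const_mult: "S t (L2_mult (\<lambda>_. c) f) = L2_mult (\<lambda>_. c) (S t f)"
 unfolding schroedinger_def by (rule fm_const_mult[OF bdd_ssym])

lemma S_S: "S t (S s f) = S (t + s) f"
proof (rule fourier_inj)
 have "ssym t \<xi> * ssym s \<xi> = ssym (t + s) \<xi>" for \<xi>
  by (simp add: cis_mult add_divide_distrib distrib_right)
 thus "fourier_L2 (S t (S s f)) = fourier_L2 (S (t + s) f)"
  by (simp add: schroedinger_def L2_mult_mult[OF bdd_ssym bdd_ssym])
qed

lemma S_0 [simp]: "S 0 f = f"
 by (rule fourier_inj) (simp add: schroedinger_def L2_mult_one)

lemma S_inner: "S t f \<bullet> S t g = f \<bullet> g"
 by (simp add: dot_norm flip: S_add)

lemma S_adj: "S t f \<bullet> g = f \<bullet> S (- t) g"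
 using S_inner[of "- t" "S t f" g] by (simp add: S_S)

lemma S_cinner: "cinner (S t f) (S t g) = cinner f g"
 by (simp add: cinner_eq S_inner flip: S_const_mult)

text \<open>Continuity in t is dominated convergence on the Fourier side; it becomes joint because
  \<open>S t\<close> is an isometry. Joint continuity is what makes Duhamel integrands
  measurable.\<close>

lemma S_tendsto:
 assumes t: "t \<longlonglongrightarrow> t0" and f: "f \<longlonglongrightarrow> f0"
 shows "(\<lambda>n. S (t n) (f n)) \<longlonglongrightarrow> S t0 f0"
proof -
 have "(\<lambda>n. L2_mult (ssym (t n)) g) \<longlonglongrightarrow> L2_mult (ssym t0) g" for g
 proof (rule L2_dominated[OF integrable_rep_sq[of g]])
  have r: "AE x in lb. \<forall>n. rep_L2 (L2_mult (ssym (t n)) g) x = ssym (t n) x * rep_L2 g x"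
   using bdd_mult.rep[OF bdd_ssym] by (simp add: AE_all_countable)
  show "AE x in lb. cmod (rep_L2 (L2_mult (ssym (t n)) g) x) \<le> mag g x" for n
   using r by eventually_elim (simp add: norm_mult)
  show "AE x in lb. (\<lambda>n. rep_L2 (L2_mult (ssym (t n)) g) x) \<longlonglongrightarrow> rep_L2 (L2_mult (ssym t0) g) x"
   using r bdd_mult.rep[OF bdd_ssym, of t0 g]
  proof eventually_elim
   case (elim x)
   have "isCont cis z" for z
    using continuous_on_cis[OF continuous_on_id, of UNIV] by (simp add: continuous_on_eq_continuous_at)
   hence "(\<lambda>n. ssym (t n) x * rep_L2 g x) \<longlonglongrightarrow> ssym t0 x * rep_L2 g x"
    by (intro tendsto_mult tendsto_const isCont_tendsto_compose[of _ cis] tendsto_intros t) auto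
   thus ?case by (simp add: elim)
  qed
 qed
 from bounded_linear.tendsto[OF bounded_linear_Fi this[of "fourier_L2 f0"]]
 have "(\<lambda>n. S (t n) f0) \<longlonglongrightarrow> S t0 f0" by (simp add: schroedinger_def fourier_multiplier_eq)
 moreover have "(\<lambda>n. S (t n) (f n - f0)) \<longlonglongrightarrow> 0"
  by (rule tendsto_norm_zero_cancel) (use f in \<open>simp add: tendsto_norm_zero_iff LIM_zero_iff\<close>)
 ultimately have "(\<lambda>n. S (t n) f0 + S (t n) (f n - f0)) \<longlonglongrightarrow> S t0 f0 + 0" by (intro tendsto_add)
 thus ?thesis by (simp add: S_diff)
qed

lemma continuous_on_S: "continuous_on UNIV (\<lambda>p. S (fst p) (snd p))"
proof (rule continuous_on_sequentiallyI)
 fix u :: "nat \<Rightarrow> real \<times> L2" and a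
 assume "u \<longlonglongrightarrow> a"
 thus "(\<lambda>n. S (fst (u n)) (snd (u n))) \<longlonglongrightarrow> S (fst a) (snd a)"
  by (intro S_tendsto tendsto_fst tendsto_snd)
qed

lemma S_measurable [measurable (raw)]:
 assumes [measurable]: "t \<in> borel_measurable M" "f \<in> borel_measurable M"
 shows "(\<lambda>x. S (t x) (f x)) \<in> borel_measurable M"
 using borel_measurable_continuous_on[OF continuous_on_S, of "\<lambda>x. (t x, f x)" M] by simp

text \<open>The quotient in the symbol is at most 2 in modulus, with equality on the third axis; the
  bound is 2 times 4/3 pi.\<close>

lemma bdd_dipole: "bdd_mult dipole_symbol (8 / 3 * pi)"
proof (rule bdd_multI)
 have "(\<lambda>\<xi>::real^3. \<xi> $ i) \<in> borel_measurable borel" for i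
  by (intro borel_measurable_continuous_onI continuous_intros)
 thus "dipole_symbol \<in> borel_measurable borel"
  unfolding dipole_symbol_def[abs_def] by measurable
 fix \<xi> :: "real^3"
 have n: "(norm \<xi>)\<^sup>2 = (\<xi> $ 1)\<^sup>2 + (\<xi> $ 2)\<^sup>2 + (\<xi> $ 3)\<^sup>2"
  unfolding power2_norm_eq_inner inner_vec_def sum_3 by (simp add: power2_eq_square)
 have "\<bar>2 * (\<xi> $ 3)\<^sup>2 - (\<xi> $ 1)\<^sup>2 - (\<xi> $ 2)\<^sup>2\<bar> \<le> 2 * (norm \<xi>)\<^sup>2"
  unfolding n using zero_le_power2[of "\<xi> $ 1"] zero_le_power2[of "\<xi> $ 2"] zero_le_power2[of "\<xi> $ 3"]
  by (intro abs_leI) (simp_all add: algebra_simps)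
 hence "\<bar>(2 * (\<xi> $ 3)\<^sup>2 - (\<xi> $ 1)\<^sup>2 - (\<xi> $ 2)\<^sup>2) / (norm \<xi>)\<^sup>2\<bar> \<le> 2"
  by (cases "\<xi> = 0") (auto simp: abs_divide divide_le_eq)
 hence "4 / 3 * pi * \<bar>(2 * (\<xi> $ 3)\<^sup>2 - (\<xi> $ 1)\<^sup>2 - (\<xi> $ 2)\<^sup>2) / (norm \<xi>)\<^sup>2\<bar> \<le> 4 / 3 * pi * 2"
  by (intro mult_left_mono) auto
 thus "cmod (dipole_symbol \<xi>) \<le> 8 / 3 * pi"
  unfolding dipole_symbol_def norm_of_real abs_mult[of "4 / 3 * pi"] by simp
qed

section \<open>An \<open>L\<^sup>4\<close> bound through the Fourier transform of the density\<close>

abbreviation chr :: "real^3 \<Rightarrow> L2 \<Rightarrow> L2" where "chr \<eta> \<equiv> L2_mult (\<lambda>x. cis (- (\<eta> \<bullet> x)))"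

lemma bdd_chr: "bdd_mult (\<lambda>x. cis (- (\<eta> \<bullet> x))) 1" by (rule bdd_mult_cis) measurable

text \<open>By \<open>gauss_plancherel\<close> the damped energy is a double integral of \<phi>
  against a positive kernel, hence increasing in a nonnegative \<phi>. This permits truncating a
  function for which no L^2 bound is known yet.\<close>

lemma gauss_mono:
 fixes \<phi> \<psi> :: "real^3 \<Rightarrow> real"
 assumes \<phi>: "integrable lb \<phi>" and \<psi>: "integrable lb \<psi>" and le: "\<And>x. 0 \<le> \<phi> x" "\<And>x. \<phi> x \<le> \<psi> x" and s: "0 < s"
 shows "(\<integral>\<xi>. (cmod (ft (\<lambda>x. complex_of_real (\<phi> x)) \<xi>))\<^sup>2 * gau (s *\<^sub>R \<xi>) \<partial>lborel)
  \<le> (\<integral>\<xi>. (cmod (ft (\<lambda>x. complex_of_real (\<psi> x)) \<xi>))\<^sup>2 * gau (s *\<^sub>R \<xi>) \<partial>lborel)"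
proof -
 define P where "P h x = (\<integral>z. gau z * h (x + s *\<^sub>R z) \<partial>lborel)" for h :: "real^3 \<Rightarrow> real" and x
 have sc: "integrable lb (\<lambda>z. h (x + s *\<^sub>R z))" and sci: "(\<integral>z. h (x + s *\<^sub>R z) \<partial>lborel) = (\<integral>z. h z \<partial>lborel) / s ^ 3"
  if h: "integrable lb h" for h :: "real^3 \<Rightarrow> real" and x
 proof -
  have [measurable]: "h \<in> borel_measurable borel" using h by (auto dest: borel_measurable_integrable)
  have i: "integrable lb (\<lambda>z. h (z + x))" by (rule integrable_translate[OF _ h]) measurable
  show "integrable lb (\<lambda>z. h (x + s *\<^sub>R z))"
   using integrable_scale[OF _ s i] by (simp add: add.commute)
  have "(\<integral>z. h z \<partial>lborel) = (\<integral>z. h (z + x) \<partial>lborel)" by (rule integral_translate[symmetric]) measurable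
  also have "\<dots> = s ^ 3 *\<^sub>R (\<integral>z. h (s *\<^sub>R z + x) \<partial>lborel)" by (rule integral_scale[OF _ s]) measurable
  finally show "(\<integral>z. h (x + s *\<^sub>R z) \<partial>lborel) = (\<integral>z. h z \<partial>lborel) / s ^ 3"
   using s by (simp add: add.commute)
 qed
 have gi: "integrable lb (\<lambda>z. gau z * h (x + s *\<^sub>R z))" if h: "integrable lb h" for h :: "real^3 \<Rightarrow> real" and x
 proof (rule Bochner_Integration.integrable_bound[OF sc[OF h, of x]])
  have [measurable]: "h \<in> borel_measurable borel" using h by (auto dest: borel_measurable_integrable)
  show "(\<lambda>z. gau z * h (x + s *\<^sub>R z)) \<in> borel_measurable lb" by measurable
  show "AE z in lb. norm (gau z * h (x + s *\<^sub>R z)) \<le> norm (h (x + s *\<^sub>R z))"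
   using gau_pos gau_le_1 by (intro AE_I2) (auto simp: abs_mult less_imp_le intro!: mult_left_le_one_le)
 qed
 have Pm [measurable]: "P h \<in> borel_measurable borel" if h: "integrable lb h" for h
 proof -
  have [measurable]: "h \<in> borel_measurable borel" using h by (auto dest: borel_measurable_integrable)
  have "(\<lambda>x. \<integral>z. gau z * h (x + s *\<^sub>R z) \<partial>lborel) \<in> borel_measurable borel" by measurable
  thus ?thesis by (simp add: P_def[abs_def])
 qed
 have P0: "0 \<le> P h x" if "\<And>x. 0 \<le> h x" for h x
  unfolding P_def by (intro integral_nonneg_AE AE_I2 mult_nonneg_nonneg less_imp_le[OF gau_pos] that)
 have Pb: "P h x \<le> (\<integral>z. h z \<partial>lborel) / s ^ 3" if h: "integrable lb h" "\<And>x. 0 \<le> h x" for h x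
  unfolding P_def sci[OF h(1), of x, symmetric]
  using gau_le_1 h(2) by (intro integral_mono gi sc h) (auto intro: mult_right_le_one_le mult_left_le_one_le less_imp_le[OF gau_pos])
 have Pi: "integrable lb (\<lambda>x. P h x * h x)" if h: "integrable lb h" "\<And>x. 0 \<le> h x" for h
 proof (rule Bochner_Integration.integrable_bound)
  have [measurable]: "h \<in> borel_measurable borel" using h by (auto dest: borel_measurable_integrable)
  note Pm[OF h(1), measurable]
  show "integrable lb (\<lambda>x. (\<integral>z. h z \<partial>lborel) / s ^ 3 * h x)" by (intro integrable_mult_right h)
  show "(\<lambda>x. P h x * h x) \<in> borel_measurable lb" by measurable
  have le: "P h x * h x \<le> (\<integral>z. h z \<partial>lborel) / s ^ 3 * h x" for x
   by (intro mult_right_mono Pb h)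
  have nn: "0 \<le> P h x * h x" for x by (intro mult_nonneg_nonneg P0 h)
  show "AE x in lb. norm (P h x * h x) \<le> norm ((\<integral>z. h z \<partial>lborel) / s ^ 3 * h x)"
   unfolding real_norm_def abs_of_nonneg[OF nn] by (intro AE_I2 order_trans[OF le abs_ge_self])
 qed
 have E: "(\<integral>\<xi>. (cmod (ft (\<lambda>x. complex_of_real (h x)) \<xi>))\<^sup>2 * gau (s *\<^sub>R \<xi>) \<partial>lborel) = sqrt (2 * pi) ^ 3 * (\<integral>x. P h x * h x \<partial>lborel)"
  if h: "integrable lb h" for h
 proof -
  have "(\<integral>z. complex_of_real (gau z) * complex_of_real (h (x + s *\<^sub>R z)) \<partial>lborel) = complex_of_real (P h x)" for x
   by (simp add: P_def flip: of_real_mult)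
  hence "complex_of_real (\<integral>\<xi>. (cmod (ft (\<lambda>x. complex_of_real (h x)) \<xi>))\<^sup>2 * gau (s *\<^sub>R \<xi>) \<partial>lborel)
   = complex_of_real (sqrt (2 * pi) ^ 3) * (\<integral>x. complex_of_real (P h x * h x) \<partial>lborel)"
   using gauss_plancherel(2)[of "\<lambda>x. complex_of_real (h x)" s] h s by simp
  also have "\<dots> = complex_of_real (sqrt (2 * pi) ^ 3 * (\<integral>x. P h x * h x \<partial>lborel))"
   unfolding integral_complex_of_real by (rule of_real_mult[symmetric])
  finally show ?thesis by (simp only: of_real_eq_iff)
 qed
 have "(\<integral>x. P \<phi> x * \<phi> x \<partial>lborel) \<le> (\<integral>x. P \<psi> x * \<psi> x \<partial>lborel)"
 proof (rule integral_mono)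
  have \<psi>0: "0 \<le> \<psi> x" for x using le[of x] by linarith
  show "integrable lb (\<lambda>x. P \<phi> x * \<phi> x)" "integrable lb (\<lambda>x. P \<psi> x * \<psi> x)"
   by (intro Pi \<phi> \<psi> le \<psi>0)+
  fix x
  have "P \<phi> x \<le> P \<psi> x"
   unfolding P_def by (intro integral_mono gi \<phi> \<psi> mult_left_mono le less_imp_le[OF gau_pos])
  thus "P \<phi> x * \<phi> x \<le> P \<psi> x * \<psi> x"
   by (intro mult_mono le P0 \<psi>0) auto
 qed
 thus ?thesis unfolding E[OF \<phi>] E[OF \<psi>] by (intro mult_left_mono) auto
qed

text \<open>\<open>cinner (chr \<eta> u) u\<close> is the Fourier transform of \<open>\<bar>u\<bar>\<^sup>2\<close> at \<open>\<eta>\<close>.\<close>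

lemma L4_of_chr:
 assumes G: "\<And>\<eta>. ennreal (cmod (cinner (chr \<eta> u) u)) \<le> G \<eta>" and K: "(\<integral>\<^sup>+\<eta>. (G \<eta>)\<^sup>2 \<partial>lborel) \<le> ennreal (A powr 4)"
  and A: "0 \<le> A"
 shows "Lp_le lb 4 (\<lambda>x. mag u x) A"
proof -
 define w where "w x = (mag u x)\<^sup>2" for x
 have wi: "integrable lb w" unfolding w_def by (rule integrable_rep_sq)
 have w0: "0 \<le> w x" for x by (simp add: w_def)
 have [measurable]: "w \<in> borel_measurable borel" unfolding w_def by measurable
 have ftw: "ft (\<lambda>x. complex_of_real (w x)) \<eta> = cinner (chr \<eta> u) u" for \<eta>
  unfolding ft_def cinner_def
 proof (rule integral_cong_AE)
  show "AE x in lb. cis (- (\<eta> \<bullet> x)) * complex_of_real (w x) = rep_L2 (chr \<eta> u) x * cnj (rep_L2 u x)"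
   using bdd_mult.rep[OF bdd_chr, of \<eta> u]
   by eventually_elim (simp only: w_def complex_norm_square mult.assoc)
 qed measurable
 \<comment> \<open>|u|^2 is so far only integrable, whereas Plancherel's theorem asks for L^2 as
   well. The bounded truncations have both, and by \<open>gauss_mono\<close> their damped energies
   stay below that of |u|^2.\<close>
 define wn where "wn n x = min (w x) (real n)" for n x
 have wnm [measurable]: "wn n \<in> borel_measurable borel" for n unfolding wn_def by measurable
 have wn0: "0 \<le> wn n x" "wn n x \<le> w x" "wn n x \<le> real n" for n x by (auto simp: wn_def w0)
 have wni: "integrable lb (wn n)" for n
  by (rule Bochner_Integration.integrable_bound[OF wi]) (use wn0 w0 in auto)
 have wnsq: "integrable lb (\<lambda>x. (wn n x)\<^sup>2)" for n
 proof (rule Bochner_Integration.integrable_bound[OF integrable_mult_right[OF wi, of "real n"]])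
  have "(wn n x)\<^sup>2 \<le> real n * w x" for x
   unfolding power2_eq_square by (intro mult_mono wn0) auto
  thus "AE x in lb. norm ((wn n x)\<^sup>2) \<le> norm (real n * w x)"
   using w0 by auto
 qed measurable
 have sq: "sq_integrable (\<lambda>x. complex_of_real (wn n x))" for n
  using wnsq[of n] by (simp add: sq_integrable_def)
 have K4: "(\<integral>\<xi>. (cmod (ft (\<lambda>x. complex_of_real (w x)) \<xi>))\<^sup>2 * gau (s *\<^sub>R \<xi>) \<partial>lborel) \<le> A powr 4" if s: "0 < s" for s
 proof -
  have i: "integrable lb (\<lambda>\<xi>. (cmod (ft (\<lambda>x. complex_of_real (w x)) \<xi>))\<^sup>2 * gau (s *\<^sub>R \<xi>))"
   using wi s by (intro gauss_plancherel(1)) auto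
  have "ennreal (\<integral>\<xi>. (cmod (ft (\<lambda>x. complex_of_real (w x)) \<xi>))\<^sup>2 * gau (s *\<^sub>R \<xi>) \<partial>lborel)
    = (\<integral>\<^sup>+\<xi>. ennreal ((cmod (ft (\<lambda>x. complex_of_real (w x)) \<xi>))\<^sup>2 * gau (s *\<^sub>R \<xi>)) \<partial>lborel)"
   by (rule nn_integral_eq_integral[OF i, symmetric]) (auto intro!: AE_I2 mult_nonneg_nonneg less_imp_le[OF gau_pos])
  also have "\<dots> \<le> (\<integral>\<^sup>+\<eta>. (G \<eta>)\<^sup>2 \<partial>lborel)"
  proof (rule nn_integral_mono)
   fix \<xi>
   have "ennreal ((cmod (ft (\<lambda>x. complex_of_real (w x)) \<xi>))\<^sup>2 * gau (s *\<^sub>R \<xi>)) \<le> ennreal ((cmod (cinner (chr \<xi> u) u))\<^sup>2 * 1)"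
    unfolding ftw by (intro ennreal_leI mult_left_mono gau_le_1) auto
   also have "\<dots> = (ennreal (cmod (cinner (chr \<xi> u) u)))\<^sup>2" by (simp add: ennreal_power)
   also have "\<dots> \<le> (G \<xi>)\<^sup>2" by (intro power_mono G) auto
   finally show "ennreal ((cmod (ft (\<lambda>x. complex_of_real (w x)) \<xi>))\<^sup>2 * gau (s *\<^sub>R \<xi>)) \<le> (G \<xi>)\<^sup>2" .
  qed
  also note K
  finally show ?thesis by (simp add: ennreal_le_iff)
 qed
 have main: "Lp_le lb 2 (wn n) (A powr 2)" for n
 proof -
  let ?f = "\<lambda>x. complex_of_real (wn n x)"
  have fi: "integrable lb ?f" using wni by simp
  have "(2 * pi) ^ 3 * (norm (L2_of ?f))\<^sup>2 \<le> A powr 4"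
  proof (rule tendsto_upperbound[OF ft_norm_limit[OF fi sq inverse_Suc_seq(1,2)]])
   show "\<forall>\<^sub>F k in sequentially. (\<integral>\<xi>. (cmod (ft ?f \<xi>))\<^sup>2 * gau (inverse (real (Suc k)) *\<^sub>R \<xi>) \<partial>lborel) \<le> A powr 4"
    by (intro always_eventually allI order_trans[OF gauss_mono[OF wni wi wn0(1,2) inverse_Suc_seq(1)] K4[OF inverse_Suc_seq(1)]])
  qed simp
  \<comment> \<open>The factor (2 pi)^3 of the unnormalised transform exceeds 1 and is
    dropped.\<close>
  moreover have "1 * (norm (L2_of ?f))\<^sup>2 \<le> (2 * pi) ^ 3 * (norm (L2_of ?f))\<^sup>2"
   using pi_ge_two by (intro mult_right_mono one_le_power) auto
  ultimately have "(norm (L2_of ?f))\<^sup>2 \<le> A powr 4" by linarith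
  hence "(\<integral>\<^sup>+x. ennreal ((wn n x)\<^sup>2) \<partial>lborel) \<le> ennreal (A powr 4)"
   using nn_integral_L2[OF sq[of n]] by (simp add: ennreal_leI)
  thus ?thesis
   using wn0 A by (simp add: Lp_le_def powr_powr)
 qed
 have "Lp_le lb 2 w (A powr 2)"
 proof (rule Lp_le_Fatou[OF main])
  show "AE x in lb. (\<lambda>n. wn n x) \<longlonglongrightarrow> w x"
  proof (rule AE_I2)
   fix x
   obtain N :: nat where N: "w x \<le> real N" using real_arch_simple by blast
   have "\<forall>\<^sub>F n in sequentially. wn n x = w x"
    by (rule eventually_sequentiallyI[of N]) (use N in \<open>auto simp: wn_def\<close>)
   thus "(\<lambda>n. wn n x) \<longlonglongrightarrow> w x" by (rule tendsto_eventually)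
  qed
 qed auto
 moreover have "\<bar>w x\<bar> powr 2 = \<bar>mag u x\<bar> powr 4" for x
  unfolding w_def by (simp add: power_abs flip: power_mult)
 ultimately show ?thesis using A by (simp add: Lp_le_def powr_powr)
qed

section \<open>Dispersive estimate and Sobolev embedding\<close>

lemma nn_integral_scale:
 fixes f :: "real^3 \<Rightarrow> ennreal"
 assumes [measurable]: "f \<in> borel_measurable borel" and c: "c \<noteq> 0"
 shows "(\<integral>\<^sup>+x. f (c *\<^sub>R x) \<partial>lborel) = ennreal (1 / \<bar>c\<bar> ^ 3) * (\<integral>\<^sup>+x. f x \<partial>lborel)"
proof -
 have "(\<integral>\<^sup>+x. f x \<partial>lborel) = (\<integral>\<^sup>+x. f x \<partial>Nonnegative_Lebesgue_Integration.density (distr lborel borel (\<lambda>x. 0 + c *\<^sub>R x)) (\<lambda>_. ennreal (\<bar>c\<bar> ^ DIM(real^3))))"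
  using c by (subst lborel_affine[of c 0]) auto
 also have "\<dots> = (\<integral>\<^sup>+x. ennreal (\<bar>c\<bar> ^ 3) * f x \<partial>distr lborel borel (\<lambda>x. 0 + c *\<^sub>R x))"
  by (subst nn_integral_density) auto
 also have "\<dots> = (\<integral>\<^sup>+x. ennreal (\<bar>c\<bar> ^ 3) * f (c *\<^sub>R x) \<partial>lborel)"
  by (subst nn_integral_distr) auto
 also have "\<dots> = ennreal (\<bar>c\<bar> ^ 3) * (\<integral>\<^sup>+x. f (c *\<^sub>R x) \<partial>lborel)"
  by (rule nn_integral_cmult) measurable
 finally have "ennreal (1 / \<bar>c\<bar> ^ 3) * (\<integral>\<^sup>+x. f x \<partial>lborel)
   = (ennreal (1 / \<bar>c\<bar> ^ 3) * ennreal (\<bar>c\<bar> ^ 3)) * (\<integral>\<^sup>+x. f (c *\<^sub>R x) \<partial>lborel)"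
  by (simp add: mult.assoc)
 also have "ennreal (1 / \<bar>c\<bar> ^ 3) * ennreal (\<bar>c\<bar> ^ 3) = 1"
  using c by (simp add: ennreal_mult[symmetric])
 finally show ?thesis by simp
qed

lemma nn_integral_reflect_scale:
 fixes f :: "real^3 \<Rightarrow> ennreal"
 assumes "f \<in> borel_measurable borel" and "c \<noteq> 0"
 shows "(\<integral>\<^sup>+x. f (y + c *\<^sub>R x) \<partial>lborel) = ennreal (1 / \<bar>c\<bar> ^ 3) * (\<integral>\<^sup>+x. f x \<partial>lborel)"
proof -
 note [measurable] = assms(1)
 have "(\<integral>\<^sup>+x. f (y + c *\<^sub>R x) \<partial>lborel) = ennreal (1 / \<bar>c\<bar> ^ 3) * (\<integral>\<^sup>+x. f (y + x) \<partial>lborel)"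
  by (rule nn_integral_scale[OF _ assms(2), of "\<lambda>x. f (y + x)"]) measurable
 also have "(\<integral>\<^sup>+x. f (y + x) \<partial>lborel) = (\<integral>\<^sup>+x. f x \<partial>lborel)"
  using nn_integral_translate[OF assms(1), of y] by (simp add: add.commute)
 finally show ?thesis .
qed

text \<open>Young's inequality \<open>L\<^sup>4\<^sup>/\<^sup>3 \<star> L\<^sup>4\<^sup>/\<^sup>3 \<subseteq> L\<^sup>2\<close>: with \<open>\<phi> = \<Phi>\<^sup>3\<^sup>/\<^sup>4\<close>, Cauchy-Schwarz is applied to the factors
 \<open>(\<Phi> \<Phi>')\<^sup>1\<^sup>/\<^sup>2\<close> and \<open>(\<Phi> \<Phi>')\<^sup>1\<^sup>/\<^sup>4\<close>.\<close>

lemma young_43: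
 fixes \<phi> :: "real^3 \<Rightarrow> real"
 assumes \<phi>: "Lp_le lb (4 / 3) \<phi> A" and c: "c \<noteq> 0"
 shows "(\<integral>\<^sup>+\<eta>. (\<integral>\<^sup>+x. ennreal (\<bar>\<phi> (x + c *\<^sub>R \<eta>)\<bar> * \<bar>\<phi> x\<bar>) \<partial>lborel)\<^sup>2 \<partial>lborel) \<le> ennreal (A powr 4 / \<bar>c\<bar> ^ 3)"
proof -
 have [measurable]: "\<phi> \<in> borel_measurable borel" using Lp_leD(1)[OF \<phi>] by simp
 define \<Phi> where "\<Phi> x = \<bar>\<phi> x\<bar> powr (4 / 3)" for x
 have [measurable]: "\<Phi> \<in> borel_measurable borel" unfolding \<Phi>_def by measurable
 have \<Phi>0: "0 \<le> \<Phi> x" for x by (simp add: \<Phi>_def)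
 define I where "I = (\<integral>\<^sup>+x. ennreal (\<Phi> x) \<partial>lborel)"
 have I: "I \<le> ennreal (A powr (4 / 3))" using Lp_leD(3)[OF \<phi>] by (simp add: I_def \<Phi>_def)
 have tI: "(\<integral>\<^sup>+x. ennreal (\<Phi> (x + y)) \<partial>lborel) = I" for y
  unfolding I_def by (rule nn_integral_translate) measurable
 have step: "(\<integral>\<^sup>+x. ennreal (\<bar>\<phi> (x + y)\<bar> * \<bar>\<phi> x\<bar>) \<partial>lborel)\<^sup>2 \<le> (\<integral>\<^sup>+x. ennreal (\<Phi> (x + y) * \<Phi> x) \<partial>lborel) * I" for y
 proof -
  let ?a = "\<lambda>x. ennreal ((\<Phi> (x + y) * \<Phi> x) powr (1 / 2))" and ?b = "\<lambda>x. ennreal ((\<Phi> (x + y) * \<Phi> x) powr (1 / 4))"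
  have e: "\<bar>\<phi> (x + y)\<bar> * \<bar>\<phi> x\<bar> = (\<Phi> (x + y) * \<Phi> x) powr (1 / 2) * (\<Phi> (x + y) * \<Phi> x) powr (1 / 4)" for x
   by (simp add: \<Phi>_def powr_mult powr_powr powr_add[symmetric] flip: powr_mult)
  have "(\<integral>\<^sup>+x. ennreal (\<bar>\<phi> (x + y)\<bar> * \<bar>\<phi> x\<bar>) \<partial>lborel)\<^sup>2 = (\<integral>\<^sup>+x. ?a x * ?b x \<partial>lborel)\<^sup>2"
   unfolding e by (simp add: ennreal_mult)
  also have "\<dots> \<le> (\<integral>\<^sup>+x. (?a x)\<^sup>2 \<partial>lborel) * (\<integral>\<^sup>+x. (?b x)\<^sup>2 \<partial>lborel)"
   by (rule Cauchy_Schwarz_nn_integral) measurable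
  also have "(\<integral>\<^sup>+x. (?a x)\<^sup>2 \<partial>lborel) = (\<integral>\<^sup>+x. ennreal (\<Phi> (x + y) * \<Phi> x) \<partial>lborel)"
  proof (rule nn_integral_cong)
   fix x
   have "((\<Phi> (x + y) * \<Phi> x) powr (1 / 2))\<^sup>2 = \<Phi> (x + y) * \<Phi> x"
    using \<Phi>0[of x] \<Phi>0[of "x + y"] by (simp add: powr_half_sqrt)
   thus "(?a x)\<^sup>2 = ennreal (\<Phi> (x + y) * \<Phi> x)" by (simp add: ennreal_power)
  qed
  \<comment> \<open>The square of this factor is the geometric mean of \<Phi> at the two points. The
    arithmetic mean bounds it, and by translation invariance that integrates to
    \<open>I\<close>.\<close>
  also have "(\<integral>\<^sup>+x. (?b x)\<^sup>2 \<partial>lborel) \<le> (\<integral>\<^sup>+x. ennreal (1 / 2 * \<Phi> (x + y) + 1 / 2 * \<Phi> x) \<partial>lborel)"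
  proof (rule nn_integral_mono)
   fix x
   have "((\<Phi> (x + y) * \<Phi> x) powr (1 / 4))\<^sup>2 = (\<Phi> (x + y) * \<Phi> x) powr (1 / 2)"
    by (simp add: power2_eq_square powr_add[symmetric])
   also have "\<dots> = \<Phi> (x + y) powr (1 / 2) * \<Phi> x powr (1 / 2)" by (simp add: powr_mult \<Phi>0)
   also have "\<dots> \<le> 1 / 2 * \<Phi> (x + y) + 1 / 2 * \<Phi> x"
    by (rule weighted_amgm) (auto simp: \<Phi>0)
   finally show "(?b x)\<^sup>2 \<le> ennreal (1 / 2 * \<Phi> (x + y) + 1 / 2 * \<Phi> x)"
    by (simp only: ennreal_power powr_ge_zero ennreal_leI)
  qed
  also have "\<dots> = (\<integral>\<^sup>+x. ennreal (1 / 2) * ennreal (\<Phi> (x + y)) + ennreal (1 / 2) * ennreal (\<Phi> x) \<partial>lborel)"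
   by (intro nn_integral_cong) (subst ennreal_mult[symmetric], simp, simp add: \<Phi>0, subst ennreal_mult[symmetric], simp, simp add: \<Phi>0,
     subst ennreal_plus[symmetric], auto simp: \<Phi>0)
  also have "\<dots> = ennreal (1 / 2) * I + ennreal (1 / 2) * I"
   by (subst nn_integral_add) (auto simp: nn_integral_cmult tI I_def[symmetric])
  also have "\<dots> = (ennreal (1 / 2) + ennreal (1 / 2)) * I" by (simp only: distrib_right)
  also have "ennreal (1 / 2) + ennreal (1 / 2) = 1" by (subst ennreal_plus[symmetric]) auto
  finally show ?thesis by (simp add: mult_left_mono)
 qed
 have "(\<integral>\<^sup>+\<eta>. (\<integral>\<^sup>+x. ennreal (\<bar>\<phi> (x + c *\<^sub>R \<eta>)\<bar> * \<bar>\<phi> x\<bar>) \<partial>lborel)\<^sup>2 \<partial>lborel)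
   \<le> (\<integral>\<^sup>+\<eta>. (\<integral>\<^sup>+x. ennreal (\<Phi> (x + c *\<^sub>R \<eta>) * \<Phi> x) \<partial>lborel) * I \<partial>lborel)"
  by (intro nn_integral_mono step)
 also have "\<dots> = (\<integral>\<^sup>+\<eta>. (\<integral>\<^sup>+x. ennreal (\<Phi> (x + c *\<^sub>R \<eta>) * \<Phi> x) \<partial>lborel) \<partial>lborel) * I"
  by (rule nn_integral_multc) measurable
 also have "(\<integral>\<^sup>+\<eta>. (\<integral>\<^sup>+x. ennreal (\<Phi> (x + c *\<^sub>R \<eta>) * \<Phi> x) \<partial>lborel) \<partial>lborel)
   = (\<integral>\<^sup>+x. (\<integral>\<^sup>+\<eta>. ennreal (\<Phi> (x + c *\<^sub>R \<eta>) * \<Phi> x) \<partial>lborel) \<partial>lborel)"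
  by (rule lborel_pair.Fubini') measurable
 also have "\<dots> = (\<integral>\<^sup>+x. (ennreal (1 / \<bar>c\<bar> ^ 3) * I) * ennreal (\<Phi> x) \<partial>lborel)"
 proof (rule nn_integral_cong)
  fix x
  have "(\<integral>\<^sup>+\<eta>. ennreal (\<Phi> (x + c *\<^sub>R \<eta>) * \<Phi> x) \<partial>lborel) = (\<integral>\<^sup>+\<eta>. ennreal (\<Phi> (x + c *\<^sub>R \<eta>)) * ennreal (\<Phi> x) \<partial>lborel)"
   by (simp add: ennreal_mult \<Phi>0)
  also have "\<dots> = (\<integral>\<^sup>+\<eta>. ennreal (\<Phi> (x + c *\<^sub>R \<eta>)) \<partial>lborel) * ennreal (\<Phi> x)"
   by (rule nn_integral_multc) measurable
  also have "(\<integral>\<^sup>+\<eta>. ennreal (\<Phi> (x + c *\<^sub>R \<eta>)) \<partial>lborel) = ennreal (1 / \<bar>c\<bar> ^ 3) * I"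
   unfolding I_def by (rule nn_integral_reflect_scale[OF _ c, of "\<lambda>x. ennreal (\<Phi> x)"]) measurable
  finally show "(\<integral>\<^sup>+\<eta>. ennreal (\<Phi> (x + c *\<^sub>R \<eta>) * \<Phi> x) \<partial>lborel) = (ennreal (1 / \<bar>c\<bar> ^ 3) * I) * ennreal (\<Phi> x)" .
 qed
 also have "\<dots> = (ennreal (1 / \<bar>c\<bar> ^ 3) * I) * I"
  unfolding I_def by (rule nn_integral_cmult) measurable
 also have "\<dots> * I \<le> (ennreal (1 / \<bar>c\<bar> ^ 3) * ennreal (A powr (4 / 3))) * ennreal (A powr (4 / 3)) * ennreal (A powr (4 / 3))"
  by (intro mult_mono I) auto
 also have "\<dots> = ennreal (1 / \<bar>c\<bar> ^ 3 * (A powr (4 / 3) * (A powr (4 / 3) * A powr (4 / 3))))"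
 proof -
  have "ennreal a * ennreal b * ennreal b * ennreal b = ennreal (a * (b * (b * b)))" if "0 \<le> a" "0 \<le> b" for a b :: real
   using that by (simp add: ennreal_mult mult.assoc)
  thus ?thesis by simp
 qed
 also have "A powr (4 / 3) * (A powr (4 / 3) * A powr (4 / 3)) = A powr 4"
  by (simp add: powr_add[symmetric])
 finally show ?thesis by simp
qed

text \<open>On the Fourier side the modulation is a translation by \<eta>. Expanding |\<xi> +
  \<eta>|^2 in the phase leaves the propagator itself, a linear phase, which is a translation by -t
  \<eta> in space, and a constant.\<close>

lemma galilei: "chr \<eta> (S t f) = L2_mult (\<lambda>_. cis (t * (norm \<eta>)\<^sup>2 / 2)) (S t (chr \<eta> (tr (- t *\<^sub>R \<eta>) f)))"
proof (rule fourier_inj, rule L2_eqI)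
 let ?F = "fourier_L2 f" and ?c = "cis (t * (norm \<eta>)\<^sup>2 / 2)"
 have b: "bdd_mult (\<lambda>\<xi>. cis (\<xi> \<bullet> (- t *\<^sub>R \<eta>))) 1" by (rule bdd_mult_cis) measurable
 have l: "AE \<xi> in lborel. rep_L2 (fourier_L2 (chr \<eta> (S t f))) \<xi> = ssym t (\<xi> + \<eta>) * rep_L2 ?F (\<xi> + \<eta>)"
  unfolding fourier_modulate schroedinger_def fourier_fm
  using rep_tr[of \<eta> "L2_mult (ssym t) ?F"] AE_translate[OF bdd_mult.rep[OF bdd_ssym, of t ?F], of \<eta>]
  by eventually_elim simp
 let ?G = "tr \<eta> (L2_mult (\<lambda>\<xi>. cis (\<xi> \<bullet> (- t *\<^sub>R \<eta>))) ?F)"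
 have e: "fourier_L2 (L2_mult (\<lambda>_. ?c) (S t (chr \<eta> (tr (- t *\<^sub>R \<eta>) f)))) = L2_mult (\<lambda>_. ?c) (L2_mult (ssym t) ?G)"
  unfolding fourier_const_mult schroedinger_def fourier_fm fourier_modulate fourier_tr ..
 have r: "AE \<xi> in lborel. rep_L2 (L2_mult (\<lambda>_. ?c) (L2_mult (ssym t) ?G)) \<xi>
   = ?c * (ssym t \<xi> * (cis ((\<xi> + \<eta>) \<bullet> (- t *\<^sub>R \<eta>)) * rep_L2 ?F (\<xi> + \<eta>)))"
  using bdd_mult.rep[OF bdd_mult_const, of ?c "L2_mult (ssym t) ?G"] bdd_mult.rep[OF bdd_ssym, of t ?G]
   rep_tr[of \<eta> "L2_mult (\<lambda>\<xi>. cis (\<xi> \<bullet> (- t *\<^sub>R \<eta>))) ?F"] AE_translate[OF bdd_mult.rep[OF b, of ?F], of \<eta>]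
  by eventually_elim (simp only:)
 have ph: "?c * (ssym t \<xi> * (cis ((\<xi> + \<eta>) \<bullet> (- t *\<^sub>R \<eta>)) * z)) = ssym t (\<xi> + \<eta>) * z" for \<xi> z
 proof -
  have n: "(norm (\<xi> + \<eta>))\<^sup>2 = (norm \<xi>)\<^sup>2 + 2 * (\<xi> \<bullet> \<eta>) + (norm \<eta>)\<^sup>2"
   by (simp add: power2_norm_eq_inner inner_add_left inner_add_right inner_commute)
  have "t * (norm \<eta>)\<^sup>2 / 2 + (- (t * (norm \<xi>)\<^sup>2 / 2) + (\<xi> + \<eta>) \<bullet> (- t *\<^sub>R \<eta>)) = - (t * (norm (\<xi> + \<eta>))\<^sup>2 / 2)"
   unfolding n by (simp add: inner_add_left power2_norm_eq_inner field_simps)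
  hence "?c * (ssym t \<xi> * cis ((\<xi> + \<eta>) \<bullet> (- t *\<^sub>R \<eta>))) = ssym t (\<xi> + \<eta>)"
   by (simp only: cis_mult)
  thus ?thesis by (simp only: mult.assoc[symmetric])
 qed
 show "AE x in lborel. rep_L2 (fourier_L2 (chr \<eta> (S t f))) x =
   rep_L2 (fourier_L2 (L2_mult (\<lambda>_. ?c) (S t (chr \<eta> (tr (- t *\<^sub>R \<eta>) f))))) x"
  unfolding e using l r by eventually_elim (simp only: ph)
qed

text \<open>The constant phase and the unitary group drop out of the pairing. Passing from t \<eta>
  to \<eta> in Young's inequality costs |t|^-3, and its fourth root is the decay rate.\<close>

theorem dispersive:
 assumes f: "Lp_le lb (4 / 3) (\<lambda>x. mag f x) A" and t: "t \<noteq> 0"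
 shows "Lp_le lb 4 (\<lambda>x. mag (S t f) x) (\<bar>t\<bar> powr (- 3 / 4) * A)"
proof (rule L4_of_chr)
 let ?\<phi> = "\<lambda>x. mag f x"
 fix \<eta>
 have "cmod (cinner (chr \<eta> (S t f)) (S t f)) = cmod (cinner (chr \<eta> (tr (- t *\<^sub>R \<eta>) f)) f)"
  unfolding galilei cinner_mult_left S_cinner by (simp add: norm_mult)
 hence "ennreal (cmod (cinner (chr \<eta> (S t f)) (S t f)))
  \<le> (\<integral>\<^sup>+x. ennreal (cmod (rep_L2 (chr \<eta> (tr (- t *\<^sub>R \<eta>) f)) x) * mag f x) \<partial>lborel)"
  using ennreal_cinner_le by metis
 also have "\<dots> = (\<integral>\<^sup>+x. ennreal (\<bar>?\<phi> (x + (- t) *\<^sub>R \<eta>)\<bar> * \<bar>?\<phi> x\<bar>) \<partial>lborel)"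
  by (rule nn_integral_cong_AE)
    (use bdd_mult.rep[OF bdd_chr, of \<eta> "tr (- t *\<^sub>R \<eta>) f"] rep_tr[of "- t *\<^sub>R \<eta>" f] in
     \<open>eventually_elim, simp add: norm_mult\<close>)
 finally show "ennreal (cmod (cinner (chr \<eta> (S t f)) (S t f)))
   \<le> (\<integral>\<^sup>+x. ennreal (\<bar>?\<phi> (x + (- t) *\<^sub>R \<eta>)\<bar> * \<bar>?\<phi> x\<bar>) \<partial>lborel)" .
next
 have A: "0 \<le> A" using f by (rule Lp_leD)
 thus "0 \<le> \<bar>t\<bar> powr (- 3 / 4) * A" by simp
 have "(\<bar>t\<bar> powr (- 3 / 4) * A) powr 4 = A powr 4 / \<bar>- t\<bar> ^ 3"
 proof -
  have "(\<bar>t\<bar> powr (- 3 / 4)) powr 4 = \<bar>t\<bar> powr (- 3)" by (simp add: powr_powr)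
  also have "\<dots> = inverse (\<bar>t\<bar> ^ 3)" using t by (simp add: powr_minus)
  finally show ?thesis using A by (simp add: powr_mult field_simps)
 qed
 thus "(\<integral>\<^sup>+\<eta>. (\<integral>\<^sup>+x. ennreal (\<bar>cmod (rep_L2 f (x + (- t) *\<^sub>R \<eta>))\<bar> * \<bar>mag f x\<bar>) \<partial>lborel)\<^sup>2 \<partial>lborel)
   \<le> ennreal ((\<bar>t\<bar> powr (- 3 / 4) * A) powr 4)"
  using young_43[OF f, of "- t"] t by simp
qed

text \<open>The transform of |u|^2 is, up to normalisation, the autocorrelation of the transform of
  u, to which the same Young inequality applies with unit dilation. The Sobolev embedding rests on
  this.\<close>

lemma hausdorff_young_4:
 assumes f: "Lp_le lb (4 / 3) (\<lambda>x. mag (fourier_L2 u) x) A"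
 shows "Lp_le lb 4 (\<lambda>x. mag u x) A"
proof (rule L4_of_chr)
 let ?F = "fourier_L2 u" let ?\<phi> = "\<lambda>x. cmod (rep_L2 ?F x)"
 fix \<eta>
 have "cinner (chr \<eta> u) u = cinner (tr \<eta> ?F) ?F"
  by (simp add: fourier_modulate[symmetric] cinner_fourier)
 hence "ennreal (cmod (cinner (chr \<eta> u) u)) \<le> (\<integral>\<^sup>+x. ennreal (mag (tr \<eta> ?F) x * cmod (rep_L2 ?F x)) \<partial>lborel)"
  using ennreal_cinner_le by metis
 also have "\<dots> = (\<integral>\<^sup>+x. ennreal (\<bar>?\<phi> (x + 1 *\<^sub>R \<eta>)\<bar> * \<bar>?\<phi> x\<bar>) \<partial>lborel)"
  by (rule nn_integral_cong_AE) (use rep_tr[of \<eta> ?F] in \<open>eventually_elim, simp\<close>)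
 finally show "ennreal (cmod (cinner (chr \<eta> u) u)) \<le> (\<integral>\<^sup>+x. ennreal (\<bar>?\<phi> (x + 1 *\<^sub>R \<eta>)\<bar> * \<bar>?\<phi> x\<bar>) \<partial>lborel)" .
next
 show "0 \<le> A" using f by (rule Lp_leD)
 show "(\<integral>\<^sup>+\<eta>. (\<integral>\<^sup>+x. ennreal (\<bar>cmod (rep_L2 (fourier_L2 u) (x + 1 *\<^sub>R \<eta>))\<bar> * \<bar>mag (fourier_L2 u) x\<bar>) \<partial>lborel)\<^sup>2 \<partial>lborel)
   \<le> ennreal (A powr 4)"
  using young_43[OF f, of 1] by simp
qed

section \<open>The L^4 weight behind the Sobolev embedding\<close>

lemma integrable_weight_1d: "integrable lborel (\<lambda>x::real. (1 + \<bar>x\<bar>) powr (- 4 / 3))"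
proof (rule integrableI_nonneg)
 have half: "(\<integral>\<^sup>+x. ennreal ((1 + x) powr (- 4 / 3)) * indicator {0..} x \<partial>lborel) = ennreal (0 - (- 3) * (1 + 0) powr (- 1 / 3))"
 proof (rule nn_integral_FTC_atLeast)
  fix x :: real assume "0 \<le> x"
  hence "((\<lambda>x. (1 + x) powr (- 1 / 3)) has_real_derivative (- 1 / 3) * (1 + x) powr (- 1 / 3 - 1)) (at x)"
   by (auto intro!: derivative_eq_intros)
  from DERIV_cmult[OF this, of "- 3"]
  show "((\<lambda>x. (- 3) * (1 + x) powr (- 1 / 3)) has_real_derivative (1 + x) powr (- 4 / 3)) (at x)"
   by simp
 next
  have "((\<lambda>x::real. (1 + x) powr (- 1 / 3)) \<longlongrightarrow> 0) at_top"
   by (rule tendsto_neg_powr) (auto intro!: filterlim_tendsto_add_at_top[OF tendsto_const] filterlim_ident)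
  from tendsto_mult[OF tendsto_const this, of "- 3"]
  show "((\<lambda>x::real. (- 3) * (1 + x) powr (- 1 / 3)) \<longlongrightarrow> 0) at_top" by simp
 qed auto
 define g where "g x = ennreal ((1 + x) powr (- 4 / 3)) * indicator {0..} x" for x :: real
 have [measurable]: "g \<in> borel_measurable borel" unfolding g_def by measurable
 have gf: "(\<integral>\<^sup>+x. g x \<partial>lborel) < \<infinity>" using half by (simp add: g_def)
 have gr: "(\<integral>\<^sup>+x. g (- x) \<partial>lborel) = (\<integral>\<^sup>+x. g x \<partial>lborel)"
  using nn_integral_real_affine[of g "-1" 0] by simp
 have "(\<integral>\<^sup>+x. ennreal ((1 + \<bar>x\<bar>) powr (- 4 / 3)) \<partial>lborel) \<le> (\<integral>\<^sup>+x. g x + g (- x) \<partial>lborel)"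
  by (rule nn_integral_mono) (auto simp: g_def split: split_indicator)
 also have "\<dots> = (\<integral>\<^sup>+x. g x \<partial>lborel) + (\<integral>\<^sup>+x. g (- x) \<partial>lborel)"
  by (rule nn_integral_add) measurable
 also have "\<dots> < \<infinity>" using gf by (simp add: gr)
 finally show "(\<integral>\<^sup>+x. ennreal ((1 + \<bar>x\<bar>) powr (- 4 / 3)) \<partial>lborel) < \<infinity>" .
qed auto

text \<open>The fourth power of the weight is split evenly over the three coordinates. Each
  coordinate is at most the norm, so the product of (1 + |\<xi>_j|)^(-4/3) dominates, and every
  factor is integrable because 4/3 > 1.\<close>

lemma weight_L4: "\<exists>C. Lp_le lb 4 (\<lambda>\<xi>. 1 / (1 + norm \<xi>)) C"
proof -
 let ?h = "\<lambda>\<xi>::real^3. \<Prod>b\<in>Basis. (1 + \<bar>\<xi> \<bullet> b\<bar>) powr (- 4 / 3)"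
 have hi: "integrable lb ?h" by (rule lborel_prod_Basis(1)) (rule integrable_weight_1d)
 have le: "\<bar>1 / (1 + norm \<xi>)\<bar> powr 4 \<le> ?h \<xi>" for \<xi> :: "real^3"
 proof -
  have "\<bar>1 / (1 + norm \<xi>)\<bar> powr 4 = (\<Prod>b\<in>(Basis :: (real^3) set). (1 + norm \<xi>) powr (- 4 / 3))"
  proof -
   have "((1 + norm \<xi>) powr (- 4 / 3)) ^ 3 = (1 + norm \<xi>) powr (- 4)"
    by (simp add: add_nonneg_eq_0_iff flip: powr_realpow powr_add add: powr_powr)
   also have "\<dots> = \<bar>1 / (1 + norm \<xi>)\<bar> powr 4"
    by (simp add: powr_minus powr_divide divide_inverse power_inverse)
   finally show ?thesis by (simp add: prod_constant)
  qed
  also have "\<dots> \<le> ?h \<xi>"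
  proof (rule prod_mono)
   fix b :: "real^3" assume "b \<in> Basis"
   hence "\<bar>\<xi> \<bullet> b\<bar> \<le> norm \<xi>" by (rule Basis_le_norm)
   thus "0 \<le> (1 + norm \<xi>) powr (- 4 / 3) \<and> (1 + norm \<xi>) powr (- 4 / 3) \<le> (1 + \<bar>\<xi> \<bullet> b\<bar>) powr (- 4 / 3)"
    by (auto intro!: powr_mono2')
  qed
  finally show ?thesis .
 qed
 have h0: "0 \<le> ?h \<xi>" for \<xi> by (intro prod_nonneg) auto
 define I where "I = (\<integral>\<xi>. ?h \<xi> \<partial>lborel)"
 have I0: "0 \<le> I" unfolding I_def using h0 by (intro integral_nonneg_AE AE_I2)
 have "(\<integral>\<^sup>+\<xi>. ennreal (\<bar>1 / (1 + norm \<xi>)\<bar> powr 4) \<partial>lb) \<le> (\<integral>\<^sup>+\<xi>. ennreal (?h \<xi>) \<partial>lb)"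
  by (intro nn_integral_mono ennreal_leI le)
 also have "\<dots> = ennreal I"
  unfolding I_def using h0 by (intro nn_integral_eq_integral hi AE_I2)
 finally have "Lp_le lb 4 (\<lambda>\<xi>. 1 / (1 + norm \<xi>)) (I powr (1 / 4))"
  using I0 by (simp add: Lp_le_def powr_powr)
 thus ?thesis ..
qed

section \<open>Test functions\<close>

text \<open>The functions p(1/s) exp(-1/s), extended by 0, form a family closed under
  differentiation, so that a single induction gives smoothness of every order.\<close>

definition bump :: "real poly \<Rightarrow> real \<Rightarrow> real" where
 "bump p s = (if 0 < s then poly p (1 / s) * exp (- (1 / s)) else 0)"

text \<open>With y = 1/s one has dy/ds = -y^2, and the derivative of p(y) exp(-y) in y is (p' - p)
  exp(-y).\<close>

definition dbump :: "real poly \<Rightarrow> real poly" where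
 "dbump p = [:0, 0, 1:] * (p - pderiv p)"

lemma poly_exp_tendsto_0: "((\<lambda>y. poly p y * exp (- y)) \<longlongrightarrow> (0::real)) at_top"
proof -
 have "((\<lambda>y. \<Sum>i\<le>degree p. coeff p i * (y ^ i / exp y)) \<longlongrightarrow> (\<Sum>i\<le>degree p. coeff p i * (0::real))) at_top"
  by (intro tendsto_sum tendsto_mult tendsto_const tendsto_power_div_exp_0)
 moreover have "(\<Sum>i\<le>degree p. coeff p i * (y ^ i / exp y)) = poly p y * exp (- y)" for y
  by (simp add: poly_altdef sum_distrib_right exp_minus divide_inverse mult.assoc)
 ultimately show ?thesis by simp
qed

lemma bump_deriv: "(bump p has_real_derivative bump (dbump p) s) (at s)"
proof -
 consider "0 < s" | "s < 0" | "s = 0" by linarith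
 thus ?thesis
 proof cases
  case 1
  have "((\<lambda>s. poly p (1 / s) * exp (- (1 / s))) has_real_derivative bump (dbump p) s) (at s)"
   using 1 by (auto intro!: derivative_eq_intros poly_DERIV[THEN DERIV_chain2]
     simp: bump_def dbump_def power2_eq_square field_simps)
  thus ?thesis
   by (rule has_field_derivative_transform_within_open[of _ _ _ "{0<..}"]) (use 1 in \<open>auto simp: bump_def\<close>)
 next
  case 2
  have "((\<lambda>s. 0) has_real_derivative bump (dbump p) s) (at s)"
   using 2 by (auto simp: bump_def)
  thus ?thesis
   by (rule has_field_derivative_transform_within_open[of _ _ _ "{..<0}"]) (use 2 in \<open>auto simp: bump_def\<close>)
 next
  case 3
  have inv: "filterlim (\<lambda>h::real. 1 / h) at_top (at_right 0)"
   using filterlim_inverse_at_top_right by (simp add: inverse_eq_divide)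
  \<comment> \<open>For h > 0 the difference quotient at 0 is again in the family, with polynomial y
    p(y), and the exponential beats every polynomial.\<close>
  have "((\<lambda>h. poly ([:0, 1:] * p) (1 / h) * exp (- (1 / h))) \<longlongrightarrow> 0) (at_right 0)"
   by (rule filterlim_compose[OF poly_exp_tendsto_0 inv])
  hence "((\<lambda>h. (bump p (0 + h) - bump p 0) / h) \<longlongrightarrow> 0) (at_right 0)"
   by (rule Lim_transform_eventually)
     (auto simp: bump_def eventually_at_filter intro!: always_eventually)
  moreover have "((\<lambda>h. (bump p (0 + h) - bump p 0) / h) \<longlongrightarrow> 0) (at_left 0)"
   by (rule tendsto_eventually) (auto simp: bump_def eventually_at_filter intro!: always_eventually)
  ultimately have "((\<lambda>h. (bump p (0 + h) - bump p 0) / h) \<longlongrightarrow> 0) (at 0)"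
   by (simp add: filterlim_at_split)
  thus ?thesis
   using 3 by (simp add: DERIV_def bump_def)
 qed
qed

section \<open>Stability of the differentiability classes\<close>

lemma C_k_Suc_imp: "C_k (Suc k) f \<Longrightarrow> C_k k f"
proof (induction k arbitrary: f)
 case 0
 thus ?case by (auto simp: continuous_on_eq_continuous_at intro: differentiable_imp_continuous_within)
qed auto

lemma partial_deriv_eq:
 assumes "(f has_derivative f') (at x)"
 shows "partial_deriv j f x = f' (axis j 1)"
 using frechet_derivative_at[OF assms] by (simp add: partial_deriv_def)

lemma has_derivative_frechet: "f differentiable (at x) \<Longrightarrow> (f has_derivative frechet_derivative f (at x)) (at x)"
 by (rule frechet_derivative_works[THEN iffD1])

lemma partial_deriv_add:
 assumes "f differentiable (at x)" "g differentiable (at x)"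
 shows "partial_deriv j (\<lambda>x. f x + g x) x = partial_deriv j f x + partial_deriv j g x"
 using partial_deriv_eq[OF has_derivative_add[OF has_derivative_frechet[OF assms(1)] has_derivative_frechet[OF assms(2)]]]
 by (simp add: partial_deriv_def)

lemma partial_deriv_mult:
 assumes "f differentiable (at x)" "g differentiable (at x)"
 shows "partial_deriv j (\<lambda>x. f x * g x) x = f x * partial_deriv j g x + partial_deriv j f x * g x"
 using partial_deriv_eq[OF has_derivative_mult[OF has_derivative_frechet[OF assms(1)] has_derivative_frechet[OF assms(2)]]]
 by (simp add: partial_deriv_def)

lemma C_k_const: "C_k k (\<lambda>x. c)"
proof (induction k arbitrary: c)
 case (Suc k)
 have "partial_deriv j (\<lambda>x. c) = (\<lambda>x. 0)" for j
  by (rule ext) (simp add: partial_deriv_eq[OF has_derivative_const])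
 thus ?case using Suc by simp
qed simp

lemma C_k_add: "C_k k f \<Longrightarrow> C_k k g \<Longrightarrow> C_k k (\<lambda>x. f x + g x)"
proof (induction k arbitrary: f g)
 case (Suc k)
 hence "partial_deriv j (\<lambda>x. f x + g x) = (\<lambda>x. partial_deriv j f x + partial_deriv j g x)" for j
  by (intro ext partial_deriv_add) auto
 thus ?case using Suc by auto
qed (auto intro: continuous_on_add)

lemma C_k_mult: "C_k k f \<Longrightarrow> C_k k g \<Longrightarrow> C_k k (\<lambda>x. f x * g x)"
proof (induction k arbitrary: f g)
 case (Suc k)
 hence "partial_deriv j (\<lambda>x. f x * g x) = (\<lambda>x. f x * partial_deriv j g x + partial_deriv j f x * g x)" for j
  by (intro ext partial_deriv_mult) auto
 moreover have "C_k k f" "C_k k g" using Suc.prems by (auto intro: C_k_Suc_imp simp del: C_k.simps(1))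
 ultimately show ?case using Suc by (auto intro!: C_k_add)
qed (auto intro: continuous_on_mult)

lemma partial_deriv_translate:
 assumes "f differentiable (at (x + y))"
 shows "(\<lambda>x. f (x + y)) differentiable (at x)" "partial_deriv j (\<lambda>x. f (x + y)) x = partial_deriv j f (x + y)"
proof -
 have "((\<lambda>x. x + y) has_derivative (\<lambda>h. h)) (at x)" by (auto intro!: derivative_eq_intros)
 from has_derivative_compose[OF this, of f "frechet_derivative f (at (x + y))"]
 have d: "((\<lambda>x. f (x + y)) has_derivative frechet_derivative f (at (x + y))) (at x)"
  using has_derivative_frechet[OF assms] by simp
 show "(\<lambda>x. f (x + y)) differentiable (at x)" using d by (auto simp: differentiable_def)
 show "partial_deriv j (\<lambda>x. f (x + y)) x = partial_deriv j f (x + y)"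
  unfolding partial_deriv_eq[OF d] by (simp add: partial_deriv_def)
qed

lemma C_k_translate: "C_k k f \<Longrightarrow> C_k k (\<lambda>x. f (x + y))"
proof (induction k arbitrary: f)
 case 0
 thus ?case by (auto intro!: continuous_on_compose2[of UNIV f] continuous_intros)
next
 case (Suc k)
 hence "partial_deriv j (\<lambda>x. f (x + y)) = (\<lambda>x. partial_deriv j f (x + y))" for j
  by (intro ext partial_deriv_translate(2)) auto
 thus ?case using Suc by (auto intro: partial_deriv_translate)
qed

text \<open>The free constant c and the free polynomial p absorb what the chain rule produces, so
  the statement reproduces itself under partial derivatives.\<close>

lemma C_k_bump: "C_k k (\<lambda>x. complex_of_real (c * bump p (\<alpha> * (x $ j) + \<beta>)))"
proof (induction k arbitrary: c p)
 case 0
 have "continuous_on UNIV (bump p)"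
  using bump_deriv by (intro continuous_at_imp_continuous_on ballI) (blast intro: DERIV_isCont)
 thus ?case
  by (auto intro!: continuous_intros continuous_on_compose2[of UNIV "bump p"])
next
 case (Suc k)
 let ?f = "\<lambda>x::real^3. complex_of_real (c * bump p (\<alpha> * (x $ j) + \<beta>))"
 have d: "(?f has_derivative (\<lambda>h. complex_of_real (c * (bump (dbump p) (\<alpha> * (x $ j) + \<beta>) * (\<alpha> * (h $ j)))))) (at x)" for x
 proof -
  have l: "((\<lambda>x::real^3. \<alpha> * (x $ j) + \<beta>) has_derivative (\<lambda>h. \<alpha> * (h $ j))) (at x)"
   by (auto intro!: derivative_eq_intros bounded_linear.has_derivative[OF bounded_linear_vec_nth])
  have "(bump p has_derivative (\<lambda>u. bump (dbump p) (\<alpha> * (x $ j) + \<beta>) * u)) (at (\<alpha> * (x $ j) + \<beta>))"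
   using bump_deriv by (rule has_field_derivative_imp_has_derivative)
  from has_derivative_compose[OF l this]
  have "((\<lambda>x. c * bump p (\<alpha> * (x $ j) + \<beta>)) has_derivative (\<lambda>h. c * (bump (dbump p) (\<alpha> * (x $ j) + \<beta>) * (\<alpha> * (h $ j))))) (at x)"
   by (rule has_derivative_mult_right)
  from bounded_linear.has_derivative[OF bounded_linear_of_real this] show ?thesis .
 qed
 have "partial_deriv i ?f = (\<lambda>x. complex_of_real ((c * \<alpha> * (axis i 1 $ j)) * bump (dbump p) (\<alpha> * (x $ j) + \<beta>)))" for i
  by (rule ext) (simp only: partial_deriv_eq[OF d] mult_ac)
 moreover have "?f differentiable (at x)" for x using d by (auto simp: differentiable_def)
 ultimately show ?case using Suc by (simp del: of_real_mult)
qed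

lemma test_function_iff: "test_function \<phi> \<longleftrightarrow> (\<forall>k. C_k k \<phi>) \<and> bounded {x. \<phi> x \<noteq> 0}"
 by (simp add: test_function_def compact_closure)

lemma test_function_add: "test_function f \<Longrightarrow> test_function g \<Longrightarrow> test_function (\<lambda>x. f x + g x)"
 unfolding test_function_iff
 by (auto intro!: C_k_add bounded_subset[of "{x. f x \<noteq> 0} \<union> {x. g x \<noteq> 0}" "{x. f x + g x \<noteq> 0}"])

lemma test_function_cmult: "test_function f \<Longrightarrow> test_function (\<lambda>x. c * f x)"
 unfolding test_function_iff
 by (auto intro!: C_k_mult C_k_const intro: bounded_subset)

lemma test_function_translate:
 assumes "test_function f" shows "test_function (\<lambda>x. f (x + y))"
 unfolding test_function_iff
proof (intro conjI allI C_k_translate)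
 have "{x. f (x + y) \<noteq> 0} = (\<lambda>x. x - y) ` {x. f x \<noteq> 0}"
  by (auto intro!: image_eqI[of _ _ "_ + y"])
 thus "bounded {x. f (x + y) \<noteq> 0}"
  using assms bounded_translation_minus[of "{x. f x \<noteq> 0}" y] by (simp add: test_function_iff)
qed (use assms in \<open>auto simp: test_function_def\<close>)

lemma test_function_deriv:
 assumes "test_function f" shows "test_function (partial_deriv j f)"
 unfolding test_function_iff
proof (intro conjI allI)
 show "C_k k (partial_deriv j f)" for k
 proof -
  have "C_k (Suc k) f" using assms unfolding test_function_def by blast
  thus ?thesis by simp
 qed
 show "bounded {x. partial_deriv j f x \<noteq> 0}"
 proof (rule bounded_subset)
  show "bounded (closure {x. f x \<noteq> 0})" using assms by (simp add: test_function_def compact_imp_bounded)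
  show "{x. partial_deriv j f x \<noteq> 0} \<subseteq> closure {x. f x \<noteq> 0}"
  proof safe
   fix x assume nz: "partial_deriv j f x \<noteq> 0"
   show "x \<in> closure {x. f x \<noteq> 0}"
   proof (rule ccontr)
    assume x: "x \<notin> closure {x. f x \<noteq> 0}"
    have z: "0 = f y" if "y \<in> - closure {x. f x \<noteq> 0}" for y
    proof -
     have "y \<notin> {x. f x \<noteq> 0}" using that closure_subset[of "{x. f x \<noteq> 0}"] by blast
     thus ?thesis by simp
    qed
    have "x \<in> - closure {x. f x \<noteq> 0}" using x by blast
    hence "(f has_derivative (\<lambda>h. 0)) (at x)"
     by (rule has_derivative_transform_within_open[OF has_derivative_const[of 0] open_Compl[OF closed_closure]]) (rule z)
    thus False using nz partial_deriv_eq[of f "\<lambda>h. 0" x j] by simp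
   qed
  qed
 qed
qed

section \<open>Test functions are bounded, square-integrable and dense\<close>

lemma test_function_bounds:
 assumes f: "test_function f"
 obtains C R where "0 \<le> C" "\<And>x. cmod (f x) \<le> C" "\<And>x. f x \<noteq> 0 \<Longrightarrow> norm x \<le> R"
  "f \<in> borel_measurable borel"
proof -
 have c: "continuous_on UNIV f" using f C_k.simps(1) unfolding test_function_def by blast
 have "bounded (f ` closure {x. f x \<noteq> 0})"
  by (rule compact_imp_bounded[OF compact_continuous_image[OF continuous_on_subset[OF c]]])
    (use f in \<open>auto simp: test_function_def\<close>)
 then obtain C where C: "\<And>x. x \<in> closure {x. f x \<noteq> 0} \<Longrightarrow> cmod (f x) \<le> C"
  by (auto simp: bounded_iff)
 have C': "cmod (f x) \<le> \<bar>C\<bar>" for x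
  using C[of x] closure_subset[of "{x. f x \<noteq> 0}"] by (cases "f x = 0") auto
 obtain R where R: "\<And>x. f x \<noteq> 0 \<Longrightarrow> norm x \<le> R"
  using f by (auto simp: test_function_iff bounded_iff)
 show thesis
  by (rule that[OF _ C' R borel_measurable_continuous_onI[OF c]]) auto
qed

lemma sq_integrable_bounded_support:
 assumes "f \<in> borel_measurable borel" "\<And>x. cmod (f x) \<le> C" "\<And>x. f x \<noteq> 0 \<Longrightarrow> norm x \<le> R"
 shows "sq_integrable f"
proof -
 have "emeasure lborel (cball 0 R :: (real^3) set) < \<infinity>" by (rule emeasure_lborel_cball_finite)
 hence s: "sq_integrable (\<lambda>x::real^3. complex_of_real C * indicator (cball 0 R) x)"
  by (intro sq_integrable_indicator(1)) auto
 have C0: "0 \<le> C" using order_trans[OF norm_ge_zero assms(2)] .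
 have "cmod (f x) \<le> cmod (complex_of_real C * indicator (cball 0 R) x)" for x
  using assms(2)[of x] assms(3)[of x] C0 by (cases "f x = 0") (auto simp: norm_mult)
 hence "(cmod (f x))\<^sup>2 \<le> 1 * ((cmod (complex_of_real C * indicator (cball 0 R) x))\<^sup>2 + (cmod (0::complex))\<^sup>2)" for x
  by (simp add: power_mono)
 from sq_integrable_bound[OF s sq_integrable_zero _ this] assms(1) show ?thesis by simp
qed

lemma sq_integrable_test: "test_function f \<Longrightarrow> sq_integrable f"
 using test_function_bounds[of f] sq_integrable_bounded_support by metis

text \<open>For s > 0 the value is exp(-1/((n+1) s)), which tends to 1: smooth approximations of the
  step function from below.\<close>

lemma bump_1_limit: "(\<lambda>n. bump 1 (real (Suc n) * s)) \<longlonglongrightarrow> (if 0 < s then 1 else 0)"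
proof (cases "0 < s")
 case True
 have "(\<lambda>n. exp (- (inverse (real (Suc n)) / s))) \<longlonglongrightarrow> exp (- (0 / s))"
  using True by (intro tendsto_intros LIMSEQ_inverse_real_of_nat) auto
 moreover have "exp (- (inverse (real (Suc n)) / s)) = bump 1 (real (Suc n) * s)" for n
  using True by (simp add: bump_def inverse_eq_divide)
 ultimately show ?thesis using True by simp
next
 case False
 hence "bump 1 (real (Suc n) * s) = 0" for n
  by (auto simp: bump_def zero_less_mult_iff)
 thus ?thesis using False by simp
qed

lemma bump_1_bounds: "0 \<le> bump 1 s" "bump 1 s \<le> 1" "s \<le> 0 \<Longrightarrow> bump 1 s = 0"
 by (auto simp: bump_def)

text \<open>By \<open>L2_box_induct\<close> only boxes have to be approximated. Products of smooth
  steps at the six faces do it; they are at most 1 and vanish off the box, so the indicator itself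
  is the majorant.\<close>

theorem test_dense: "f \<in> closure {L2_of \<phi> |\<phi>. test_function \<phi>}"
proof (induction f rule: L2_box_induct)
 case (lim X l)
 thus ?case using closed_sequentially[OF closed_closure] by blast
next
 case (add f g)
 then obtain X Y where X: "\<And>n. X n \<in> {L2_of \<phi> |\<phi>. test_function \<phi>}" "X \<longlonglongrightarrow> f"
  and Y: "\<And>n. Y n \<in> {L2_of \<phi> |\<phi>. test_function \<phi>}" "Y \<longlonglongrightarrow> g"
  unfolding closure_sequential by blast
 have "X n + Y n \<in> {L2_of \<phi> |\<phi>. test_function \<phi>}" for n
 proof -
  obtain \<phi> \<psi> where "X n = L2_of \<phi>" "test_function \<phi>" "Y n = L2_of \<psi>" "test_function \<psi>"
   using X(1)[of n] Y(1)[of n] by auto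
  thus ?thesis
   by (auto simp: L2_of_add[symmetric] sq_integrable_test intro!: exI[of _ "\<lambda>x. \<phi> x + \<psi> x"] test_function_add)
 qed
 thus ?case unfolding closure_sequential using tendsto_add[OF X(2) Y(2)]
  by (intro exI[of _ "\<lambda>n. X n + Y n"]) simp
next
 case (mult c f)
 then obtain X where X: "\<And>n. X n \<in> {L2_of \<phi> |\<phi>. test_function \<phi>}" "X \<longlonglongrightarrow> f"
  unfolding closure_sequential by blast
 have "L2_mult (\<lambda>_. c) (X n) \<in> {L2_of \<phi> |\<phi>. test_function \<phi>}" for n
 proof -
  obtain \<phi> where "X n = L2_of \<phi>" "test_function \<phi>" using X(1)[of n] by auto
  thus ?thesis
   by (auto simp: L2_of_cmult[symmetric] sq_integrable_test intro!: exI[of _ "\<lambda>x. c * \<phi> x"] test_function_cmult)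
 qed
 moreover have "(\<lambda>n. L2_mult (\<lambda>_. c) (X n)) \<longlonglongrightarrow> L2_mult (\<lambda>_. c) f"
  by (rule bounded_linear.tendsto[OF bdd_mult.bounded_linear[OF bdd_mult_const] X(2)])
 ultimately show ?case unfolding closure_sequential by (intro exI[of _ "\<lambda>n. L2_mult (\<lambda>_. c) (X n)"]) simp
next
 case (box a b)
 \<comment> \<open>Each factor is spelled out in the affine form that \<open>C_k_bump\<close>
   expects; \<open>\<phi>_eq\<close> is the readable version.\<close>
 define \<phi> where "\<phi> n x = (\<Prod>j\<in>UNIV. complex_of_real (1 * bump 1 (real (Suc n) * (x $ j) + - (real (Suc n) * a $ j)))
   * complex_of_real (1 * bump 1 ((- real (Suc n)) * (x $ j) + real (Suc n) * b $ j)))" for n and x :: "real^3"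
 have \<phi>_eq: "\<phi> n x = complex_of_real (\<Prod>j\<in>UNIV. bump 1 (real (Suc n) * (x $ j - a $ j)) * bump 1 (real (Suc n) * (b $ j - x $ j)))" for n x
 proof -
  have "real (Suc n) * (x $ j) + - (real (Suc n) * a $ j) = real (Suc n) * (x $ j - a $ j)"
   "(- real (Suc n)) * (x $ j) + real (Suc n) * b $ j = real (Suc n) * (b $ j - x $ j)" for j
   by (simp_all only: algebra_simps)
  thus ?thesis by (simp only: \<phi>_def of_real_prod of_real_mult mult_1)
 qed
 have prodC: "C_k k (\<lambda>x. \<Prod>j\<in>J. g j x)" if "finite J" "\<And>j. C_k k (g j)" for k and J :: "3 set" and g
  using that by (induction J) (auto intro!: C_k_const C_k_mult)
 have zero: "\<phi> n x = 0" if "x \<notin> box a b" for n x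
 proof -
  obtain j where "x $ j - a $ j \<le> 0 \<or> b $ j - x $ j \<le> 0" using \<open>x \<notin> box a b\<close> by (auto simp: mem_box_cart not_less)
  hence "bump 1 (real (Suc n) * (x $ j - a $ j)) * bump 1 (real (Suc n) * (b $ j - x $ j)) = 0"
   by (auto intro!: bump_1_bounds(3) mult_nonneg_nonpos)
  hence "(\<Prod>j\<in>UNIV. bump 1 (real (Suc n) * (x $ j - a $ j)) * bump 1 (real (Suc n) * (b $ j - x $ j))) = 0"
   by (intro prod_zero) auto
  thus ?thesis by (simp only: \<phi>_eq of_real_0)
 qed
 have le1: "cmod (\<phi> n x) \<le> 1" for n x
 proof -
  have "\<bar>\<Prod>j\<in>UNIV. bump 1 (real (Suc n) * (x $ j - a $ j)) * bump 1 (real (Suc n) * (b $ j - x $ j))\<bar> \<le> 1"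
   unfolding abs_prod by (intro prod_le_1) (auto simp: abs_mult bump_1_bounds intro!: mult_le_one)
  thus ?thesis by (simp only: \<phi>_eq norm_of_real)
 qed
 have test: "test_function (\<phi> n)" for n
  unfolding test_function_iff
 proof (intro conjI allI)
  show "C_k k (\<phi> n)" for k unfolding \<phi>_def by (intro prodC C_k_mult C_k_bump) simp
  show "bounded {x. \<phi> n x \<noteq> 0}" using zero by (intro bounded_subset[OF bounded_box[of a b]]) blast
 qed
 have "(\<lambda>n. L2_of (\<phi> n)) \<longlonglongrightarrow> L2_of (indicator (box a b))"
 proof (rule tendsto_L2_dominated[where w = "indicator (box a b)"])
  show "\<phi> n \<in> borel_measurable lborel" for n using sq_integrable_test[OF test] by (rule sq_integrable_measurable)
  show "integrable lborel (\<lambda>x. (indicator (box a b) x :: real)\<^sup>2)"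
   using sq_integrable_indicator(2)[of "box a b" 1] emeasure_lborel_box_finite[of a b] by simp
  show "cmod (\<phi> n x) \<le> indicator (box a b) x" for n x
   using zero[of x n] le1[of n x] by (cases "x \<in> box a b") auto
  show "cmod (indicator (box a b) x) \<le> indicator (box a b) x" for x :: "real^3"
   by (auto split: split_indicator)
  fix x :: "real^3"
  show "(\<lambda>n. \<phi> n x) \<longlonglongrightarrow> indicator (box a b) x"
  proof (cases "x \<in> box a b")
   case True
   have "(\<lambda>n. \<Prod>j\<in>UNIV. bump 1 (real (Suc n) * (x $ j - a $ j)) * bump 1 (real (Suc n) * (b $ j - x $ j)))
    \<longlonglongrightarrow> (\<Prod>j\<in>(UNIV::3 set). (if 0 < x $ j - a $ j then 1 else 0) * (if 0 < b $ j - x $ j then 1 else 0))"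
    by (intro tendsto_prod tendsto_mult bump_1_limit)
   also have "(\<Prod>j\<in>(UNIV::3 set). (if 0 < x $ j - a $ j then 1 else 0) * (if 0 < b $ j - x $ j then 1 else 0)) = (1::real)"
    using True by (intro prod.neutral) (auto simp: mem_box_cart)
   finally have "(\<lambda>n. \<phi> n x) \<longlonglongrightarrow> complex_of_real 1" unfolding \<phi>_eq by (rule tendsto_of_real)
   thus ?thesis using True by simp
  qed (simp add: zero)
 qed measurable
 thus ?case unfolding closure_sequential using test
  by (intro exI[of _ "\<lambda>n. L2_of (\<phi> n)"]) blast
qed

section \<open>Difference quotients and weak derivatives\<close>

abbreviation ax :: "3 \<Rightarrow> real^3" where "ax j \<equiv> axis j 1"

definition dq :: "3 \<Rightarrow> real \<Rightarrow> L2 \<Rightarrow> L2" where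
 "dq j h f = (1 / h) *\<^sub>R (tr (h *\<^sub>R ax j) f - f)"

lemma bounded_linear_dq: "bounded_linear (dq j h)"
 unfolding dq_def[abs_def]
 by (rule bounded_linear_compose[OF bounded_linear_scaleR_right bounded_linear_sub[OF bounded_linear_tr bounded_linear_ident]])

lemmas dq_add = linear_add[OF bounded_linear.linear[OF bounded_linear_dq]]
lemmas dq_diff = linear_diff[OF bounded_linear.linear[OF bounded_linear_dq]]
lemmas dq_zero [simp] = linear_0[OF bounded_linear.linear[OF bounded_linear_dq]]

lemma dq_commute:
 assumes T: "bounded_linear T" "\<And>y f. T (tr y f) = tr y (T f)"
 shows "T (dq j h f) = dq j h (T f)"
 using bounded_linear.linear[OF T(1)] by (simp add: dq_def linear_scale linear_diff T(2))

lemma S_dq: "S t (dq j h f) = dq j h (S t f)"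
 by (rule dq_commute[OF bounded_linear_S S_tr])

lemma dq_const_mult: "L2_mult (\<lambda>_. c) (dq j h f) = dq j h (L2_mult (\<lambda>_. c) f)"
 by (rule dq_commute[OF bdd_mult.bounded_linear[OF bdd_mult_const]]) (simp add: tr_mult[OF bdd_mult_const])

lemma cj_dq: "cj (dq j h f) = dq j h (cj f)"
proof (rule dq_commute)
 show "bounded_linear cj"
 proof (rule bounded_linear_intro[where K = 1])
  show "cj (f + g) = cj f + cj g" for f g
   by (rule L2_eqI) (use rep_add[of "cj f" "cj g"] rep_cj[of f] rep_cj[of g] rep_cj[of "f + g"] rep_add[of f g] in
    \<open>eventually_elim, simp\<close>)
  show "cj (r *\<^sub>R f) = r *\<^sub>R cj f" for r f
   by (rule L2_eqI) (use rep_scaleR[of r "cj f"] rep_cj[of f] rep_cj[of "r *\<^sub>R f"] rep_scaleR[of r f] in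
    \<open>eventually_elim, simp\<close>)
 qed simp
 show "cj (tr y f) = tr y (cj f)" for y f
  by (rule L2_eqI) (use rep_cj[of "tr y f"] rep_tr[of y f] rep_tr[of y "cj f"] AE_translate[OF rep_cj[of f], of y] in
   \<open>eventually_elim, simp\<close>)
qed

text \<open>A telescoping sum: the quotient with step h is the mean of N translates of the quotient
  with step h/N. As N grows, coarse quotients are compared with the derivative without loss of a
  constant.\<close>

lemma dq_average:
 assumes "0 < N"
 shows "dq j h f = (1 / real N) *\<^sub>R (\<Sum>k<N. tr ((real k * h / real N) *\<^sub>R ax j) (dq j (h / real N) f))"
proof (cases "h = 0")
 case True
 thus ?thesis by (simp add: dq_def)
next
 case False
 define y where "y k = (real k * h / real N) *\<^sub>R ax j" for k
 have "(\<Sum>k<N. tr (y k) (dq j (h / real N) f)) = (\<Sum>k<N. (real N / h) *\<^sub>R (tr (y (Suc k)) f - tr (y k) f))"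
 proof (rule sum.cong[OF refl])
  fix k
  have "y k + (h / real N) *\<^sub>R ax j = y (Suc k)"
   by (simp add: y_def scaleR_add_left[symmetric] add_divide_distrib[symmetric] algebra_simps)
  thus "tr (y k) (dq j (h / real N) f) = (real N / h) *\<^sub>R (tr (y (Suc k)) f - tr (y k) f)"
   by (simp add: dq_def tr_scaleR tr_diff tr_tr)
 qed
 also have "\<dots> = (real N / h) *\<^sub>R (tr (y N) f - tr (y 0) f)"
  unfolding scaleR_sum_right[symmetric] by (simp only: sum_lessThan_telescope[of "\<lambda>k. tr (y k) f"])
 finally have "(\<Sum>k<N. tr (y k) (dq j (h / real N) f)) = (real N / h) *\<^sub>R (tr (h *\<^sub>R ax j) f - f)"
  using assms by (simp add: y_def)
 thus ?thesis using assms unfolding y_def by (simp add: dq_def)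
qed

subsection \<open>Difference quotients in Fourier space\<close>

text \<open>The Fourier symbol of \<open>dq j h\<close>. It is bounded by |\<xi>_j| and tends to
  \<i> \<xi>_j as h tends to 0.\<close>

definition qsym :: "3 \<Rightarrow> real \<Rightarrow> real^3 \<Rightarrow> complex" where
 "qsym j h \<xi> = (cis (h * \<xi> $ j) - 1) / complex_of_real h"

lemma nth_measurable [measurable]: "(\<lambda>\<xi>::real^3. \<xi> $ j) \<in> borel_measurable borel"
 by (intro borel_measurable_continuous_onI continuous_intros)

lemma cmod_cis_minus_1: "cmod (cis x - 1) \<le> \<bar>x\<bar>"
 using iexp_approx1[of x 0] by (simp add: cis_conv_exp)

lemma cmod_qsym_le: "cmod (qsym j h \<xi>) \<le> \<bar>\<xi> $ j\<bar>"
proof (cases "h = 0")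
 case False
 have "cmod (cis (h * \<xi> $ j) - 1) \<le> \<bar>h\<bar> * \<bar>\<xi> $ j\<bar>"
  using cmod_cis_minus_1[of "h * \<xi> $ j"] by (simp add: abs_mult)
 thus ?thesis using False by (simp add: qsym_def norm_divide field_simps)
qed (simp add: qsym_def)

lemma bdd_qsym: "bdd_mult (qsym j h) (2 / \<bar>h\<bar>)"
proof (rule bdd_multI)
 show "qsym j h \<in> borel_measurable borel" unfolding qsym_def[abs_def] by measurable
 show "cmod (qsym j h \<xi>) \<le> 2 / \<bar>h\<bar>" for \<xi>
  using norm_triangle_ineq4[of "cis (h * \<xi> $ j)" 1] by (simp add: qsym_def norm_divide divide_right_mono)
qed

lemma qsym_tendsto:
 assumes h: "h \<longlonglongrightarrow> 0" "\<And>n. h n \<noteq> 0"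
 shows "(\<lambda>n. qsym j (h n) \<xi>) \<longlonglongrightarrow> \<i> * complex_of_real (\<xi> $ j)"
proof -
 let ?c = "\<i> * complex_of_real (\<xi> $ j)"
 have "((\<lambda>z. exp (z * ?c)) has_field_derivative ?c) (at 0)"
  by (auto intro!: derivative_eq_intros)
 hence "((\<lambda>z. (exp (z * ?c) - 1) / z) \<longlongrightarrow> ?c) (at 0)"
  by (simp add: DERIV_def)
 moreover have "filterlim (\<lambda>n. complex_of_real (h n)) (at 0) sequentially"
  using tendsto_of_real[OF h(1), where 'a = complex] h(2) by (auto simp: filterlim_at)
 ultimately have "(\<lambda>n. (exp (complex_of_real (h n) * ?c) - 1) / complex_of_real (h n)) \<longlonglongrightarrow> ?c"
  by (rule filterlim_compose)
 thus ?thesis by (simp add: qsym_def cis_conv_exp mult_ac)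
qed

lemma fourier_dq: "fourier_L2 (dq j h f) = L2_mult (qsym j h) (fourier_L2 f)"
proof (rule L2_eqI)
 let ?F = "fourier_L2 f" and ?c = "\<lambda>\<xi>. cis (\<xi> \<bullet> (h *\<^sub>R ax j))"
 have b: "bdd_mult ?c 1" by (rule bdd_mult_cis) measurable
 have e: "fourier_L2 (dq j h f) = (1 / h) *\<^sub>R (L2_mult ?c ?F - ?F)"
  using bounded_linear.linear[OF bounded_linear_fourier]
  by (simp add: dq_def linear_scale linear_diff fourier_tr)
 have ip: "\<xi> \<bullet> (h *\<^sub>R ax j) = h * \<xi> $ j" for \<xi> by (simp add: inner_axis)
 have c: "(1 / h) *\<^sub>R (a * z - z) = (a - 1) / complex_of_real h * z" for a z
  by (simp add: scaleR_conv_of_real field_simps)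
 show "AE \<xi> in lborel. rep_L2 (fourier_L2 (dq j h f)) \<xi> = rep_L2 (L2_mult (qsym j h) ?F) \<xi>"
  unfolding e
  using rep_scaleR[of "1 / h" "L2_mult ?c ?F - ?F"] rep_diff[of "L2_mult ?c ?F" ?F] bdd_mult.rep[OF b, of ?F]
   bdd_mult.rep[OF bdd_qsym, of j h ?F]
  by eventually_elim (simp only: ip qsym_def c)
qed

lemma nn_norm_dq:
 "(\<integral>\<^sup>+\<xi>. ennreal ((cmod (qsym j h \<xi> * rep_L2 (fourier_L2 f) \<xi>))\<^sup>2) \<partial>lborel) = ennreal ((norm (dq j h f))\<^sup>2)"
proof -
 have "ennreal ((norm (dq j h f))\<^sup>2) = ennreal ((norm (L2_mult (qsym j h) (fourier_L2 f)))\<^sup>2)"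
  by (simp add: fourier_dq[symmetric])
 also have "\<dots> = (\<integral>\<^sup>+\<xi>. ennreal ((cmod (rep_L2 (L2_mult (qsym j h) (fourier_L2 f)) \<xi>))\<^sup>2) \<partial>lborel)"
  by (rule nn_norm_L2[symmetric])
 also have "\<dots> = (\<integral>\<^sup>+\<xi>. ennreal ((cmod (qsym j h \<xi> * rep_L2 (fourier_L2 f) \<xi>))\<^sup>2) \<partial>lborel)"
  by (rule nn_integral_cong_AE) (use bdd_mult.rep[OF bdd_qsym, of j h "fourier_L2 f"] in \<open>eventually_elim, simp\<close>)
 finally show ?thesis ..
qed

text \<open>The j-th derivative is in L^2 with norm at most M, said without presupposing a
  derivative. It is equivalent to all difference quotients in direction j being bounded by
  M.\<close>

definition Fder :: "3 \<Rightarrow> L2 \<Rightarrow> real \<Rightarrow> bool" where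
 "Fder j f M \<longleftrightarrow> 0 \<le> M \<and> (\<integral>\<^sup>+\<xi>. ennreal ((\<bar>\<xi> $ j\<bar> * cmod (rep_L2 (fourier_L2 f) \<xi>))\<^sup>2) \<partial>lborel) \<le> ennreal (M\<^sup>2)"

text \<open>Fatou's lemma on the Fourier side, where the symbols converge pointwise.\<close>

lemma Fder_liminf:
 assumes h: "h \<longlonglongrightarrow> 0" "\<And>n. h n \<noteq> 0" and M: "\<And>n. norm (dq j (h n) f) \<le> M"
 shows "Fder j f M"
 unfolding Fder_def
proof
 show M0: "0 \<le> M" using order_trans[OF norm_ge_zero M] .
 let ?F = "rep_L2 (fourier_L2 f)"
 have [measurable]: "qsym j (h n) \<in> borel_measurable borel" for n using bdd_qsym by (simp add: bdd_mult_def)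
 have "(\<integral>\<^sup>+\<xi>. ennreal ((\<bar>\<xi> $ j\<bar> * cmod (?F \<xi>))\<^sup>2) \<partial>lborel)
   = (\<integral>\<^sup>+\<xi>. liminf (\<lambda>n. ennreal ((cmod (qsym j (h n) \<xi> * ?F \<xi>))\<^sup>2)) \<partial>lborel)"
 proof (rule nn_integral_cong)
  fix \<xi>
  have "(\<lambda>n. ennreal ((cmod (qsym j (h n) \<xi> * ?F \<xi>))\<^sup>2)) \<longlonglongrightarrow> ennreal ((cmod (\<i> * complex_of_real (\<xi> $ j) * ?F \<xi>))\<^sup>2)"
   by (intro tendsto_intros qsym_tendsto h)
  hence "liminf (\<lambda>n. ennreal ((cmod (qsym j (h n) \<xi> * ?F \<xi>))\<^sup>2)) = ennreal ((cmod (\<i> * complex_of_real (\<xi> $ j) * ?F \<xi>))\<^sup>2)"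
   by (intro lim_imp_Liminf) auto
  thus "ennreal ((\<bar>\<xi> $ j\<bar> * cmod (?F \<xi>))\<^sup>2) = liminf (\<lambda>n. ennreal ((cmod (qsym j (h n) \<xi> * ?F \<xi>))\<^sup>2))"
   by (simp add: norm_mult)
 qed
 also have "\<dots> \<le> liminf (\<lambda>n. \<integral>\<^sup>+\<xi>. ennreal ((cmod (qsym j (h n) \<xi> * ?F \<xi>))\<^sup>2) \<partial>lborel)"
  by (rule nn_integral_liminf) measurable
 also have "\<dots> \<le> liminf (\<lambda>n. ennreal (M\<^sup>2))"
  unfolding nn_norm_dq using M by (intro Liminf_mono always_eventually allI ennreal_leI power_mono) auto
 finally show "(\<integral>\<^sup>+\<xi>. ennreal ((\<bar>\<xi> $ j\<bar> * cmod (?F \<xi>))\<^sup>2) \<partial>lborel) \<le> ennreal (M\<^sup>2)"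
  by (simp add: Liminf_const)
qed

lemma Fder_dq_le:
 assumes "Fder j f M" shows "norm (dq j h f) \<le> M"
proof -
 have "ennreal ((norm (dq j h f))\<^sup>2) \<le> (\<integral>\<^sup>+\<xi>. ennreal ((\<bar>\<xi> $ j\<bar> * cmod (rep_L2 (fourier_L2 f) \<xi>))\<^sup>2) \<partial>lborel)"
  unfolding nn_norm_dq[symmetric]
  by (intro nn_integral_mono ennreal_leI power_mono) (auto simp: norm_mult intro!: mult_right_mono cmod_qsym_le)
 also have "\<dots> \<le> ennreal (M\<^sup>2)" using assms by (simp add: Fder_def)
 finally have "(norm (dq j h f))\<^sup>2 \<le> M\<^sup>2" by (simp add: ennreal_le_iff)
 thus ?thesis by (rule power2_le_imp_le) (use assms in \<open>simp add: Fder_def\<close>)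
qed

definition sder :: "3 \<Rightarrow> L2 \<Rightarrow> L2" where
 "sder j f = Fi (L2_of (\<lambda>\<xi>. \<i> * complex_of_real (\<xi> $ j) * rep_L2 (fourier_L2 f) \<xi>))"

text \<open>The symbols are dominated by the modulus of their limit, so bounded quotients converge
  strongly and not merely weakly.\<close>

lemma Fder_tendsto:
 assumes F: "Fder j f M" and h: "h \<longlonglongrightarrow> 0" "\<And>n. h n \<noteq> 0"
 shows "(\<lambda>n. dq j (h n) f) \<longlonglongrightarrow> sder j f"
proof -
 let ?F = "rep_L2 (fourier_L2 f)" and ?g = "\<lambda>\<xi>. \<i> * complex_of_real (\<xi> $ j) * rep_L2 (fourier_L2 f) \<xi>"
 have gm: "?g \<in> borel_measurable lborel" by measurable
 have g: "sq_integrable ?g"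
  by (rule sq_integrable_nn_le(1)[OF gm, of M]) (use F in \<open>auto simp: Fder_def norm_mult\<close>)
 have "(\<lambda>n. L2_mult (qsym j (h n)) (fourier_L2 f)) \<longlonglongrightarrow> L2_of ?g"
 proof (rule L2_dominated[where w = "\<lambda>\<xi>. cmod (?g \<xi>)"])
  show "integrable lb (\<lambda>\<xi>. (cmod (?g \<xi>))\<^sup>2)" using g by (simp add: sq_integrable_def)
  show "AE \<xi> in lb. cmod (rep_L2 (L2_mult (qsym j (h n)) (fourier_L2 f)) \<xi>) \<le> cmod (?g \<xi>)" for n
   using bdd_mult.rep[OF bdd_qsym, of j "h n" "fourier_L2 f"]
   by eventually_elim (auto simp: norm_mult intro!: mult_right_mono cmod_qsym_le)
  have "AE \<xi> in lb. \<forall>n. rep_L2 (L2_mult (qsym j (h n)) (fourier_L2 f)) \<xi> = qsym j (h n) \<xi> * ?F \<xi>"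
   using bdd_mult.rep[OF bdd_qsym] by (simp add: AE_all_countable)
  thus "AE \<xi> in lb. (\<lambda>n. rep_L2 (L2_mult (qsym j (h n)) (fourier_L2 f)) \<xi>) \<longlonglongrightarrow> rep_L2 (L2_of ?g) \<xi>"
   using rep_L2_of[OF g]
  proof eventually_elim
   case (elim \<xi>)
   show ?case unfolding elim(2) using elim(1) by (simp only:) (intro tendsto_mult qsym_tendsto h tendsto_const)
  qed
 qed
 from bounded_linear.tendsto[OF bounded_linear_Fi this]
 show ?thesis by (simp add: sder_def fourier_dq[symmetric])
qed

subsection \<open>Weak derivatives\<close>

text \<open>Bilinear rather than sesquilinear, because \<open>has_weak_deriv\<close> integrates the
  plain product.\<close>

definition pairing :: "L2 \<Rightarrow> L2 \<Rightarrow> complex" where "pairing f g = cinner f (cj g)"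

lemma pairing_L2_of:
 assumes "sq_integrable \<phi>" shows "pairing f (L2_of \<phi>) = (\<integral>x. rep_L2 f x * \<phi> x \<partial>lborel)"
 unfolding pairing_def cinner_cj
 by (rule integral_cong_AE) (use rep_L2_of[OF assms] assms in \<open>auto elim!: eventually_mono dest: sq_integrable_measurable\<close>)

lemma pairing_le: "cmod (pairing f g) \<le> norm f * norm g"
 using cmod_cinner_le[of f "cj g"] by (simp add: pairing_def)

lemma pairing_tendsto: "X \<longlonglongrightarrow> f \<Longrightarrow> Y \<longlonglongrightarrow> g \<Longrightarrow> (\<lambda>n. pairing (X n) (Y n)) \<longlonglongrightarrow> pairing f g"
 unfolding pairing_def by (intro tendsto_cinner tendsto_cj)

lemma cinner_linear:
 "cinner (f + g) k = cinner f k + cinner g k" "cinner (f - g) k = cinner f k - cinner g k"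
 "cinner (r *\<^sub>R f) k = r *\<^sub>R cinner f k"
 "cinner k (f + g) = cinner k f + cinner k g" "cinner k (f - g) = cinner k f - cinner k g"
 "cinner k (r *\<^sub>R f) = r *\<^sub>R cinner k f"
proof -
 note L = bounded_linear.linear[OF bdd_mult.bounded_linear[OF bdd_mult_const[of \<i>]]]
 show "cinner (f + g) k = cinner f k + cinner g k" "cinner (f - g) k = cinner f k - cinner g k"
 "cinner (r *\<^sub>R f) k = r *\<^sub>R cinner f k"
 "cinner k (f + g) = cinner k f + cinner k g" "cinner k (f - g) = cinner k f - cinner k g"
 "cinner k (r *\<^sub>R f) = r *\<^sub>R cinner k f"
  by (simp_all add: cinner_eq complex_eq_iff linear_add[OF L] linear_diff[OF L] linear_scale[OF L] inner_add_left
   inner_add_right inner_diff_left inner_diff_right)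
qed

lemma cinner_tr: "cinner (tr y f) (tr y g) = cinner f g"
proof -
 have "tr y f \<bullet> tr y g = f \<bullet> g" for f g
  by (simp add: dot_norm tr_add[symmetric])
 thus ?thesis
  by (simp add: cinner_eq tr_mult[OF bdd_mult_const, symmetric])
qed

lemma cinner_dq: "cinner (dq j h f) g = - cinner f (dq j (- h) g)"
proof (cases "h = 0")
 case False
 have "cinner (tr (h *\<^sub>R ax j) f) g = cinner f (tr ((- h) *\<^sub>R ax j) g)"
  using cinner_tr[of "(- h) *\<^sub>R ax j" "tr (h *\<^sub>R ax j) f" g] by (simp add: tr_tr)
 thus ?thesis by (simp add: dq_def cinner_linear algebra_simps)
qed (use cinner_linear(3)[of 0 0 g] cinner_linear(6)[of f 0 0] in \<open>simp add: dq_def\<close>)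

lemma pairing_dq: "pairing (dq j h f) g = - pairing f (dq j (- h) g)"
 by (simp add: pairing_def cinner_dq cj_dq)

lemma has_vector_derivative_quotient_tendsto:
 assumes "(f has_vector_derivative d) (at x)"
 shows "((\<lambda>s. (f (x + s) - f x) /\<^sub>R s) \<longlongrightarrow> d) (at 0)"
proof (rule LIM_zero_cancel, rule tendsto_norm_zero_cancel)
 have "(\<lambda>s. norm (f (x + s) - f x - s *\<^sub>R d) / norm s) \<midarrow>0\<rightarrow> 0"
  using assms by (simp add: has_vector_derivative_def has_derivative_at)
 moreover have "\<forall>\<^sub>F s in at 0. norm (f (x + s) - f x - s *\<^sub>R d) / norm s = norm ((f (x + s) - f x) /\<^sub>R s - d)"
 proof (rule eventually_at_ball'[THEN eventually_mono, of 1])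
  fix s :: real assume s: "s \<in> ball 0 1 \<and> s \<noteq> 0 \<and> s \<in> UNIV"
  hence "(f (x + s) - f x) /\<^sub>R s - d = (1 / s) *\<^sub>R (f (x + s) - f x - s *\<^sub>R d)"
   by (simp add: scaleR_diff_right inverse_eq_divide)
  thus "norm (f (x + s) - f x - s *\<^sub>R d) / norm s = norm ((f (x + s) - f x) /\<^sub>R s - d)"
   by simp
 qed simp
 ultimately show "((\<lambda>s. norm ((f (x + s) - f x) /\<^sub>R s - d)) \<longlongrightarrow> 0) (at 0)"
  by (rule Lim_transform_eventually)
qed

text \<open>The mean value inequality bounds the quotients by the supremum of the derivative, and
  they all vanish outside one ball, so dominated convergence applies.\<close>

lemma test_dq_tendsto:
 assumes \<phi>: "test_function \<phi>" and h: "h \<longlonglongrightarrow> 0" "\<And>n. h n \<noteq> 0"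
 shows "(\<lambda>n. dq j (h n) (L2_of \<phi>)) \<longlonglongrightarrow> L2_of (partial_deriv j \<phi>)"
proof -
 let ?d = "partial_deriv j \<phi>"
 have s\<phi>: "sq_integrable \<phi>" and sd: "sq_integrable ?d"
  using \<phi> by (auto intro: sq_integrable_test test_function_deriv)
 have diff: "\<phi> differentiable (at x)" for x
 proof -
  have "C_k (Suc 0) \<phi>" using \<phi> unfolding test_function_def by blast
  thus ?thesis by simp
 qed
 have vd: "((\<lambda>s. \<phi> (x + s *\<^sub>R ax j)) has_vector_derivative ?d (x + s *\<^sub>R ax j)) (at s)" for x s
 proof -
  have l: "((\<lambda>s. x + s *\<^sub>R ax j) has_derivative (\<lambda>u. u *\<^sub>R ax j)) (at s)"
   by (auto intro!: derivative_eq_intros)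
  note dd = has_derivative_frechet[OF diff, of "x + s *\<^sub>R ax j"]
  have "linear (frechet_derivative \<phi> (at (x + s *\<^sub>R ax j)))" using dd by (rule has_derivative_linear)
  hence "(\<lambda>u. frechet_derivative \<phi> (at (x + s *\<^sub>R ax j)) (u *\<^sub>R ax j)) = (\<lambda>u. u *\<^sub>R ?d (x + s *\<^sub>R ax j))"
   by (simp add: linear_scale partial_deriv_def)
  with has_derivative_compose[OF l dd] show ?thesis by (simp add: has_vector_derivative_def)
 qed
 obtain C R where C: "0 \<le> C" "\<And>x. cmod (?d x) \<le> C"
  using test_function_bounds[OF test_function_deriv[OF \<phi>, of j]] by metis
 obtain C' R where R: "\<And>x. \<phi> x \<noteq> 0 \<Longrightarrow> norm x \<le> R"
  using test_function_bounds[OF \<phi>] by metis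
 obtain K where K: "\<And>n. \<bar>h n\<bar> \<le> K"
  using convergent_imp_Bseq[OF convergentI[OF h(1)]] by (auto simp: Bseq_def)
 have on: "onorm (\<lambda>u. u *\<^sub>R ?d z) \<le> C" for z
 proof (rule onorm_le)
  show "norm (u *\<^sub>R ?d z) \<le> C * norm u" for u
   using mult_right_mono[OF C(2)[of z] abs_ge_zero[of u]] by (simp add: mult.commute)
 qed
 have mv: "cmod (\<phi> (x + s *\<^sub>R ax j) - \<phi> x) \<le> C * \<bar>s\<bar>" for x s
 proof -
  have "norm (\<phi> (x + s *\<^sub>R ax j) - \<phi> (x + 0 *\<^sub>R ax j)) \<le> C * norm (s - 0)"
   by (rule differentiable_bound[of UNIV "\<lambda>s. \<phi> (x + s *\<^sub>R ax j)" "\<lambda>s u. u *\<^sub>R ?d (x + s *\<^sub>R ax j)"])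
     (use vd on in \<open>auto simp: has_vector_derivative_def\<close>)
  thus ?thesis by simp
 qed
 have rep: "AE x in lb. \<forall>n. rep_L2 (dq j (h n) (L2_of \<phi>)) x = (\<phi> (x + h n *\<^sub>R ax j) - \<phi> x) /\<^sub>R h n"
 proof -
  have "AE x in lb. rep_L2 (dq j (h n) (L2_of \<phi>)) x = (\<phi> (x + h n *\<^sub>R ax j) - \<phi> x) /\<^sub>R h n" for n
   unfolding dq_def
   using rep_scaleR[of "1 / h n" "tr (h n *\<^sub>R ax j) (L2_of \<phi>) - L2_of \<phi>"] rep_diff[of "tr (h n *\<^sub>R ax j) (L2_of \<phi>)" "L2_of \<phi>"]
    rep_tr[of "h n *\<^sub>R ax j" "L2_of \<phi>"] rep_L2_of[OF s\<phi>] AE_translate[OF rep_L2_of[OF s\<phi>], of "h n *\<^sub>R ax j"]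
   by eventually_elim (simp add: inverse_eq_divide)
  thus ?thesis by (simp add: AE_all_countable)
 qed
 show ?thesis
 proof (rule L2_dominated[where w = "\<lambda>x. C * indicator (cball 0 (R + K)) x"])
  have "emeasure lborel (cball 0 (R + K) :: (real^3) set) < \<infinity>"
   by (rule emeasure_lborel_cball_finite)
  thus "integrable lb (\<lambda>x. (C * indicator (cball 0 (R + K)) x :: real)\<^sup>2)"
   by (intro sq_integrable_indicator(2)) auto
  show "AE x in lb. cmod (rep_L2 (dq j (h n) (L2_of \<phi>)) x) \<le> C * indicator (cball 0 (R + K)) x" for n
   using rep
  proof eventually_elim
   case (elim x)
   have b: "cmod ((\<phi> (x + h n *\<^sub>R ax j) - \<phi> x) /\<^sub>R h n) \<le> C"
    unfolding norm_scaleR using mv[of x "h n"] h(2)[of n] by (simp add: field_simps)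
   show ?case
   proof (cases "x \<in> cball 0 (R + K)")
    case True
    thus ?thesis using b elim by simp
   next
    case False
    hence x: "R + K < norm x" by simp
    have K0: "0 \<le> K" using K[of 0] by linarith
    have "\<phi> x = 0" using R[of x] x K0 by fastforce
    moreover have "\<phi> (x + h n *\<^sub>R ax j) = 0"
    proof (rule ccontr)
     assume "\<phi> (x + h n *\<^sub>R ax j) \<noteq> 0"
     hence "norm (x + h n *\<^sub>R ax j) \<le> R" by (rule R)
     moreover have "norm x \<le> norm (x + h n *\<^sub>R ax j) + norm (h n *\<^sub>R ax j)"
      using norm_triangle_ineq4[of "x + h n *\<^sub>R ax j" "h n *\<^sub>R ax j"] by simp
     moreover have "norm (h n *\<^sub>R ax j) \<le> K" using K[of n] by (simp add: norm_axis_1)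
     ultimately show False using x by linarith
    qed
    ultimately show ?thesis using elim C(1) by simp
   qed
  qed
  show "AE x in lb. (\<lambda>n. rep_L2 (dq j (h n) (L2_of \<phi>)) x) \<longlonglongrightarrow> rep_L2 (L2_of ?d) x"
   using rep rep_L2_of[OF sd]
  proof eventually_elim
   case (elim x)
   have "((\<lambda>s. (\<phi> (x + s *\<^sub>R ax j) - \<phi> x) /\<^sub>R s) \<longlongrightarrow> ?d x) (at 0)"
    using has_vector_derivative_quotient_tendsto[OF vd[of x 0]] by simp
   hence "(\<lambda>n. (\<phi> (x + h n *\<^sub>R ax j) - \<phi> x) /\<^sub>R h n) \<longlonglongrightarrow> ?d x"
    by (rule filterlim_compose) (use h in \<open>auto simp: filterlim_at\<close>)
   thus ?case by (simp add: elim)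
  qed
 qed
qed

lemma has_weak_deriv_iff:
 "has_weak_deriv j f g \<longleftrightarrow>
  (\<forall>\<phi>. test_function \<phi> \<longrightarrow> pairing f (L2_of (partial_deriv j \<phi>)) = - pairing g (L2_of \<phi>))"
 unfolding has_weak_deriv_def
 by (auto simp: pairing_L2_of sq_integrable_test test_function_deriv)

text \<open>The discrete integration by parts \<open>pairing_dq\<close> passes to the limit on both
  sides.\<close>

lemma has_weak_deriv_of_dq:
 assumes "h \<longlonglongrightarrow> 0" "\<And>n. h n \<noteq> 0" and g: "(\<lambda>n. dq j (h n) f) \<longlonglongrightarrow> g"
 shows "has_weak_deriv j f g"
 unfolding has_weak_deriv_iff
proof (intro allI impI)
 fix \<phi> assume \<phi>: "test_function \<phi>"
 have "(\<lambda>n. - h n) \<longlonglongrightarrow> 0" "\<And>n. - h n \<noteq> 0" using tendsto_minus[OF assms(1)] assms(2) by auto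
 hence "(\<lambda>n. - pairing f (dq j (- h n) (L2_of \<phi>))) \<longlonglongrightarrow> - pairing f (L2_of (partial_deriv j \<phi>))"
  by (intro tendsto_minus pairing_tendsto tendsto_const test_dq_tendsto \<phi>)
 moreover have "(\<lambda>n. pairing (dq j (h n) f) (L2_of \<phi>)) \<longlonglongrightarrow> pairing g (L2_of \<phi>)"
  by (intro pairing_tendsto tendsto_const g)
 ultimately have "- pairing f (L2_of (partial_deriv j \<phi>)) = pairing g (L2_of \<phi>)"
  unfolding pairing_dq by (rule LIMSEQ_unique)
 thus "pairing f (L2_of (partial_deriv j \<phi>)) = - pairing g (L2_of \<phi>)" by (metis minus_minus)
qed

lemma test_approx: obtains \<phi> where "\<And>n. test_function (\<phi> n)" "(\<lambda>n::nat. L2_of (\<phi> n)) \<longlonglongrightarrow> f"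
proof -
 obtain X where X: "\<And>n. X n \<in> {L2_of \<phi> |\<phi>. test_function \<phi>}" "X \<longlonglongrightarrow> f"
  using test_dense[of f] unfolding closure_sequential by blast
 then obtain \<phi> where "\<And>n. test_function (\<phi> n)" "\<And>n. X n = L2_of (\<phi> n)" by simp metis
 hence "X = (\<lambda>n. L2_of (\<phi> n))" by auto
 with X(2) \<open>\<And>n. test_function (\<phi> n)\<close> show thesis by (intro that[of \<phi>]) simp_all
qed

lemma norm_le_of_test:
 assumes "\<And>\<phi>. test_function \<phi> \<Longrightarrow> cmod (pairing u (L2_of \<phi>)) \<le> M * norm (L2_of \<phi>)"
  and M: "0 \<le> M"
 shows "norm u \<le> M"
proof -
 have "cmod (pairing u f) \<le> M * norm f" for f
 proof -
  obtain \<phi> where \<phi>: "\<And>n. test_function (\<phi> n)" "(\<lambda>n::nat. L2_of (\<phi> n)) \<longlonglongrightarrow> f" by (rule test_approx[of f]) blast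
  show ?thesis
  proof (rule LIMSEQ_le)
   show "(\<lambda>n. cmod (pairing u (L2_of (\<phi> n)))) \<longlonglongrightarrow> cmod (pairing u f)"
    by (intro tendsto_norm pairing_tendsto tendsto_const \<phi>)
   show "(\<lambda>n. M * norm (L2_of (\<phi> n))) \<longlonglongrightarrow> M * norm f" by (intro tendsto_intros \<phi>)
  qed (use assms(1) \<phi>(1) in blast)
 qed
 \<comment> \<open>Testing with the conjugate of u turns the bilinear pairing into the squared
   norm.\<close>
 from this[of "cj u"] have "(norm u)\<^sup>2 \<le> M * norm u" by (simp add: pairing_def cinner_self norm_power)
 thus ?thesis by (cases "norm u = 0") (auto simp: power2_eq_square M)
qed

text \<open>Gives the \<open>THE\<close> in \<open>weak_deriv\<close> its meaning; it rests on the
  density of test functions.\<close>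

lemma has_weak_deriv_unique:
 assumes "has_weak_deriv j f g" "has_weak_deriv j f g'" shows "g = g'"
proof -
 have "norm (g - g') \<le> 0"
 proof (rule norm_le_of_test)
  fix \<phi> assume "test_function \<phi>"
  hence "pairing g (L2_of \<phi>) = pairing g' (L2_of \<phi>)"
   using assms unfolding has_weak_deriv_iff by (metis neg_equal_iff_equal)
  thus "cmod (pairing (g - g') (L2_of \<phi>)) \<le> 0 * norm (L2_of \<phi>)"
   by (simp add: pairing_def cinner_linear)
 qed simp
 thus ?thesis by simp
qed

lemma partial_deriv_translate_test:
 assumes "test_function \<phi>" shows "partial_deriv j (\<lambda>x. \<phi> (x + y)) = (\<lambda>x. partial_deriv j \<phi> (x + y))"
proof -
 have "C_k (Suc 0) \<phi>" using assms unfolding test_function_def by blast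
 thus ?thesis by (intro ext partial_deriv_translate(2)) simp
qed

text \<open>The average representation of the difference quotient of a test function turns the weak
 derivative into a bound on the difference quotients of \<open>f\<close>.\<close>

lemma has_weak_deriv_dq_le:
 assumes fg: "has_weak_deriv j f g" shows "norm (dq j h f) \<le> norm g"
proof (cases "h = 0")
 case False
 show ?thesis
 proof (rule norm_le_of_test)
  fix \<phi> assume \<phi>: "test_function \<phi>"
  define d where "d = L2_of (partial_deriv j \<phi>)"
  define N where "N n = Suc n" for n
  \<comment> \<open>A translate of the derivative is the derivative of a translate, again of a test
    function. So the weak derivative bounds every term of the average by the same constant.\<close>
  have tr_d: "cmod (pairing f (tr y d)) \<le> norm g * norm (L2_of \<phi>)" for y
  proof -
   have "tr y d = L2_of (partial_deriv j (\<lambda>x. \<phi> (x + y)))"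
    unfolding d_def using \<phi>
    by (simp add: tr_L2_of sq_integrable_test test_function_deriv partial_deriv_translate_test)
   hence "pairing f (tr y d) = - pairing g (tr y (L2_of \<phi>))"
    using fg test_function_translate[OF \<phi>, of y] \<phi> by (simp add: has_weak_deriv_iff tr_L2_of sq_integrable_test)
   thus ?thesis using pairing_le[of g "tr y (L2_of \<phi>)"] by simp
  qed
  have avg: "cmod (pairing f (dq j (- h) (L2_of \<phi>))) \<le> norm f * norm (dq j (- h / real (N n)) (L2_of \<phi>) - d) + norm g * norm (L2_of \<phi>)" for n
  proof -
   let ?N = "real (N n)"
   define y where "y k = (real k * (- h) / ?N) *\<^sub>R ax j" for k
   have N: "0 < ?N" by (simp add: N_def)
   have cs: "cj (\<Sum>k\<in>A. F k) = (\<Sum>k\<in>A. cj (F k))" if "finite A" for A and F :: "nat \<Rightarrow> L2"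
    using that
   proof (induction A)
    case (insert a A)
    have "cj (u + v) = cj u + cj v" for u v
     by (rule L2_eqI) (use rep_add[of "cj u" "cj v"] rep_cj[of u] rep_cj[of v] rep_cj[of "u + v"] rep_add[of u v] in
      \<open>eventually_elim, simp\<close>)
    thus ?case using insert by simp
   qed (use cj_dq[of j 0 0] in \<open>simp add: dq_def\<close>)
   have ps: "pairing f (r *\<^sub>R (\<Sum>k\<in>A. F k)) = r *\<^sub>R (\<Sum>k\<in>A. pairing f (F k))" if "finite A" for r A and F :: "nat \<Rightarrow> L2"
   proof -
    have cr: "cj (r *\<^sub>R u) = r *\<^sub>R cj u" for u
     by (rule L2_eqI) (use rep_scaleR[of r "cj u"] rep_cj[of u] rep_cj[of "r *\<^sub>R u"] rep_scaleR[of r u] in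
      \<open>eventually_elim, simp\<close>)
    have "cinner f (\<Sum>k\<in>A. G k) = (\<Sum>k\<in>A. cinner f (G k))" for G :: "nat \<Rightarrow> L2"
     using that by (induction A) (auto simp: cinner_linear, use cinner_linear(6)[of f 0 0] in simp)
    thus ?thesis by (simp add: pairing_def cr cs[OF that] cinner_linear)
   qed
   have t: "cmod (pairing f (tr (y k) (dq j (- h / ?N) (L2_of \<phi>)))) \<le> norm f * norm (dq j (- h / ?N) (L2_of \<phi>) - d) + norm g * norm (L2_of \<phi>)" for k
   proof -
    have e: "tr (y k) (dq j (- h / ?N) (L2_of \<phi>)) = tr (y k) (dq j (- h / ?N) (L2_of \<phi>) - d) + tr (y k) d"
     by (simp add: tr_add[symmetric])
    have "pairing f (u + v) = pairing f u + pairing f v" for u v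
     using ps[of "{0,1}" 1 "\<lambda>k. if k = 0 then u else v"] by simp
    hence "cmod (pairing f (tr (y k) (dq j (- h / ?N) (L2_of \<phi>))))
     \<le> cmod (pairing f (tr (y k) (dq j (- h / ?N) (L2_of \<phi>) - d))) + cmod (pairing f (tr (y k) d))"
     unfolding e using norm_triangle_ineq by metis
    thus ?thesis using tr_d[of "y k"] pairing_le[of f "tr (y k) (dq j (- h / ?N) (L2_of \<phi>) - d)"] by simp
   qed
   have "pairing f (dq j (- h) (L2_of \<phi>)) = (1 / ?N) *\<^sub>R (\<Sum>k<N n. pairing f (tr (y k) (dq j (- h / ?N) (L2_of \<phi>))))"
    unfolding y_def by (subst dq_average[of "N n"]) (simp_all only: N_def ps finite_lessThan zero_less_Suc)
   also have "cmod \<dots> \<le> (1 / ?N) * (\<Sum>k<N n. norm f * norm (dq j (- h / ?N) (L2_of \<phi>) - d) + norm g * norm (L2_of \<phi>))"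
    using N by (simp only: norm_scaleR) (intro mult_mono order_trans[OF norm_sum] sum_mono t, auto)
   also have "\<dots> = norm f * norm (dq j (- h / ?N) (L2_of \<phi>) - d) + norm g * norm (L2_of \<phi>)"
    using N by simp
   finally show ?thesis .
  qed
  have "cmod (pairing f (dq j (- h) (L2_of \<phi>))) \<le> norm f * 0 + norm g * norm (L2_of \<phi>)"
  proof (rule LIMSEQ_le_const)
   have h0: "(\<lambda>n. - h / real (N n)) \<longlonglongrightarrow> 0"
    using tendsto_mult[OF tendsto_const LIMSEQ_inverse_real_of_nat, of "- h"] by (simp add: N_def divide_inverse)
   have "(\<lambda>n. norm (dq j (- h / real (N n)) (L2_of \<phi>) - d)) \<longlonglongrightarrow> 0"
    unfolding d_def
    by (intro tendsto_norm_zero LIM_zero test_dq_tendsto \<phi> h0) (use False in \<open>simp add: N_def\<close>)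
   thus "(\<lambda>n. norm f * norm (dq j (- h / real (N n)) (L2_of \<phi>) - d) + norm g * norm (L2_of \<phi>)) \<longlonglongrightarrow> norm f * 0 + norm g * norm (L2_of \<phi>)"
    by (intro tendsto_intros)
  qed (use avg in blast)
  thus "cmod (pairing (dq j h f) (L2_of \<phi>)) \<le> norm g * norm (L2_of \<phi>)"
   by (simp add: pairing_dq)
 qed simp
qed (simp add: dq_def)

lemma inverse_Suc_ne: "inverse (real (Suc n)) \<noteq> 0" by simp

lemma H1_of_Fder:
 assumes "\<And>j. \<exists>M. Fder j f M" shows "f \<in> H1"
 unfolding H1_def using has_weak_deriv_of_dq[OF inverse_Suc_seq(2) inverse_Suc_ne] Fder_tendsto[OF _ inverse_Suc_seq(2) inverse_Suc_ne] assms
 by blast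

lemma weak_deriv_eqI: "has_weak_deriv j f g \<Longrightarrow> weak_deriv j f = g"
 unfolding weak_deriv_def using has_weak_deriv_unique by blast

lemma H1_Fder:
 assumes "f \<in> H1" shows "Fder j f (norm (weak_deriv j f))"
proof -
 obtain g where g: "has_weak_deriv j f g" using assms by (auto simp: H1_def)
 have "Fder j f (norm g)"
  by (rule Fder_liminf[OF inverse_Suc_seq(2) inverse_Suc_ne has_weak_deriv_dq_le[OF g]])
 thus ?thesis by (simp add: weak_deriv_eqI[OF g])
qed

lemma H1_dq_le: "f \<in> H1 \<Longrightarrow> norm (dq j h f) \<le> norm (weak_deriv j f)"
 by (rule Fder_dq_le[OF H1_Fder])

lemma H1_dq_tendsto:
 assumes "f \<in> H1" "h \<longlonglongrightarrow> 0" "\<And>n. h n \<noteq> 0"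
 shows "(\<lambda>n. dq j (h n) f) \<longlonglongrightarrow> weak_deriv j f"
proof -
 have l: "(\<lambda>n. dq j (h n) f) \<longlonglongrightarrow> sder j f"
  by (rule Fder_tendsto[OF H1_Fder[OF assms(1)] assms(2,3)])
 from weak_deriv_eqI[OF has_weak_deriv_of_dq[OF assms(2,3) l]] l show ?thesis by simp
qed

lemma Fder_weak_deriv_le:
 assumes "f \<in> H1" "Fder j f M" shows "norm (weak_deriv j f) \<le> M"
 by (rule LIMSEQ_le_const2[OF tendsto_norm[OF H1_dq_tendsto[OF assms(1) inverse_Suc_seq(2) inverse_Suc_ne]]])
   (use Fder_dq_le[OF assms(2)] in blast)

lemma Fder_dqI: "(\<And>h. h \<noteq> 0 \<Longrightarrow> norm (dq j h f) \<le> M) \<Longrightarrow> Fder j f M"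
 using Fder_liminf[OF inverse_Suc_seq(2) inverse_Suc_ne] by simp

lemma weak_deriv_diff:
 assumes "f \<in> H1" "g \<in> H1" shows "weak_deriv j (f - g) = weak_deriv j f - weak_deriv j g"
proof (rule weak_deriv_eqI, rule has_weak_deriv_of_dq[OF inverse_Suc_seq(2) inverse_Suc_ne])
 show "(\<lambda>n. dq j (inverse (real (Suc n))) (f - g)) \<longlonglongrightarrow> weak_deriv j f - weak_deriv j g"
  unfolding dq_diff by (intro tendsto_diff H1_dq_tendsto assms inverse_Suc_seq(2) inverse_Suc_ne)
qed

text \<open>The function and its three derivatives contribute at most M^2 each, and 4 M^2 is the
  square of 2 M.\<close>

lemma H1_normI:
 assumes f: "norm f \<le> M" and F: "\<And>j. Fder j f M"
 shows "f \<in> H1" "H1_norm f \<le> 2 * M"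
proof -
 show H: "f \<in> H1" using F by (intro H1_of_Fder) blast
 have M: "0 \<le> M" using order_trans[OF norm_ge_zero f] .
 have "(norm f)\<^sup>2 + (\<Sum>j\<in>UNIV. (norm (weak_deriv j f))\<^sup>2) \<le> M\<^sup>2 + (\<Sum>j\<in>(UNIV::3 set). M\<^sup>2)"
  by (intro add_mono sum_mono power_mono f Fder_weak_deriv_le H F) auto
 also have "\<dots> = (2 * M)\<^sup>2" by (simp add: power_mult_distrib)
 finally show "H1_norm f \<le> 2 * M"
  unfolding H1_norm_def using M by (intro real_le_lsqrt) (auto intro!: sum_nonneg)
qed

lemma H1_norm_ge: "norm f \<le> H1_norm f" "norm (weak_deriv j f) \<le> H1_norm f"
proof -
 have "(norm f)\<^sup>2 \<le> (norm f)\<^sup>2 + (\<Sum>j\<in>UNIV. (norm (weak_deriv j f))\<^sup>2)" by (simp add: sum_nonneg)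
 thus "norm f \<le> H1_norm f" unfolding H1_norm_def by (rule real_le_rsqrt)
 have "(norm (weak_deriv j f))\<^sup>2 \<le> (norm f)\<^sup>2 + (\<Sum>j\<in>UNIV. (norm (weak_deriv j f))\<^sup>2)"
  using member_le_sum[of j UNIV "\<lambda>j. (norm (weak_deriv j f))\<^sup>2"] by (simp add: add_increasing)
 thus "norm (weak_deriv j f) \<le> H1_norm f" unfolding H1_norm_def by (rule real_le_rsqrt)
qed

section \<open>The norms \<open>L\<^sup>4\<close> and \<open>L\<^sup>4\<^sup>/\<^sup>3\<close> on the space \<open>L\<^sup>2\<close>\<close>

abbreviation lp :: "real \<Rightarrow> L2 \<Rightarrow> real \<Rightarrow> bool" where
 "lp p f A \<equiv> Lp_le lb p (\<lambda>x. mag f x) A"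

lemma Lp_le_zero: "0 < p \<Longrightarrow> Lp_le M p (\<lambda>x. 0) 0"
 by (simp add: Lp_le_def)

lemma lp_mono_AE:
 assumes "lp p g A" "AE x in lb. mag f x \<le> mag g x" "0 < p"
 shows "lp p f A"
 by (rule Lp_le_mono_AE[OF assms(1)]) (use assms in auto)

lemma lp_add:
 assumes "lp p f A" "lp p g B" "1 \<le> p" shows "lp p (f + g) (A + B)"
proof (rule Lp_le_mono_AE[OF Lp_le_add[OF assms]])
 show "AE x in lb. \<bar>mag (f + g) x\<bar> \<le> \<bar>mag f x + mag g x\<bar>"
  using rep_add[of f g] by eventually_elim (simp add: norm_triangle_ineq)
qed (use assms in auto)

lemma lp_scaleR:
 assumes "lp p f A" "0 < p" shows "lp p (r *\<^sub>R f) (\<bar>r\<bar> * A)"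
proof (rule Lp_le_mono_AE[OF Lp_le_cmult[OF assms, of r]])
 show "AE x in lb. \<bar>mag (r *\<^sub>R f) x\<bar> \<le> \<bar>r * mag f x\<bar>"
  using rep_scaleR[of r f] by eventually_elim (simp add: abs_mult)
qed (use assms in auto)

lemma lp_mult_unimodular:
 assumes "lp p f A" "0 < p" "cmod c = 1" shows "lp p (L2_mult (\<lambda>_. c) f) A"
proof (rule lp_mono_AE[OF assms(1) _ assms(2)])
 show "AE x in lb. cmod (rep_L2 (L2_mult (\<lambda>_. c) f) x) \<le> mag f x"
  using bdd_mult.rep[OF bdd_mult_const, of c f] by eventually_elim (simp add: norm_mult assms(3))
qed

lemma lp_diff:
 assumes "lp p f A" "lp p g B" "1 \<le> p" shows "lp p (f - g) (A + B)"
 using lp_add[OF assms(1) lp_scaleR[OF assms(2), of "-1"] assms(3)] assms(3) by simp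

lemma lp_zero: "0 < p \<Longrightarrow> lp p 0 0"
 by (rule Lp_le_mono_AE[OF Lp_le_zero]) (use rep_zero in \<open>auto elim!: eventually_mono\<close>)

lemma lp_sum:
 assumes "finite I" "\<And>i. i \<in> I \<Longrightarrow> lp p (f i) (A i)" "1 \<le> p"
 shows "lp p (\<Sum>i\<in>I. f i) (\<Sum>i\<in>I. A i)"
 using assms by (induction I) (auto intro: lp_zero lp_add)

lemma lp_tr:
 assumes f: "lp p f A" and p: "0 < p" shows "lp p (tr y f) A"
proof -
 have "(\<integral>\<^sup>+x. ennreal (\<bar>mag (tr y f) x\<bar> powr p) \<partial>lb) = (\<integral>\<^sup>+x. ennreal (\<bar>cmod (rep_L2 f (x + y))\<bar> powr p) \<partial>lb)"
  by (rule nn_integral_cong_AE) (use rep_tr[of y f] in \<open>eventually_elim, simp\<close>)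
 also have "\<dots> = (\<integral>\<^sup>+x. ennreal (\<bar>mag f x\<bar> powr p) \<partial>lb)"
  by (rule nn_integral_translate) measurable
 finally show ?thesis using f by (simp add: Lp_le_def)
qed

lemma lp_tendsto:
 assumes X: "\<And>n. lp p (X n) A" and lim: "X \<longlonglongrightarrow> f" and p: "0 < p"
 shows "lp p f A"
proof -
 obtain r :: "nat \<Rightarrow> nat" where r: "AE x in lborel. (\<lambda>n. rep_L2 (X (r n)) x) \<longlonglongrightarrow> rep_L2 f x"
  using L2_subseq_AE[OF lim] by blast
 show ?thesis
  by (rule Lp_le_Fatou[of _ _ "\<lambda>n x. cmod (rep_L2 (X (r n)) x)"])
    (use X r p in \<open>auto elim!: eventually_mono intro: tendsto_norm\<close>)
qed

lemma lp_2_iff: "lp 2 f A \<longleftrightarrow> norm f \<le> A"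
proof (cases "0 \<le> A")
 case True
 thus ?thesis using norm_L2_le_iff[OF True, of f] by (simp add: Lp_le_def)
next
 case False
 thus ?thesis using order_trans[OF norm_ge_zero, of f A] by (auto simp: Lp_le_def)
qed

lemma cinner_lp:
 assumes "lp 4 f A" "lp (4 / 3) g B" shows "cmod (cinner f g) \<le> A * B"
proof -
 have "Lp_le lb 1 (\<lambda>x. mag f x * mag g x) (A * B)"
  by (rule Lp_le_mult[OF assms]) auto
 note 1 = Lp_leD(3)[OF this]
 have AB: "0 \<le> A * B" using Lp_leD(2)[OF assms(1)] Lp_leD(2)[OF assms(2)] by simp
 have e: "\<bar>cmod u * cmod v\<bar> powr 1 = cmod u * cmod v" for u v by (simp add: abs_mult)
 have "ennreal (cmod (cinner f g)) \<le> ennreal (A * B)"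
  using 1 unfolding e powr_one[OF AB] by (rule order_trans[OF ennreal_cinner_le])
 thus ?thesis using AB by (simp add: ennreal_le_iff)
qed

text \<open>The functions \<open>v min(\<bar>v\<bar>, n)\<^sup>2\<close>, which are Lipschitz, serve as test functions for the \<open>L\<^sup>4\<close> norm of \<open>v\<close>.\<close>

definition cut :: "nat \<Rightarrow> complex \<Rightarrow> complex" where
 "cut n z = complex_of_real ((min (cmod z) (real n))\<^sup>2) * z"

definition Cut :: "nat \<Rightarrow> L2 \<Rightarrow> L2" where "Cut n f = L2_of (\<lambda>x. cut n (rep_L2 f x))"

lemma cut_measurable [measurable]: "cut n \<in> borel_measurable borel"
 unfolding cut_def[abs_def] by measurable

lemma cmod_cut: "cmod (cut n z) = (min (cmod z) (real n))\<^sup>2 * cmod z"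
 by (simp add: cut_def norm_mult norm_power)

lemma cmod_cut_le: "cmod (cut n z) \<le> (real n)\<^sup>2 * cmod z"
 unfolding cmod_cut by (intro mult_right_mono power_mono) auto

lemma sq_cut: "sq_integrable (\<lambda>x. cut n (rep_L2 f x))"
 by (rule sq_integrable_dom[where C = "(real n)\<^sup>2" and f = f]) (auto intro!: AE_I2 cmod_cut_le)

lemma rep_Cut: "AE x in lborel. rep_L2 (Cut n f) x = cut n (rep_L2 f x)"
 unfolding Cut_def by (rule rep_L2_of[OF sq_cut])

text \<open>The pairing of f with its own test function. As n grows it increases to the fourth power
  of the L^4 norm, be that finite or infinite.\<close>

definition qn :: "nat \<Rightarrow> L2 \<Rightarrow> real" where "qn n f = f \<bullet> Cut n f"

lemma qn_integral:
 "integrable lb (\<lambda>x. (min (mag f x) (real n))\<^sup>2 * (mag f x)\<^sup>2)"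
 "qn n f = (\<integral>x. (min (mag f x) (real n))\<^sup>2 * (mag f x)\<^sup>2 \<partial>lborel)"
proof -
 have e: "z \<bullet> cut n z = (min (cmod z) (real n))\<^sup>2 * (cmod z)\<^sup>2" for z
  by (simp add: cut_def scaleR_conv_of_real[symmetric] power2_norm_eq_inner flip: of_real_power)
 have i: "integrable lb (\<lambda>x. rep_L2 f x \<bullet> cut n (rep_L2 f x))"
  by (rule sq_integrable_inner) (auto intro: sq_cut)
 thus "integrable lb (\<lambda>x. (min (mag f x) (real n))\<^sup>2 * (mag f x)\<^sup>2)"
  by (simp only: e)
 have "qn n f = (\<integral>x. rep_L2 f x \<bullet> cut n (rep_L2 f x) \<partial>lborel)"
  unfolding qn_def inner_L2_rep
  by (rule integral_cong_AE) (use rep_Cut[of n f] in \<open>auto elim!: eventually_mono\<close>)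
 thus "qn n f = (\<integral>x. (min (mag f x) (real n))\<^sup>2 * (mag f x)\<^sup>2 \<partial>lborel)"
  by (simp only: e)
qed

lemma qn_nonneg: "0 \<le> qn n f"
 unfolding qn_integral(2) by (intro integral_nonneg_AE AE_I2) auto

lemma qn_nn: "(\<integral>\<^sup>+x. ennreal ((min (mag f x) (real n))\<^sup>2 * (mag f x)\<^sup>2) \<partial>lborel) = ennreal (qn n f)"
 unfolding qn_integral(2) by (rule nn_integral_eq_integral[OF qn_integral(1)]) auto

text \<open>With m = min(a, n), the power (m^2 a)^(4/3) equals m^2 m^(2/3) a^(4/3), which is at most
  m^2 a^2 since m is at most a. Thus the dual norm of the test function is a power of the pairing
  itself.\<close>

lemma Cut_lp: "lp (4 / 3) (Cut n f) (qn n f powr (3 / 4))"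
proof -
 have p: "((min a b)\<^sup>2 * a) powr (4 / 3) \<le> (min a b)\<^sup>2 * a\<^sup>2" if "0 \<le> a" "0 \<le> b" for a b :: real
 proof (cases "min a b = 0")
  case False
  hence pos: "0 < min a b" "0 < a" using that by auto
  have "((min a b)\<^sup>2 * a) powr (4 / 3) = (min a b) powr (8 / 3) * a powr (4 / 3)"
   using pos by (simp add: powr_mult powr_powr flip: powr_numeral)
  also have "(min a b) powr (8 / 3) = (min a b) powr 2 * (min a b) powr (2 / 3)"
   by (simp add: powr_add[symmetric])
  also have "\<dots> * a powr (4 / 3) \<le> (min a b) powr 2 * a powr (2 / 3) * a powr (4 / 3)"
   using pos by (intro mult_right_mono mult_left_mono powr_mono2) auto
  also have "\<dots> = (min a b) powr 2 * a powr 2"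
   by (simp add: mult.assoc powr_add[symmetric])
  also have "\<dots> = (min a b)\<^sup>2 * a\<^sup>2" using pos by simp
  finally show ?thesis .
 qed auto
 have "(\<integral>\<^sup>+x. ennreal (\<bar>mag (Cut n f) x\<bar> powr (4 / 3)) \<partial>lb)
   \<le> (\<integral>\<^sup>+x. ennreal ((min (mag f x) (real n))\<^sup>2 * (mag f x)\<^sup>2) \<partial>lborel)"
 proof (rule nn_integral_mono_AE)
  show "AE x in lb. ennreal (\<bar>mag (Cut n f) x\<bar> powr (4 / 3)) \<le> ennreal ((min (mag f x) (real n))\<^sup>2 * (mag f x)\<^sup>2)"
   using rep_Cut[of n f] by eventually_elim (use p in \<open>auto simp: cmod_cut intro!: ennreal_leI\<close>)
 qed
 also have "\<dots> = ennreal ((qn n f powr (3 / 4)) powr (4 / 3))"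
  unfolding qn_nn using qn_nonneg[of n f] by (simp add: powr_powr)
 finally show ?thesis by (simp add: Lp_le_def)
qed

lemma lp_4_of_qn:
 assumes q: "\<And>n. qn n f \<le> A powr 4" and A: "0 \<le> A" shows "lp 4 f A"
proof -
 let ?r = "\<lambda>x. mag f x"
 define g where "g n x = min (?r x) (real n) * ?r x" for n x
 have g: "Lp_le lb 2 (g n) (A powr 2)" for n
 proof -
  have "(\<integral>\<^sup>+x. ennreal (\<bar>g n x\<bar> powr 2) \<partial>lb) = ennreal (qn n f)"
   unfolding qn_nn[symmetric] g_def by (simp add: abs_mult power_mult_distrib)
  also have "\<dots> \<le> ennreal ((A powr 2) powr 2)" using q[of n] by (simp add: powr_powr ennreal_leI)
  finally show ?thesis unfolding Lp_le_def by (simp add: g_def[abs_def])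
 qed
 have "Lp_le lb 2 (\<lambda>x. ?r x * ?r x) (A powr 2)"
 proof (rule Lp_le_Fatou[OF g])
  show "AE x in lb. (\<lambda>n. g n x) \<longlonglongrightarrow> ?r x * ?r x"
  proof (rule AE_I2)
   fix x
   obtain N :: nat where N: "?r x \<le> real N" using real_arch_simple by blast
   have "\<forall>\<^sub>F n in sequentially. g n x = ?r x * ?r x"
    by (rule eventually_sequentiallyI[of N]) (use N in \<open>auto simp: g_def\<close>)
   thus "(\<lambda>n. g n x) \<longlonglongrightarrow> ?r x * ?r x" by (rule tendsto_eventually)
  qed
 qed auto
 moreover have "\<bar>a * a\<bar> powr 2 = \<bar>a\<bar> powr 4" for a :: real
  by (simp add: power_abs flip: power2_eq_square power_mult)
 ultimately show ?thesis using A by (simp add: Lp_le_def powr_powr)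
qed

text \<open>Tested with \<open>Cut n v\<close>, the hypothesis reads q \<le> A q^(3/4). Dividing is
  legitimate because the cut-off keeps q finite, and q \<le> A^4 results for every n.\<close>

lemma lp_4_dual:
 assumes d: "\<And>\<phi> B. lp (4 / 3) \<phi> B \<Longrightarrow> v \<bullet> \<phi> \<le> A * B" and A: "0 \<le> A"
 shows "lp 4 v A"
proof (rule lp_4_of_qn[OF _ A])
 fix n
 have q: "qn n v \<le> A * qn n v powr (3 / 4)"
  unfolding qn_def[of n v] by (rule d[OF Cut_lp, unfolded qn_def])
 show "qn n v \<le> A powr 4"
 proof (cases "qn n v = 0")
  case False
  hence pos: "0 < qn n v" using qn_nonneg[of n v] by simp
  have "qn n v powr (1 / 4) * qn n v powr (3 / 4) \<le> A * qn n v powr (3 / 4)"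
   using q pos by (simp add: powr_add[symmetric])
  hence "qn n v powr (1 / 4) \<le> A" using pos by simp
  hence "(qn n v powr (1 / 4)) powr 4 \<le> A powr 4" by (intro powr_mono2) auto
  thus ?thesis using pos by (simp add: powr_powr)
 qed simp
qed

text \<open>The Bochner integral in \<open>Lp_norm\<close> is 0 when it diverges, so
  \<open>n4\<close> is 0 off L^4. Hence the companion predicate \<open>L4\<close>.\<close>

definition n4 :: "L2 \<Rightarrow> real" where "n4 f = Lp_norm 4 (rep_L2 f)"

definition L4 :: "L2 \<Rightarrow> bool" where "L4 f \<longleftrightarrow> (\<exists>A. lp 4 f A)"

lemma n4_nonneg: "0 \<le> n4 f" by (simp add: n4_def Lp_norm_def)

lemma Lp_le_Lp_norm:
 assumes f: "f \<in> borel_measurable lb" and A: "Lp_le lb p (\<lambda>x. cmod (f x)) A" and p: "0 < p"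
 shows "in_Lp p f" "Lp_le lb p (\<lambda>x. cmod (f x)) (Lp_norm p f)" "Lp_norm p f \<le> A"
proof -
 have i: "integrable lb (\<lambda>x. cmod (f x) powr p)"
 proof (rule integrableI_nonneg)
  have "(\<integral>\<^sup>+x. ennreal (cmod (f x) powr p) \<partial>lb) \<le> ennreal (A powr p)" using Lp_leD(3)[OF A] by simp
  also have "\<dots> < \<infinity>" by simp
  finally show "(\<integral>\<^sup>+x. ennreal (cmod (f x) powr p) \<partial>lb) < \<infinity>" .
 qed (use f in auto)
 thus "in_Lp p f" using f by (simp add: in_Lp_def)
 have e: "(\<integral>\<^sup>+x. ennreal (cmod (f x) powr p) \<partial>lb) = ennreal (\<integral>x. cmod (f x) powr p \<partial>lborel)"
  by (rule nn_integral_eq_integral[OF i]) simp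
 have i0: "0 \<le> (\<integral>x. cmod (f x) powr p \<partial>lborel)" by simp
 show "Lp_le lb p (\<lambda>x. cmod (f x)) (Lp_norm p f)"
  using f e i0 p by (simp add: Lp_le_def Lp_norm_def powr_powr)
 have "(\<integral>x. cmod (f x) powr p \<partial>lborel) \<le> A powr p"
  using Lp_leD(3)[OF A] e by (simp add: ennreal_le_iff)
 hence "Lp_norm p f \<le> (A powr p) powr (1 / p)"
  unfolding Lp_norm_def using p i0 by (intro powr_mono2) auto
 thus "Lp_norm p f \<le> A" using p Lp_leD(2)[OF A] by (simp add: powr_powr)
qed

lemma L4_n4: "L4 f \<Longrightarrow> lp 4 f (n4 f)"
 unfolding L4_def n4_def using Lp_le_Lp_norm(2)[of "rep_L2 f" 4] by auto

lemma L4_in_Lp: "L4 f \<Longrightarrow> in_Lp 4 (rep_L2 f)"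
 unfolding L4_def using Lp_le_Lp_norm(1)[of "rep_L2 f" 4] by auto

lemma n4_le: "lp 4 f A \<Longrightarrow> n4 f \<le> A"
 unfolding n4_def using Lp_le_Lp_norm(3)[of "rep_L2 f" 4] by auto

lemma in_Lp_L4:
 assumes "in_Lp 4 (rep_L2 f)" shows "L4 f"
proof -
 have "(\<integral>\<^sup>+x. ennreal (mag f x powr 4) \<partial>lb) = ennreal (\<integral>x. mag f x powr 4 \<partial>lborel)"
  by (rule nn_integral_eq_integral) (use assms in \<open>auto simp: in_Lp_def\<close>)
 hence "lp 4 f ((\<integral>x. mag f x powr 4 \<partial>lborel) powr (1 / 4))"
  by (simp add: Lp_le_def powr_powr)
 thus ?thesis by (auto simp: L4_def)
qed

lemma L4I: "lp 4 f A \<Longrightarrow> L4 f" by (auto simp: L4_def)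

lemma L4_diff: "L4 f \<Longrightarrow> L4 g \<Longrightarrow> L4 (f - g)"
 unfolding L4_def by (elim exE) (rule exI, rule lp_diff, auto)

lemma L4_scaleR: "L4 f \<Longrightarrow> L4 (r *\<^sub>R f)"
 unfolding L4_def by (elim exE) (rule exI, rule lp_scaleR, auto)

lemma L4_tr: "L4 f \<Longrightarrow> L4 (tr y f)"
 unfolding L4_def by (elim exE) (rule exI, rule lp_tr, auto)

lemma L4_dq: "L4 f \<Longrightarrow> L4 (dq j h f)"
 by (simp add: dq_def L4_scaleR L4_diff L4_tr)

lemma n4_add: "L4 f \<Longrightarrow> L4 g \<Longrightarrow> n4 (f + g) \<le> n4 f + n4 g"
 by (intro n4_le lp_add L4_n4) auto

lemma n4_diff: "L4 f \<Longrightarrow> L4 g \<Longrightarrow> n4 (f - g) \<le> n4 f + n4 g"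
 by (intro n4_le lp_diff L4_n4) auto

lemma n4_tr: "L4 f \<Longrightarrow> n4 (tr y f) = n4 f"
proof -
 assume f: "L4 f"
 have 1: "n4 (tr y f) \<le> n4 f" if "L4 f" for f y by (rule n4_le[OF lp_tr[OF L4_n4[OF that]]]) simp
 from 1[OF f, of y] 1[OF L4_tr[OF f, of y], of "- y"] show ?thesis by (simp add: tr_tr)
qed

text \<open>By \<open>lp_tendsto\<close> the sublevel sets of the extended-valued integral are
  closed in L^2, so the integral is Borel. Reading it through \<open>enn2real\<close> reproduces the
  value 0 off L^4.\<close>

lemma n4_measurable [measurable]: "n4 \<in> borel_measurable borel"
proof -
 let ?Q = "\<lambda>f. \<integral>\<^sup>+x. ennreal (mag f x powr 4) \<partial>lborel"
 have Q: "?Q \<in> borel_measurable borel"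
 proof (rule borel_measurableI_le)
  fix c
  have "closed {f. ?Q f \<le> c}"
   unfolding closed_sequential_limits
  proof (intro allI impI, elim conjE)
   fix X f assume X: "\<forall>n. X n \<in> {f. ?Q f \<le> c}" and lim: "X \<longlonglongrightarrow> f"
   show "f \<in> {f. ?Q f \<le> c}"
   proof (cases "c = \<top>")
    case False
    then obtain r where r: "c = ennreal r" "0 \<le> r" by (cases c) auto
    have "lp 4 (X n) (r powr (1 / 4))" for n
     using X r by (simp add: Lp_le_def powr_powr)
    hence "lp 4 f (r powr (1 / 4))" by (rule lp_tendsto[OF _ lim]) simp
    thus ?thesis using r by (simp add: Lp_le_def powr_powr)
   qed simp
  qed
  thus "{w \<in> space borel. ?Q w \<le> c} \<in> sets borel" by simp
 qed
 have "n4 f = enn2real (?Q f) powr (1 / 4)" for f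
  unfolding n4_def Lp_norm_def by (subst integral_eq_nn_integral) auto
 hence e: "n4 = (\<lambda>f. enn2real (?Q f) powr (1 / 4))" by auto
 define Qf where "Qf = ?Q"
 have [measurable]: "Qf \<in> borel_measurable borel" unfolding Qf_def by (rule Q)
 have "(\<lambda>f. enn2real (Qf f) powr (1 / 4)) \<in> borel_measurable borel" by measurable
 thus ?thesis unfolding e Qf_def .
qed

section \<open>Sobolev embedding\<close>

text \<open>Hoelder on the Fourier side: the transform times 1 + |\<xi>| is in L^2 and the inverse
  weight is in L^4, so the transform is in L^(4/3), which is the hypothesis of
  \<open>hausdorff_young_4\<close>.\<close>

lemma sobolev: "\<exists>C>0. \<forall>f M. norm f \<le> M \<longrightarrow> (\<forall>j. Fder j f M) \<longrightarrow> lp 4 f (C * M)"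
proof -
 obtain C where C: "Lp_le lb 4 (\<lambda>\<xi>. 1 / (1 + norm \<xi>)) C" using weight_L4 by blast
 have "lp 4 f (3 * (\<bar>C\<bar> + 1) * M)" if f: "norm f \<le> M" and F: "\<And>j. Fder j f M" for f M
 proof (rule hausdorff_young_4)
  let ?F = "\<lambda>\<xi>. cmod (rep_L2 (fourier_L2 f) \<xi>)"
  have M: "0 \<le> M" using order_trans[OF norm_ge_zero f] .
  have pt: "((1 + norm \<xi>) * ?F \<xi>)\<^sup>2 \<le> 2 * (?F \<xi>)\<^sup>2 + (\<Sum>j\<in>UNIV. 2 * (\<bar>\<xi> $ j\<bar> * ?F \<xi>)\<^sup>2)" for \<xi>
  proof -
   have n: "(norm \<xi>)\<^sup>2 = (\<Sum>j\<in>UNIV. (\<xi> $ j)\<^sup>2)"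
    unfolding power2_norm_eq_inner inner_vec_def by (simp add: power2_eq_square)
   have "(1 + norm \<xi>)\<^sup>2 \<le> 2 + 2 * (norm \<xi>)\<^sup>2"
    using sum_squares_bound[of 1 "norm \<xi>"] by (simp add: power2_sum)
   hence "(1 + norm \<xi>)\<^sup>2 * (?F \<xi>)\<^sup>2 \<le> (2 + 2 * (norm \<xi>)\<^sup>2) * (?F \<xi>)\<^sup>2" by (rule mult_right_mono) simp
   thus ?thesis
    unfolding power_mult_distrib by (simp add: n distrib_right sum_distrib_left sum_distrib_right mult.assoc)
  qed
  have m: "(\<lambda>\<xi>. ennreal (2 * (\<bar>\<xi> $ j\<bar> * ?F \<xi>)\<^sup>2)) \<in> borel_measurable lb" for j by measurable
  have "(\<integral>\<^sup>+\<xi>. ennreal (((1 + norm \<xi>) * ?F \<xi>)\<^sup>2) \<partial>lb)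
   \<le> (\<integral>\<^sup>+\<xi>. ennreal (2 * (?F \<xi>)\<^sup>2) + (\<Sum>j\<in>UNIV. ennreal (2 * (\<bar>\<xi> $ j\<bar> * ?F \<xi>)\<^sup>2)) \<partial>lb)"
   by (intro nn_integral_mono order_trans[OF ennreal_leI[OF pt]])
     (subst sum_ennreal, simp, subst ennreal_plus, auto intro!: sum_nonneg)
  also have "\<dots> = (\<integral>\<^sup>+\<xi>. ennreal (2 * (?F \<xi>)\<^sup>2) \<partial>lb) + (\<Sum>j\<in>UNIV. \<integral>\<^sup>+\<xi>. ennreal (2 * (\<bar>\<xi> $ j\<bar> * ?F \<xi>)\<^sup>2) \<partial>lb)"
  proof -
   have "(\<integral>\<^sup>+\<xi>. (\<Sum>j\<in>UNIV. ennreal (2 * (\<bar>\<xi> $ j\<bar> * ?F \<xi>)\<^sup>2)) \<partial>lb) = (\<Sum>j\<in>UNIV. \<integral>\<^sup>+\<xi>. ennreal (2 * (\<bar>\<xi> $ j\<bar> * ?F \<xi>)\<^sup>2) \<partial>lb)"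
    by (rule nn_integral_sum) (rule m)
   moreover have "(\<integral>\<^sup>+\<xi>. ennreal (2 * (?F \<xi>)\<^sup>2) + (\<Sum>j\<in>UNIV. ennreal (2 * (\<bar>\<xi> $ j\<bar> * ?F \<xi>)\<^sup>2)) \<partial>lb)
    = (\<integral>\<^sup>+\<xi>. ennreal (2 * (?F \<xi>)\<^sup>2) \<partial>lb) + (\<integral>\<^sup>+\<xi>. (\<Sum>j\<in>UNIV. ennreal (2 * (\<bar>\<xi> $ j\<bar> * ?F \<xi>)\<^sup>2)) \<partial>lb)"
    by (rule nn_integral_add) measurable
   ultimately show ?thesis by (simp only:)
  qed
  also have "\<dots> \<le> ennreal (2 * M\<^sup>2) + (\<Sum>j\<in>(UNIV :: 3 set). ennreal (2 * M\<^sup>2))"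
  proof (intro add_mono sum_mono)
   have two: "(\<integral>\<^sup>+\<xi>. ennreal (2 * g \<xi>) \<partial>lb) \<le> ennreal (2 * M\<^sup>2)"
    if "(\<integral>\<^sup>+\<xi>. ennreal (g \<xi>) \<partial>lb) \<le> ennreal (M\<^sup>2)" "g \<in> borel_measurable borel" for g
   proof -
    have "(\<integral>\<^sup>+\<xi>. ennreal (2 * g \<xi>) \<partial>lb) = 2 * (\<integral>\<^sup>+\<xi>. ennreal (g \<xi>) \<partial>lb)"
     using that(2) by (subst nn_integral_cmult[symmetric]) (auto simp: ennreal_mult')
    also have "\<dots> \<le> 2 * ennreal (M\<^sup>2)" by (intro mult_left_mono that) auto
    finally show ?thesis by (simp add: ennreal_mult'')
   qed
   have "(norm f)\<^sup>2 \<le> M\<^sup>2" using f by (intro power_mono) auto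
   thus "(\<integral>\<^sup>+\<xi>. ennreal (2 * (?F \<xi>)\<^sup>2) \<partial>lb) \<le> ennreal (2 * M\<^sup>2)"
    by (intro two) (auto simp: nn_norm_L2 ennreal_leI)
   show "(\<integral>\<^sup>+\<xi>. ennreal (2 * (\<bar>\<xi> $ j\<bar> * ?F \<xi>)\<^sup>2) \<partial>lb) \<le> ennreal (2 * M\<^sup>2)" for j
    using F[of j] by (intro two) (auto simp: Fder_def)
  qed
  also have "\<dots> = ennreal (2 * M\<^sup>2 + (\<Sum>j\<in>(UNIV :: 3 set). 2 * M\<^sup>2))"
   by (subst sum_ennreal, simp, subst ennreal_plus, auto)
  \<comment> \<open>Four terms of 2 M^2 make 8 M^2, rounded up to a perfect square.\<close>
  also have "\<dots> \<le> ennreal ((3 * M)\<^sup>2)" using M by (intro ennreal_leI) (simp add: power_mult_distrib)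
  finally have "Lp_le lb 2 (\<lambda>\<xi>. (1 + norm \<xi>) * ?F \<xi>) (3 * M)"
   using M by (simp add: Lp_le_def)
  from Lp_le_mult[OF this C, of "4 / 3"]
  have "Lp_le lb (4 / 3) (\<lambda>\<xi>. ((1 + norm \<xi>) * ?F \<xi>) * (1 / (1 + norm \<xi>))) (3 * M * C)" by simp
  moreover have "((1 + norm \<xi>) * ?F \<xi>) * (1 / (1 + norm \<xi>)) = ?F \<xi>" for \<xi> :: "real^3"
   using add_pos_nonneg[of 1 "norm \<xi>"] by simp
  ultimately have "Lp_le lb (4 / 3) ?F (3 * M * C)" by (simp only:)
  thus "Lp_le lb (4 / 3) ?F (3 * (\<bar>C\<bar> + 1) * M)"
   by (rule Lp_le_weaken) (use mult_left_mono[of C "\<bar>C\<bar> + 1" "3 * M"] M in \<open>auto simp: mult_ac\<close>)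
 qed
 thus ?thesis by (intro exI[of _ "3 * (\<bar>C\<bar> + 1)"]) auto
qed

text \<open>Again by averaging over finer steps.\<close>

lemma dq_lp:
 assumes lim: "\<And>h. h \<longlonglongrightarrow> 0 \<Longrightarrow> (\<And>n::nat. h n \<noteq> 0) \<Longrightarrow> (\<lambda>n. dq j (h n) f) \<longlonglongrightarrow> g" and g: "lp p g A" and p: "1 \<le> p"
  and h: "h \<noteq> 0"
 shows "lp p (dq j h f) A"
proof (rule lp_tendsto)
 define N where "N n = Suc n" for n :: nat
 define y where "y n k = (real k * h / real (N n)) *\<^sub>R ax j" for n k
 define X where "X n = (1 / real (N n)) *\<^sub>R (\<Sum>k<N n. tr (y n k) g)" for n
 show "lp p (X n) A" for n
 proof -
  have "lp p (\<Sum>k<N n. tr (y n k) g) (\<Sum>k<N n. A)" using g p by (intro lp_sum lp_tr) auto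
  from lp_scaleR[OF this, of "1 / real (N n)"] p show ?thesis by (simp add: X_def N_def)
 qed
 have h0: "(\<lambda>n. h / real (N n)) \<longlonglongrightarrow> 0"
  using tendsto_mult[OF tendsto_const LIMSEQ_inverse_real_of_nat, of h] by (simp add: N_def divide_inverse)
 have e: "norm (X n - dq j h f) \<le> norm (g - dq j (h / real (N n)) f)" for n
 proof -
  have "X n - dq j h f = (1 / real (N n)) *\<^sub>R (\<Sum>k<N n. tr (y n k) (g - dq j (h / real (N n)) f))"
   unfolding X_def y_def by (subst dq_average[of "N n"]) (simp_all add: N_def tr_diff sum_subtractf scaleR_diff_right)
  also have "norm \<dots> \<le> (1 / real (N n)) * (\<Sum>k<N n. norm (g - dq j (h / real (N n)) f))"
   by (simp only: norm_scaleR) (intro mult_mono order_trans[OF norm_sum] sum_mono, auto simp: N_def)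
  finally show ?thesis by (simp add: N_def)
 qed
 have "(\<lambda>n. dq j (h / real (N n)) f) \<longlonglongrightarrow> g"
  by (rule lim[OF h0]) (use h in \<open>simp add: N_def\<close>)
 hence "(\<lambda>n. norm (g - dq j (h / real (N n)) f)) \<longlonglongrightarrow> norm (g - g)"
  by (intro tendsto_norm tendsto_diff tendsto_const)
 hence l0: "(\<lambda>n. norm (g - dq j (h / real (N n)) f)) \<longlonglongrightarrow> 0" by simp
 have "(\<lambda>n. norm (X n - dq j h f)) \<longlonglongrightarrow> 0"
  by (rule tendsto_sandwich[OF _ _ tendsto_const l0]) (simp_all add: e always_eventually)
 thus "X \<longlonglongrightarrow> dq j h f" by (simp add: tendsto_norm_zero_iff LIM_zero_iff)
qed (use p in simp)

section \<open>The Hardy-Littlewood-Sobolev inequality in time\<close>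

text \<open>The decay rate of \<open>dispersive\<close>.\<close>

definition ker :: "real \<Rightarrow> real" where "ker u = \<bar>u\<bar> powr (- 3 / 4)"

lemma ker_nonneg: "0 \<le> ker u" and ker_minus: "ker (- u) = ker u"
 by (simp_all add: ker_def)

lemma ker_sym: "ker (s - t) = ker (t - s)"
 using ker_minus[of "s - t"] by simp

lemma ker_measurable [measurable]: "ker \<in> borel_measurable borel"
 unfolding ker_def[abs_def] by measurable

lemma nn_integral_even:
 assumes [measurable]: "f \<in> borel_measurable borel" and even: "\<And>x::real. f (- x) = f x"
 shows "(\<integral>\<^sup>+x. f x \<partial>lborel) \<le> 2 * (\<integral>\<^sup>+x. f x * indicator {0..} x \<partial>lborel)"
proof -
 let ?g = "\<lambda>x. f x * indicator {0..} x"
 have r: "(\<integral>\<^sup>+x. ?g (- x) \<partial>lborel) = (\<integral>\<^sup>+x. ?g x \<partial>lborel)"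
  using nn_integral_real_affine[of ?g "-1" 0] by simp
 have "(\<integral>\<^sup>+x. f x \<partial>lborel) \<le> (\<integral>\<^sup>+x. ?g x + ?g (- x) \<partial>lborel)"
  by (rule nn_integral_mono) (auto simp: even split: split_indicator)
 also have "\<dots> = (\<integral>\<^sup>+x. ?g x \<partial>lborel) + (\<integral>\<^sup>+x. ?g (- x) \<partial>lborel)"
  by (rule nn_integral_add) measurable
 finally show ?thesis unfolding r by (simp only: mult_2)
qed

lemma ker_near_half:
 assumes "0 \<le> R" shows "(\<integral>\<^sup>+u. ennreal (ker u) * indicator {0..R} u \<partial>lborel) = ennreal (4 * R powr (1 / 4))"
proof -
 have "(\<integral>\<^sup>+u. ennreal (ker u) * indicator {0..R} u \<partial>lborel) = (\<integral>\<^sup>+u. ennreal (u powr (- 3 / 4)) * indicator {0..R} u \<partial>lborel)"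
  by (rule nn_integral_cong) (auto simp: ker_def split: split_indicator)
 also have "\<dots> = ennreal (R powr (- 3 / 4 + 1) / (- 3 / 4 + 1))"
  by (rule nn_integral_has_integral_lebesgue'[OF _ has_integral_powr_from_0]) (use assms in auto)
 finally show ?thesis by simp
qed

lemma ker_near:
 assumes "0 \<le> R" shows "(\<integral>\<^sup>+u. ennreal (ker u) * indicator {- R..R} u \<partial>lborel) \<le> ennreal (8 * R powr (1 / 4))"
proof -
 have "(\<integral>\<^sup>+u. ennreal (ker u) * indicator {- R..R} u \<partial>lborel)
   \<le> 2 * (\<integral>\<^sup>+u. ennreal (ker u) * indicator {- R..R} u * indicator {0..} u \<partial>lborel)"
  by (rule nn_integral_even) (auto simp: ker_minus split: split_indicator)
 also have "(\<integral>\<^sup>+u. ennreal (ker u) * indicator {- R..R} u * indicator {0..} u \<partial>lborel) = (\<integral>\<^sup>+u. ennreal (ker u) * indicator {0..R} u \<partial>lborel)"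
  by (rule nn_integral_cong) (use assms in \<open>auto split: split_indicator\<close>)
 also have "2 * \<dots> = ennreal (2 * (4 * R powr (1 / 4)))"
  unfolding ker_near_half[OF assms] by (simp add: ennreal_mult')
 finally show ?thesis by simp
qed

lemma ker_far:
 assumes R: "0 < R"
 shows "(\<integral>\<^sup>+u. ennreal (\<bar>u\<bar> powr (- 2)) * indicator (- {- R..R}) u \<partial>lborel) \<le> ennreal (2 / R)"
proof -
 have "(\<integral>\<^sup>+u. ennreal (\<bar>u\<bar> powr (- 2)) * indicator (- {- R..R}) u \<partial>lborel)
   \<le> 2 * (\<integral>\<^sup>+u. ennreal (\<bar>u\<bar> powr (- 2)) * indicator (- {- R..R}) u * indicator {0..} u \<partial>lborel)"
  by (rule nn_integral_even) (auto split: split_indicator)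
 also have "(\<integral>\<^sup>+u. ennreal (\<bar>u\<bar> powr (- 2)) * indicator (- {- R..R}) u * indicator {0..} u \<partial>lborel)
   \<le> (\<integral>\<^sup>+u. ennreal (u powr (- 2)) * indicator {R..} u \<partial>lborel)"
  by (rule nn_integral_mono) (use R in \<open>auto split: split_indicator\<close>)
 also have "(\<integral>\<^sup>+u. ennreal (u powr (- 2)) * indicator {R..} u \<partial>lborel) = ennreal (- (R powr (- 2 + 1)) / (- 2 + 1))"
  by (rule nn_integral_has_integral_lebesgue'[OF _ has_integral_powr_to_inf]) (use R in auto)
 also have "2 * ennreal (- (R powr (- 2 + 1)) / (- 2 + 1)) = ennreal (2 * R powr (- 1))"
 proof -
  have "2 * ennreal x = ennreal (2 * x)" for x by (simp add: ennreal_mult')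
  thus ?thesis by simp
 qed
 also have "2 * R powr (- 1) = 2 / R" using R by (simp add: powr_minus divide_inverse)
 finally show ?thesis by (simp add: mult_left_mono)
qed

lemma nn_integral_shift_reflect:
 fixes f :: "real \<Rightarrow> ennreal"
 assumes [measurable]: "f \<in> borel_measurable borel"
 shows "(\<integral>\<^sup>+s. f (t - s) \<partial>lborel) = (\<integral>\<^sup>+u. f u \<partial>lborel)"
 using nn_integral_real_affine[of f "-1" t] by simp

text \<open>
 By symmetry it suffices to integrate over \<open>f s \<le> f t\<close>. For fixed \<open>t\<close> this leaves
 \<open>\<integral> min(f s, M) \<bar>t - s\<bar>\<^sup>-\<^sup>3\<^sup>/\<^sup>4 ds\<close> with \<open>M = f t\<close>, which is split at \<open>\<bar>t - s\<bar> = M\<^sup>-\<^sup>8\<^sup>/\<^sup>5\<close>.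
\<close>

lemma hls_inner:
 assumes f: "Lp_le lborel (8 / 5) f 1" and f0: "\<And>s. 0 \<le> f s" and M: "0 < M"
 shows "(\<integral>\<^sup>+s. ennreal (f s * ker (t - s)) * indicator {s. f s \<le> M} s \<partial>lborel) \<le> ennreal (11 * M powr (3 / 5))"
proof -
 have [measurable]: "f \<in> borel_measurable borel" using Lp_leD(1)[OF f] by simp
 define R where "R = M powr (- 8 / 5)"
 have R: "0 < R" using M by (simp add: R_def)
 define g1 where "g1 u = ennreal M * (ennreal (ker u) * indicator {- R..R} u)" for u
 define g2 where "g2 s = ennreal (M powr (3 / 5)) * ennreal (\<bar>f s\<bar> powr (8 / 5))" for s
 define g3 where "g3 u = ennreal (1 / M) * (ennreal (\<bar>u\<bar> powr (- 2)) * indicator (- {- R..R}) u)" for u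
 have [measurable]: "g1 \<in> borel_measurable borel" "g2 \<in> borel_measurable borel" "g3 \<in> borel_measurable borel"
  unfolding g1_def g2_def g3_def by measurable
 \<comment> \<open>Used away from the diagonal. The weights 5/8 and 3/8 turn the two terms into f
   and |u|^(-3/4), and the powers of M cancel because 3/5 times 5/8 is 3/8. The power |u|^-2 is
   integrable at infinity.\<close>
 have young: "f s * ker u \<le> M powr (3 / 5) * f s powr (8 / 5) + 1 / M * \<bar>u\<bar> powr (- 2)" for s u
 proof -
  have "(M powr (3 / 5) * f s powr (8 / 5)) powr (5 / 8) * (1 / M * \<bar>u\<bar> powr (- 2)) powr (3 / 8)
    \<le> 5 / 8 * (M powr (3 / 5) * f s powr (8 / 5)) + 3 / 8 * (1 / M * \<bar>u\<bar> powr (- 2))"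
   by (rule weighted_amgm) (use M in auto)
  also have "\<dots> \<le> 1 * (M powr (3 / 5) * f s powr (8 / 5)) + 1 * (1 / M * \<bar>u\<bar> powr (- 2))"
   by (intro add_mono mult_right_mono) (use M in auto)
  also have "(M powr (3 / 5) * f s powr (8 / 5)) powr (5 / 8) * (1 / M * \<bar>u\<bar> powr (- 2)) powr (3 / 8)
    = (M powr (3 / 8) * (1 / M) powr (3 / 8)) * (f s * ker u)"
  proof -
   have "(M powr (3 / 5) * f s powr (8 / 5)) powr (5 / 8) = M powr (3 / 8) * f s"
    using f0[of s] M by (simp add: powr_mult powr_powr)
   moreover have "(1 / M * \<bar>u\<bar> powr (- 2)) powr (3 / 8) = (1 / M) powr (3 / 8) * ker u"
    by (subst powr_mult) (use M in \<open>simp_all add: ker_def powr_powr\<close>)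
   ultimately show ?thesis by (simp only: mult_ac)
  qed
  also have "M powr (3 / 8) * (1 / M) powr (3 / 8) = 1" using M by (simp add: powr_divide)
  finally show ?thesis by simp
 qed
 have pt: "ennreal (f s * ker (t - s)) * indicator {s. f s \<le> M} s \<le> g1 (t - s) + (g2 s + g3 (t - s))" for s
 proof (cases "f s \<le> M")
  case True
  show ?thesis
  proof (cases "t - s \<in> {- R..R}")
   case in_R: True
   have "ennreal (f s * ker (t - s)) \<le> ennreal (M * ker (t - s))"
    using True ker_nonneg by (intro ennreal_leI mult_right_mono)
   also have "\<dots> = g1 (t - s)" using in_R M by (simp add: g1_def ennreal_mult' ker_nonneg)
   finally show ?thesis using True by (simp add: add_increasing2)
  next
   case False
   have "ennreal (f s * ker (t - s)) \<le> ennreal (M powr (3 / 5) * f s powr (8 / 5) + 1 / M * \<bar>t - s\<bar> powr (- 2))"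
    by (rule ennreal_leI[OF young])
   also have "\<dots> = ennreal (M powr (3 / 5) * f s powr (8 / 5)) + ennreal (1 / M * \<bar>t - s\<bar> powr (- 2))"
    using M by (intro ennreal_plus) auto
   also have "\<dots> = g2 s + g3 (t - s)"
   proof -
    have gen: "ennreal (a * b) + ennreal (c * d) = ennreal a * ennreal b + ennreal c * ennreal d"
     if "0 \<le> a" "0 \<le> c" for a b c d
     using that by (simp add: ennreal_mult')
    have i: "indicator (- {- R..R}) (t - s) = (1 :: ennreal)" using False by simp
    show ?thesis unfolding g2_def g3_def i mult_1_right abs_of_nonneg[OF f0]
     by (rule gen) (use M in simp_all)
   qed
   finally show ?thesis using True by (simp add: add_increasing)
  qed
 qed simp
 have "(\<integral>\<^sup>+s. ennreal (f s * ker (t - s)) * indicator {s. f s \<le> M} s \<partial>lborel) \<le> (\<integral>\<^sup>+s. g1 (t - s) + (g2 s + g3 (t - s)) \<partial>lborel)"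
  by (intro nn_integral_mono pt)
 also have "\<dots> = (\<integral>\<^sup>+s. g1 (t - s) \<partial>lborel) + ((\<integral>\<^sup>+s. g2 s \<partial>lborel) + (\<integral>\<^sup>+s. g3 (t - s) \<partial>lborel))"
  by (subst nn_integral_add, measurable, subst nn_integral_add, measurable)
 also have "(\<integral>\<^sup>+s. g1 (t - s) \<partial>lborel) = (\<integral>\<^sup>+u. g1 u \<partial>lborel)" by (rule nn_integral_shift_reflect) measurable
 also have "\<dots> = ennreal M * (\<integral>\<^sup>+u. ennreal (ker u) * indicator {- R..R} u \<partial>lborel)"
  unfolding g1_def by (rule nn_integral_cmult) measurable
 also have "\<dots> \<le> ennreal M * ennreal (8 * R powr (1 / 4))"
  using R by (intro mult_left_mono ker_near) auto
 also have "\<dots> = ennreal (8 * M powr (3 / 5))"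
 proof -
  have "M * R powr (1 / 4) = M powr 1 * M powr (- 2 / 5)" using M by (simp add: R_def powr_powr)
  also have "\<dots> = M powr (3 / 5)" by (simp only: powr_add[symmetric]) simp
  finally show ?thesis using M by (simp add: ennreal_mult'[symmetric])
 qed
 also have "(\<integral>\<^sup>+s. g2 s \<partial>lborel) = ennreal (M powr (3 / 5)) * (\<integral>\<^sup>+s. ennreal (\<bar>f s\<bar> powr (8 / 5)) \<partial>lborel)"
  unfolding g2_def by (rule nn_integral_cmult) measurable
 also have "\<dots> \<le> ennreal (M powr (3 / 5)) * ennreal 1"
  using Lp_leD(3)[OF f] by (intro mult_left_mono) auto
 also have "(\<integral>\<^sup>+s. g3 (t - s) \<partial>lborel) = (\<integral>\<^sup>+u. g3 u \<partial>lborel)" by (rule nn_integral_shift_reflect) measurable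
 also have "\<dots> = ennreal (1 / M) * (\<integral>\<^sup>+u. ennreal (\<bar>u\<bar> powr (- 2)) * indicator (- {- R..R}) u \<partial>lborel)"
  unfolding g3_def by (rule nn_integral_cmult) measurable
 also have "\<dots> \<le> ennreal (1 / M) * ennreal (2 / R)" using R by (intro mult_left_mono ker_far) auto
 also have "\<dots> = ennreal (2 * M powr (3 / 5))"
 proof -
  have "1 / M * (2 / R) = 2 * (M powr (- 1) * M powr (8 / 5))"
  proof -
   have "R = M powr (- (8 / 5))" by (simp add: R_def)
   hence e1: "R = inverse (M powr (8 / 5))" by (simp only: powr_minus)
   have e2: "M powr (- 1) = 1 / M" using M by (subst powr_minus_divide) simp
   have "1 / M * (2 / inverse x) = 2 * (1 / M * x)" for x by (simp add: divide_inverse)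
   thus ?thesis unfolding e1 e2 .
  qed
  also have "M powr (- 1) * M powr (8 / 5) = M powr (3 / 5)" by (simp only: powr_add[symmetric]) simp
  finally have "ennreal (1 / M * (2 / R)) = ennreal (2 * M powr (3 / 5))" by (rule arg_cong)
  thus ?thesis using M by (simp only: ennreal_mult' less_imp_le[OF M] zero_le_divide_1_iff)
 qed
 \<comment> \<open>The choice of R makes all contributions scale like M^(3/5): 8 from near the
   diagonal, 1 from the normalisation of f, 2 from the tail of |u|^-2.\<close>
 also have "ennreal (8 * M powr (3 / 5)) + (ennreal (M powr (3 / 5)) * ennreal 1 + ennreal (2 * M powr (3 / 5)))
   = ennreal (11 * M powr (3 / 5))"
 proof -
  have "ennreal (8 * x) + (ennreal x + ennreal (2 * x)) = ennreal (11 * x)" if "0 \<le> x" for x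
   using that by (simp add: ennreal_plus[symmetric] del: ennreal_plus)
  thus ?thesis by simp
 qed
 finally show ?thesis by (simp add: add_mono)
qed

text \<open>With M = f t the inner bound times f t is 11 f(t)^(8/5), whose integral is at most 11.
  The other half of the plane gives at most the same after exchanging the variables.\<close>

lemma hls_diag:
 assumes f: "Lp_le lborel (8 / 5) f 1" and f0: "\<And>s. 0 \<le> f s"
 shows "(\<integral>\<^sup>+t. (\<integral>\<^sup>+s. ennreal (f s * f t * ker (t - s)) \<partial>lborel) \<partial>lborel) \<le> ennreal 22"
proof -
 have [measurable]: "f \<in> borel_measurable borel" using Lp_leD(1)[OF f] by simp
 define h where "h s t = ennreal (f s * f t * ker (t - s)) * indicator {p. f (fst p) \<le> f (snd p)} (s, t)" for s t
 have hm [measurable]: "(\<lambda>p. h (fst p) (snd p)) \<in> borel_measurable (borel \<Otimes>\<^sub>M borel)"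
  unfolding h_def by measurable
 have hm' [measurable]: "(\<lambda>s. h s t) \<in> borel_measurable borel" "(\<lambda>s. h t s) \<in> borel_measurable borel" for t
  unfolding h_def by measurable
 have half: "(\<integral>\<^sup>+t. (\<integral>\<^sup>+s. h s t \<partial>lborel) \<partial>lborel) \<le> ennreal 11"
 proof -
  have "(\<integral>\<^sup>+s. h s t \<partial>lborel) \<le> ennreal 11 * ennreal (\<bar>f t\<bar> powr (8 / 5))" for t
  proof (cases "f t = 0")
   case False
   hence M: "0 < f t" using f0[of t] by simp
   have "(\<integral>\<^sup>+s. h s t \<partial>lborel) = (\<integral>\<^sup>+s. ennreal (f t) * (ennreal (f s * ker (t - s)) * indicator {s. f s \<le> f t} s) \<partial>lborel)"
    by (rule nn_integral_cong) (auto simp: h_def ennreal_mult'[symmetric] f0 mult_ac split: split_indicator)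
   also have "\<dots> = ennreal (f t) * (\<integral>\<^sup>+s. ennreal (f s * ker (t - s)) * indicator {s. f s \<le> f t} s \<partial>lborel)"
    by (rule nn_integral_cmult) measurable
   also have "\<dots> \<le> ennreal (f t) * ennreal (11 * f t powr (3 / 5))"
    by (intro mult_left_mono hls_inner f f0 M) auto
   also have "\<dots> = ennreal (11 * (f t powr 1 * f t powr (3 / 5)))"
    using M by (simp add: ennreal_mult'[symmetric] mult_ac)
   also have "f t powr 1 * f t powr (3 / 5) = f t powr (8 / 5)" by (simp only: powr_add[symmetric]) simp
   finally show ?thesis using M by (simp add: ennreal_mult')
  qed (simp add: h_def)
  hence "(\<integral>\<^sup>+t. (\<integral>\<^sup>+s. h s t \<partial>lborel) \<partial>lborel) \<le> (\<integral>\<^sup>+t. ennreal 11 * ennreal (\<bar>f t\<bar> powr (8 / 5)) \<partial>lborel)"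
   by (rule nn_integral_mono)
  also have "\<dots> = ennreal 11 * (\<integral>\<^sup>+t. ennreal (\<bar>f t\<bar> powr (8 / 5)) \<partial>lborel)"
   by (rule nn_integral_cmult) measurable
  also have "\<dots> \<le> ennreal 11 * ennreal 1" using Lp_leD(3)[OF f] by (intro mult_left_mono) auto
  finally show ?thesis by simp
 qed
 have "(\<integral>\<^sup>+t. (\<integral>\<^sup>+s. ennreal (f s * f t * ker (t - s)) \<partial>lborel) \<partial>lborel)
  \<le> (\<integral>\<^sup>+t. (\<integral>\<^sup>+s. h s t + h t s \<partial>lborel) \<partial>lborel)"
  by (intro nn_integral_mono) (auto simp: h_def ker_sym mult_ac split: split_indicator)
 also have "\<dots> = (\<integral>\<^sup>+t. (\<integral>\<^sup>+s. h s t \<partial>lborel) + (\<integral>\<^sup>+s. h t s \<partial>lborel) \<partial>lborel)"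
  by (intro nn_integral_cong nn_integral_add) measurable
 also have "\<dots> = (\<integral>\<^sup>+t. (\<integral>\<^sup>+s. h s t \<partial>lborel) \<partial>lborel) + (\<integral>\<^sup>+t. (\<integral>\<^sup>+s. h t s \<partial>lborel) \<partial>lborel)"
  unfolding h_def by (rule nn_integral_add) measurable
 also have "(\<integral>\<^sup>+t. (\<integral>\<^sup>+s. h t s \<partial>lborel) \<partial>lborel) = (\<integral>\<^sup>+s. (\<integral>\<^sup>+t. h t s \<partial>lborel) \<partial>lborel)"
  by (rule lborel_pair.Fubini') (unfold h_def, measurable)
 also have "(\<integral>\<^sup>+t. (\<integral>\<^sup>+s. h s t \<partial>lborel) \<partial>lborel) + (\<integral>\<^sup>+s. (\<integral>\<^sup>+t. h t s \<partial>lborel) \<partial>lborel) \<le> ennreal 11 + ennreal 11"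
  by (intro add_mono half)
 also have "\<dots> = ennreal 22" by (subst ennreal_plus[symmetric]) auto
 finally show ?thesis .
qed

theorem hls:
 assumes f: "Lp_le lborel (8 / 5) f A" and g: "Lp_le lborel (8 / 5) g B" and nn: "\<And>s. 0 \<le> f s" "\<And>s. 0 \<le> g s"
 shows "(\<integral>\<^sup>+t. (\<integral>\<^sup>+s. ennreal (f s * g t * ker (t - s)) \<partial>lborel) \<partial>lborel) \<le> ennreal (88 * A * B)"
proof -
 have A0: "0 \<le> A" "0 \<le> B" using f g by (auto dest: Lp_leD)
 have main: "(\<integral>\<^sup>+t. (\<integral>\<^sup>+s. ennreal (f s * g t * ker (t - s)) \<partial>lborel) \<partial>lborel) \<le> ennreal (88 * A * B)"
  if f: "Lp_le lborel (8 / 5) f A" and g: "Lp_le lborel (8 / 5) g B" and pos: "0 < A" "0 < B" for A B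
 proof -
  have [measurable]: "f \<in> borel_measurable borel" "g \<in> borel_measurable borel"
   using Lp_leD(1)[OF f] Lp_leD(1)[OF g] by simp_all
  \<comment> \<open>Polarisation for nonnegative functions: h has norm at most 1 and dominates both
    f/(2A) and g/(2B), so the diagonal case yields the factor 4 times 22.\<close>
  define h where "h s = 1 / (2 * A) * f s + 1 / (2 * B) * g s" for s
  have h0: "0 \<le> h s" for s using nn pos by (simp add: h_def)
  have [measurable]: "h \<in> borel_measurable borel" unfolding h_def by measurable
  have "Lp_le lborel (8 / 5) h (\<bar>1 / (2 * A)\<bar> * A + \<bar>1 / (2 * B)\<bar> * B)"
   unfolding h_def[abs_def] by (intro Lp_le_add Lp_le_cmult f g) auto
  hence h: "Lp_le lborel (8 / 5) h 1" using pos by simp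
  have pt: "f s * g t * ker (t - s) \<le> 4 * A * B * (h s * h t * ker (t - s))" for s t
  proof -
   have "f s \<le> 2 * A * h s" "g t \<le> 2 * B * h t"
    using pos nn[of s] nn[of t] by (auto simp: h_def distrib_left)
   hence "f s * g t \<le> (2 * A * h s) * (2 * B * h t)"
    using nn pos h0 by (intro mult_mono) auto
   hence "f s * g t * ker (t - s) \<le> (2 * A * h s) * (2 * B * h t) * ker (t - s)"
    by (rule mult_right_mono[OF _ ker_nonneg])
   thus ?thesis by (simp add: mult_ac)
  qed
  have "(\<integral>\<^sup>+t. (\<integral>\<^sup>+s. ennreal (f s * g t * ker (t - s)) \<partial>lborel) \<partial>lborel)
   \<le> (\<integral>\<^sup>+t. (\<integral>\<^sup>+s. ennreal (4 * A * B) * ennreal (h s * h t * ker (t - s)) \<partial>lborel) \<partial>lborel)"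
   using pt pos by (intro nn_integral_mono) (simp add: ennreal_mult'[symmetric] ennreal_leI)
  also have "\<dots> = (\<integral>\<^sup>+t. ennreal (4 * A * B) * (\<integral>\<^sup>+s. ennreal (h s * h t * ker (t - s)) \<partial>lborel) \<partial>lborel)"
   by (intro nn_integral_cong nn_integral_cmult) measurable
  also have "\<dots> = ennreal (4 * A * B) * (\<integral>\<^sup>+t. (\<integral>\<^sup>+s. ennreal (h s * h t * ker (t - s)) \<partial>lborel) \<partial>lborel)"
   by (rule nn_integral_cmult) measurable
  also have "\<dots> \<le> ennreal (4 * A * B) * ennreal 22"
   by (intro mult_left_mono hls_diag h h0) auto
  also have "\<dots> = ennreal (88 * A * B)"
   using pos by (subst ennreal_mult'[symmetric]) (auto simp: mult_ac)
  finally show ?thesis .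
 qed
 show ?thesis
 proof (rule LIMSEQ_le_const)
  let ?A = "\<lambda>n. A + inverse (real (Suc n))" and ?B = "\<lambda>n. B + inverse (real (Suc n))"
  have "(\<lambda>n. 88 * ?A n * ?B n) \<longlonglongrightarrow> 88 * (A + 0) * (B + 0)"
   by (intro tendsto_intros LIMSEQ_inverse_real_of_nat)
  thus "(\<lambda>n. ennreal (88 * ?A n * ?B n)) \<longlonglongrightarrow> ennreal (88 * A * B)"
   by (intro tendsto_ennrealI) simp
  have "(\<integral>\<^sup>+t. (\<integral>\<^sup>+s. ennreal (f s * g t * ker (t - s)) \<partial>lborel) \<partial>lborel) \<le> ennreal (88 * ?A n * ?B n)" for n
   by (rule main[OF Lp_le_weaken[OF f] Lp_le_weaken[OF g]]) (use A0 in \<open>auto intro!: add_nonneg_pos\<close>)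
  thus "\<exists>N. \<forall>n\<ge>N. (\<integral>\<^sup>+t. (\<integral>\<^sup>+s. ennreal (f s * g t * ker (t - s)) \<partial>lborel) \<partial>lborel) \<le> ennreal (88 * ?A n * ?B n)"
   by blast
 qed
qed

lemma powr_self_bound:
 fixes Y C :: real
 assumes "0 \<le> Y" "Y \<le> C * Y powr (5 / 8)" "0 \<le> C"
 shows "Y \<le> C powr (8 / 3)"
proof (cases "Y = 0")
 case False
 hence pos: "0 < Y" using assms by simp
 have "Y powr (3 / 8) * Y powr (5 / 8) \<le> C * Y powr (5 / 8)"
  using assms(2) pos by (simp add: powr_add[symmetric])
 hence "Y powr (3 / 8) \<le> C" using pos by simp
 hence "(Y powr (3 / 8)) powr (8 / 3) \<le> C powr (8 / 3)" by (intro powr_mono2) auto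
 thus ?thesis using pos by (simp add: powr_powr)
qed (simp add: assms)

text \<open>Duality by testing q with q^(5/3), whose L^(8/5) norm is Y^(5/8) for Y the integral of
  q^(8/3). Then \<open>hls\<close> gives Y at most a constant times Y^(5/8). Dividing needs Y
  finite, hence the truncations k in height and in support.\<close>

lemma hls_dual:
 assumes \<gamma>: "Lp_le lborel (8 / 5) \<gamma> A" and \<gamma>0: "\<And>s. 0 \<le> \<gamma> s"
  and q [measurable]: "q \<in> borel_measurable borel" and q0: "\<And>t. 0 \<le> q t"
  and le: "\<And>t. ennreal (q t) \<le> ennreal C * (\<integral>\<^sup>+s. ennreal (\<gamma> s * ker (t - s)) \<partial>lborel)" and C: "0 \<le> C"
 shows "L83 q (88 * C * A)"
proof -
 have A0: "0 \<le> A" using \<gamma> by (rule Lp_leD)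
 have [measurable]: "\<gamma> \<in> borel_measurable borel" using Lp_leD(1)[OF \<gamma>] by simp
 define k where "k n t = min (q t) (real n) * indicator {- real n..real n} t" for n t
 have km [measurable]: "k n \<in> borel_measurable borel" for n unfolding k_def by measurable
 have k0: "0 \<le> k n t" "k n t \<le> q t" "k n t \<le> real n * indicator {- real n..real n} t" for n t
  using q0[of t] by (auto simp: k_def split: split_indicator)
 have main: "L83 (k n) (88 * C * A)" for n
 proof -
  define Y where "Y = enn2real (\<integral>\<^sup>+t. ennreal (k n t powr (8 / 3)) \<partial>lborel)"
  have "(\<integral>\<^sup>+t. ennreal (k n t powr (8 / 3)) \<partial>lborel) \<le> (\<integral>\<^sup>+t. ennreal (real n powr (8 / 3)) * indicator {- real n..real n} t \<partial>lborel)"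
  proof (rule nn_integral_mono)
   fix t
   show "ennreal (k n t powr (8 / 3)) \<le> ennreal (real n powr (8 / 3)) * indicator {- real n..real n} t"
    using k0(1,3)[of n t] by (auto split: split_indicator intro!: ennreal_leI powr_mono2)
  qed
  also have "\<dots> < \<infinity>" by (simp add: nn_integral_cmult_indicator ennreal_mult_less_top)
  finally have Y: "(\<integral>\<^sup>+t. ennreal (k n t powr (8 / 3)) \<partial>lborel) = ennreal Y"
   by (simp add: Y_def less_top)
  have Y0: "0 \<le> Y" by (simp add: Y_def)
  define g where "g t = k n t powr (5 / 3)" for t
  have g: "Lp_le lborel (8 / 5) g (Y powr (5 / 8))"
   unfolding Lp_le_def g_def using Y Y0 by (simp add: powr_powr)
  have "ennreal Y = (\<integral>\<^sup>+t. ennreal (k n t) * ennreal (g t) \<partial>lborel)"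
  proof -
   have "k n t powr (8 / 3) = k n t * g t" for t
    using k0(1)[of n t] powr_add[of "k n t" 1 "5 / 3"] by (simp add: g_def)
   thus ?thesis unfolding Y[symmetric] using k0(1) by (simp add: ennreal_mult' )
  qed
  also have "\<dots> \<le> (\<integral>\<^sup>+t. ennreal C * (\<integral>\<^sup>+s. ennreal (\<gamma> s * g t * ker (t - s)) \<partial>lborel) \<partial>lborel)"
  proof (rule nn_integral_mono)
   fix t
   have "ennreal (k n t) * ennreal (g t) \<le> (ennreal C * (\<integral>\<^sup>+s. ennreal (\<gamma> s * ker (t - s)) \<partial>lborel)) * ennreal (g t)"
    by (intro mult_right_mono order_trans[OF ennreal_leI[OF k0(2)] le]) auto
   also have "\<dots> = ennreal C * ((\<integral>\<^sup>+s. ennreal (\<gamma> s * ker (t - s)) \<partial>lborel) * ennreal (g t))"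
    by (rule mult.assoc)
   also have "(\<integral>\<^sup>+s. ennreal (\<gamma> s * ker (t - s)) \<partial>lborel) * ennreal (g t) = (\<integral>\<^sup>+s. ennreal (\<gamma> s * ker (t - s)) * ennreal (g t) \<partial>lborel)"
    by (rule nn_integral_multc[symmetric]) measurable
   also have "\<dots> = (\<integral>\<^sup>+s. ennreal (\<gamma> s * g t * ker (t - s)) \<partial>lborel)"
    by (intro nn_integral_cong) (simp add: ennreal_mult'[symmetric] \<gamma>0 ker_nonneg mult_ac g_def)
   finally show "ennreal (k n t) * ennreal (g t) \<le> ennreal C * (\<integral>\<^sup>+s. ennreal (\<gamma> s * g t * ker (t - s)) \<partial>lborel)" .
  qed
  also have "\<dots> = ennreal C * (\<integral>\<^sup>+t. (\<integral>\<^sup>+s. ennreal (\<gamma> s * g t * ker (t - s)) \<partial>lborel) \<partial>lborel)"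
   unfolding g_def by (rule nn_integral_cmult) measurable
  also have "\<dots> \<le> ennreal C * ennreal (88 * A * Y powr (5 / 8))"
   by (intro mult_left_mono hls \<gamma> g \<gamma>0) (auto simp: g_def)
  also have "\<dots> = ennreal (88 * C * A * Y powr (5 / 8))" using C A0 by (simp add: ennreal_mult'[symmetric] mult_ac)
  finally have "Y \<le> 88 * C * A * Y powr (5 / 8)" using C A0 by (simp add: ennreal_le_iff)
  hence "Y \<le> (88 * C * A) powr (8 / 3)" using Y0 C A0 by (intro powr_self_bound) auto
  thus ?thesis using Y k0(1) C A0 by (simp add: Lp_le_def ennreal_leI)
 qed
 show ?thesis
 proof (rule Lp_le_Fatou[OF main])
  show "AE t in lborel. (\<lambda>n. k n t) \<longlonglongrightarrow> q t"
  proof (rule AE_I2)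
   fix t
   obtain N :: nat where N: "max (q t) \<bar>t\<bar> \<le> real N" using real_arch_simple by blast
   have "\<forall>\<^sub>F n in sequentially. k n t = q t"
    by (rule eventually_sequentiallyI[of N]) (use N in \<open>auto simp: k_def split: split_indicator\<close>)
   thus "(\<lambda>n. k n t) \<longlonglongrightarrow> q t" by (rule tendsto_eventually)
  qed
 qed auto
qed

subsection \<open>A singular Gronwall lemma\<close>

text \<open>Let \<tau> be the infimum of the times at which d is nonzero. On a window of length
  \<eta> after \<tau> the singular kernel has small mass, so d is at most half of its own finite
  supremum there. Hence d vanishes on the window, against the choice of \<tau>.\<close>

lemma singular_gronwall:
 fixes d :: "real \<Rightarrow> real"
 assumes d0: "\<And>t. 0 \<le> d t" and bd: "\<And>t. 0 \<le> t \<Longrightarrow> t \<le> T \<Longrightarrow> d t \<le> B" and A: "0 \<le> A"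
  and le: "\<And>t. 0 \<le> t \<Longrightarrow> t \<le> T \<Longrightarrow> ennreal (d t) \<le> ennreal A * (\<integral>\<^sup>+s. ennreal (ker (t - s) * d s) * indicator {0..t} s \<partial>lborel)"
  and t: "0 \<le> t" "t \<le> T"
 shows "d t = 0"
proof (rule ccontr)
 assume "d t \<noteq> 0"
 define Z where "Z = {t. 0 \<le> t \<and> t \<le> T \<and> d t \<noteq> 0}"
 have Z: "Z \<noteq> {}" "bdd_below Z" using \<open>d t \<noteq> 0\<close> t by (auto simp: Z_def bdd_below_def)
 define \<tau> where "\<tau> = Inf Z"
 have \<tau>0: "0 \<le> \<tau>" unfolding \<tau>_def by (rule cInf_greatest[OF Z(1)]) (auto simp: Z_def)
 have zero: "d s = 0" if "0 \<le> s" "s < \<tau>" "s \<le> T" for s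
  using cInf_lower[OF _ Z(2), of s] that by (force simp: Z_def \<tau>_def)
 \<comment> \<open>The kernel has mass 4 \<eta>^(1/4) on a one-sided window of length \<eta>; this
   choice makes A times it at most 1/2, and A + 1 in place of A avoids a division by 0.\<close>
 define \<eta> where "\<eta> = (1 / (8 * (A + 1))) powr 4"
 have \<eta>: "0 < \<eta>" "A * (4 * \<eta> powr (1 / 4)) \<le> 1 / 2"
 proof -
  have "\<eta> powr (1 / 4) = 1 / (8 * (A + 1))"
   unfolding \<eta>_def by (subst powr_powr) (use A in simp)
  hence "8 * (A + 1) * \<eta> powr (1 / 4) = 1" using A by simp
  hence "A * (4 * \<eta> powr (1 / 4)) = 1 / 2 - 4 * \<eta> powr (1 / 4)" by (simp add: algebra_simps)
  thus "A * (4 * \<eta> powr (1 / 4)) \<le> 1 / 2" using powr_ge_zero[of \<eta> "1 / 4"] by linarith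
 qed (use A in \<open>simp add: \<eta>_def\<close>)
 define W where "W = {s. \<tau> \<le> s \<and> s \<le> \<tau> + \<eta> \<and> s \<le> T}"
 obtain t1 where t1: "t1 \<in> Z" "t1 < \<tau> + \<eta>"
  using cInf_lessD[OF Z(1), of "\<tau> + \<eta>"] \<eta>(1) by (auto simp: \<tau>_def)
 have t1W: "t1 \<in> W" "0 < d t1"
  using t1 cInf_lower[OF t1(1) Z(2)] d0[of t1] by (auto simp: W_def Z_def \<tau>_def)
 define D where "D = Sup (d ` W)"
 have bdd: "bdd_above (d ` W)"
  using bd \<tau>0 by (auto simp: bdd_above_def W_def intro!: exI[of _ B])
 have dD: "d s \<le> D" if "s \<in> W" for s unfolding D_def by (rule cSup_upper[OF _ bdd]) (use that in auto)
 have D0: "0 < D" using dD[OF t1W(1)] t1W(2) by linarith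
 have half: "d u \<le> D / 2" if u: "u \<in> W" for u
 proof -
  have uT: "0 \<le> u" "u \<le> T" using u \<tau>0 by (auto simp: W_def)
  have "(\<integral>\<^sup>+s. ennreal (ker (u - s) * d s) * indicator {0..u} s \<partial>lborel)
    \<le> (\<integral>\<^sup>+s. ennreal D * (ennreal (ker (u - s)) * indicator {0..\<eta>} (u - s)) \<partial>lborel)"
  proof (rule nn_integral_mono)
   fix s
   show "ennreal (ker (u - s) * d s) * indicator {0..u} s \<le> ennreal D * (ennreal (ker (u - s)) * indicator {0..\<eta>} (u - s))"
   proof (cases "0 \<le> s \<and> s \<le> u \<and> \<tau> \<le> s")
    case True
    hence "s \<in> W" using u by (auto simp: W_def)
    moreover have "u - s \<in> {0..\<eta>}" using True u by (auto simp: W_def)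
    moreover have "ennreal (ker (u - s) * d s) \<le> ennreal (D * ker (u - s))"
     using dD[OF \<open>s \<in> W\<close>] mult_right_mono[OF _ ker_nonneg[of "u - s"]] by (intro ennreal_leI) (simp add: mult.commute)
    ultimately show ?thesis using True D0 by (simp add: ennreal_mult')
   next
    case False
    have "s \<notin> {0..u} \<or> d s = 0"
     using False zero[of s] uT by auto
    thus ?thesis by auto
   qed
  qed
  also have "\<dots> = ennreal D * (\<integral>\<^sup>+s. ennreal (ker (u - s)) * indicator {0..\<eta>} (u - s) \<partial>lborel)"
   by (rule nn_integral_cmult) measurable
  also have "(\<integral>\<^sup>+s. ennreal (ker (u - s)) * indicator {0..\<eta>} (u - s) \<partial>lborel) = ennreal (4 * \<eta> powr (1 / 4))"
   using nn_integral_shift_reflect[of "\<lambda>x. ennreal (ker x) * indicator {0..\<eta>} x" u] \<eta>(1)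
   by (simp add: ker_near_half)
  finally have "ennreal (d u) \<le> ennreal A * (ennreal D * ennreal (4 * \<eta> powr (1 / 4)))"
   by (intro order_trans[OF le[OF uT]] mult_left_mono) auto
  also have "\<dots> = ennreal (A * (4 * \<eta> powr (1 / 4)) * D)" using A D0 by (simp add: ennreal_mult'[symmetric] mult_ac)
  also have "\<dots> \<le> ennreal (1 / 2 * D)" using \<eta>(2) D0 by (intro ennreal_leI mult_right_mono) auto
  finally show ?thesis using D0 by (simp add: ennreal_le_iff)
 qed
 have "D \<le> D / 2" unfolding D_def[of ] by (rule cSup_least) (use t1W half in \<open>auto simp: D_def\<close>)
 thus False using D0 by simp
qed

section \<open>Strichartz estimates\<close>

lemma S_pairing:
 assumes f: "lp (4 / 3) f A" and g: "lp (4 / 3) g B" and t: "t \<noteq> 0"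
 shows "\<bar>S t f \<bullet> g\<bar> \<le> ker t * A * B"
proof -
 have "cmod (cinner (S t f) g) \<le> (\<bar>t\<bar> powr (- 3 / 4) * A) * B"
  by (rule cinner_lp[OF dispersive[OF f t] g])
 moreover have "\<bar>S t f \<bullet> g\<bar> \<le> cmod (cinner (S t f) g)"
  using abs_Re_le_cmod[of "cinner (S t f) g"] by (simp add: Re_cinner)
 ultimately show ?thesis by (simp add: ker_def)
qed

lemma integrable_S:
 fixes G :: "real \<Rightarrow> L2"
 assumes G: "integrable lborel G"
 shows "integrable lborel (\<lambda>s. S (t - s) (G s))" "integrable lborel (\<lambda>s. S (- s) (G s))"
proof -
 have [measurable]: "G \<in> borel_measurable borel" using G by (auto dest: borel_measurable_integrable)
 show "integrable lborel (\<lambda>s. S (t - s) (G s))"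
  by (rule Bochner_Integration.integrable_bound[OF integrable_norm[OF G]]) auto
 show "integrable lborel (\<lambda>s. S (- s) (G s))"
  by (rule Bochner_Integration.integrable_bound[OF integrable_norm[OF G]]) auto
qed

text \<open>The \<open>T T\<^sup>*\<close> argument: the square of the norm is a double integral of \<open>\<langle>S(s - t) G t, G s\<rangle>\<close>.\<close>

theorem strichartz_dual:
 assumes G: "integrable lborel G" and \<gamma>: "Lp_le lborel (8 / 5) \<gamma> A" and \<gamma>0: "\<And>s. 0 \<le> \<gamma> s"
  and lpG: "AE s in lborel. lp (4 / 3) (G s) (\<gamma> s)"
 shows "norm (\<integral>s. S (- s) (G s) \<partial>lborel) \<le> 10 * A"
proof -
 have A0: "0 \<le> A" using \<gamma> by (rule Lp_leD)
 have [measurable]: "\<gamma> \<in> borel_measurable borel" using Lp_leD(1)[OF \<gamma>] by simp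
 let ?u = "\<lambda>s. S (- s) (G s)"
 let ?v = "\<integral>s. S (- s) (G s) \<partial>lborel"
 have iu: "integrable lborel ?u" by (rule integrable_S(2)[OF G])
 have in1: "ennreal \<bar>?v \<bullet> w\<bar> \<le> (\<integral>\<^sup>+t. ennreal \<bar>?u t \<bullet> w\<bar> \<partial>lborel)" for w
 proof -
  have e: "?v \<bullet> w = (\<integral>t. ?u t \<bullet> w \<partial>lborel)" by (rule integral_inner_left[symmetric]) (use iu in auto)
  show ?thesis unfolding e using integral_norm_bound_ennreal[OF integrable_inner_left[of w, OF iu]] iu by simp
 qed
 have "ennreal ((norm ?v)\<^sup>2) \<le> (\<integral>\<^sup>+s. ennreal \<bar>?u s \<bullet> ?v\<bar> \<partial>lborel)"
  using in1[of ?v] by (simp add: power2_norm_eq_inner)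
 also have "\<dots> \<le> (\<integral>\<^sup>+s. (\<integral>\<^sup>+t. ennreal (\<gamma> t * \<gamma> s * ker (s - t)) \<partial>lborel) \<partial>lborel)"
 proof (rule nn_integral_mono_AE, use lpG in eventually_elim)
  case (elim s)
  note lps = elim
  have "ennreal \<bar>?u s \<bullet> ?v\<bar> = ennreal \<bar>?v \<bullet> ?u s\<bar>" by (simp add: inner_commute)
  also have "\<dots> \<le> (\<integral>\<^sup>+t. ennreal \<bar>?u t \<bullet> ?u s\<bar> \<partial>lborel)" by (rule in1)
  also have "\<dots> \<le> (\<integral>\<^sup>+t. ennreal (\<gamma> t * \<gamma> s * ker (s - t)) \<partial>lborel)"
  proof (rule nn_integral_mono_AE)
   have "AE t in lborel. t \<noteq> s" by (rule AE_lborel_singleton)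
   thus "AE t in lborel. ennreal \<bar>?u t \<bullet> ?u s\<bar> \<le> ennreal (\<gamma> t * \<gamma> s * ker (s - t))"
    using lpG
   proof eventually_elim
    case (elim t)
    have "?u t \<bullet> ?u s = S (s - t) (G t) \<bullet> G s"
     using S_adj[of "- s" "G s" "S (- t) (G t)"] by (simp add: S_S inner_commute)
    thus ?case using S_pairing[OF elim(2) lps, of "s - t"] elim
     by (intro ennreal_leI) (simp add: mult_ac)
   qed
  qed
  finally show ?case .
 qed
 also have "\<dots> \<le> ennreal (88 * A * A)" by (rule hls[OF \<gamma> \<gamma> \<gamma>0 \<gamma>0])
 finally have "(norm ?v)\<^sup>2 \<le> 88 * A * A" using A0 by (simp add: ennreal_le_iff)
 \<comment> \<open>This is the origin of the Strichartz constant 10: the square root of 88, rounded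
   up.\<close>
 also have "\<dots> \<le> (10 * A)\<^sup>2" by (simp add: power2_eq_square)
 finally show ?thesis by (rule power2_le_imp_le) (use A0 in simp)
qed

text \<open>Makes \<open>Cut n\<close> continuous on L^2, hence measurable along a flow. If |w| is
  at most |z|, the second term of the splitting either has |w| at most n or vanishes, both moduli
  being cut at n.\<close>

lemma Lipschitz_cut: "\<exists>L\<ge>0. \<forall>z w. cmod (cut n z - cut n w) \<le> L * cmod (z - w)"
proof (intro exI[of _ "3 * (real n)\<^sup>2"] conjI allI)
 have main: "cmod (cut n z - cut n w) \<le> 3 * (real n)\<^sup>2 * cmod (z - w)" if le: "cmod w \<le> cmod z" for z w
 proof -
  let ?a = "min (cmod z) (real n)" and ?b = "min (cmod w) (real n)"
  have ab: "0 \<le> ?b" "?b \<le> ?a" "?a \<le> real n" "?a - ?b \<le> cmod (z - w)" 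
   using le norm_triangle_ineq2[of z w] by auto
  have "cut n z - cut n w = complex_of_real (?a\<^sup>2) * (z - w) + complex_of_real (?a\<^sup>2 - ?b\<^sup>2) * w"
   by (simp add: cut_def algebra_simps)
  hence "cmod (cut n z - cut n w) \<le> \<bar>?a\<^sup>2\<bar> * cmod (z - w) + \<bar>?a\<^sup>2 - ?b\<^sup>2\<bar> * cmod w"
   using norm_triangle_ineq[of "complex_of_real (?a\<^sup>2) * (z - w)" "complex_of_real (?a\<^sup>2 - ?b\<^sup>2) * w"]
   by (simp only: norm_mult norm_of_real)
  also have "\<bar>?a\<^sup>2\<bar> * cmod (z - w) \<le> (real n)\<^sup>2 * cmod (z - w)"
   using ab by (intro mult_right_mono) (auto intro: power_mono)
  also have "\<bar>?a\<^sup>2 - ?b\<^sup>2\<bar> * cmod w \<le> (2 * (real n)\<^sup>2) * cmod (z - w)"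
  proof (cases "cmod w \<le> real n")
   case True
   have "\<bar>?a\<^sup>2 - ?b\<^sup>2\<bar> = (?a - ?b) * (?a + ?b)"
    using ab by (simp add: power2_eq_square algebra_simps abs_of_nonneg mult_mono)
   also have "\<dots> * cmod w \<le> (cmod (z - w) * (2 * real n)) * real n"
    using ab True by (intro mult_mono) auto
   finally show ?thesis by (simp add: power2_eq_square mult_ac)
  next
   case False
   hence "?a = ?b" using le by simp
   thus ?thesis by simp
  qed
  finally show ?thesis by (simp add: algebra_simps)
 qed
 fix z w
 show "cmod (cut n z - cut n w) \<le> 3 * (real n)\<^sup>2 * cmod (z - w)"
  using main[of w z] main[of z w] by (cases "cmod w \<le> cmod z") (auto simp: norm_minus_commute)
qed simp

lemma Nemytskii_tendsto:
 fixes \<theta> :: "complex \<Rightarrow> complex"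
 assumes \<theta>: "\<And>z w. cmod (\<theta> z - \<theta> w) \<le> L * cmod (z - w)" "\<theta> 0 = 0" and L: "0 \<le> L" and [measurable]: "\<theta> \<in> borel_measurable borel"
 shows "norm (L2_of (\<lambda>x. \<theta> (rep_L2 f x)) - L2_of (\<lambda>x. \<theta> (rep_L2 g x))) \<le> L * norm (f - g)"
  and "sq_integrable (\<lambda>x. \<theta> (rep_L2 f x))"
  and "continuous_on UNIV (\<lambda>f. L2_of (\<lambda>x. \<theta> (rep_L2 f x)))"
proof -
 show sq: "sq_integrable (\<lambda>x. \<theta> (rep_L2 f x))" for f
  by (rule sq_integrable_dom[where C = L and f = f]) (use \<theta>(1)[of _ 0] \<theta>(2) in auto)
 show lip: "norm (L2_of (\<lambda>x. \<theta> (rep_L2 f x)) - L2_of (\<lambda>x. \<theta> (rep_L2 g x))) \<le> L * norm (f - g)" for f g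
  unfolding L2_of_diff[OF sq sq, symmetric]
 proof (rule norm_L2_of_le[OF _ _ L])
  show "AE x in lb. cmod (\<theta> (rep_L2 f x) - \<theta> (rep_L2 g x)) \<le> L * mag (f - g) x"
   using rep_diff[of f g] by eventually_elim (use \<theta>(1) in simp)
 qed measurable
 show "continuous_on UNIV (\<lambda>f. L2_of (\<lambda>x. \<theta> (rep_L2 f x)))"
 proof (rule continuous_on_sequentiallyI)
  fix u :: "nat \<Rightarrow> L2" and a assume "u \<longlonglongrightarrow> a"
  hence "(\<lambda>n. L * norm (u n - a)) \<longlonglongrightarrow> L * 0"
   by (intro tendsto_mult tendsto_const tendsto_norm_zero) (simp add: LIM_zero_iff)
  hence l0: "(\<lambda>n. L * norm (u n - a)) \<longlonglongrightarrow> 0" by simp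
  have "(\<lambda>n. norm (L2_of (\<lambda>x. \<theta> (rep_L2 (u n) x)) - L2_of (\<lambda>x. \<theta> (rep_L2 a x)))) \<longlonglongrightarrow> 0"
   by (rule tendsto_sandwich[OF _ _ tendsto_const l0]) (simp_all add: lip always_eventually)
  thus "(\<lambda>n. L2_of (\<lambda>x. \<theta> (rep_L2 (u n) x))) \<longlonglongrightarrow> L2_of (\<lambda>x. \<theta> (rep_L2 a x))"
   by (simp add: tendsto_norm_zero_iff LIM_zero_iff)
 qed
qed

lemma continuous_Cut: "continuous_on UNIV (Cut n)"
proof -
 obtain L where L: "0 \<le> L" "\<And>z w. cmod (cut n z - cut n w) \<le> L * cmod (z - w)" using Lipschitz_cut by blast
 have "cut n 0 = 0" by (simp add: cut_def)
 from Nemytskii_tendsto(3)[OF L(2) this L(1) cut_measurable] show ?thesis by (simp add: Cut_def[abs_def])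
qed

lemma Cut_measurable [measurable]: "Cut n \<in> borel_measurable borel"
 by (rule borel_measurable_continuous_onI[OF continuous_Cut])

lemma qn_measurable [measurable]: "qn n \<in> borel_measurable borel"
 unfolding qn_def[abs_def] by measurable

lemma qn_le: "qn n f \<le> (real n)\<^sup>2 * (norm f)\<^sup>2"
proof -
 have "qn n f \<le> (\<integral>x. (real n)\<^sup>2 * (mag f x)\<^sup>2 \<partial>lborel)"
  unfolding qn_integral(2)
  by (rule integral_mono[OF qn_integral(1)]) (auto intro!: mult_right_mono power_mono integrable_rep_sq)
 thus ?thesis by (simp add: norm_L2_sq)
qed

lemma norm_Cut_le: "(norm (Cut n f))\<^sup>2 \<le> (real n)\<^sup>2 * qn n f"
proof -
 have "(norm (Cut n f))\<^sup>2 = (\<integral>x. (cmod (cut n (rep_L2 f x)))\<^sup>2 \<partial>lborel)"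
  unfolding Cut_def by (rule norm_L2_of[OF sq_cut])
 also have "\<dots> \<le> (\<integral>x. (real n)\<^sup>2 * ((min (mag f x) (real n))\<^sup>2 * (mag f x)\<^sup>2) \<partial>lborel)"
 proof (rule integral_mono)
  show "integrable lb (\<lambda>x. (cmod (cut n (rep_L2 f x)))\<^sup>2)" using sq_cut by (simp add: sq_integrable_def)
  show "integrable lb (\<lambda>x. (real n)\<^sup>2 * ((min (mag f x) (real n))\<^sup>2 * (mag f x)\<^sup>2))"
   by (intro integrable_mult_right qn_integral)
  fix x
  have "(cmod (cut n (rep_L2 f x)))\<^sup>2 = (min (mag f x) (real n))\<^sup>2 * ((min (mag f x) (real n))\<^sup>2 * (mag f x)\<^sup>2)"
   unfolding cmod_cut power_mult_distrib by (simp add: power2_eq_square)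
  also have "\<dots> \<le> (real n)\<^sup>2 * ((min (mag f x) (real n))\<^sup>2 * (mag f x)\<^sup>2)"
   by (intro mult_right_mono power_mono) auto
  finally show "(cmod (cut n (rep_L2 f x)))\<^sup>2 \<le> (real n)\<^sup>2 * ((min (mag f x) (real n))\<^sup>2 * (mag f x)\<^sup>2)" .
 qed
 also have "\<dots> = (real n)\<^sup>2 * qn n f" by (simp add: qn_integral(2))
 finally show ?thesis .
qed

lemma qn_le_n4: "L4 f \<Longrightarrow> qn n f \<le> n4 f powr 4"
proof -
 assume f: "L4 f"
 have "ennreal (qn n f) \<le> (\<integral>\<^sup>+x. ennreal (\<bar>mag f x\<bar> powr 4) \<partial>lb)"
  unfolding qn_nn[symmetric]
 proof (rule nn_integral_mono, rule ennreal_leI)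
  fix x
  have "(min (mag f x) (real n))\<^sup>2 * (mag f x)\<^sup>2 \<le> (mag f x)\<^sup>2 * (mag f x)\<^sup>2"
   by (intro mult_right_mono power_mono) auto
  also have "\<dots> = \<bar>mag f x\<bar> powr 4" by (simp flip: power_add)
  finally show "(min (mag f x) (real n))\<^sup>2 * (mag f x)\<^sup>2 \<le> \<bar>mag f x\<bar> powr 4" .
 qed
 also have "\<dots> \<le> ennreal (n4 f powr 4)" by (rule Lp_leD(3)[OF L4_n4[OF f]])
 finally show ?thesis by (simp add: ennreal_le_iff)
qed

text \<open>Duality with a forcing term normalised so that its pairing with \<open>S t f\<close> is
  q^(2/3), the integrand to be bounded, while its L^(4/3) norm is q^(5/12), with L^(8/5) norm
  Y^(5/8) in time. \<open>strichartz_dual\<close> then bounds Y by a multiple of Y^(5/8), and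
  cutting in height and in time keeps Y finite.\<close>

theorem strichartz_hom:
 assumes L4: "\<And>t. L4 (S t f)"
 shows "L83 (\<lambda>t. n4 (S t f)) (10 * norm f)"
proof -
 define q where "q n t = qn n (S t f) * indicator {- real n..real n} t" for n t
 have qm [measurable]: "q n \<in> borel_measurable borel" for n unfolding q_def by measurable
 have q0: "0 \<le> q n t" for n t by (simp add: q_def qn_nonneg)
 define B where "B n = (real n)\<^sup>2 * (norm f)\<^sup>2" for n
 have qB: "q n t \<le> B n * indicator {- real n..real n} t" for n t
  using qn_le[of n "S t f"] by (simp add: q_def B_def split: split_indicator)
 have main: "L83 (\<lambda>t. q n t powr (1 / 4)) (10 * norm f)" for n
 proof -
  define Y where "Y = enn2real (\<integral>\<^sup>+t. ennreal (q n t powr (2 / 3)) \<partial>lborel)"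
  have "(\<integral>\<^sup>+t. ennreal (q n t powr (2 / 3)) \<partial>lborel) \<le> (\<integral>\<^sup>+t. ennreal (B n powr (2 / 3)) * indicator {- real n..real n} t \<partial>lborel)"
  proof (rule nn_integral_mono)
   fix t
   show "ennreal (q n t powr (2 / 3)) \<le> ennreal (B n powr (2 / 3)) * indicator {- real n..real n} t"
   proof (cases "t \<in> {- real n..real n}")
    case True
    thus ?thesis using q0[of n t] qB[of n t] by (auto intro!: ennreal_leI powr_mono2)
   qed (simp add: q_def)
  qed
  also have "\<dots> < \<infinity>" by (simp add: nn_integral_cmult_indicator ennreal_mult_less_top)
  finally have Y: "(\<integral>\<^sup>+t. ennreal (q n t powr (2 / 3)) \<partial>lborel) = ennreal Y"
   by (simp add: Y_def less_top)
  have Y0: "0 \<le> Y" by (simp add: Y_def)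
  \<comment> \<open>Where q vanishes, the negative power is 0 by convention, so \<open>G\<close> is
    0 there.\<close>
  define G where "G t = (q n t powr (- 1 / 3) * indicator {- real n..real n} t) *\<^sub>R Cut n (S t f)" for t
  have [measurable]: "G \<in> borel_measurable borel" unfolding G_def by measurable
  define \<gamma> where "\<gamma> t = q n t powr (5 / 12)" for t
  have \<gamma>: "Lp_le lborel (8 / 5) \<gamma> (Y powr (5 / 8))"
   unfolding Lp_le_def \<gamma>_def using Y Y0 by (simp add: powr_powr)
  have lpG: "lp (4 / 3) (G t) (\<gamma> t)" for t
  proof (cases "t \<in> {- real n..real n}")
   case True
   have "lp (4 / 3) (G t) (\<bar>q n t powr (- 1 / 3) * indicator {- real n..real n} t\<bar> * qn n (S t f) powr (3 / 4))"
    unfolding G_def by (rule lp_scaleR[OF Cut_lp]) simp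
   moreover have "\<bar>q n t powr (- 1 / 3) * indicator {- real n..real n} t\<bar> * qn n (S t f) powr (3 / 4) = \<gamma> t"
   proof (cases "q n t = 0")
    case False
    thus ?thesis using True by (simp add: \<gamma>_def q_def powr_add[symmetric])
   qed (use True in \<open>simp add: \<gamma>_def q_def\<close>)
   ultimately show ?thesis by simp
  next
   case False
   hence "G t = 0" "\<gamma> t = 0" by (auto simp: G_def \<gamma>_def q_def)
   thus ?thesis by (simp add: lp_zero)
  qed
  have iG: "integrable lborel G"
  proof (rule integrableI_bounded)
   have nb: "norm (G t) \<le> real n * B n powr (1 / 6) * indicator {- real n..real n} t" for t
   proof (cases "t \<in> {- real n..real n} \<and> q n t \<noteq> 0")
    case True
    hence q: "q n t = qn n (S t f)" "0 < q n t" using q0[of n t] by (auto simp: q_def)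
    have "norm (Cut n (S t f)) \<le> real n * q n t powr (1 / 2)"
    proof (rule power2_le_imp_le)
     show "(norm (Cut n (S t f)))\<^sup>2 \<le> (real n * q n t powr (1 / 2))\<^sup>2"
      using norm_Cut_le[of n "S t f"] q by (simp add: power_mult_distrib powr_half_sqrt)
    qed simp
    hence "norm (G t) \<le> q n t powr (- 1 / 3) * (real n * q n t powr (1 / 2))"
     using True by (simp add: G_def mult_left_mono)
    also have "\<dots> = real n * q n t powr (1 / 6)" by (simp add: powr_add[symmetric])
    also have "\<dots> \<le> real n * B n powr (1 / 6)"
     using q0[of n t] qB[of n t] True by (intro mult_left_mono powr_mono2) auto
    finally show ?thesis using True by simp
   next
    case False
    hence "G t = 0" by (auto simp: G_def)
    thus ?thesis by simp
   qed
   have "(\<integral>\<^sup>+t. ennreal (norm (G t)) \<partial>lborel) \<le> (\<integral>\<^sup>+t. ennreal (real n * B n powr (1 / 6)) * indicator {- real n..real n} t \<partial>lborel)"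
    by (intro nn_integral_mono order_trans[OF ennreal_leI[OF nb]]) (auto split: split_indicator)
   also have "\<dots> < \<infinity>" by (simp add: nn_integral_cmult_indicator ennreal_mult_less_top)
   finally show "(\<integral>\<^sup>+t. ennreal (norm (G t)) \<partial>lborel) < \<infinity>" .
  qed simp
  have qG: "S t f \<bullet> G t = q n t powr (2 / 3)" for t
  proof (cases "t \<in> {- real n..real n} \<and> q n t \<noteq> 0")
   case True
   hence "S t f \<bullet> G t = q n t powr (- 1 / 3) * q n t powr 1"
    using q0[of n t] by (simp add: G_def q_def qn_def)
   thus ?thesis by (simp only: powr_add[symmetric]) simp
  qed (auto simp: G_def q_def)
  have iu: "integrable lborel (\<lambda>t. S (- t) (G t))" by (rule integrable_S(2)[OF iG])
  have e: "f \<bullet> S (- t) (G t) = q n t powr (2 / 3)" for t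
   using S_adj[of t f "G t"] by (simp add: qG)
  have "(\<integral>t. q n t powr (2 / 3) \<partial>lborel) = f \<bullet> (\<integral>t. S (- t) (G t) \<partial>lborel)"
   unfolding e[symmetric] by (rule integral_inner_right) (use iu in auto)
  moreover have "(\<integral>t. q n t powr (2 / 3) \<partial>lborel) = Y"
   unfolding Y_def by (subst integral_eq_nn_integral) auto
  ultimately have "Y = f \<bullet> (\<integral>t. S (- t) (G t) \<partial>lborel)" by simp
  also have "\<dots> \<le> norm f * norm (\<integral>t. S (- t) (G t) \<partial>lborel)" by (rule norm_cauchy_schwarz)
  also have "\<dots> \<le> norm f * (10 * Y powr (5 / 8))"
   by (intro mult_left_mono strichartz_dual[OF iG \<gamma>]) (auto simp: lpG, simp add: \<gamma>_def)
  finally have "Y \<le> (10 * norm f) powr (8 / 3)" by (intro powr_self_bound Y0) (auto simp: mult_ac)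
  thus ?thesis using Y by (simp add: Lp_le_def powr_powr ennreal_leI)
 qed
 show ?thesis
 proof (rule Lp_le_liminf[OF main])
  show "(\<lambda>t. n4 (S t f)) \<in> borel_measurable lborel" by measurable
  show "AE t in lborel. ennreal (\<bar>n4 (S t f)\<bar> powr (8 / 3)) \<le> liminf (\<lambda>n. ennreal (\<bar>q n t powr (1 / 4)\<bar> powr (8 / 3)))"
  proof (rule AE_I2)
   fix t
   define L where "L = liminf (\<lambda>n. ennreal (\<bar>q n t powr (1 / 4)\<bar> powr (8 / 3)))"
   have inc: "qn n (S t f) \<le> qn m (S t f)" if "n \<le> m" for n m
    unfolding qn_integral(2)
    by (rule integral_mono[OF qn_integral(1) qn_integral(1)]) (use that in \<open>auto intro!: mult_right_mono power_mono\<close>)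
   have le: "ennreal (qn n (S t f) powr (2 / 3)) \<le> L" for n
    unfolding L_def
   proof (rule Liminf_bounded)
    obtain N :: nat where N: "\<bar>t\<bar> \<le> real N" using real_arch_simple by blast
    show "\<forall>\<^sub>F m in sequentially. ennreal (qn n (S t f) powr (2 / 3)) \<le> ennreal (\<bar>q m t powr (1 / 4)\<bar> powr (8 / 3))"
    proof (rule eventually_sequentiallyI[of "max n N"])
     fix m assume m: "max n N \<le> m"
     hence "t \<in> {- real m..real m}" using N by auto
     hence "q m t = qn m (S t f)" by (simp add: q_def)
     thus "ennreal (qn n (S t f) powr (2 / 3)) \<le> ennreal (\<bar>q m t powr (1 / 4)\<bar> powr (8 / 3))"
      using inc[of n m] m qn_nonneg by (simp add: powr_powr ennreal_leI powr_mono2)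
    qed
   qed
   show "ennreal (\<bar>n4 (S t f)\<bar> powr (8 / 3)) \<le> L"
   proof (cases "L = \<top>")
    case False
    then obtain l where l: "L = ennreal l" "0 \<le> l" by (cases L) auto
    have "qn n (S t f) \<le> (l powr (3 / 8)) powr 4" for n
    proof -
     have "qn n (S t f) powr (2 / 3) \<le> l" using le[of n] l by (simp add: ennreal_le_iff)
     hence "(qn n (S t f) powr (2 / 3)) powr (3 / 2) \<le> l powr (3 / 2)" by (intro powr_mono2) auto
     thus ?thesis using qn_nonneg[of n "S t f"] by (simp add: powr_powr)
    qed
    hence "n4 (S t f) \<le> l powr (3 / 8)" by (intro n4_le lp_4_of_qn) auto
    hence "n4 (S t f) powr (8 / 3) \<le> (l powr (3 / 8)) powr (8 / 3)" by (intro powr_mono2 n4_nonneg) auto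
    thus ?thesis using l n4_nonneg[of "S t f"] by (simp add: powr_powr ennreal_leI)
   qed simp
  qed
 qed
qed

text \<open>The integral is taken in L^2, so its L^4 bound is obtained by duality:
  \<open>lp_4_dual\<close> tests it with L^(4/3) functions, and the dispersive estimate acts under
  the integral sign. When the right-hand side is infinite there is nothing to show.\<close>

theorem strichartz_inhom_pt:
 assumes G: "integrable lborel G" and \<gamma>0: "\<And>s. 0 \<le> \<gamma> s" and [measurable]: "\<gamma> \<in> borel_measurable borel"
  and lpG: "AE s in lborel. lp (4 / 3) (G s) (\<gamma> s)" and L4: "L4 (\<integral>s. S (t - s) (G s) \<partial>lborel)"
 shows "ennreal (n4 (\<integral>s. S (t - s) (G s) \<partial>lborel)) \<le> (\<integral>\<^sup>+s. ennreal (\<gamma> s * ker (t - s)) \<partial>lborel)"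
proof (cases "(\<integral>\<^sup>+s. ennreal (\<gamma> s * ker (t - s)) \<partial>lborel) = \<top>")
 case False
 then obtain x where x: "(\<integral>\<^sup>+s. ennreal (\<gamma> s * ker (t - s)) \<partial>lborel) = ennreal x" "0 \<le> x"
  by (cases "\<integral>\<^sup>+s. ennreal (\<gamma> s * ker (t - s)) \<partial>lborel") auto
 have iu: "integrable lborel (\<lambda>s. S (t - s) (G s))" by (rule integrable_S(1)[OF G])
 have "lp 4 (\<integral>s. S (t - s) (G s) \<partial>lborel) x"
 proof (rule lp_4_dual)
  fix \<phi> B assume \<phi>: "lp (4 / 3) \<phi> B"
  have B0: "0 \<le> B" using \<phi> by (rule Lp_leD)
  have e: "(\<integral>s. S (t - s) (G s) \<partial>lborel) \<bullet> \<phi> = (\<integral>s. S (t - s) (G s) \<bullet> \<phi> \<partial>lborel)"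
   by (rule integral_inner_left[symmetric]) (use iu in auto)
  have "ennreal \<bar>(\<integral>s. S (t - s) (G s) \<partial>lborel) \<bullet> \<phi>\<bar> \<le> (\<integral>\<^sup>+s. ennreal \<bar>S (t - s) (G s) \<bullet> \<phi>\<bar> \<partial>lborel)"
   unfolding e using integral_norm_bound_ennreal[OF integrable_inner_left[of \<phi>, OF iu]] iu by simp
  also have "\<dots> \<le> (\<integral>\<^sup>+s. ennreal (\<gamma> s * ker (t - s)) * ennreal B \<partial>lborel)"
  proof (rule nn_integral_mono_AE)
   have "AE s in lborel. s \<noteq> t" by (rule AE_lborel_singleton)
   thus "AE s in lborel. ennreal \<bar>S (t - s) (G s) \<bullet> \<phi>\<bar> \<le> ennreal (\<gamma> s * ker (t - s)) * ennreal B"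
    using lpG
   proof eventually_elim
    case (elim s)
    thus ?case using S_pairing[OF elim(2) \<phi>, of "t - s"] \<gamma>0 ker_nonneg B0
     by (simp add: ennreal_mult'[symmetric] mult_ac ennreal_leI)
   qed
  qed
  also have "\<dots> = ennreal x * ennreal B" by (subst nn_integral_multc) (auto simp: x)
  also have "\<dots> = ennreal (x * B)" using x B0 by (simp add: ennreal_mult')
  finally show "(\<integral>s. S (t - s) (G s) \<partial>lborel) \<bullet> \<phi> \<le> x * B" using x B0 by (simp add: ennreal_le_iff)
 qed (rule x)
 hence "n4 (\<integral>s. S (t - s) (G s) \<partial>lborel) \<le> x" by (rule n4_le)
 thus ?thesis by (simp add: x ennreal_leI)
qed simp

section \<open>The nonlinearity\<close>

text \<open>Functions that agree almost everywhere are junk together. So the nonlinearity can be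
  rewritten before it is known to lie in L^2.\<close>

lemma L2_of_cong_AE_junk:
 assumes [measurable]: "f \<in> borel_measurable lborel" "g \<in> borel_measurable lborel" and eq: "AE x in lborel. f x = g x"
 shows "L2_of f = L2_of g"
proof (cases "sq_integrable f")
 case True
 thus ?thesis by (rule L2_of_cong_AE[OF _ assms(2) eq])
next
 case False
 have "AE x in lborel. g x = f x" using eq by eventually_elim simp
 hence "\<not> sq_integrable g" using False sq_integrable_cong_AE[of g f] by auto
 with False show ?thesis by (simp add: L2_of_def)
qed

lemma sq_integrable_translate_iff: "sq_integrable (\<lambda>x. g (x + y)) \<longleftrightarrow> sq_integrable g"
 using sq_integrable_translate[of g y] sq_integrable_translate[of "\<lambda>x. g (x + y)" "- y"] by auto

lemma L2_of_translate: "L2_of (\<lambda>x. g (x + y)) = tr y (L2_of g)"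
proof (cases "sq_integrable g")
 case False
 thus ?thesis
  using linear_0[OF bounded_linear.linear[OF bounded_linear_tr[of y]]] by (simp add: L2_of_def sq_integrable_translate_iff)
qed (simp add: tr_L2_of)

lemma L4_iff_nn: "L4 f \<longleftrightarrow> (\<integral>\<^sup>+x. ennreal ((mag f x)^4) \<partial>lborel) < \<infinity>"
proof
 assume "L4 f"
 from Lp_leD(3)[OF L4_n4[OF this]] show "(\<integral>\<^sup>+x. ennreal ((mag f x)^4) \<partial>lborel) < \<infinity>"
  by (simp add: le_less_trans)
next
 assume "(\<integral>\<^sup>+x. ennreal ((mag f x)^4) \<partial>lborel) < \<infinity>"
 then obtain r where r: "(\<integral>\<^sup>+x. ennreal ((mag f x)^4) \<partial>lborel) = ennreal r" "0 \<le> r"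
  by (cases "\<integral>\<^sup>+x. ennreal ((mag f x)^4) \<partial>lborel") auto
 hence "lp 4 f (r powr (1 / 4))" by (simp add: Lp_le_def powr_powr)
 thus "L4 f" by (rule L4I)
qed

lemma sq_density_iff: "sq_integrable (\<lambda>x. complex_of_real ((mag f x)\<^sup>2)) \<longleftrightarrow> L4 f"
proof -
 have e: "(cmod (complex_of_real ((mag f x)\<^sup>2)))\<^sup>2 = (mag f x)^4" for x
  by (simp only: norm_of_real abs_power2 power_mult[symmetric]) simp
 show ?thesis
 proof
  assume "sq_integrable (\<lambda>x. complex_of_real ((mag f x)\<^sup>2))"
  from nn_integral_L2[OF this] show "L4 f" unfolding e L4_iff_nn by simp
 next
  assume "L4 f"
  thus "sq_integrable (\<lambda>x. complex_of_real ((mag f x)\<^sup>2))"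
   unfolding L4_iff_nn e[symmetric] by (intro sq_integrableI_nn) auto
 qed
qed

lemma rep_density: "L4 f \<Longrightarrow> AE x in lborel. rep_L2 (Defs.density f) x = complex_of_real ((mag f x)\<^sup>2)"
 unfolding Defs.density_def by (rule rep_L2_of) (simp only: sq_density_iff)

lemma density_not_L4: "\<not> L4 f \<Longrightarrow> Defs.density f = 0"
 unfolding Defs.density_def L2_of_def sq_density_iff by simp

lemma density_tr: "Defs.density (tr y f) = tr y (Defs.density f)"
 unfolding Defs.density_def L2_of_translate[symmetric]
proof (rule L2_of_cong_AE_junk)
 show "AE x in lb. complex_of_real ((mag (tr y f) x)\<^sup>2) = complex_of_real ((cmod (rep_L2 f (x + y)))\<^sup>2)"
  using rep_tr[of y f] by eventually_elim simp
qed measurable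

lemma n4_zero [simp]: "n4 0 = 0" 
 using n4_le[OF lp_zero] n4_nonneg[of 0] by simp

lemma L4_zero [simp]: "L4 0" by (rule L4I[OF lp_zero]) simp

text \<open>A difference of two squares, and Hoelder with 1/4 + 1/4 = 1/2.\<close>

lemma density_diff:
 assumes f: "L4 f" and g: "L4 g"
 shows "norm (Defs.density f - Defs.density g) \<le> (n4 f + n4 g) * n4 (f - g)"
proof -
 have "Lp_le lb 2 (\<lambda>x. (mag f x + mag g x) * mag (f - g) x) ((n4 f + n4 g) * n4 (f - g))"
  by (rule Lp_le_mult[OF Lp_le_add[OF L4_n4[OF f] L4_n4[OF g]] L4_n4[OF L4_diff[OF f g]]]) simp_all
 hence "lp 2 (Defs.density f - Defs.density g) ((n4 f + n4 g) * n4 (f - g))"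
 proof (rule Lp_le_mono_AE)
  show "AE x in lb. \<bar>mag (Defs.density f - Defs.density g) x\<bar>
   \<le> \<bar>(mag f x + mag g x) * mag (f - g) x\<bar>"
   using rep_density[OF f] rep_density[OF g] rep_diff[of f g] rep_diff[of "Defs.density f" "Defs.density g"]
  proof eventually_elim
   case (elim x)
   let ?a = "rep_L2 f x" and ?b = "rep_L2 g x"
   have "rep_L2 (Defs.density f - Defs.density g) x = complex_of_real ((cmod ?a)\<^sup>2 - (cmod ?b)\<^sup>2)" using elim by simp
   also have "(cmod ?a)\<^sup>2 - (cmod ?b)\<^sup>2 = (cmod ?a + cmod ?b) * (cmod ?a - cmod ?b)"
    by (simp add: power2_eq_square algebra_simps)
   finally have "mag (Defs.density f - Defs.density g) x = (cmod ?a + cmod ?b) * \<bar>cmod ?a - cmod ?b\<bar>"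
    by (simp only: norm_of_real abs_mult) simp
   also have "\<dots> \<le> (cmod ?a + cmod ?b) * cmod (?a - ?b)"
    using norm_triangle_ineq3[of ?a ?b] by (intro mult_left_mono) auto
   finally show ?case using elim by simp
  qed
 qed simp_all
 thus ?thesis by (simp add: lp_2_iff)
qed

section \<open>The potential and the Lipschitz bounds for the nonlinearity\<close>

locale dipolar =
 fixes lam1 lam2 :: real
 assumes lam1: "lam1 \<noteq> 0"
begin

definition Wl :: "L2 \<Rightarrow> L2" where "Wl u = lam1 *\<^sub>R u + lam2 *\<^sub>R dipole_conv u"
text \<open>The potential generated by f: where \<open>L2_of\<close> is not junk, the nonlinearity
  is this potential times f.\<close>

definition W :: "L2 \<Rightarrow> L2" where "W f = Wl (Defs.density f)"
definition CW :: real where "CW = \<bar>lam1\<bar> + \<bar>lam2\<bar> * (8 / 3 * pi)"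
text \<open>The functions at which neither use of \<open>L2_of\<close> in the nonlinearity is junk,
  neither the inner one for the density nor the outer one.\<close>

definition good :: "L2 \<Rightarrow> bool" where "good f \<longleftrightarrow> L4 f \<and> sq_integrable (\<lambda>x. rep_L2 (W f) x * rep_L2 f x)"
abbreviation N :: "L2 \<Rightarrow> L2" where "N \<equiv> nonlinearity lam1 lam2"

lemma CW_nonneg: "0 \<le> CW" by (simp add: CW_def)

lemma bounded_linear_Wl: "bounded_linear Wl"
 unfolding Wl_def[abs_def] dipole_conv_def
 by (intro bounded_linear_add bounded_linear_const_scaleR bounded_linear_ident bounded_linear_fm[OF bdd_dipole])

lemma Wl_diff: "Wl (u - v) = Wl u - Wl v" and Wl_zero: "Wl 0 = 0"
 using linear_diff[OF bounded_linear.linear[OF bounded_linear_Wl]] linear_0[OF bounded_linear.linear[OF bounded_linear_Wl]] by auto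

lemma norm_Wl: "norm (Wl u) \<le> CW * norm u"
proof -
 have "norm (Wl u) \<le> \<bar>lam1\<bar> * norm u + \<bar>lam2\<bar> * norm (dipole_conv u)"
  unfolding Wl_def by (rule order_trans[OF norm_triangle_ineq]) simp
 also have "\<bar>lam2\<bar> * norm (dipole_conv u) \<le> \<bar>lam2\<bar> * (8 / 3 * pi * norm u)"
  unfolding dipole_conv_def by (intro mult_left_mono norm_fm_le[OF bdd_dipole]) simp
 finally show ?thesis by (simp add: CW_def algebra_simps)
qed

lemma Wl_tr: "Wl (tr y u) = tr y (Wl u)"
 unfolding Wl_def dipole_conv_def fm_tr[OF bdd_dipole] by (simp add: tr_add tr_scaleR)

lemma W_tr: "W (tr y f) = tr y (W f)" by (simp add: W_def density_tr Wl_tr)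

lemma W_diff:
 assumes "L4 f" "L4 g" shows "norm (W f - W g) \<le> CW * ((n4 f + n4 g) * n4 (f - g))"
 unfolding W_def Wl_diff[symmetric]
 by (rule order_trans[OF norm_Wl mult_left_mono[OF density_diff[OF assms] CW_nonneg]])

lemma norm_W:
 assumes "L4 f" shows "norm (W f) \<le> CW * (n4 f)\<^sup>2"
proof -
 have "Defs.density 0 = 0" 
  unfolding Defs.density_def by (rule L2_of_eqI) (use rep_zero in \<open>auto elim!: eventually_mono\<close>)
 hence "W 0 = 0" by (simp add: W_def Wl_zero)
 thus ?thesis using W_diff[OF assms L4_zero] by (simp add: power2_eq_square)
qed

definition integrand :: "L2 \<Rightarrow> real^3 \<Rightarrow> complex" where
 "integrand f x = complex_of_real lam1 * complex_of_real ((mag f x)\<^sup>2) * rep_L2 f x +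
   complex_of_real lam2 * rep_L2 (dipole_conv (Defs.density f)) x * rep_L2 f x"

lemma integrand_measurable [measurable]: "integrand f \<in> borel_measurable borel"
 unfolding integrand_def[abs_def] by measurable

lemma N_integrand: "N f = L2_of (integrand f)"
 unfolding nonlinearity_def integrand_def[abs_def] ..

lemma integrand_eq:
 assumes "L4 f" shows "AE x in lborel. integrand f x = rep_L2 (W f) x * rep_L2 f x"
 using rep_density[OF assms] rep_add[of "lam1 *\<^sub>R Defs.density f" "lam2 *\<^sub>R dipole_conv (Defs.density f)"]
  rep_scaleR[of lam1 "Defs.density f"] rep_scaleR[of lam2 "dipole_conv (Defs.density f)"]
proof eventually_elim
 case (elim x)
 thus ?case by (simp add: integrand_def W_def Wl_def scaleR_conv_of_real algebra_simps)
qed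

lemma rep_N: assumes "good f" shows "AE x in lborel. rep_L2 (N f) x = rep_L2 (W f) x * rep_L2 f x"
proof -
 have L4: "L4 f" and sq: "sq_integrable (\<lambda>x. rep_L2 (W f) x * rep_L2 f x)" using assms by (auto simp: good_def)
 have e: "N f = L2_of (\<lambda>x. rep_L2 (W f) x * rep_L2 f x)" unfolding N_integrand
  by (rule L2_of_cong_AE_junk[OF _ _ integrand_eq[OF L4]]) auto
 show ?thesis unfolding e by (rule rep_L2_of[OF sq])
qed

text \<open>If f were not in L^4, its density would be the junk value 0, the dipolar term would
  vanish, and square-integrability of lam1 |f|^2 f with lam1 \<noteq> 0 would put f in L^6; together
  with L^2 this gives L^4. So the nonlinearity is 0 outside \<open>good\<close>.\<close>

lemma good_of_sq_integrand:
 assumes sq: "sq_integrable (integrand f)" shows "good f"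
proof -
 have L4: "L4 f"
 proof (rule ccontr)
  assume n: "\<not> L4 f"
  have d: "dipole_conv 0 = 0" unfolding dipole_conv_def
   using linear_0[OF bounded_linear.linear[OF bounded_linear_fm[OF bdd_dipole]]] .
  have e: "AE x in lborel. (mag f x)^4 \<le> (1 / lam1\<^sup>2) * (cmod (integrand f x))\<^sup>2 + (mag f x)\<^sup>2"
   using rep_zero
  proof eventually_elim
   case (elim x)
   let ?r = "mag f x"
   have "cmod (integrand f x) = \<bar>lam1\<bar> * ?r^3"
    using elim by (simp add: integrand_def density_not_L4[OF n] d norm_mult norm_power power2_eq_square power3_eq_cube)
   hence "(1 / lam1\<^sup>2) * (cmod (integrand f x))\<^sup>2 = ?r^6" using lam1 by (simp add: power_mult_distrib flip: power_mult)
   moreover have "?r^4 \<le> ?r^6 + ?r^2"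
   proof -
    have "?r^4 = ?r^3 * ?r" by (simp add: power_def numeral_eq_Suc)
    also have "\<dots> \<le> ?r^6 + ?r^2" using sum_squares_bound[of "?r^3" ?r]
      mult_nonneg_nonneg[OF zero_le_power[OF norm_ge_zero] norm_ge_zero, of "rep_L2 f x" 3 "rep_L2 f x"]
     by (simp add: power_mult[symmetric] del: mult_nonneg_nonneg zero_le_power)
    finally show ?thesis .
   qed
   ultimately show ?case by simp
  qed
  have "(\<integral>\<^sup>+x. ennreal ((mag f x)^4) \<partial>lborel)
   \<le> (\<integral>\<^sup>+x. ennreal ((1 / lam1\<^sup>2) * (cmod (integrand f x))\<^sup>2 + (mag f x)\<^sup>2) \<partial>lborel)"
   by (rule nn_integral_mono_AE) (use e in eventually_elim, intro ennreal_leI, simp)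
  also have "\<dots> < \<infinity>"
  proof -
   have "integrable lb (\<lambda>x. (1 / lam1\<^sup>2) * (cmod (integrand f x))\<^sup>2 + (mag f x)\<^sup>2)"
    using sq integrable_rep_sq[of f] by (intro Bochner_Integration.integrable_add integrable_mult_right) (auto simp: sq_integrable_def)
   thus ?thesis by (subst nn_integral_eq_integral) auto
  qed
  finally show False using n L4_iff_nn by blast
 qed
 moreover have "sq_integrable (\<lambda>x. rep_L2 (W f) x * rep_L2 f x)"
  by (rule sq_integrable_cong_AE[OF sq _ integrand_eq[OF L4]]) simp
 ultimately show ?thesis by (simp add: good_def)
qed

lemma N_junk: "\<not> good f \<Longrightarrow> N f = 0"
 using good_of_sq_integrand by (auto simp: N_integrand L2_of_def)

lemma N_tr: "N (tr y f) = tr y (N f)"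
 unfolding N_integrand L2_of_translate[symmetric]
proof (rule L2_of_cong_AE_junk)
 have e: "dipole_conv (Defs.density (tr y f)) = tr y (dipole_conv (Defs.density f))"
  unfolding density_tr dipole_conv_def fm_tr[OF bdd_dipole] ..
 show "AE x in lb. integrand (tr y f) x = integrand f (x + y)"
  using rep_tr[of y f] rep_tr[of y "dipole_conv (Defs.density f)"]
  by eventually_elim (simp add: integrand_def e)
qed measurable

lemma good_tr: assumes "good f" shows "good (tr y f)"
proof -
 have "sq_integrable (\<lambda>x. rep_L2 (W f) (x + y) * rep_L2 f (x + y))"
  using assms sq_integrable_translate_iff[of "\<lambda>x. rep_L2 (W f) x * rep_L2 f x" y] by (simp add: good_def)
 hence "sq_integrable (\<lambda>x. rep_L2 (W (tr y f)) x * rep_L2 (tr y f) x)"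
 proof (rule sq_integrable_cong_AE)
  show "AE x in lb. rep_L2 (W f) (x + y) * rep_L2 f (x + y) = rep_L2 (W (tr y f)) x * rep_L2 (tr y f) x"
   unfolding W_tr using rep_tr[of y f] rep_tr[of y "W f"] by eventually_elim simp
 qed simp
 thus ?thesis using assms L4_tr by (simp add: good_def)
qed

lemma good_zero: "good 0"
proof -
 have "AE x in lb. 0 = rep_L2 (W 0) x * rep_L2 0 x" using rep_zero by eventually_elim simp
 from sq_integrable_cong_AE[OF sq_integrable_zero _ this] show ?thesis by (simp add: good_def)
qed

lemma N_zero: "N 0 = 0"
 by (rule L2_eqI) (use rep_N[OF good_zero] rep_zero in eventually_elim, simp)

text \<open>The difference splits into (W f - W g) f and W g (f - g), each estimated by Hoelder with
  1/2 + 1/4 = 3/4. The first contributes 2 and the second 1 to the factor 3.\<close>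

lemma N_diff_lp:
 assumes f: "good f" and g: "good g" and a: "n4 f \<le> a" "n4 g \<le> a"
 shows "lp (4 / 3) (N f - N g) (3 * CW * a\<^sup>2 * n4 (f - g))"
proof -
 have L4: "L4 f" "L4 g" using f g by (auto simp: good_def)
 let ?d = "n4 (f - g)"
 have a0: "0 \<le> a" using a n4_nonneg[of f] by linarith
 have d0: "0 \<le> ?d" by (rule n4_nonneg)
 have w1: "norm (W f - W g) \<le> CW * (2 * a * ?d)"
  by (rule order_trans[OF W_diff[OF L4]]) (use a d0 CW_nonneg in \<open>intro mult_left_mono mult_right_mono; simp\<close>)
 have w2: "norm (W g) \<le> CW * a\<^sup>2"
  by (rule order_trans[OF norm_W[OF L4(2)]]) (use a CW_nonneg n4_nonneg in \<open>intro mult_left_mono power_mono; simp\<close>)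
 have f4: "lp 4 f a" by (rule Lp_le_weaken[OF L4_n4[OF L4(1)] a(1)]) simp
 have "Lp_le lb (4 / 3) (\<lambda>x. mag (W f - W g) x * mag f x + mag (W g) x * mag (f - g) x)
   (CW * (2 * a * ?d) * a + CW * a\<^sup>2 * ?d)"
  by (rule Lp_le_add[OF Lp_le_mult[where p = 2 and q = 4] Lp_le_mult[where p = 2 and q = 4]])
    (use w1 w2 f4 L4_n4[OF L4_diff[OF L4]] in \<open>simp_all add: lp_2_iff\<close>)
 hence "lp (4 / 3) (N f - N g) (CW * (2 * a * ?d) * a + CW * a\<^sup>2 * ?d)"
 proof (rule Lp_le_mono_AE)
  show "AE x in lb. \<bar>mag (N f - N g) x\<bar>
   \<le> \<bar>mag (W f - W g) x * mag f x + mag (W g) x * mag (f - g) x\<bar>"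
   using rep_N[OF f] rep_N[OF g] rep_diff[of "N f" "N g"] rep_diff[of "W f" "W g"] rep_diff[of f g]
  proof eventually_elim
   case (elim x)
   have "rep_L2 (N f - N g) x = rep_L2 (W f - W g) x * rep_L2 f x + rep_L2 (W g) x * rep_L2 (f - g) x"
    unfolding elim by (simp add: algebra_simps)
   thus ?case using norm_triangle_ineq[of "rep_L2 (W f - W g) x * rep_L2 f x" "rep_L2 (W g) x * rep_L2 (f - g) x"]
    by (simp add: norm_mult)
  qed
 qed simp_all
 thus ?thesis by (simp add: power2_eq_square algebra_simps)
qed

text \<open>Valid at every f, because outside \<open>good\<close> the nonlinearity is 0. Later
  estimates therefore need no case distinction.\<close>

lemma N_lp: "lp (4 / 3) (N f) (3 * CW * (n4 f)\<^sup>2 * n4 f)"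
proof (cases "good f")
 case True
 from N_diff_lp[OF this good_zero order_refl] show ?thesis by (simp add: N_zero n4_nonneg)
next
 case False
 thus ?thesis
  by (simp add: N_junk) (rule Lp_le_weaken[OF lp_zero], simp_all add: n4_nonneg CW_nonneg)
qed

text \<open>The nonlinearity commutes with translations, so its Lipschitz bound for f and a
  translate of f, divided by h, takes the place of a product rule.\<close>

lemma N_dq_lp: "lp (4 / 3) (dq j h (N f)) (3 * CW * (n4 f)\<^sup>2 * n4 (dq j h f))"
proof (cases "good f \<and> h \<noteq> 0")
 case True
 hence g: "good f" and h: "h \<noteq> 0" by auto
 hence L4: "L4 f" by (simp add: good_def)
 let ?t = "tr (h *\<^sub>R ax j)"
 have "lp (4 / 3) (N (?t f) - N f) (3 * CW * (n4 f)\<^sup>2 * n4 (?t f - f))"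
  by (rule N_diff_lp[OF good_tr[OF g] g]) (simp_all add: n4_tr[OF L4])
 from lp_scaleR[OF this, of "1 / h"]
 have "lp (4 / 3) (dq j h (N f)) (\<bar>1 / h\<bar> * (3 * CW * (n4 f)\<^sup>2 * n4 (?t f - f)))"
  by (simp add: dq_def N_tr)
 moreover have "\<bar>1 / h\<bar> * n4 (?t f - f) \<le> n4 (dq j h f)"
 proof -
  have "lp 4 (h *\<^sub>R dq j h f) (\<bar>h\<bar> * n4 (dq j h f))"
   by (rule lp_scaleR[OF L4_n4[OF L4_dq[OF L4]]]) simp
  hence "n4 (?t f - f) \<le> \<bar>h\<bar> * n4 (dq j h f)" using h by (intro n4_le) (simp add: dq_def)
  thus ?thesis using h by (simp add: field_simps)
 qed
 hence "\<bar>1 / h\<bar> * (3 * CW * (n4 f)\<^sup>2 * n4 (?t f - f)) \<le> 3 * CW * (n4 f)\<^sup>2 * n4 (dq j h f)"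
  using CW_nonneg mult_left_mono[of "\<bar>1 / h\<bar> * n4 (?t f - f)" "n4 (dq j h f)" "3 * CW * (n4 f)\<^sup>2"]
  by (simp add: mult_ac)
 ultimately show ?thesis by (rule Lp_le_weaken) simp
next
 case False
 hence "dq j h (N f) = 0"
  using dq_zero by (auto simp: N_junk dq_def[of j 0])
 thus ?thesis
  by simp (rule Lp_le_weaken[OF lp_zero], simp_all add: n4_nonneg CW_nonneg)
qed

lemma norm_dq_W:
 assumes L4: "L4 f" and h: "h \<noteq> 0" shows "norm (dq j h (W f)) \<le> CW * (2 * n4 f * n4 (dq j h f))"
proof -
 let ?t = "tr (h *\<^sub>R ax j)"
 have "norm (dq j h (W f)) = \<bar>1 / h\<bar> * norm (W (?t f) - W f)" by (simp add: dq_def W_tr)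
 also have "\<dots> \<le> \<bar>1 / h\<bar> * (CW * (2 * n4 f * n4 (?t f - f)))"
  using W_diff[OF L4_tr[OF L4] L4] by (intro mult_left_mono) (simp_all add: n4_tr[OF L4])
 also have "\<dots> \<le> CW * (2 * n4 f * n4 (dq j h f))"
 proof -
  have "lp 4 (h *\<^sub>R dq j h f) (\<bar>h\<bar> * n4 (dq j h f))"
   by (rule lp_scaleR[OF L4_n4[OF L4_dq[OF L4]]]) simp
  hence "n4 (?t f - f) \<le> \<bar>h\<bar> * n4 (dq j h f)" using h by (intro n4_le) (simp add: dq_def)
  hence "\<bar>1 / h\<bar> * n4 (?t f - f) \<le> n4 (dq j h f)" using h by (simp add: field_simps)
  thus ?thesis
   using CW_nonneg n4_nonneg[of f] mult_left_mono[of "\<bar>1 / h\<bar> * n4 (?t f - f)" "n4 (dq j h f)" "CW * (2 * n4 f)"]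
   by (simp add: mult_ac)
 qed
 finally show ?thesis .
qed

text \<open>\<open>W f\<close> has its gradient in \<open>L\<^sup>2\<close>, so by the Sobolev inequality it lies in \<open>L\<^sup>4\<close>; in this way
 the boundedness of the dipolar convolution is needed only on \<open>L\<^sup>2\<close>.\<close>

lemma good_criterion:
 "\<exists>C>0. \<forall>f b. L4 f \<longrightarrow> (\<forall>j. liminf (\<lambda>n. ennreal (n4 (dq j (inverse (real (Suc n))) f))) \<le> ennreal b) \<longrightarrow> 0 \<le> b \<longrightarrow>
   good f \<and> norm (N f) \<le> C * (n4 f)\<^sup>2 * (b + 1 + n4 f)"
proof -
 obtain C where C: "0 < C" "\<And>f M. norm f \<le> M \<Longrightarrow> (\<And>j. Fder j f M) \<Longrightarrow> lp 4 f (C * M)" using sobolev by blast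
 have main: "good f \<and> norm (N f) \<le> (C * (2 * CW) + 1) * (n4 f)\<^sup>2 * (b + 1 + n4 f)"
  if L4: "L4 f" and li: "\<And>j. liminf (\<lambda>n. ennreal (n4 (dq j (inverse (real (Suc n))) f))) \<le> ennreal b" and b: "0 \<le> b" for f b
 proof -
  \<comment> \<open>The summand n4 f is there so that one M bounds both the potential and its
    difference quotients, as the Sobolev embedding requires.\<close>
  define M where "M = CW * (2 * n4 f * (b + 1 + n4 f))"
  have Fd: "Fder j (W f) M" for j
  proof -
   let ?x = "\<lambda>n. n4 (dq j (inverse (real (Suc n))) f)"
   have "\<exists>\<^sub>F n in sequentially. ?x n < b + 1"
   proof (rule ccontr)
    assume "\<not> (\<exists>\<^sub>F n in sequentially. ?x n < b + 1)"
    hence "\<forall>\<^sub>F n in sequentially. ennreal (b + 1) \<le> ennreal (?x n)"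
     by (simp add: not_frequently not_less) (auto elim!: eventually_mono intro: ennreal_leI)
    hence "ennreal (b + 1) \<le> liminf (\<lambda>n. ennreal (?x n))" by (rule Liminf_bounded)
    with li[of j] have "ennreal (b + 1) \<le> ennreal b" by (rule order_trans[rotated])
    thus False using b by (simp add: ennreal_le_iff)
   qed
   hence inf: "infinite {n. ?x n < b + 1}"
    by (simp add: frequently_sequentially infinite_nat_iff_unbounded_le)
   \<comment> \<open>Only a lower limit is bounded, so the quotients stay below b + 1 along a
     subsequence; \<open>Fder_liminf\<close> asks for no more than one sequence of steps.\<close>
   define r where "r = enumerate {n. ?x n < b + 1}"
   have r: "strict_mono r" "\<And>n. ?x (r n) < b + 1"
    using inf enumerate_in_set[OF inf] by (auto simp: r_def intro: strict_mono_enumerate)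
   show ?thesis
   proof (rule Fder_liminf)
    show "(\<lambda>n. inverse (real (Suc (r n)))) \<longlonglongrightarrow> 0"
     using LIMSEQ_subseq_LIMSEQ[OF inverse_Suc_seq(2) r(1)] by (simp add: o_def)
    show "inverse (real (Suc (r n))) \<noteq> 0" for n by (rule inverse_Suc_ne)
    fix n
    have "?x (r n) \<le> b + 1 + n4 f" using r(2)[of n] n4_nonneg[of f] by linarith
    thus "norm (dq j (inverse (real (Suc (r n)))) (W f)) \<le> M"
     unfolding M_def
     by (intro order_trans[OF norm_dq_W[OF L4 inverse_Suc_ne]] mult_left_mono CW_nonneg) (simp_all add: n4_nonneg)
   qed
  qed
  have "norm (W f) \<le> M"
   unfolding M_def
  proof (rule order_trans[OF norm_W[OF L4] mult_left_mono[OF _ CW_nonneg]])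
   have "(n4 f)\<^sup>2 \<le> n4 f * (2 * (b + 1 + n4 f))"
    unfolding power2_eq_square using b n4_nonneg[of f] by (intro mult_left_mono) auto
   thus "(n4 f)\<^sup>2 \<le> 2 * n4 f * (b + 1 + n4 f)" by (simp only: mult_ac)
  qed
  hence "lp 4 (W f) (C * M)" by (rule C(2)) (rule Fd)
  from Lp_le_mult[OF this L4_n4[OF L4], of 2]
  have 2: "Lp_le lb 2 (\<lambda>x. mag (W f) x * mag f x) (C * M * n4 f)" by simp
  have n: "0 \<le> C * M * n4 f" using Lp_leD(2)[OF 2] .
  have "(\<integral>\<^sup>+x. ennreal ((cmod (rep_L2 (W f) x * rep_L2 f x))\<^sup>2) \<partial>lborel) \<le> ennreal ((C * M * n4 f)\<^sup>2)"
   using Lp_leD(3)[OF 2] n by (simp add: norm_mult abs_mult)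
  note sq = sq_integrable_nn_le[OF _ this n]
  have g: "good f" using L4 sq by (simp add: good_def)
  have "N f = L2_of (\<lambda>x. rep_L2 (W f) x * rep_L2 f x)"
   by (rule L2_of_eqI[symmetric]) (use rep_N[OF g] in auto)
  hence "norm (N f) \<le> C * M * n4 f" using sq by simp
  also have "\<dots> = C * (2 * CW) * (n4 f)\<^sup>2 * (b + 1 + n4 f)" by (simp add: M_def power2_eq_square)
  also have "\<dots> \<le> (C * (2 * CW) + 1) * (n4 f)\<^sup>2 * (b + 1 + n4 f)"
   using b n4_nonneg[of f] by (intro mult_right_mono) auto
  finally show ?thesis using g by simp
 qed
 moreover have "0 < C * (2 * CW) + 1" using C(1) CW_nonneg by (intro add_nonneg_pos mult_nonneg_nonneg) auto
 ultimately show ?thesis by blast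
qed

subsection \<open>Measurability\<close>

text \<open>Truncation of the modulus, encoded as the metric projection onto a disc, which is
  Lipschitz with constant 1.\<close>

definition th :: "nat \<Rightarrow> complex \<Rightarrow> complex" where "th m = closest_point (cball 0 (real m))"

lemma th_Lip: "cmod (th m z - th m w) \<le> cmod (z - w)"
 using closest_point_lipschitz[of "cball (0::complex) (real m)" z w] by (simp add: th_def dist_norm)

lemma th_zero: "th m 0 = 0" unfolding th_def by (rule closest_point_self) simp

lemma th_le: "cmod (th m z) \<le> real m" "cmod (th m z) \<le> cmod z"
 using closest_point_in_set[of "cball (0::complex) (real m)" z] th_Lip[of m z 0] by (auto simp: th_def[symmetric] th_zero)

lemma th_measurable [measurable]: "th m \<in> borel_measurable borel"
 unfolding th_def by (intro borel_measurable_continuous_onI continuous_on_closest_point) auto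

lemma th_eventually: "\<forall>\<^sub>F m in sequentially. th m z = z"
proof -
 obtain n :: nat where n: "cmod z \<le> real n" using real_arch_simple by blast
 show ?thesis
  by (rule eventually_sequentiallyI[of n]) (use n in \<open>auto simp: th_def intro!: closest_point_self\<close>)
qed

text \<open>Membership in L^4 is boundedness of the sequence \<open>qn n f\<close>, hence a
  countable combination of Borel conditions.\<close>

lemma L4_set_measurable [measurable]: "Measurable.pred borel L4"
proof -
 have "L4 f \<longleftrightarrow> (\<exists>K::nat. \<forall>n. qn n f \<le> real K)" for f
 proof
  assume f: "L4 f"
  obtain K :: nat where "n4 f powr 4 \<le> real K" using real_arch_simple by blast
  thus "\<exists>K::nat. \<forall>n. qn n f \<le> real K" using qn_le_n4[OF f] order_trans by blast
 next
  assume "\<exists>K::nat. \<forall>n. qn n f \<le> real K"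
  then obtain K :: nat where "\<And>n. qn n f \<le> real K" by blast
  hence "lp 4 f (real K powr (1 / 4))" by (intro lp_4_of_qn) (auto simp: powr_powr)
  thus "L4 f" by (rule L4I)
 qed
 hence "L4 = (\<lambda>f. \<exists>K::nat. \<forall>n. qn n f \<le> real K)" by (intro ext)
 hence "Measurable.pred borel L4 \<longleftrightarrow> Measurable.pred borel (\<lambda>f. \<exists>K::nat. \<forall>n. qn n f \<le> real K)"
  by (rule arg_cong)
 also have \<dots> by measurable
 finally show ?thesis .
qed

text \<open>The density is not continuous on L^2, but it is a pointwise limit of densities of
  truncations, which are Lipschitz. Off L^4 the approximants are set to 0 to match the junk
  value.\<close>

lemma density_measurable [measurable]: "Defs.density \<in> borel_measurable borel"
proof (rule borel_measurable_LIMSEQ_metric)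
 let ?d = "\<lambda>k z. complex_of_real ((cmod (th k z))\<^sup>2)"
 define D where "D k f = L2_of (\<lambda>x. ?d k (rep_L2 f x))" for k f
 have Lip: "cmod (?d k z - ?d k w) \<le> (2 * real k) * cmod (z - w)" for k z w
 proof -
  let ?a = "cmod (th k z)" and ?b = "cmod (th k w)"
  have "?d k z - ?d k w = complex_of_real ((?a + ?b) * (?a - ?b))" by (simp add: power2_eq_square algebra_simps)
  hence "cmod (?d k z - ?d k w) = (?a + ?b) * \<bar>?a - ?b\<bar>" by (simp only: norm_of_real abs_mult) simp
  also have "\<dots> \<le> (2 * real k) * cmod (z - w)"
   using th_le(1)[of k z] th_le(1)[of k w] order_trans[OF norm_triangle_ineq3[of "th k z" "th k w"] th_Lip[of k z w]]
   by (intro mult_mono) auto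
  finally show ?thesis .
 qed
 note nem = Nemytskii_tendsto[where \<theta> = "?d k" and L = "2 * real k" for k, OF Lip]
 have cD: "D k \<in> borel_measurable borel" for k
  unfolding D_def[abs_def] by (rule borel_measurable_continuous_onI[OF nem(3)]) (auto simp: th_zero)
 show "(\<lambda>f. if L4 f then D k f else 0) \<in> borel_measurable borel" for k using cD by measurable
 fix f
 show "(\<lambda>k. if L4 f then D k f else 0) \<longlonglongrightarrow> Defs.density f"
 proof (cases "L4 f")
  case True
  have rD: "AE x in lborel. rep_L2 (D k f) x = ?d k (rep_L2 f x)" for k
   unfolding D_def by (rule rep_L2_of[OF nem(2)]) (auto simp: th_zero)
  have "(\<lambda>k. D k f) \<longlonglongrightarrow> Defs.density f"
  proof (rule L2_dominated)
   have "sq_integrable (\<lambda>x. complex_of_real ((mag f x)\<^sup>2))" using True by (simp only: sq_density_iff)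
   thus "integrable lb (\<lambda>x. ((mag f x)\<^sup>2)\<^sup>2)" by (simp add: sq_integrable_def norm_power)
   show "AE x in lb. mag (D k f) x \<le> (mag f x)\<^sup>2" for k
    using rD[of k] by eventually_elim (simp add: norm_power th_le power_mono)
   have "AE x in lborel. \<forall>k. rep_L2 (D k f) x = ?d k (rep_L2 f x)" using rD by (simp add: AE_all_countable)
   with rep_density[OF True] show "AE x in lb. (\<lambda>k. rep_L2 (D k f) x) \<longlonglongrightarrow> rep_L2 (Defs.density f) x"
   proof eventually_elim
    case (elim x)
    show ?case by (rule tendsto_eventually) (use th_eventually[of "rep_L2 f x"] in eventually_elim, simp add: elim)
   qed
  qed
  thus ?thesis using True by simp
 qed (simp add: density_not_L4)
qed

text \<open>The product of w and f with both factors truncated: jointly continuous on L^2, and for w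
  = \<open>W f\<close> convergent to the nonlinearity on \<open>good\<close>.\<close>

definition NM :: "nat \<Rightarrow> L2 \<Rightarrow> L2 \<Rightarrow> L2" where "NM m w f = L2_of (\<lambda>x. th m (rep_L2 w x) * th m (rep_L2 f x))"

lemma sq_NM: "sq_integrable (\<lambda>x. th m (rep_L2 w x) * th m (rep_L2 f x))"
 by (rule sq_integrable_dom[where C = "real m" and f = f])
   (auto simp: norm_mult th_le intro!: mult_mono)

lemma rep_NM: "AE x in lborel. rep_L2 (NM m w f) x = th m (rep_L2 w x) * th m (rep_L2 f x)"
 unfolding NM_def by (rule rep_L2_of[OF sq_NM])

lemma NM_diff: "norm (NM m w f - NM m w' f') \<le> real m * norm (w - w') + real m * norm (f - f')"
proof -
 have 1: "norm (NM m w f - NM m w' f) \<le> real m * norm (w - w')"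
  unfolding NM_def L2_of_diff[OF sq_NM sq_NM, symmetric]
 proof (rule norm_L2_of_le)
  show "AE x in lb. cmod (th m (rep_L2 w x) * th m (rep_L2 f x) - th m (rep_L2 w' x) * th m (rep_L2 f x)) \<le> real m * mag (w - w') x"
   using rep_diff[of w w']
   by eventually_elim
     (simp add: left_diff_distrib[symmetric] norm_mult mult.commute[of "cmod (th m _ - th m _)"] mult_mono th_le th_Lip)
 qed auto
 have 2: "norm (NM m w' f - NM m w' f') \<le> real m * norm (f - f')"
  unfolding NM_def L2_of_diff[OF sq_NM sq_NM, symmetric]
 proof (rule norm_L2_of_le)
  show "AE x in lb. cmod (th m (rep_L2 w' x) * th m (rep_L2 f x) - th m (rep_L2 w' x) * th m (rep_L2 f' x)) \<le> real m * mag (f - f') x"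
   using rep_diff[of f f']
   by eventually_elim (simp add: right_diff_distrib[symmetric] norm_mult mult_mono th_le th_Lip)
 qed auto
 have "NM m w f - NM m w' f' = (NM m w f - NM m w' f) + (NM m w' f - NM m w' f')" by simp
 thus ?thesis using norm_triangle_ineq[of "NM m w f - NM m w' f" "NM m w' f - NM m w' f'"] 1 2 by (simp only:)
qed

lemma continuous_NM: "continuous_on UNIV (\<lambda>p. NM m (fst p) (snd p))"
proof (rule continuous_on_sequentiallyI)
 fix u and p :: "L2 \<times> L2" assume u: "u \<longlonglongrightarrow> p"
 have "(\<lambda>n. real m * norm (fst (u n) - fst p) + real m * norm (snd (u n) - snd p)) \<longlonglongrightarrow> real m * norm (fst p - fst p) + real m * norm (snd p - snd p)"
  by (intro tendsto_intros u)
 hence l0: "(\<lambda>n. real m * norm (fst (u n) - fst p) + real m * norm (snd (u n) - snd p)) \<longlonglongrightarrow> 0" by simp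
 have "(\<lambda>n. norm (NM m (fst (u n)) (snd (u n)) - NM m (fst p) (snd p))) \<longlonglongrightarrow> 0"
  by (rule tendsto_sandwich[OF _ _ tendsto_const l0]) (simp_all add: NM_diff always_eventually)
 thus "(\<lambda>n. NM m (fst (u n)) (snd (u n))) \<longlonglongrightarrow> NM m (fst p) (snd p)"
  by (simp add: tendsto_norm_zero_iff LIM_zero_iff)
qed

lemma W_measurable [measurable]: "W \<in> borel_measurable borel"
proof -
 have [measurable]: "Wl \<in> borel_measurable borel"
  by (rule borel_measurable_continuous_onI) (rule linear_continuous_on[OF bounded_linear_Wl])
 show ?thesis unfolding W_def[abs_def] by measurable
qed

lemma NM_W_measurable [measurable]: "(\<lambda>f. NM m (W f) f) \<in> borel_measurable borel"
 by (rule borel_measurable_continuous_Pair[OF _ _ continuous_NM]) measurable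

text \<open>By Fatou's lemma, square-integrability of the product amounts to boundedness of its
  truncations, and in this form \<open>good\<close> is visibly a Borel set.\<close>

lemma good_iff: "good f \<longleftrightarrow> L4 f \<and> (\<exists>K::nat. \<forall>m. norm (NM m (W f) f) \<le> real K)"
proof safe
 assume g: "good f"
 thus "L4 f" by (simp add: good_def)
 obtain K :: nat where K: "norm (N f) \<le> real K" using real_arch_simple by blast
 have le: "norm (NM m (W f) f) \<le> 1 * norm (N f)" for m
  unfolding NM_def
 proof (rule norm_L2_of_le)
  show "AE x in lb. cmod (th m (rep_L2 (W f) x) * th m (rep_L2 f x)) \<le> 1 * mag (N f) x"
   using rep_N[OF g] by eventually_elim (simp add: norm_mult mult_mono th_le)
 qed auto
 thus "\<exists>K::nat. \<forall>m. norm (NM m (W f) f) \<le> real K" 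
  by (intro exI[of _ K] allI order_trans[OF le]) (use K in simp)
next
 fix K :: nat assume L4: "L4 f" and K: "\<forall>m. norm (NM m (W f) f) \<le> real K"
 let ?p = "\<lambda>x. rep_L2 (W f) x * rep_L2 f x"
 have "Lp_le lb 2 (\<lambda>x. cmod (?p x)) (real K)"
 proof (rule Lp_le_Fatou)
  show "lp 2 (NM m (W f) f) (real K)" for m using K by (simp add: lp_2_iff)
  have "AE x in lborel. \<forall>m. rep_L2 (NM m (W f) f) x = th m (rep_L2 (W f) x) * th m (rep_L2 f x)"
   using rep_NM by (simp add: AE_all_countable)
  thus "AE x in lb. (\<lambda>m. cmod (rep_L2 (NM m (W f) f) x)) \<longlonglongrightarrow> cmod (?p x)"
  proof eventually_elim
   case (elim x)
   show ?case
    by (rule tendsto_eventually)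
      (use th_eventually[of "rep_L2 f x"] th_eventually[of "rep_L2 (W f) x"] in eventually_elim, simp add: elim)
  qed
 qed simp_all
 from Lp_leD(3)[OF this] have "(\<integral>\<^sup>+x. ennreal ((cmod (?p x))\<^sup>2) \<partial>lborel) \<le> ennreal ((real K)\<^sup>2)" by simp
 from sq_integrable_nn_le(1)[OF _ this] L4 show "good f" by (simp add: good_def)
qed

lemma good_measurable [measurable]: "Measurable.pred borel good"
 unfolding good_iff[abs_def] by measurable

lemma N_measurable [measurable]: "N \<in> borel_measurable borel"
proof (rule borel_measurable_LIMSEQ_metric)
 show "(\<lambda>f. if good f then NM m (W f) f else 0) \<in> borel_measurable borel" for m by measurable
 fix f
 show "(\<lambda>m. if good f then NM m (W f) f else 0) \<longlonglongrightarrow> N f"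
 proof (cases "good f")
  case True
  have "(\<lambda>m. NM m (W f) f) \<longlonglongrightarrow> N f"
  proof (rule L2_dominated[OF integrable_rep_sq[of "N f"]])
   show "AE x in lb. cmod (rep_L2 (NM m (W f) f) x) \<le> mag (N f) x" for m
    using rep_NM[of m "W f" f] rep_N[OF True] by eventually_elim (simp add: norm_mult mult_mono th_le)
   have "AE x in lborel. \<forall>m. rep_L2 (NM m (W f) f) x = th m (rep_L2 (W f) x) * th m (rep_L2 f x)"
    using rep_NM by (simp add: AE_all_countable)
   thus "AE x in lb. (\<lambda>m. rep_L2 (NM m (W f) f) x) \<longlonglongrightarrow> rep_L2 (N f) x"
    using rep_N[OF True]
   proof eventually_elim
    case (elim x)
    show ?case
     by (rule tendsto_eventually)
       (use th_eventually[of "rep_L2 f x"] th_eventually[of "rep_L2 (W f) x"] in eventually_elim, simp add: elim)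
   qed
  qed
  thus ?thesis using True by simp
 qed (simp add: N_junk)
qed

end

section \<open>The Duhamel integral\<close>

text \<open>\<open>ort t\<close> is the weight turning a Lebesgue integral into the oriented integral from \<open>0\<close> to \<open>t\<close>.\<close>

definition ort :: "real \<Rightarrow> real \<Rightarrow> real" where "ort t s = indicator {..t} s - indicator {..0} s"

lemma ort_abs: "\<bar>ort t s\<bar> \<le> 1" "\<bar>ort t s\<bar> \<le> indicator {- \<bar>t\<bar>..\<bar>t\<bar>} s"
 by (auto simp: ort_def split: split_indicator)

lemma ort_diff: "t' \<le> t \<Longrightarrow> ort t s - ort t' s = indicator {t'<..t} s"
 by (auto simp: ort_def split: split_indicator)

lemma ort_measurable [measurable]: "ort t \<in> borel_measurable borel"
 unfolding ort_def[abs_def] by measurable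

definition locint :: "(real \<Rightarrow> L2) \<Rightarrow> bool" where
 "locint G \<longleftrightarrow> G \<in> borel_measurable borel \<and> (\<forall>a b. set_integrable lborel {a..b} G)"

text \<open>The Duhamel integral brought back to time 0; \<open>S t (Duh G t)\<close> is the usual
  one. In this form increments in t are integrals over a window, and scattering is convergence of
  \<open>Duh G t\<close>.\<close>

definition Duh :: "(real \<Rightarrow> L2) \<Rightarrow> real \<Rightarrow> L2" where
 "Duh G t = (\<integral>s. S (- s) (ort t s *\<^sub>R G s) \<partial>lborel)"

lemma locint_weight:
 assumes G: "locint G" and [measurable]: "\<phi> \<in> borel_measurable borel" and b: "\<And>s. \<bar>\<phi> s\<bar> \<le> indicator {a..b} s"
 shows "integrable lborel (\<lambda>s. \<phi> s *\<^sub>R G s)"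
proof (rule Bochner_Integration.integrable_bound)
 have [measurable]: "G \<in> borel_measurable borel" using G by (simp add: locint_def)
 show "integrable lborel (\<lambda>s. indicator {a..b} s *\<^sub>R G s)" using G by (simp add: locint_def set_integrable_def)
 show "(\<lambda>s. \<phi> s *\<^sub>R G s) \<in> borel_measurable lborel" by measurable
 show "AE s in lborel. norm (\<phi> s *\<^sub>R G s) \<le> norm (indicator {a..b} s *\<^sub>R G s)"
  using b by (intro AE_I2) (simp add: mult_right_mono)
qed

lemma locint_ort: "locint G \<Longrightarrow> integrable lborel (\<lambda>s. ort t s *\<^sub>R G s)"
 by (rule locint_weight[OF _ _ ort_abs(2)]) measurable

lemma integrable_Duh: "locint G \<Longrightarrow> integrable lborel (\<lambda>s. S (- s) (ort t s *\<^sub>R G s))"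
 by (rule integrable_S(2)[OF locint_ort])

lemma locint_linear:
 assumes G: "locint G" and T: "bounded_linear T" shows "locint (\<lambda>s. T (G s))"
proof -
 have [measurable]: "T \<in> borel_measurable borel"
  by (rule borel_measurable_continuous_onI[OF linear_continuous_on[OF T]])
 have [measurable]: "G \<in> borel_measurable borel" using G by (simp add: locint_def)
 have "set_integrable lborel {a..b} (\<lambda>s. T (G s))" for a b
 proof -
  have "integrable lborel (\<lambda>s. indicator {a..b} s *\<^sub>R G s)" using G by (simp add: locint_def set_integrable_def)
  from integrable_bounded_linear[OF T this] show ?thesis
   by (simp add: set_integrable_def linear_scale[OF bounded_linear.linear[OF T]])
 qed
 thus ?thesis by (simp add: locint_def)
qed

lemma locint_diff: "locint G \<Longrightarrow> locint H \<Longrightarrow> locint (\<lambda>s. G s - H s)"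
 by (auto simp: locint_def intro!: set_integral_diff)

lemma Duh_time_diff:
 assumes G: "locint G" and "t' \<le> t"
 shows "Duh G t - Duh G t' = (\<integral>s. S (- s) (indicator {t'<..t} s *\<^sub>R G s) \<partial>lborel)"
 unfolding Duh_def Bochner_Integration.integral_diff[OF integrable_Duh[OF G] integrable_Duh[OF G], symmetric]
 by (simp add: S_diff[symmetric] scaleR_diff_left[symmetric] ort_diff[OF assms(2)])

lemma Duh_diff:
 assumes "locint G" "locint H" shows "Duh G t - Duh H t = Duh (\<lambda>s. G s - H s) t"
 unfolding Duh_def Bochner_Integration.integral_diff[OF integrable_Duh[OF assms(1)] integrable_Duh[OF assms(2)], symmetric]
 by (simp add: S_diff scaleR_diff_right)

lemma Duh_linear:
 assumes G: "locint G" and T: "bounded_linear T" "\<And>t f. T (S t f) = S t (T f)"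
 shows "T (Duh G t) = Duh (\<lambda>s. T (G s)) t"
 unfolding Duh_def integral_bounded_linear[OF T(1) integrable_Duh[OF G], symmetric]
 by (simp add: T(2) linear_scale[OF bounded_linear.linear[OF T(1)]])

lemma lp_scaleR_1:
 assumes f: "lp p f A" and r: "\<bar>r\<bar> \<le> 1" and p: "0 < p" shows "lp p (r *\<^sub>R f) A"
 by (rule Lp_le_weaken[OF lp_scaleR[OF f p] _ p]) (use r Lp_leD(2)[OF f] in \<open>simp add: mult_left_le_one_le\<close>)

lemma norm_Duh:
 assumes G: "locint G" and \<gamma>: "Lp_le lborel (8 / 5) \<gamma> A" "\<And>s. 0 \<le> \<gamma> s"
  and lpG: "AE s in lborel. lp (4 / 3) (G s) (\<gamma> s)"
 shows "norm (Duh G t) \<le> 10 * A"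
 unfolding Duh_def
 by (rule strichartz_dual[OF locint_ort[OF G] \<gamma>]) (use lpG in eventually_elim, rule lp_scaleR_1, auto simp: ort_abs)

lemma norm_Duh_time_diff:
 assumes G: "locint G" and \<gamma>: "Lp_le lborel (8 / 5) (\<lambda>s. indicator {t'<..t} s * \<gamma> s) A" "\<And>s. 0 \<le> \<gamma> s"
  and lpG: "AE s in lborel. lp (4 / 3) (G s) (\<gamma> s)" and t: "t' \<le> t"
 shows "norm (Duh G t - Duh G t') \<le> 10 * A"
 unfolding Duh_time_diff[OF G t]
proof (rule strichartz_dual[OF _ \<gamma>(1)])
 show "integrable lborel (\<lambda>s. indicator {t'<..t} s *\<^sub>R G s)"
  by (rule locint_weight[OF G, of _ t' t]) (auto split: split_indicator)
 show "AE s in lborel. lp (4 / 3) (indicator {t'<..t} s *\<^sub>R G s) (indicator {t'<..t} s * \<gamma> s)"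
  using lpG by eventually_elim (auto split: split_indicator intro: lp_zero)
qed (use \<gamma>(2) in auto)

lemma continuous_Duh:
 assumes G: "locint G" shows "continuous_on UNIV (Duh G)"
proof (rule continuous_on_sequentiallyI)
 fix u :: "nat \<Rightarrow> real" and a assume u: "u \<longlonglongrightarrow> a"
 have [measurable]: "G \<in> borel_measurable borel" using G by (simp add: locint_def)
 obtain K where K: "\<And>n. \<bar>u n\<bar> \<le> K"
  using convergent_imp_bounded[OF u] by (auto simp: bounded_iff)
 show "(\<lambda>n. Duh G (u n)) \<longlonglongrightarrow> Duh G a"
  unfolding Duh_def
 proof (rule integral_dominated_convergence)
  show "integrable lborel (\<lambda>s. norm (indicator {-K..K} s *\<^sub>R G s))"
   using G by (intro integrable_norm) (simp add: locint_def set_integrable_def)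
  show "AE s in lborel. norm (S (- s) (ort (u n) s *\<^sub>R G s)) \<le> norm (indicator {-K..K} s *\<^sub>R G s)" for n
  proof (rule AE_I2)
   fix s
   have "\<bar>ort (u n) s\<bar> \<le> indicator {-K..K} s"
    by (rule order_trans[OF ort_abs(2)]) (use K[of n] in \<open>auto split: split_indicator\<close>)
   thus "norm (S (- s) (ort (u n) s *\<^sub>R G s)) \<le> norm (indicator {-K..K} s *\<^sub>R G s)"
    by (simp add: mult_right_mono)
  qed
  have "AE s in lborel. s \<noteq> a" by (rule AE_lborel_singleton)
  thus "AE s in lborel. (\<lambda>n. S (- s) (ort (u n) s *\<^sub>R G s)) \<longlonglongrightarrow> S (- s) (ort a s *\<^sub>R G s)"
  proof eventually_elim
   case (elim s)
   have "\<forall>\<^sub>F n in sequentially. (s \<le> u n) = (s \<le> a)"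
   proof (cases "s < a")
    case True
    thus ?thesis using order_tendstoD(1)[OF u True] by (auto elim: eventually_mono)
   next
    case False
    hence "a < s" using elim by simp
    from order_tendstoD(2)[OF u this] show ?thesis by eventually_elim (use \<open>a < s\<close> in auto)
   qed
   thus ?case
    by (intro tendsto_eventually, elim eventually_mono) (simp add: ort_def indicator_def)
  qed
 qed measurable
qed

lemma continuous_S_comp: "continuous_on A f \<Longrightarrow> continuous_on A (\<lambda>t. S t (f t))"
 using continuous_on_compose2[OF continuous_on_S, of A "\<lambda>t. (t, f t)"] by (simp add: continuous_on_Pair continuous_on_id)

lemma n4_Duh:
 assumes G: "locint G" and \<gamma>: "\<gamma> \<in> borel_measurable borel" "\<And>s. 0 \<le> \<gamma> s"
  and lpG: "AE s in lborel. lp (4 / 3) (G s) (\<gamma> s)" and L4: "L4 (S t (Duh G t))"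
 shows "ennreal (n4 (S t (Duh G t))) \<le> (\<integral>\<^sup>+s. ennreal (\<bar>ort t s\<bar> * \<gamma> s * ker (t - s)) \<partial>lborel)"
proof -
 have e: "S t (Duh G t) = (\<integral>s. S (t - s) (ort t s *\<^sub>R G s) \<partial>lborel)"
  unfolding Duh_def integral_bounded_linear[OF bounded_linear_S integrable_Duh[OF G], symmetric] by (simp add: S_S)
 show ?thesis
  unfolding e
 proof (rule strichartz_inhom_pt[OF locint_ort[OF G]])
  show "AE s in lborel. lp (4 / 3) (ort t s *\<^sub>R G s) (\<bar>ort t s\<bar> * \<gamma> s)"
   using lpG by eventually_elim (rule lp_scaleR, auto)
 qed (use \<gamma> L4 in \<open>auto simp: e[symmetric]\<close>)
qed

lemma Lp_Duh:
 assumes G: "locint G" and \<gamma>: "Lp_le lborel (8 / 5) \<gamma> A" "\<And>s. 0 \<le> \<gamma> s"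
  and lpG: "AE s in lborel. lp (4 / 3) (G s) (\<gamma> s)" and L4: "\<And>t. L4 (S t (Duh G t))"
 shows "L83 (\<lambda>t. n4 (S t (Duh G t))) (88 * A)"
proof -
 have [measurable]: "Duh G \<in> borel_measurable borel"
  by (rule borel_measurable_continuous_onI[OF continuous_Duh[OF G]])
 have m [measurable]: "\<gamma> \<in> borel_measurable borel" using Lp_leD(1)[OF \<gamma>(1)] by simp
 have "L83 (\<lambda>t. n4 (S t (Duh G t))) (88 * 1 * A)"
 proof (rule hls_dual[OF \<gamma>])
  fix t
  have "ennreal (n4 (S t (Duh G t))) \<le> (\<integral>\<^sup>+s. ennreal (\<bar>ort t s\<bar> * \<gamma> s * ker (t - s)) \<partial>lborel)"
   by (rule n4_Duh[OF G m \<gamma>(2) lpG L4])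
  also have "\<dots> \<le> (\<integral>\<^sup>+s. ennreal (\<gamma> s * ker (t - s)) \<partial>lborel)"
   by (intro nn_integral_mono ennreal_leI mult_right_mono mult_left_le_one_le ort_abs \<gamma>(2) ker_nonneg) auto
  finally show "ennreal (n4 (S t (Duh G t))) \<le> ennreal 1 * (\<integral>\<^sup>+s. ennreal (\<gamma> s * ker (t - s)) \<partial>lborel)" by simp
 qed (auto simp: n4_nonneg)
 thus ?thesis by simp
qed

text \<open>Translates the oriented integral in \<open>solution\<close> into \<open>Duh\<close>. The
  integral sees F strictly between 0 and t only, so a solution on an interval may be replaced by a
  cut-off defined on the whole line.\<close>

lemma interval_Duh:
 assumes G: "locint G" and eq: "\<And>s. min 0 t < s \<Longrightarrow> s < max 0 t \<Longrightarrow> F s = G s"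
 shows "interval_lebesgue_integrable lborel 0 (ereal t) (\<lambda>s. S (t - s) (F s))"
  and "(LBINT s=0..ereal t. S (t - s) (F s)) = S t (Duh G t)"
proof -
 have [measurable]: "G \<in> borel_measurable borel" using G by (simp add: locint_def)
 have ei: "einterval 0 (ereal t) = {0<..<t}" "einterval (ereal t) 0 = {t<..<0}"
  using einterval_eq(1)[of 0 t] einterval_eq(1)[of t 0] by (simp_all add: zero_ereal_def)
 have i: "integrable lborel (\<lambda>s. S (t - s) (ort t s *\<^sub>R G s))" by (rule integrable_S(1)[OF locint_ort[OF G]])
 have I: "(\<integral>s. S (t - s) (ort t s *\<^sub>R G s) \<partial>lborel) = S t (Duh G t)"
  unfolding Duh_def integral_bounded_linear[OF bounded_linear_S integrable_Duh[OF G], symmetric] by (simp add: S_S)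
 have ae: "AE s in lborel. s \<noteq> 0 \<and> s \<noteq> t"
  using AE_lborel_singleton[of 0] AE_lborel_singleton[of t] by eventually_elim simp
 show "interval_lebesgue_integrable lborel 0 (ereal t) (\<lambda>s. S (t - s) (F s))"
  and "(LBINT s=0..ereal t. S (t - s) (F s)) = S t (Duh G t)"
 proof (atomize(full), cases "0 \<le> t")
  case True
  have e: "(\<lambda>s. indicator {0<..<t} s *\<^sub>R S (t - s) (F s)) = (\<lambda>s. indicator {0<..<t} s *\<^sub>R S (t - s) (G s))"
   using eq True by (auto simp: fun_eq_iff split: split_indicator)
  have c: "AE s in lborel. S (t - s) (ort t s *\<^sub>R G s) = indicator {0<..<t} s *\<^sub>R S (t - s) (G s)"
   using ae by eventually_elim (use True in \<open>auto simp: ort_def split: split_indicator\<close>)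
  have "integrable lborel (\<lambda>s. indicator {0<..<t} s *\<^sub>R S (t - s) (G s))"
   by (rule Bochner_Integration.integrable_cong_AE[THEN iffD1, OF _ _ c i]) measurable
  moreover have "(\<integral>s. indicator {0<..<t} s *\<^sub>R S (t - s) (G s) \<partial>lborel) = S t (Duh G t)"
   unfolding I[symmetric] by (rule integral_cong_AE[symmetric, OF _ _ c]) measurable
  ultimately show "interval_lebesgue_integrable lborel 0 (ereal t) (\<lambda>s. S (t - s) (F s)) \<and>
    (LBINT s=0..ereal t. S (t - s) (F s)) = S t (Duh G t)"
   using True by (simp add: interval_lebesgue_integrable_def interval_lebesgue_integral_def ei
     set_integrable_def set_lebesgue_integral_def e)
 next
  case False
  have e: "(\<lambda>s. indicator {t<..<0} s *\<^sub>R S (t - s) (F s)) = (\<lambda>s. indicator {t<..<0} s *\<^sub>R S (t - s) (G s))"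
   using eq False by (auto simp: fun_eq_iff split: split_indicator)
  have c: "AE s in lborel. S (t - s) (ort t s *\<^sub>R G s) = - (indicator {t<..<0} s *\<^sub>R S (t - s) (G s))"
   using ae by eventually_elim (use False in \<open>auto simp: ort_def S_scaleR[of _ "-1", simplified] split: split_indicator\<close>)
  have "integrable lborel (\<lambda>s. - (indicator {t<..<0} s *\<^sub>R S (t - s) (G s)))"
   by (rule Bochner_Integration.integrable_cong_AE[THEN iffD1, OF _ _ c i]) measurable
  hence "integrable lborel (\<lambda>s. indicator {t<..<0} s *\<^sub>R S (t - s) (G s))"
   using Bochner_Integration.integrable_minus by fastforce
  moreover have "- (\<integral>s. indicator {t<..<0} s *\<^sub>R S (t - s) (G s) \<partial>lborel) = S t (Duh G t)"
   unfolding I[symmetric] Bochner_Integration.integral_minus[symmetric]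
   by (rule integral_cong_AE[symmetric, OF _ _ c]) measurable
  ultimately show "interval_lebesgue_integrable lborel 0 (ereal t) (\<lambda>s. S (t - s) (F s)) \<and>
    (LBINT s=0..ereal t. S (t - s) (F s)) = S t (Duh G t)"
   using False by (simp add: interval_lebesgue_integrable_def interval_lebesgue_integral_def ei
     set_integrable_def set_lebesgue_integral_def e zero_ereal_def)
 qed
qed

text \<open>Where \<open>f\<close> is not in \<open>L\<^sup>4\<close> the junk value \<open>n4 f = 0\<close> makes the second claim trivial.\<close>

lemma n4_lsc:
 assumes X: "X \<longlonglongrightarrow> f" and L4: "\<And>n. L4 (X n)" and p: "0 < p"
 shows "liminf (\<lambda>n. ennreal (n4 (X n) powr p)) < \<infinity> \<Longrightarrow> L4 f"
  and "ennreal (n4 f powr p) \<le> liminf (\<lambda>n. ennreal (n4 (X n) powr p))"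
proof -
 have main: "lp 4 f c" if c: "0 < c" "liminf (\<lambda>n. ennreal (n4 (X n) powr p)) < ennreal (c powr p)" for c
 proof -
  have "\<exists>\<^sub>F n in sequentially. n4 (X n) < c"
  proof (rule ccontr)
   assume "\<not> (\<exists>\<^sub>F n in sequentially. n4 (X n) < c)"
   hence "\<forall>\<^sub>F n in sequentially. ennreal (c powr p) \<le> ennreal (n4 (X n) powr p)"
    unfolding not_frequently not_less using c p by (auto elim!: eventually_mono intro!: ennreal_leI powr_mono2)
   from Liminf_bounded[OF this] c(2) show False by simp
  qed
  hence inf: "infinite {n. n4 (X n) < c}"
   by (simp add: frequently_sequentially infinite_nat_iff_unbounded_le)
  have l: "(\<lambda>n. X (enumerate {n. n4 (X n) < c} n)) \<longlonglongrightarrow> f"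
   using LIMSEQ_subseq_LIMSEQ[OF X strict_mono_enumerate[OF inf]] by (simp add: o_def)
  have "lp 4 (X (enumerate {n. n4 (X n) < c} n)) c" for n
   using enumerate_in_set[OF inf, of n] by (intro Lp_le_weaken[OF L4_n4[OF L4]]) auto
  from lp_tendsto[OF this l] show ?thesis by simp
 qed
 show "L4 f" if fin: "liminf (\<lambda>n. ennreal (n4 (X n) powr p)) < \<infinity>"
 proof -
  obtain r where r: "liminf (\<lambda>n. ennreal (n4 (X n) powr p)) = ennreal r" "0 \<le> r"
   by (cases "liminf (\<lambda>n. ennreal (n4 (X n) powr p))") (use fin in auto)
  have "((r + 1) powr (1 / p)) powr p = r + 1" using r p by (simp add: powr_powr)
  thus ?thesis using r by (intro L4I[OF main[of "(r + 1) powr (1 / p)"]]) (auto simp: ennreal_less_iff)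
 qed
 show "ennreal (n4 f powr p) \<le> liminf (\<lambda>n. ennreal (n4 (X n) powr p))"
 proof (rule ccontr)
  assume "\<not> ?thesis"
  hence lt: "liminf (\<lambda>n. ennreal (n4 (X n) powr p)) < ennreal (n4 f powr p)" by simp
  obtain r where r: "liminf (\<lambda>n. ennreal (n4 (X n) powr p)) = ennreal r" "0 \<le> r"
   by (cases "liminf (\<lambda>n. ennreal (n4 (X n) powr p))") (use lt in auto)
  hence rl: "r < n4 f powr p" using lt by (simp add: ennreal_less_iff)
  define c where "c = ((r + n4 f powr p) / 2) powr (1 / p)"
  have cp: "c powr p = (r + n4 f powr p) / 2" using r rl p by (simp add: c_def powr_powr)
  have c: "0 < c" using r rl by (simp add: c_def)
  have "lp 4 f c" by (rule main[OF c]) (use r rl in \<open>simp add: cp ennreal_less_iff\<close>)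
  hence "n4 f powr p \<le> c powr p" using p by (intro powr_mono2 n4_le n4_nonneg) auto
  thus False using cp rl by simp
 qed
qed

text \<open>Fatou's lemma in time on top of lower semicontinuity in space. The lower limit is
  integrable, hence finite at almost every time, and there the limit function is in L^4.\<close>

lemma Lp_n4_liminf:
 assumes B: "\<And>n. Lp_le lborel p (\<lambda>t. n4 (X n t)) A" and lim: "\<And>t. (\<lambda>n. X n t) \<longlonglongrightarrow> Y t"
  and L4: "\<And>n t. L4 (X n t)" and p: "0 < p" and Y: "Y \<in> borel_measurable borel"
 shows "Lp_le lborel p (\<lambda>t. n4 (Y t)) A" "AE t in lborel. L4 (Y t)"
proof -
 have [measurable]: "(\<lambda>t. n4 (X n t)) \<in> borel_measurable borel" for n using Lp_leD(1)[OF B[of n]] by simp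
 show "Lp_le lborel p (\<lambda>t. n4 (Y t)) A"
 proof (rule Lp_le_liminf[OF B])
  show "AE t in lborel. ennreal (\<bar>n4 (Y t)\<bar> powr p) \<le> liminf (\<lambda>n. ennreal (\<bar>n4 (X n t)\<bar> powr p))"
   using n4_lsc(2)[OF lim L4 p] by (simp add: n4_nonneg)
 qed (use Y in measurable)
 have "(\<integral>\<^sup>+t. liminf (\<lambda>n. ennreal (n4 (X n t) powr p)) \<partial>lborel) \<le> liminf (\<lambda>n. \<integral>\<^sup>+t. ennreal (n4 (X n t) powr p) \<partial>lborel)"
  by (rule nn_integral_liminf) measurable
 also have "\<dots> \<le> liminf (\<lambda>n::nat. ennreal (A powr p))"
  by (intro Liminf_mono always_eventually allI) (use Lp_leD(3)[OF B] in \<open>simp add: n4_nonneg\<close>)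
 also have "\<dots> = ennreal (A powr p)" by (simp add: Liminf_const)
 finally have "(\<integral>\<^sup>+t. liminf (\<lambda>n. ennreal (n4 (X n t) powr p)) \<partial>lborel) \<noteq> \<infinity>" by (auto simp: top_unique)
 from nn_integral_PInf_AE[OF _ this] have "AE t in lborel. liminf (\<lambda>n. ennreal (n4 (X n t) powr p)) \<noteq> \<infinity>" by simp
 thus "AE t in lborel. L4 (Y t)"
  by eventually_elim (rule n4_lsc(1)[OF lim L4 p], simp add: less_top)
qed

section \<open>Global solutions with small data\<close>

lemma dq_measurable [measurable]: "dq j h \<in> borel_measurable borel"
 by (rule borel_measurable_continuous_onI[OF linear_continuous_on[OF bounded_linear_dq]])

lemma ennreal_le_1_plus_powr: "ennreal x \<le> 1 + ennreal (x powr (8 / 3))"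
proof -
 have "x \<le> 1 + x powr (8 / 3)"
 proof (cases "x \<le> 1")
  case False
  hence "x powr 1 \<le> x powr (8 / 3)" by (intro powr_mono) auto
  thus ?thesis using False by simp
 qed (use powr_ge_zero[of x "8 / 3"] in linarith)
 thus ?thesis by (metis ennreal_1 ennreal_leI ennreal_plus powr_ge_zero zero_le_one)
qed

lemma nn_integral_loc:
 assumes g: "L83 g R" and g0: "\<And>t. 0 \<le> g t"
 shows "(\<integral>\<^sup>+t. ennreal (g t) * indicator {a..b} t \<partial>lborel) \<le> ennreal (max 0 (b - a) + R powr (8 / 3))"
proof -
 have [measurable]: "g \<in> borel_measurable borel" using Lp_leD(1)[OF g] by simp
 have "(\<integral>\<^sup>+t. ennreal (g t) * indicator {a..b} t \<partial>lborel) \<le> (\<integral>\<^sup>+t. indicator {a..b} t + ennreal (\<bar>g t\<bar> powr (8 / 3)) \<partial>lborel)"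
 proof (rule nn_integral_mono)
  fix t
  show "ennreal (g t) * indicator {a..b} t \<le> indicator {a..b} t + ennreal (\<bar>g t\<bar> powr (8 / 3))"
   using ennreal_le_1_plus_powr[of "g t"] g0 by (simp split: split_indicator)
 qed
 also have "\<dots> \<le> ennreal (max 0 (b - a)) + ennreal (R powr (8 / 3))"
  by (subst nn_integral_add) (auto intro!: add_mono Lp_leD(3)[OF g] simp: ennreal_leI max_def)
 finally show ?thesis by simp
qed

lemma Lp_n4_add:
 assumes "L83 (\<lambda>t. n4 (f t)) A" "L83 (\<lambda>t. n4 (g t)) B"
  and L4: "\<And>t. L4 (f t)" "\<And>t. L4 (g t)" and m: "(\<lambda>t. f t + g t) \<in> borel_measurable borel"
 shows "L83 (\<lambda>t. n4 (f t + g t)) (A + B)"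
 by (rule Lp_le_mono_AE[OF Lp_le_add[OF assms(1,2)]])
   (use n4_add[OF L4] m n4_nonneg in \<open>auto intro!: AE_I2 simp: add_nonneg_nonneg\<close>)

abbreviation J :: "L2 \<Rightarrow> L2" where "J \<equiv> L2_mult (\<lambda>_. \<i>)"

lemma bounded_linear_J: "bounded_linear J" by (rule bdd_mult.bounded_linear[OF bdd_mult_const])

lemma norm_J [simp]: "norm (J f) = norm f" by (rule norm_L2_mult_unimodular) auto

lemma L4_J: "L4 f \<Longrightarrow> L4 (J f)" and n4_J: "L4 f \<Longrightarrow> n4 (J f) \<le> n4 f"
 using lp_mult_unimodular[OF L4_n4, of f \<i>] by (auto intro: L4I n4_le)

lemma J_diff: "J (f - g) = J f - J g"
 by (rule linear_diff[OF bounded_linear.linear[OF bounded_linear_J]])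

lemma n4_add_J:
 assumes "L4 f" "L4 g" shows "n4 (f - J g) \<le> n4 f + n4 g"
 using n4_diff[OF assms(1) L4_J[OF assms(2)]] n4_J[OF assms(2)] by linarith

lemma Lp_free_plus_Duh:
 assumes G: "locint G" and L4: "\<And>t. L4 (S t u)" "\<And>t. L4 (S t (Duh G t))"
  and u: "norm u \<le> e" and B: "L83 (\<lambda>t. n4 (S t (Duh G t))) B"
 shows "L83 (\<lambda>t. n4 (S t (u - J (Duh G t)))) (10 * e + B)"
proof (rule Lp_le_mono_AE[OF Lp_le_add[OF Lp_le_weaken[OF strichartz_hom[OF L4(1)]] B]])
 have "continuous_on UNIV (\<lambda>t. S t (u - J (Duh G t)))"
  by (intro continuous_S_comp continuous_intros bounded_linear.continuous_on[OF bounded_linear_J] continuous_Duh[OF G])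
 note [measurable] = borel_measurable_continuous_onI[OF this]
 show "(\<lambda>t. n4 (S t (u - J (Duh G t)))) \<in> borel_measurable lborel" by measurable
 have "n4 (S t (u - J (Duh G t))) \<le> n4 (S t u) + n4 (S t (Duh G t))" for t
  unfolding S_diff S_const_mult by (rule n4_add_J[OF L4])
 thus "AE t in lborel. \<bar>n4 (S t (u - J (Duh G t)))\<bar> \<le> \<bar>n4 (S t u) + n4 (S t (Duh G t))\<bar>"
  by (intro AE_I2) (simp add: n4_nonneg add_nonneg_nonneg)
qed (use u in simp_all)

context dipolar
begin

section \<open>Local integrability of the nonlinearity, the solution space, and the
  contraction\<close>

abbreviation DN :: "(real \<Rightarrow> L2) \<Rightarrow> real \<Rightarrow> L2" where "DN \<psi> \<equiv> Duh (\<lambda>s. N (\<psi> s))"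

definition CS :: real where
 "CS = (SOME C. 0 < C \<and> (\<forall>f M. norm f \<le> M \<longrightarrow> (\<forall>j. Fder j f M) \<longrightarrow> lp 4 f (C * M)))"

lemma CS_pos: "0 < CS" and CS_Fder: "norm f \<le> M \<Longrightarrow> (\<And>j. Fder j f M) \<Longrightarrow> lp 4 f (CS * M)"
 using someI_ex[OF sobolev] unfolding CS_def by blast+

lemma CS_dq: "norm f \<le> M \<Longrightarrow> (\<And>j h. norm (dq j h f) \<le> M) \<Longrightarrow> lp 4 f (CS * M)"
 by (rule CS_Fder) (auto intro: Fder_dqI)

text \<open>Difference quotients bounded in L^1 in time have, by Fatou, finite lower limits at
  almost every time, which is what \<open>good_criterion\<close> takes as input. Summed over the
  directions, these limits also give an integrable majorant for the L^2 norm of the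
  nonlinearity.\<close>

lemma good_AE:
 fixes \<psi> :: "real \<Rightarrow> L2"
 assumes [measurable]: "\<psi> \<in> borel_measurable borel" and L4: "\<And>t. L4 (\<psi> t)" "\<And>t. n4 (\<psi> t) \<le> K"
  and D: "\<And>j n. (\<integral>\<^sup>+t. ennreal (n4 (dq j (inverse (real (Suc n))) (\<psi> t))) * indicator {a..b} t \<partial>lborel) \<le> ennreal D"
 shows "AE t in lborel. t \<in> {a..b} \<longrightarrow> good (\<psi> t)" "set_integrable lborel {a..b} (\<lambda>t. N (\<psi> t))"
proof -
 obtain C where C: "0 < C" "\<And>f b. L4 f \<Longrightarrow> (\<And>j. liminf (\<lambda>n. ennreal (n4 (dq j (inverse (real (Suc n))) f))) \<le> ennreal b) \<Longrightarrow> 0 \<le> b \<Longrightarrow>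
   good f \<and> norm (N f) \<le> C * (n4 f)\<^sup>2 * (b + 1 + n4 f)"
  using good_criterion by blast
 have K0: "0 \<le> K" using L4(2)[of 0] n4_nonneg[of "\<psi> 0"] by linarith
 define L where "L j t = liminf (\<lambda>n. ennreal (n4 (dq j (inverse (real (Suc n))) (\<psi> t))) * indicator {a..b} t)" for j t
 have [measurable]: "L j \<in> borel_measurable borel" for j unfolding L_def by measurable
 define s where "s t = (\<Sum>j\<in>UNIV. L j t)" for t
 have [measurable]: "s \<in> borel_measurable borel" unfolding s_def by measurable
 have "(\<integral>\<^sup>+t. L j t \<partial>lborel) \<le> ennreal D" for j
  unfolding L_def
  by (rule order_trans[OF nn_integral_liminf Liminf_le]) (use D in \<open>auto intro: always_eventually\<close>)
 hence "(\<integral>\<^sup>+t. s t \<partial>lborel) \<le> (\<Sum>j\<in>(UNIV :: 3 set). ennreal D)"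
  unfolding s_def by (subst nn_integral_sum) (measurable, intro sum_mono)
 also have "\<dots> < \<infinity>" by (simp add: ennreal_mult_less_top)
 finally have sfin: "(\<integral>\<^sup>+t. s t \<partial>lborel) < \<infinity>" .
 hence "AE t in lborel. s t \<noteq> \<infinity>" by (intro nn_integral_PInf_AE) auto
 hence main: "AE t in lborel. t \<in> {a..b} \<longrightarrow> good (\<psi> t) \<and> ennreal (norm (N (\<psi> t))) \<le> ennreal (C * K\<^sup>2) * (s t + ennreal (1 + K))"
 proof eventually_elim
  case (elim t)
  show ?case
  proof
   assume t: "t \<in> {a..b}"
   obtain b where b: "s t = ennreal b" "0 \<le> b" using elim by (cases "s t") auto
   have "liminf (\<lambda>n. ennreal (n4 (dq j (inverse (real (Suc n))) (\<psi> t)))) \<le> ennreal b" for j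
   proof -
    have "L j t \<le> s t" unfolding s_def by (rule member_le_sum) auto
    thus ?thesis using t b by (simp add: L_def)
   qed
   from C(2)[OF L4(1) this b(2)] have *: "good (\<psi> t)" "norm (N (\<psi> t)) \<le> C * (n4 (\<psi> t))\<^sup>2 * (b + 1 + n4 (\<psi> t))" by auto
   note *(2)
   also have "\<dots> \<le> C * K\<^sup>2 * (b + (1 + K))"
    using C(1) b(2) K0 L4(2)[of t] n4_nonneg[of "\<psi> t"] by (intro mult_mono power_mono) auto
   finally have "ennreal (norm (N (\<psi> t))) \<le> ennreal (C * K\<^sup>2 * (b + (1 + K)))" by (rule ennreal_leI)
   also have "\<dots> = ennreal (C * K\<^sup>2) * (s t + ennreal (1 + K))"
    using C(1) b K0 by (simp add: ennreal_mult' ennreal_plus[symmetric] del: ennreal_plus)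
   finally show "good (\<psi> t) \<and> ennreal (norm (N (\<psi> t))) \<le> ennreal (C * K\<^sup>2) * (s t + ennreal (1 + K))" using *(1) by simp
  qed
 qed
 thus "AE t in lborel. t \<in> {a..b} \<longrightarrow> good (\<psi> t)" by eventually_elim simp
 show "set_integrable lborel {a..b} (\<lambda>t. N (\<psi> t))"
  unfolding set_integrable_def
 proof (rule integrableI_bounded)
  have "(\<integral>\<^sup>+t. ennreal (norm (indicator {a..b} t *\<^sub>R N (\<psi> t))) \<partial>lborel)
   \<le> (\<integral>\<^sup>+t. ennreal (C * K\<^sup>2) * (s t + ennreal (1 + K) * indicator {a..b} t) \<partial>lborel)"
   by (rule nn_integral_mono_AE) (use main in eventually_elim, auto split: split_indicator)
  also have "\<dots> < \<infinity>"
   using sfin by (simp add: nn_integral_cmult nn_integral_add nn_integral_cmult_indicator ennreal_mult_less_top ennreal_add_less_top emeasure_lborel_Icc_eq)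
  finally show "(\<integral>\<^sup>+t. ennreal (norm (indicator {a..b} t *\<^sub>R N (\<psi> t))) \<partial>lborel) < \<infinity>" .
 qed measurable
qed

text \<open>The ball of radius R in bounded functions with values in H^1 and in L^(8/3) with values
  in W^(1,4), with gradients replaced by quotients bounded uniformly in h. Continuity is asked in
  L^2 only; continuity in H^1 is recovered for fixed points.\<close>

definition X :: "real \<Rightarrow> (real \<Rightarrow> L2) \<Rightarrow> bool" where
 "X R \<psi> \<longleftrightarrow> continuous_on UNIV \<psi> \<and> (\<forall>t. norm (\<psi> t) \<le> R \<and> (\<forall>j h. norm (dq j h (\<psi> t)) \<le> R)) \<and>
   L83 (\<lambda>t. n4 (\<psi> t)) R \<and> (\<forall>j h. L83 (\<lambda>t. n4 (dq j h (\<psi> t))) R)"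

lemma XD:
 assumes "X R \<psi>"
 shows "continuous_on UNIV \<psi>" "\<psi> \<in> borel_measurable borel" "norm (\<psi> t) \<le> R" "norm (dq j h (\<psi> t)) \<le> R"
  "L83 (\<lambda>t. n4 (\<psi> t)) R" "L83 (\<lambda>t. n4 (dq j h (\<psi> t))) R"
  "L4 (\<psi> t)" "n4 (\<psi> t) \<le> CS * R" "0 \<le> R"
proof -
 show 1: "continuous_on UNIV \<psi>" "norm (\<psi> t) \<le> R" "norm (dq j h (\<psi> t)) \<le> R"
  "L83 (\<lambda>t. n4 (\<psi> t)) R" "L83 (\<lambda>t. n4 (dq j h (\<psi> t))) R"
  using assms by (auto simp: X_def)
 show "\<psi> \<in> borel_measurable borel" by (rule borel_measurable_continuous_onI[OF 1(1)])
 have "lp 4 (\<psi> t) (CS * R)" by (rule CS_dq) (use assms in \<open>auto simp: X_def\<close>)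
 thus "L4 (\<psi> t)" "n4 (\<psi> t) \<le> CS * R" by (auto intro: L4I n4_le)
 show "0 \<le> R" using 1(2) norm_ge_zero order_trans by blast
qed

lemma X_good:
 assumes X: "X R \<psi>" shows "AE t in lborel. good (\<psi> t)" "locint (\<lambda>t. N (\<psi> t))"
proof -
 note [measurable] = XD(2)[OF X]
 note g = good_AE[OF _ XD(7)[OF X] XD(8)[OF X] nn_integral_loc[OF XD(6)[OF X] n4_nonneg]]
 have "AE t in lborel. \<forall>n::nat. t \<in> {- real n..real n} \<longrightarrow> good (\<psi> t)"
  unfolding AE_all_countable by (intro allI g(1)) measurable
 thus "AE t in lborel. good (\<psi> t)"
 proof eventually_elim
  case (elim t)
  obtain n :: nat where "\<bar>t\<bar> \<le> real n" using real_arch_simple by blast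
  hence "t \<in> {- real n..real n}" by auto
  with elim show ?case by blast
 qed
 show "locint (\<lambda>t. N (\<psi> t))" unfolding locint_def using g(2) by auto
qed

text \<open>Interpolates (n4)^2 as (n4)^(4/3) (n4)^(2/3). The first factor is at most (CS R)^(4/3)
  by Sobolev; if w bounds n4 in L^(8/3) on a time window, then w^(2/3) bounds the second factor in
  L^4 there.\<close>

definition kap :: "real \<Rightarrow> real \<Rightarrow> real" where "kap R w = (CS * R) powr (4 / 3) * w powr (2 / 3)"

lemma X_n4_sq:
 assumes X: "X R \<psi>" and A [measurable]: "A \<in> sets borel"
  and w: "L83 (\<lambda>s. indicator A s * n4 (\<psi> s)) w"
 shows "Lp_le lborel 4 (\<lambda>s. indicator A s * (n4 (\<psi> s))\<^sup>2) (kap R w)"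
proof -
 note [measurable] = XD(2)[OF X]
 have "Lp_le lborel 4 (\<lambda>s. (CS * R) powr (4 / 3) * \<bar>indicator A s * n4 (\<psi> s)\<bar> powr (2 / 3)) (\<bar>(CS * R) powr (4 / 3)\<bar> * w powr (2 / 3))"
  using Lp_le_cmult[OF Lp_le_powr[OF w, of "2 / 3"], of "(CS * R) powr (4 / 3)"] by simp
 hence "Lp_le lborel 4 (\<lambda>s. indicator A s * (n4 (\<psi> s))\<^sup>2) (\<bar>(CS * R) powr (4 / 3)\<bar> * w powr (2 / 3))"
 proof (rule Lp_le_mono_AE)
  have "(n4 (\<psi> s))\<^sup>2 \<le> (CS * R) powr (4 / 3) * n4 (\<psi> s) powr (2 / 3)" for s
  proof -
   have "(n4 (\<psi> s))\<^sup>2 = n4 (\<psi> s) powr (4 / 3) * n4 (\<psi> s) powr (2 / 3)"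
    using n4_nonneg[of "\<psi> s"] by (simp add: powr_add[symmetric])
   also have "\<dots> \<le> (CS * R) powr (4 / 3) * n4 (\<psi> s) powr (2 / 3)"
    by (intro mult_right_mono powr_mono2 XD(8)[OF X] n4_nonneg) auto
   finally show ?thesis .
  qed
  thus "AE s in lborel. \<bar>indicator A s * (n4 (\<psi> s))\<^sup>2\<bar> \<le> \<bar>(CS * R) powr (4 / 3) * \<bar>indicator A s * n4 (\<psi> s)\<bar> powr (2 / 3)\<bar>"
   by (intro AE_I2) (auto simp: n4_nonneg split: split_indicator)
 qed (simp, measurable)
 thus ?thesis by (simp add: kap_def)
qed

text \<open>An increment of the Duhamel integral sees only its window, and smallness of n4 on the
  window enters through \<open>kap\<close>. Short windows give continuity in time, remote ones the
  Cauchy property at infinity.\<close>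

lemma X_inc:
 assumes X: "X R \<psi>" and t: "t' \<le> t" and w: "L83 (\<lambda>s. indicator {t'<..t} s * n4 (\<psi> s)) w"
 defines "D \<equiv> DN \<psi> t - DN \<psi> t'"
 shows "norm D \<le> 30 * CW * kap R w * R" "norm (dq j h D) \<le> 30 * CW * kap R w * R"
proof -
 note G = X_good(2)[OF X]
 have \<gamma>: "Lp_le lborel (8 / 5) (\<lambda>s. indicator {t'<..t} s * (3 * CW * (n4 (\<psi> s))\<^sup>2 * b s)) (3 * CW * (kap R w * R))"
  if b: "L83 b R" for b
 proof -
  have "Lp_le lborel (8 / 5) (\<lambda>s. (indicator {t'<..t} s * (n4 (\<psi> s))\<^sup>2) * b s) (kap R w * R)"
   by (rule Lp_le_mult[OF X_n4_sq[OF X _ w] b]) auto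
  from Lp_le_cmult[OF this, of "3 * CW"] show ?thesis using CW_nonneg by (simp add: mult_ac)
 qed
 show "norm D \<le> 30 * CW * kap R w * R"
  unfolding D_def
  using norm_Duh_time_diff[OF G \<gamma>[OF XD(5)[OF X]] _ AE_I2[OF N_lp] t] CW_nonneg n4_nonneg by (simp add: mult_ac)
 have e: "dq j h D = Duh (\<lambda>s. dq j h (N (\<psi> s))) t - Duh (\<lambda>s. dq j h (N (\<psi> s))) t'"
  unfolding D_def dq_diff
  by (simp add: Duh_linear[OF G bounded_linear_dq S_dq[symmetric]])
 show "norm (dq j h D) \<le> 30 * CW * kap R w * R"
  unfolding e
  using norm_Duh_time_diff[OF locint_linear[OF G bounded_linear_dq] \<gamma>[OF XD(6)[OF X, of j h]] _ AE_I2[OF N_dq_lp] t]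
   CW_nonneg n4_nonneg by (simp add: mult_ac)
qed

lemma X_window:
 assumes X: "X R \<psi>" and [measurable]: "A \<in> sets borel" shows "L83 (\<lambda>s. indicator A s * n4 (\<psi> s)) R"
proof -
 note [measurable] = XD(2)[OF X]
 show ?thesis by (rule Lp_le_mono_AE[OF XD(5)[OF X]]) (auto intro!: AE_I2 split: split_indicator)
qed

text \<open>264 is 88 times 3, from \<open>Lp_Duh\<close> and the nonlinear estimates. The smaller
  constant 10 of \<open>norm_Duh\<close> is rounded up to 88 so that a single constant
  serves.\<close>

definition c0 :: real where "c0 = 264 * CW * CS powr (4 / 3)"

lemma c0_nonneg: "0 \<le> c0" by (simp add: c0_def CW_nonneg)

lemma kap_self: "0 \<le> R \<Longrightarrow> 264 * CW * kap R R = c0 * R\<^sup>2"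
 by (cases "R = 0") (simp_all add: kap_def c0_def powr_mult powr_add[symmetric])

lemma Duh_bounds:
 assumes G: "locint G" and m: "Lp_le lborel 4 m k" "\<And>s. 0 \<le> m s" and b: "L83 b B" "\<And>s. 0 \<le> b s"
  and lpG: "AE s in lborel. lp (4 / 3) (G s) (3 * CW * m s * b s)"
 shows "norm (Duh G t) \<le> 264 * CW * k * B"
  and "(\<And>t. L4 (S t (Duh G t))) \<Longrightarrow> L83 (\<lambda>t. n4 (S t (Duh G t))) (264 * CW * k * B)"
proof -
 have "Lp_le lborel (8 / 5) (\<lambda>s. m s * b s) (k * B)" by (rule Lp_le_mult[OF m(1) b(1)]) auto
 from Lp_le_cmult[OF this, of "3 * CW"] have \<gamma>: "Lp_le lborel (8 / 5) (\<lambda>s. 3 * CW * m s * b s) (3 * CW * k * B)"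
  using CW_nonneg by (simp add: mult_ac)
 have \<gamma>0: "0 \<le> 3 * CW * m s * b s" for s using CW_nonneg m b by simp
 have "norm (Duh G t) \<le> 10 * (3 * CW * k * B)" by (rule norm_Duh[OF G \<gamma> \<gamma>0 lpG])
 also have "\<dots> \<le> 264 * CW * k * B"
  using Lp_leD(2)[OF \<gamma>] by simp
 finally show "norm (Duh G t) \<le> 264 * CW * k * B" .
 show "L83 (\<lambda>t. n4 (S t (Duh G t))) (264 * CW * k * B)" if "\<And>t. L4 (S t (Duh G t))"
  using Lp_Duh[OF G \<gamma> \<gamma>0 lpG that] by (simp add: mult_ac)
qed

lemma X_Duh:
 assumes X: "X R \<psi>"
 defines "G \<equiv> \<lambda>s. N (\<psi> s)"
 shows "norm (Duh G t) \<le> c0 * R\<^sup>2 * R" "norm (dq j h (Duh G t)) \<le> c0 * R\<^sup>2 * R"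
  "L4 (S t (Duh G t))"
  "L83 (\<lambda>t. n4 (S t (Duh G t))) (c0 * R\<^sup>2 * R)"
  "L83 (\<lambda>t. n4 (S t (Duh (\<lambda>s. dq j h (G s)) t))) (c0 * R\<^sup>2 * R)"
proof -
 note X_G = X_good(2)[OF X, folded G_def]
 have sq: "Lp_le lborel 4 (\<lambda>s. (n4 (\<psi> s))\<^sup>2) (kap R R)"
  using X_n4_sq[OF X _ X_window[OF X], of UNIV] by simp
 note k = kap_self[OF XD(9)[OF X]]
 note b1 = Duh_bounds[OF X_G sq _ XD(5)[OF X] n4_nonneg, unfolded k]
 have b2: "norm (Duh (\<lambda>s. dq j h (G s)) t) \<le> c0 * R\<^sup>2 * R"
  "(\<And>t. L4 (S t (Duh (\<lambda>s. dq j h (G s)) t))) \<Longrightarrow> L83 (\<lambda>t. n4 (S t (Duh (\<lambda>s. dq j h (G s)) t))) (c0 * R\<^sup>2 * R)" for j h t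
 proof -
  have a: "AE s in lborel. lp (4 / 3) (dq j h (G s)) (3 * CW * (n4 (\<psi> s))\<^sup>2 * n4 (dq j h (\<psi> s)))"
   unfolding G_def by (intro AE_I2 N_dq_lp)
  note b = Duh_bounds[OF locint_linear[OF X_G bounded_linear_dq] sq _ XD(6)[OF X] n4_nonneg a, unfolded k]
  show "norm (Duh (\<lambda>s. dq j h (G s)) t) \<le> c0 * R\<^sup>2 * R"
   "(\<And>t. L4 (S t (Duh (\<lambda>s. dq j h (G s)) t))) \<Longrightarrow> L83 (\<lambda>t. n4 (S t (Duh (\<lambda>s. dq j h (G s)) t))) (c0 * R\<^sup>2 * R)"
   using b by simp_all
 qed
 have dqD: "dq j h (Duh G t) = Duh (\<lambda>s. dq j h (G s)) t" for j h t
  by (rule Duh_linear[OF X_G bounded_linear_dq S_dq[symmetric]])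
 show n: "norm (Duh G t) \<le> c0 * R\<^sup>2 * R" "norm (dq j h (Duh G t)) \<le> c0 * R\<^sup>2 * R" for t j h
  unfolding dqD by (rule b1(1), simp_all add: G_def N_lp) (use b2(1)[of j h] in \<open>simp add: G_def\<close>)
 show L: "L4 (S t (Duh G t))" for t
  by (rule L4I[OF CS_dq[where M = "c0 * R\<^sup>2 * R"]]) (auto simp: n S_dq[symmetric])
 show "L83 (\<lambda>t. n4 (S t (Duh G t))) (c0 * R\<^sup>2 * R)"
  by (rule b1(2)) (use L in \<open>auto simp: G_def N_lp\<close>)
 show "L83 (\<lambda>t. n4 (S t (Duh (\<lambda>s. dq j h (G s)) t))) (c0 * R\<^sup>2 * R)"
  by (rule b2(2)) (use L4_dq[OF L, of j h] in \<open>simp add: S_dq[symmetric] dqD\<close>)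
qed

definition Phi :: "L2 \<Rightarrow> (real \<Rightarrow> L2) \<Rightarrow> real \<Rightarrow> L2" where
 "Phi \<psi>0 \<psi> t = S t (\<psi>0 - J (DN \<psi> t))"

lemma X_Phi:
 assumes X: "X R \<psi>" and e: "norm \<psi>0 \<le> e" "\<And>j h. norm (dq j h \<psi>0) \<le> e" and R: "10 * e + c0 * R\<^sup>2 * R \<le> R"
 shows "X R (Phi \<psi>0 \<psi>)"
proof -
 note G = X_good(2)[OF X]
 note D = X_Duh[OF X]
 have e0: "0 \<le> e" using e(1) norm_ge_zero order_trans by blast
 have r: "e + c0 * R\<^sup>2 * R \<le> R" using R e0 by linarith
 have dqP: "dq j h (Phi \<psi>0 \<psi> t) = S t (dq j h \<psi>0 - J (Duh (\<lambda>s. dq j h (N (\<psi> s))) t))" for j h t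
  unfolding Phi_def S_dq[symmetric] dq_diff dq_const_mult[symmetric]
   Duh_linear[OF G bounded_linear_dq S_dq[symmetric]] ..
 have L0: "L4 (S t \<psi>0)" for t
  by (rule L4I[OF CS_dq[where M = e]]) (auto simp: e S_dq[symmetric])
 have n: "norm (u - J v) \<le> R" if "norm u \<le> e" "norm v \<le> c0 * R\<^sup>2 * R" for u v
  using norm_triangle_ineq4[of u "J v"] that r by simp
 have "continuous_on UNIV (Phi \<psi>0 \<psi>)"
  unfolding Phi_def[abs_def]
  by (intro continuous_S_comp continuous_intros bounded_linear.continuous_on[OF bounded_linear_J] continuous_Duh[OF G])
 moreover have "norm (Phi \<psi>0 \<psi> t) \<le> R" "norm (dq j h (Phi \<psi>0 \<psi> t)) \<le> R" for t j h
  unfolding dqP unfolding Phi_def norm_S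
  by (rule n[OF e(1) D(1)], rule n[OF e(2)], use D(2)[of j h t] in \<open>simp add: Duh_linear[OF G bounded_linear_dq S_dq[symmetric]]\<close>)
 moreover have "L83 (\<lambda>t. n4 (Phi \<psi>0 \<psi> t)) R"
  unfolding Phi_def by (rule Lp_le_weaken[OF Lp_free_plus_Duh[OF G L0 D(3) e(1) D(4)] R]) simp
 moreover have "L83 (\<lambda>t. n4 (dq j h (Phi \<psi>0 \<psi> t))) R" for j h
  unfolding dqP
 proof (rule Lp_le_weaken[OF Lp_free_plus_Duh[OF locint_linear[OF G bounded_linear_dq] _ _ e(2) D(5)] R])
  show "L4 (S t (dq j h \<psi>0))" for t using L4_dq[OF L0] by (simp add: S_dq)
  show "L4 (S t (Duh (\<lambda>s. dq j h (N (\<psi> s))) t))" for t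
   using L4_dq[OF D(3)[of t], of j h] by (simp add: S_dq[symmetric] Duh_linear[OF G bounded_linear_dq S_dq[symmetric]])
 qed simp
 ultimately show ?thesis by (simp add: X_def)
qed

text \<open>The distance involves no derivatives. Both \<open>n4\<close> functions have L^8 norm at
  most the square root of \<open>kap R R\<close>, so the square of their sum has L^4 norm at most 4
  \<open>kap R R\<close>. The contraction factor is thus 4 c0 R^2, at most 1/2.\<close>

lemma Phi_contraction:
 assumes X: "X R \<psi>" and Y: "X R \<phi>" and R: "8 * c0 * R\<^sup>2 \<le> 1"
  and B: "L83 (\<lambda>t. n4 (\<psi> t - \<phi> t)) B"
 shows "norm (Phi \<psi>0 \<psi> t - Phi \<psi>0 \<phi> t) \<le> B / 2"
  and "L83 (\<lambda>t. n4 (Phi \<psi>0 \<psi> t - Phi \<psi>0 \<phi> t)) (B / 2)"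
proof -
 have B0: "0 \<le> B" by (rule Lp_leD(2)[OF B])
 have R0: "0 \<le> R" by (rule XD(9)[OF X])
 note GX = X_good(2)[OF X] and GY = X_good(2)[OF Y]
 let ?G = "\<lambda>s. N (\<psi> s) - N (\<phi> s)"
 note G = locint_diff[OF GX GY]
 let ?m = "\<lambda>s. (n4 (\<psi> s) + n4 (\<phi> s))\<^sup>2"
 have 8: "Lp_le lborel 8 (\<lambda>s. n4 (f s)) (kap R R powr (1 / 2))" if f: "X R f" for f
 proof -
  have "Lp_le lborel 4 (\<lambda>s. (n4 (f s))\<^sup>2) (kap R R)"
   using X_n4_sq[OF f _ X_window[OF f], of UNIV] by simp
  from Lp_le_powr[OF this, of "1 / 2"] show ?thesis using n4_nonneg by (simp add: powr_half_sqrt)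
 qed
 have k0: "0 \<le> kap R R" by (simp add: kap_def)
 have "Lp_le lborel 8 (\<lambda>s. n4 (\<psi> s) + n4 (\<phi> s)) (2 * kap R R powr (1 / 2))"
  using Lp_le_add[OF 8[OF X] 8[OF Y]] by simp
 from Lp_le_powr[OF this, of 2] have m: "Lp_le lborel 4 ?m (4 * kap R R)"
  using k0 n4_nonneg by (simp add: powr_mult powr_powr add_nonneg_nonneg)
 have lpG: "AE s in lborel. lp (4 / 3) (?G s) (3 * CW * ?m s * n4 (\<psi> s - \<phi> s))"
  using X_good(1)[OF X] X_good(1)[OF Y] by eventually_elim (rule N_diff_lp, auto simp: n4_nonneg)
 have e: "Phi \<psi>0 \<psi> t - Phi \<psi>0 \<phi> t = S t (0 - J (Duh ?G t))" for t
  unfolding Phi_def S_diff[symmetric] Duh_diff[OF GX GY, symmetric] by (simp add: J_diff)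
 have le: "264 * CW * (4 * kap R R) * B \<le> B / 2"
 proof -
  have "264 * CW * (4 * kap R R) * B = (8 * (264 * CW * kap R R)) * B / 2" by simp
  also have "\<dots> = 8 * c0 * R\<^sup>2 * B / 2" unfolding kap_self[OF R0] by simp
  also have "\<dots> \<le> B / 2" using mult_right_mono[OF R B0] by (simp only: mult_1 divide_right_mono zero_le_numeral)
  finally show ?thesis .
 qed
 have "norm (Duh ?G t) \<le> 264 * CW * (4 * kap R R) * B"
  by (rule Duh_bounds(1)[OF G m _ B _ lpG]) (auto simp: n4_nonneg)
 thus "norm (Phi \<psi>0 \<psi> t - Phi \<psi>0 \<phi> t) \<le> B / 2" unfolding e using le by simp
 have L: "L4 (S t (Duh ?G t))" for t
  unfolding Duh_diff[OF GX GY, symmetric] S_diff by (intro L4_diff X_Duh(3)[OF X] X_Duh(3)[OF Y])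
 have "L83 (\<lambda>t. n4 (S t (Duh ?G t))) (264 * CW * (4 * kap R R) * B)"
  by (rule Duh_bounds(2)[OF G m _ B _ lpG L]) (auto simp: n4_nonneg)
 from Lp_free_plus_Duh[OF G _ L _ Lp_le_weaken[OF this le], of 0 0]
 show "L83 (\<lambda>t. n4 (Phi \<psi>0 \<psi> t - Phi \<psi>0 \<phi> t)) (B / 2)" unfolding e by simp
qed

end

lemma norm_dq_commute: "norm (dq j h (x - y)) = norm (dq j h (y - x))"
 unfolding dq_diff by (rule norm_minus_commute)

context dipolar
begin

lemma X_zero: assumes "0 \<le> R" shows "X R (\<lambda>_. 0)"
proof -
 have "dq j h 0 = 0" for j h by (rule dq_zero)
 moreover have "L83 (\<lambda>t. 0) R" by (rule Lp_le_weaken[OF Lp_le_zero]) (use assms in auto)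
 ultimately show ?thesis using assms by (simp add: X_def)
qed

text \<open>Every bound in \<open>X\<close> is lower semicontinuous under L^2 convergence at each
  time, so no convergence of derivatives is asked for.\<close>

lemma X_closed:
 assumes X: "\<And>n. X R (\<phi> n)" and lim: "\<And>t. (\<lambda>n. \<phi> n t) \<longlonglongrightarrow> \<psi> t" and c: "continuous_on UNIV \<psi>"
 shows "X R \<psi>"
proof -
 have dqlim: "(\<lambda>n. dq j h (\<phi> n t)) \<longlonglongrightarrow> dq j h (\<psi> t)" for j h t
  by (rule bounded_linear.tendsto[OF bounded_linear_dq lim])
 note [measurable] = borel_measurable_continuous_onI[OF c]
 have "norm (\<psi> t) \<le> R" "norm (dq j h (\<psi> t)) \<le> R" for t j h
  using LIMSEQ_le_const2[OF tendsto_norm[OF lim[of t]]] LIMSEQ_le_const2[OF tendsto_norm[OF dqlim[of j h t]]]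
   XD(3,4)[OF X] by blast+
 moreover have "L83 (\<lambda>t. n4 (\<psi> t)) R"
  by (rule Lp_n4_liminf(1)[OF XD(5)[OF X] lim XD(7)[OF X]]) auto
 moreover have "L83 (\<lambda>t. n4 (dq j h (\<psi> t))) R" for j h
  by (rule Lp_n4_liminf(1)[OF XD(6)[OF X] dqlim L4_dq[OF XD(7)[OF X]]]) auto
 ultimately show ?thesis using c by (simp add: X_def)
qed

text \<open>Picard iteration: the iterates converge uniformly in L^2 by the Weierstrass test. The
  contraction takes the L^(8/3) L^4 distance as input, so this distance from the iterates to the
  limit is recovered by lower semicontinuity before the limit is recognised as a fixed
  point.\<close>

lemma fixed_point:
 assumes e: "norm \<psi>0 \<le> e" "\<And>j h. norm (dq j h \<psi>0) \<le> e"
  and R: "0 \<le> R" "10 * e + c0 * R\<^sup>2 * R \<le> R" "8 * c0 * R\<^sup>2 \<le> 1"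
 shows "\<exists>\<psi>. X R \<psi> \<and> (\<forall>t. \<psi> t = Phi \<psi>0 \<psi> t)"
proof -
 define \<phi> where "\<phi> n = (Phi \<psi>0 ^^ n) (\<lambda>_. 0)" for n
 have \<phi>0: "\<phi> 0 = (\<lambda>_. 0)" and \<phi>S: "\<phi> (Suc n) = Phi \<psi>0 (\<phi> n)" for n by (simp_all add: \<phi>_def)
 have X\<phi>: "X R (\<phi> n)" for n
  by (induction n) (use X_zero[OF R(1)] X_Phi[OF _ e R(2)] in \<open>simp_all add: \<phi>0 \<phi>S\<close>)
 note [measurable] = XD(2)[OF X\<phi>]
 have d: "L83 (\<lambda>t. n4 (\<phi> (Suc n) t - \<phi> n t)) (R / 2 ^ n)" for n
 proof (induction n)
  case 0
  thus ?case using XD(5)[OF X\<phi>[of 1]] by (simp add: \<phi>0)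
 next
  case (Suc n)
  from Phi_contraction(2)[OF X\<phi> X\<phi> R(3) Suc, of \<psi>0] show ?case by (simp add: \<phi>S mult.commute)
 qed
 have nd: "norm (\<phi> (Suc n) t - \<phi> n t) \<le> R * (1 / 2) ^ n" for n t
 proof (cases n)
  case 0
  thus ?thesis using XD(3)[OF X\<phi>[of 1]] by (simp add: \<phi>0)
 next
  case (Suc m)
  from Phi_contraction(1)[OF X\<phi> X\<phi> R(3) d[of m], of \<psi>0 t] show ?thesis
   by (simp add: \<phi>S Suc power_divide)
 qed
 define \<psi> where "\<psi> t = (\<Sum>i. \<phi> (Suc i) t - \<phi> i t)" for t
 have "uniform_limit UNIV (\<lambda>n t. \<Sum>i<n. \<phi> (Suc i) t - \<phi> i t) \<psi> sequentially"
  unfolding \<psi>_def by (rule Weierstrass_m_test[OF nd]) (auto intro!: summable_mult summable_geometric)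
 moreover have "(\<Sum>i<n. \<phi> (Suc i) t - \<phi> i t) = \<phi> n t" for n t
  by (subst sum_lessThan_telescope) (simp add: \<phi>0)
 ultimately have ul: "uniform_limit UNIV \<phi> \<psi> sequentially" by (simp add: fun_eq_iff)
 have lim: "(\<lambda>n. \<phi> n t) \<longlonglongrightarrow> \<psi> t" for t by (rule tendsto_uniform_limitI[OF ul]) simp
 have X\<psi>: "X R \<psi>"
  by (rule X_closed[OF X\<phi> lim uniform_limit_theorem[OF _ ul]]) (auto intro: always_eventually XD(1)[OF X\<phi>])
 note [measurable] = XD(2)[OF X\<psi>]
 have tail: "L83 (\<lambda>t. n4 (\<psi> t - \<phi> n t)) (2 * R / 2 ^ n)" for n
 proof (rule Lp_n4_liminf(1))
  \<comment> \<open>The induction carries the exact geometric partial sum; the bound 2 R / 2^n alone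
    would not reproduce itself.\<close>
  have "L83 (\<lambda>t. n4 (\<phi> (n + k) t - \<phi> n t)) (2 * R / 2 ^ n - 2 * R / 2 ^ (n + k))" for k
  proof (induction k)
   case 0
   thus ?case by (simp add: Lp_le_zero)
  next
   case (Suc k)
   have "L83 (\<lambda>t. n4 ((\<phi> (Suc (n + k)) t - \<phi> (n + k) t) + (\<phi> (n + k) t - \<phi> n t)))
     (R / 2 ^ (n + k) + (2 * R / 2 ^ n - 2 * R / 2 ^ (n + k)))"
    by (rule Lp_n4_add[OF d Suc]) (auto intro: L4_diff XD(7)[OF X\<phi>])
   thus ?case by (simp add: field_simps)
  qed
  thus "L83 (\<lambda>t. n4 (\<phi> (n + k) t - \<phi> n t)) (2 * R / 2 ^ n)" for k
   by (rule Lp_le_weaken) (use R(1) in auto)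
  show "(\<lambda>k. \<phi> (n + k) t - \<phi> n t) \<longlonglongrightarrow> \<psi> t - \<phi> n t" for t
   using tendsto_diff[OF LIMSEQ_ignore_initial_segment[OF lim[of t], of n] tendsto_const] by (simp add: add.commute)
 qed (auto intro: L4_diff XD(7)[OF X\<phi>])
 have "\<psi> t = Phi \<psi>0 \<psi> t" for t
 proof -
  have "(\<lambda>n. R * (1 / 2) ^ n) \<longlonglongrightarrow> R * 0" by (intro tendsto_mult tendsto_const LIMSEQ_power_zero) simp
  hence l0: "(\<lambda>n. R * (1 / 2) ^ n) \<longlonglongrightarrow> 0" by simp
  have "norm (Phi \<psi>0 \<psi> t - \<phi> (Suc n) t) \<le> R * (1 / 2) ^ n" for n
   using Phi_contraction(1)[OF X\<psi> X\<phi> R(3) tail, of \<psi>0 t n] by (simp add: \<phi>S power_divide)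
  hence "(\<lambda>n. norm (\<phi> (Suc n) t - Phi \<psi>0 \<psi> t)) \<longlonglongrightarrow> 0"
   by (intro tendsto_sandwich[OF _ _ tendsto_const l0]) (simp_all add: norm_minus_commute)
  hence "(\<lambda>n. \<phi> (Suc n) t) \<longlonglongrightarrow> Phi \<psi>0 \<psi> t"
   by (simp add: tendsto_norm_zero_iff LIM_zero_iff)
  from LIMSEQ_unique[OF LIMSEQ_Suc[OF lim] this] show ?thesis .
 qed
 with X\<psi> show ?thesis by blast
qed

subsection \<open>Regularity and scattering\<close>

lemma X_H1: assumes X: "X R \<psi>" shows "\<psi> t \<in> H1"
 by (rule H1_normI(1)[OF XD(3)[OF X]]) (auto intro: Fder_dqI XD(4)[OF X])

lemma in_Lq_loc_LpI:
 assumes "L83 (\<lambda>t. n4 (u t)) A" "AE t in lborel. L4 (u t)"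
 shows "in_Lq_loc_Lp UNIV (8 / 3) 4 u"
proof -
 have [measurable]: "(\<lambda>t. n4 (u t)) \<in> borel_measurable borel" using Lp_leD(1)[OF assms(1)] by simp
 have "integrable lborel (\<lambda>t. n4 (u t) powr (8 / 3))"
 proof (rule integrableI_bounded)
  show "(\<integral>\<^sup>+t. ennreal (norm (n4 (u t) powr (8 / 3))) \<partial>lborel) < \<infinity>"
   using Lp_leD(3)[OF assms(1)] by (simp add: n4_nonneg le_less_trans)
 qed measurable
 hence "set_integrable lborel {a..b} (\<lambda>t. n4 (u t) powr (8 / 3))" for a b
  unfolding set_integrable_def by (rule integrable_mult_indicator[rotated]) simp
 moreover have "AE t in lborel. t \<in> {a..b} \<longrightarrow> in_Lp 4 (rep_L2 (u t))" for a b
  using assms(2) by eventually_elim (simp add: L4_in_Lp)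
 ultimately show ?thesis by (simp add: in_Lq_loc_Lp_def n4_def)
qed

text \<open>On a window of length |s - t| the uniform bound on \<open>n4\<close> has L^(8/3) norm at
  most CS R |s - t|^(3/8), and \<open>X_inc\<close> does the rest.\<close>

lemma Duh_Holder:
 assumes X: "X R \<psi>"
 defines "D \<equiv> DN \<psi>"
 shows "norm (D s - D t) \<le> 30 * CW * kap R (CS * R * \<bar>s - t\<bar> powr (3 / 8)) * R"
  and "norm (dq j h (D s - D t)) \<le> 30 * CW * kap R (CS * R * \<bar>s - t\<bar> powr (3 / 8)) * R"
proof -
 note [measurable] = XD(2)[OF X]
 have R0: "0 \<le> CS * R" using XD(9)[OF X] CS_pos by simp
 have w: "L83 (\<lambda>s. indicator {a<..b} s * n4 (\<psi> s)) (CS * R * \<bar>b - a\<bar> powr (3 / 8))" if "a \<le> b" for a b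
  unfolding Lp_le_def
 proof (intro conjI)
  have "(\<integral>\<^sup>+s. ennreal (\<bar>indicator {a<..b} s * n4 (\<psi> s)\<bar> powr (8 / 3)) \<partial>lborel) \<le> (\<integral>\<^sup>+s. ennreal ((CS * R) powr (8 / 3)) * indicator {a<..b} s \<partial>lborel)"
   by (intro nn_integral_mono) (auto intro!: ennreal_leI powr_mono2 XD(8)[OF X] simp: n4_nonneg split: split_indicator)
  also have "\<dots> = ennreal ((CS * R * \<bar>b - a\<bar> powr (3 / 8)) powr (8 / 3))"
   using that R0 by (simp add: nn_integral_cmult_indicator powr_mult powr_powr ennreal_mult')
  finally show "(\<integral>\<^sup>+s. ennreal (\<bar>indicator {a<..b} s * n4 (\<psi> s)\<bar> powr (8 / 3)) \<partial>lborel) \<le> \<dots>" .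
 qed (use R0 in \<open>simp_all, measurable?\<close>)
 show "norm (D s - D t) \<le> 30 * CW * kap R (CS * R * \<bar>s - t\<bar> powr (3 / 8)) * R"
  "norm (dq j h (D s - D t)) \<le> 30 * CW * kap R (CS * R * \<bar>s - t\<bar> powr (3 / 8)) * R"
 proof (atomize(full), cases "t \<le> s")
  case True
  from X_inc[OF X this w[OF this]] 
  show "norm (D s - D t) \<le> 30 * CW * kap R (CS * R * \<bar>s - t\<bar> powr (3 / 8)) * R \<and>
   norm (dq j h (D s - D t)) \<le> 30 * CW * kap R (CS * R * \<bar>s - t\<bar> powr (3 / 8)) * R" by (simp add: D_def)
 next
  case False
  hence "s \<le> t" by simp
  from X_inc[OF X this w[OF this]] 
  show "norm (D s - D t) \<le> 30 * CW * kap R (CS * R * \<bar>s - t\<bar> powr (3 / 8)) * R \<and>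
   norm (dq j h (D s - D t)) \<le> 30 * CW * kap R (CS * R * \<bar>s - t\<bar> powr (3 / 8)) * R"
   by (simp add: D_def norm_minus_commute norm_dq_commute[where y = "Duh _ t"] abs_minus_commute)
 qed
qed

lemma fixed_point_solution:
 assumes X: "X R \<psi>" and fp: "\<And>t. \<psi> t = Phi \<psi>0 \<psi> t"
 shows "solution lam1 lam2 \<psi>0 UNIV \<psi>"
proof -
 let ?D = "DN \<psi>"
 note [measurable] = XD(2)[OF X]
 have H: "\<psi> t \<in> H1" for t by (rule X_H1[OF X])
 have cont: "((\<lambda>s. H1_norm (\<psi> s - \<psi> t)) \<longlongrightarrow> 0) (at t)" for t
 proof -
  define Z where "Z = \<psi>0 - J (?D t)"
  have ZS: "Z = S (- t) (\<psi> t)" by (subst fp) (simp add: Phi_def S_S Z_def)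
  have sw: "weak_deriv j (S s (\<psi> t)) = S s (weak_deriv j (\<psi> t))" "S s (\<psi> t) \<in> H1" for s j
  proof -
   have "(\<lambda>n. dq j (inverse (real (Suc n))) (S s (\<psi> t))) \<longlonglongrightarrow> S s (weak_deriv j (\<psi> t))"
    unfolding S_dq[symmetric]
    by (rule bounded_linear.tendsto[OF bounded_linear_S H1_dq_tendsto[OF H inverse_Suc_seq(2) inverse_Suc_ne]])
   from weak_deriv_eqI[OF has_weak_deriv_of_dq[OF inverse_Suc_seq(2) inverse_Suc_ne this]]
   show "weak_deriv j (S s (\<psi> t)) = S s (weak_deriv j (\<psi> t))" .
   show "S s (\<psi> t) \<in> H1"
    by (rule H1_normI(1)[where M = R]) (auto intro!: Fder_dqI simp: S_dq[symmetric] XD(3,4)[OF X])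
  qed
  define w where "w j = weak_deriv j (\<psi> t)" for j
  \<comment> \<open>One majorant for the difference and for all its quotients: the Duhamel
    increment, plus the free motion of \<psi> t and of its weak derivatives, on which the group is
    strongly continuous.\<close>
  define M where "M s = 30 * CW * kap R (CS * R * \<bar>s - t\<bar> powr (3 / 8)) * R + (norm (S (s - t) (\<psi> t) - \<psi> t) +
   (\<Sum>j\<in>UNIV. norm (S (s - t) (w j) - w j)))" for s
  have le: "H1_norm (\<psi> s - \<psi> t) \<le> 2 * M s" for s
  proof (rule H1_normI(2))
   let ?u = "S (s - t) (\<psi> t) - \<psi> t"
   have e: "\<psi> s - \<psi> t = - S s (J (?D s - ?D t)) + ?u"
   proof -
    have "\<psi> s = S s (Z - J (?D s - ?D t))" by (subst fp) (simp add: Phi_def Z_def J_diff)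
    thus ?thesis by (simp add: S_diff ZS S_S)
   qed
   have s0: "0 \<le> (\<Sum>j\<in>UNIV. norm (S (s - t) (w j) - w j))" by (simp add: sum_nonneg)
   show "norm (\<psi> s - \<psi> t) \<le> M s"
    unfolding e using norm_triangle_ineq[of "- S s (J (?D s - ?D t))" ?u] Duh_Holder(1)[OF X, of s t] s0
    by (simp add: M_def)
   fix j show "Fder j (\<psi> s - \<psi> t) (M s)"
   proof (rule Fder_dqI)
    fix h
    have "dq j h (\<psi> s - \<psi> t) = - S s (J (dq j h (?D s - ?D t))) + dq j h ?u"
     unfolding e dq_add linear_neg[OF bounded_linear.linear[OF bounded_linear_dq]]
     by (simp add: S_dq dq_const_mult)
    moreover have "norm (dq j h ?u) \<le> norm (S (s - t) (w j) - w j)"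
    proof -
     have "?u \<in> H1"
     proof (rule H1_normI(1)[where M = "2 * R"])
      show "norm ?u \<le> 2 * R"
       using norm_triangle_ineq4[of "S (s - t) (\<psi> t)" "\<psi> t"] XD(3)[OF X, of t] by simp
      show "Fder j ?u (2 * R)" for j
      proof (rule Fder_dqI)
       fix h
       show "norm (dq j h ?u) \<le> 2 * R"
        using norm_triangle_ineq4[of "S (s - t) (dq j h (\<psi> t))" "dq j h (\<psi> t)"] XD(4)[OF X, of j h t]
        by (simp add: dq_diff S_dq[symmetric])
      qed
     qed
     from H1_dq_le[OF this, of j h] show ?thesis by (simp add: weak_deriv_diff[OF sw(2) H] sw w_def)
    qed
    moreover have "norm (S (s - t) (w j) - w j) \<le> (\<Sum>j\<in>UNIV. norm (S (s - t) (w j) - w j))"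
     by (rule member_le_sum) auto
    ultimately show "norm (dq j h (\<psi> s - \<psi> t)) \<le> M s"
     using norm_triangle_ineq[of "- S s (J (dq j h (?D s - ?D t)))" "dq j h ?u"] Duh_Holder(2)[OF X, where j = j and h = h, of s t]
      norm_ge_zero[of ?u]
     unfolding M_def by (simp only: norm_minus_cancel norm_S norm_J)
   qed
  qed
  have Sl: "((\<lambda>s. S (s - t) f) \<longlongrightarrow> f) (at t)" for f
  proof -
   have "continuous_on UNIV (\<lambda>s. (s - t, f))" by (intro continuous_intros)
   from continuous_on_compose2[OF continuous_on_S this] have "continuous_on UNIV (\<lambda>s. S (s - t) f)" by simp
   thus ?thesis by (simp add: continuous_on_def) (metis S_0 diff_self)
  qed
  have "((\<lambda>s. \<bar>s - t\<bar> powr a) \<longlongrightarrow> 0) (at t)" if "0 < a" for a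
   by (rule tendsto_zero_powrI[of _ _ "\<lambda>_. a"]) (use that in \<open>auto intro!: tendsto_eq_intros\<close>)
  \<comment> \<open>\<open>kap\<close> raises |s - t|^(3/8) to the power 2/3, and 3/8 times 2/3 is
    1/4.\<close>
  from this[of "1 / 4"] have k: "((\<lambda>s. kap R (CS * R * \<bar>s - t\<bar> powr (3 / 8))) \<longlongrightarrow> 0) (at t)"
   using XD(9)[OF X] CS_pos by (simp add: kap_def powr_mult powr_powr tendsto_mult_right_zero)
  have "((\<lambda>s. 2 * M s) \<longlongrightarrow> 2 * (30 * CW * 0 * R + (norm (\<psi> t - \<psi> t) + (\<Sum>j\<in>UNIV. norm (w j - w j))))) (at t)"
   unfolding M_def by (intro tendsto_intros k Sl)
  hence l0: "((\<lambda>s. 2 * M s) \<longlongrightarrow> 0) (at t)" by simp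
  show ?thesis
   by (rule tendsto_sandwich[OF _ _ tendsto_const l0]) (simp_all add: le always_eventually order_trans[OF norm_ge_zero H1_norm_ge(1)])
 qed
 have L: "in_Lq_loc_Lp UNIV (8 / 3) 4 \<psi>"
  by (rule in_Lq_loc_LpI[OF XD(5)[OF X]]) (simp add: XD(7)[OF X])
 \<comment> \<open>Weak derivatives are L^2 limits of quotients; measurability, the L^(8/3) bound
   and membership in L^4 at almost every time are all inherited from these.\<close>
 have wL: "in_Lq_loc_Lp UNIV (8 / 3) 4 (\<lambda>t. weak_deriv j (\<psi> t))" for j
 proof -
  have lim: "(\<lambda>n. dq j (inverse (real (Suc n))) (\<psi> t)) \<longlonglongrightarrow> weak_deriv j (\<psi> t)" for t
   by (rule H1_dq_tendsto[OF H inverse_Suc_seq(2) inverse_Suc_ne])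
  have "(\<lambda>t. weak_deriv j (\<psi> t)) \<in> borel_measurable borel"
   by (rule borel_measurable_LIMSEQ_metric[OF _ lim]) measurable
  from Lp_n4_liminf[OF XD(6)[OF X] lim L4_dq[OF XD(7)[OF X]] _ this] show ?thesis
   by (intro in_Lq_loc_LpI) auto
 qed
 have "interval_lebesgue_integrable lborel 0 (ereal t) (\<lambda>s. S (t - s) (N (\<psi> s))) \<and>
   \<psi> t = S t \<psi>0 - J (LBINT s=0..ereal t. S (t - s) (N (\<psi> s)))" for t
  using interval_Duh[OF X_good(2)[OF X], of t "\<lambda>s. N (\<psi> s)"] fp[of t] by (simp add: Phi_def S_diff S_const_mult)
 note duhamel = this
 have "is_interval (UNIV :: real set)" "open (UNIV :: real set)" "0 \<in> (UNIV :: real set)" by auto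
 moreover have "\<forall>t\<in>UNIV. \<psi> t \<in> H1" "\<forall>t\<in>UNIV. ((\<lambda>s. H1_norm (\<psi> s - \<psi> t)) \<longlongrightarrow> 0) (at t within UNIV)"
  using H cont by auto
 ultimately show ?thesis unfolding solution_def using L wL duhamel by (intro conjI ballI allI; fast)
qed

text \<open>The tail of a convergent integral tends to 0. The sign \<sigma> treats both directions
  of time at once.\<close>

lemma X_tail:
 assumes X: "X R \<psi>" and \<sigma>: "\<sigma> = 1 \<or> \<sigma> = -1"
 obtains w where "(w \<longlongrightarrow> 0) at_top" "\<And>T. L83 (\<lambda>s. indicator {s. T \<le> \<sigma> * s} s * n4 (\<psi> s)) (w T)"
proof -
 note [measurable] = XD(2)[OF X]
 define I where "I T = (\<integral>s. indicator {s. T \<le> \<sigma> * s} s * n4 (\<psi> s) powr (8 / 3) \<partial>lborel)" for T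
 have i: "integrable lborel (\<lambda>s. n4 (\<psi> s) powr (8 / 3))"
  by (rule integrableI_bounded) (use Lp_leD(3)[OF XD(5)[OF X]] in \<open>simp_all add: n4_nonneg le_less_trans\<close>)
 have iT: "integrable lborel (\<lambda>s. indicator {s. T \<le> \<sigma> * s} s * n4 (\<psi> s) powr (8 / 3))" for T
  using integrable_mult_indicator[OF _ i, of "{s. T \<le> \<sigma> * s}"] by simp
 have I0: "0 \<le> I T" for T unfolding I_def by (intro integral_nonneg_AE AE_I2) (simp add: mult_nonneg_nonneg)
 have "(I \<longlongrightarrow> (\<integral>s. (0::real) \<partial>(lborel :: real measure))) at_top"
  unfolding I_def
 proof (rule integral_dominated_convergence_at_top[OF _ _ i])
  show "AE s in lborel. ((\<lambda>T. indicator {s. T \<le> \<sigma> * s} s * n4 (\<psi> s) powr (8 / 3)) \<longlongrightarrow> 0) at_top"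
  proof (rule AE_I2)
   fix s
   show "((\<lambda>T. indicator {s. T \<le> \<sigma> * s} s * n4 (\<psi> s) powr (8 / 3)) \<longlongrightarrow> 0) at_top"
    by (rule tendsto_eventually) (use eventually_gt_at_top[of "\<sigma> * s"] in \<open>eventually_elim, simp\<close>)
  qed
 qed (auto intro!: always_eventually AE_I2 split: split_indicator)
 hence lI: "(I \<longlongrightarrow> 0) at_top" by simp
 show ?thesis
 proof
  show "((\<lambda>T. I T powr (3 / 8)) \<longlongrightarrow> 0) at_top"
   by (rule tendsto_zero_powrI[OF lI tendsto_const]) (simp_all add: I0)
  fix T
  have "(\<integral>\<^sup>+s. ennreal (\<bar>indicator {s. T \<le> \<sigma> * s} s * n4 (\<psi> s)\<bar> powr (8 / 3)) \<partial>lborel)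
   = (\<integral>\<^sup>+s. ennreal (indicator {s. T \<le> \<sigma> * s} s * n4 (\<psi> s) powr (8 / 3)) \<partial>lborel)"
   by (intro nn_integral_cong) (auto simp: n4_nonneg split: split_indicator)
  also have "\<dots> = ennreal (I T)" unfolding I_def by (intro nn_integral_eq_integral iT AE_I2) (simp add: mult_nonneg_nonneg)
  finally show "L83 (\<lambda>s. indicator {s. T \<le> \<sigma> * s} s * n4 (\<psi> s)) (I T powr (3 / 8))"
   using I0[of T] by (simp add: Lp_le_def powr_powr)
 qed
qed

lemma scattering:
 assumes X: "X R \<psi>" and fp: "\<And>t. \<psi> t = Phi \<psi>0 \<psi> t" and \<sigma>: "\<sigma> = 1 \<or> \<sigma> = -1"
 shows "\<exists>\<psi>p\<in>H1. ((\<lambda>t. H1_norm (\<psi> (\<sigma> * t) - S (\<sigma> * t) \<psi>p)) \<longlongrightarrow> 0) at_top"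
proof -
 obtain w where w: "(w \<longlongrightarrow> 0) at_top"
  "\<And>T. L83 (\<lambda>s. indicator {s. T \<le> \<sigma> * s} s * n4 (\<psi> s)) (w T)"
  using X_tail[OF X \<sigma>] by blast
 note [measurable] = XD(2)[OF X]
 define D where "D t = DN \<psi> (\<sigma> * t)" for t
 define b where "b T = 30 * CW * kap R (w T) * R" for T
 have "((\<lambda>T. w T powr (2 / 3)) \<longlongrightarrow> 0) at_top"
  by (rule tendsto_zero_powrI[OF w(1) tendsto_const]) (use Lp_leD(2)[OF w(2)] in simp_all)
 hence b0: "(b \<longlongrightarrow> 0) at_top"
  unfolding b_def kap_def by (auto intro!: tendsto_mult_right_zero tendsto_mult_left_zero)
 have win: "L83 (\<lambda>s. indicator {p<..q} s * n4 (\<psi> s)) (w T)" if "{p<..q} \<subseteq> {s. T \<le> \<sigma> * s}" for p q T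
  by (rule Lp_le_mono_AE[OF w(2)]) (use that in \<open>auto intro!: AE_I2 split: split_indicator\<close>)
 have inc: "norm (D t - D T) \<le> b T" "norm (dq j h (D t - D T)) \<le> b T" if "T \<le> t" for t T j h
 proof -
  have "norm (D t - D T) \<le> b T \<and> norm (dq j h (D t - D T)) \<le> b T"
  proof (cases "\<sigma> = 1")
   case True
   have "{T<..t} \<subseteq> {s. T \<le> \<sigma> * s}" using True by auto
   from X_inc[OF X \<open>T \<le> t\<close> win[OF this]] show ?thesis by (simp add: D_def b_def True)
  next
   case False
   hence s: "\<sigma> = -1" using \<sigma> by simp
   have "{- t<..- T} \<subseteq> {s. T \<le> \<sigma> * s}" "- t \<le> - T" using s that by auto
   from X_inc[OF X this(2) win[OF this(1)]] show ?thesis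
    by (simp add: D_def b_def s norm_minus_commute norm_dq_commute[where y = "Duh _ (- T)"])
  qed
  thus "norm (D t - D T) \<le> b T" "norm (dq j h (D t - D T)) \<le> b T" by auto
 qed
 have bn: "(\<lambda>n. b (real n)) \<longlonglongrightarrow> 0" by (rule filterlim_compose[OF b0 filterlim_real_sequentially])
 have "Cauchy (\<lambda>n. D (real n))"
 proof (rule CauchyI)
  fix e :: real assume "0 < e"
  then obtain M where M: "b (real M) < e / 2"
   using order_tendstoD(2)[OF bn, of "e / 2"] by (auto simp: eventually_sequentially)
  have "norm (D (real m) - D (real n)) < e" if "M \<le> m" "M \<le> n" for m n
   using inc(1)[of "real M" "real m"] inc(1)[of "real M" "real n"] M that
    norm_triangle_ineq4[of "D (real m) - D (real M)" "D (real n) - D (real M)"] by simp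
  thus "\<exists>M. \<forall>m\<ge>M. \<forall>n\<ge>M. norm (D (real m) - D (real n)) < e" by blast
 qed
 then obtain Di where Di: "(\<lambda>n. D (real n)) \<longlonglongrightarrow> Di" using Cauchy_convergent convergent_def by blast
 have lin: "bounded_linear (dq j h)" for j h by (rule bounded_linear_dq)
 have inf: "norm (Di - D T) \<le> b T" "norm (dq j h (Di - D T)) \<le> b T" for T j h
 proof -
  obtain n0 :: nat where n0: "T \<le> real n0" using real_arch_simple by blast
  have 1: "(\<lambda>n. D (real n) - D T) \<longlonglongrightarrow> Di - D T" by (intro tendsto_intros Di)
  show "norm (Di - D T) \<le> b T"
   by (rule LIMSEQ_le_const2[OF tendsto_norm[OF 1]]) (use n0 in \<open>auto intro!: exI[of _ n0] inc\<close>)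
  show "norm (dq j h (Di - D T)) \<le> b T"
   by (rule LIMSEQ_le_const2[OF tendsto_norm[OF bounded_linear.tendsto[OF lin 1]]])
     (use n0 in \<open>auto intro!: exI[of _ n0] inc\<close>)
 qed
 \<comment> \<open>With this choice the distance to the free solution is, up to a unitary factor,
   exactly the missing part Di - D t of the Duhamel integral.\<close>
 define \<psi>p where "\<psi>p = \<psi>0 - J Di"
 have e: "\<psi> (\<sigma> * t) - S (\<sigma> * t) \<psi>p = S (\<sigma> * t) (J (Di - D t))" for t
  by (subst fp) (simp add: Phi_def \<psi>p_def D_def S_diff J_diff)
 have F: "Fder j (\<psi> (\<sigma> * t) - S (\<sigma> * t) \<psi>p) (b t)" "norm (\<psi> (\<sigma> * t) - S (\<sigma> * t) \<psi>p) \<le> b t" for t j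
  unfolding e using inf(1)[of t] inf(2)[where T = t] by (auto intro!: Fder_dqI simp: S_dq[symmetric] dq_const_mult[symmetric])
 \<comment> \<open>At time 0 the free solution is \<psi>p itself, written as the solution minus a
   difference that has just been bounded.\<close>
 have "S (\<sigma> * 0) \<psi>p \<in> H1"
 proof (rule H1_normI(1)[where M = "R + b 0"])
  have e2: "S (\<sigma> * 0) \<psi>p = \<psi> (\<sigma> * 0) - (\<psi> (\<sigma> * 0) - S (\<sigma> * 0) \<psi>p)" by simp
  show "norm (S (\<sigma> * 0) \<psi>p) \<le> R + b 0"
   by (subst e2, rule order_trans[OF norm_triangle_ineq4]) (rule add_mono[OF XD(3)[OF X] F(2)])
  show "Fder j (S (\<sigma> * 0) \<psi>p) (R + b 0)" for j
  proof (rule Fder_dqI)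
   fix h
   show "norm (dq j h (S (\<sigma> * 0) \<psi>p)) \<le> R + b 0"
    by (subst e2, subst linear_diff[OF bounded_linear.linear[OF lin]], rule order_trans[OF norm_triangle_ineq4])
      (rule add_mono[OF XD(4)[OF X] Fder_dq_le[OF F(1)]])
  qed
 qed
 hence "\<psi>p \<in> H1" by simp
 moreover have "((\<lambda>t. H1_norm (\<psi> (\<sigma> * t) - S (\<sigma> * t) \<psi>p)) \<longlongrightarrow> 0) at_top"
 proof -
  have l0: "((\<lambda>t. 2 * b t) \<longlongrightarrow> 0) at_top" using tendsto_mult_right_zero[OF b0] .
  show ?thesis
   by (rule tendsto_sandwich[OF _ _ tendsto_const l0])
     (simp_all add: H1_normI(2)[OF F(2) F(1)] always_eventually order_trans[OF norm_ge_zero H1_norm_ge(1)])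
 qed
 ultimately show ?thesis by blast
qed

end

section \<open>Uniqueness\<close>

lemma n4_eq_0:
 assumes "L4 f" "n4 f = 0" shows "f = 0"
proof -
 have "(\<integral>\<^sup>+x. ennreal (mag f x powr 4) \<partial>lborel) = 0"
  using Lp_leD(3)[OF L4_n4[OF assms(1)]] assms(2) by simp
 hence "AE x in lborel. ennreal (mag f x powr 4) = 0"
  by (subst (asm) nn_integral_0_iff_AE) auto
 hence "AE x in lborel. rep_L2 f x = rep_L2 0 x"
  using rep_zero by eventually_elim (simp add: ennreal_eq_0_iff)
 thus ?thesis by (rule L2_eqI)
qed

lemma nn_integral_sign:
 fixes f :: "real \<Rightarrow> ennreal"
 assumes [measurable]: "f \<in> borel_measurable borel" and "\<sigma> = 1 \<or> \<sigma> = -1"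
 shows "(\<integral>\<^sup>+r. f (\<sigma> * r) \<partial>lborel) = (\<integral>\<^sup>+r. f r \<partial>lborel)"
 using assms(2) nn_integral_shift_reflect[OF assms(1), of 0] by auto

lemma H1_continuousD:
 assumes H: "\<And>t. t \<in> I \<Longrightarrow> \<psi> t \<in> H1" and c: "\<And>t. t \<in> I \<Longrightarrow> ((\<lambda>s. H1_norm (\<psi> s - \<psi> t)) \<longlongrightarrow> 0) (at t within I)"
 shows "continuous_on I \<psi>" "continuous_on I (\<lambda>t. weak_deriv j (\<psi> t))"
proof -
 have ev: "\<forall>\<^sub>F s in at t within I. s \<in> I" for t by (simp add: eventually_at_filter)
 have "((\<lambda>s. norm (\<psi> s - \<psi> t)) \<longlongrightarrow> 0) (at t within I)" if "t \<in> I" for t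
  by (rule tendsto_sandwich[OF _ _ tendsto_const c[OF that]]) (simp_all add: H1_norm_ge always_eventually)
 thus "continuous_on I \<psi>" by (simp add: continuous_on_def tendsto_norm_zero_iff LIM_zero_iff)
 have "((\<lambda>s. norm (weak_deriv j (\<psi> s) - weak_deriv j (\<psi> t))) \<longlongrightarrow> 0) (at t within I)" if "t \<in> I" for t
 proof (rule tendsto_sandwich[OF _ _ tendsto_const c[OF that]])
  show "\<forall>\<^sub>F s in at t within I. norm (weak_deriv j (\<psi> s) - weak_deriv j (\<psi> t)) \<le> H1_norm (\<psi> s - \<psi> t)"
   using ev
  proof eventually_elim
   case (elim s)
   show ?case using H1_norm_ge(2)[of j "\<psi> s - \<psi> t"] by (simp add: weak_deriv_diff[OF H[OF elim] H[OF that]])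
  qed
 qed simp
 thus "continuous_on I (\<lambda>t. weak_deriv j (\<psi> t))" by (simp add: continuous_on_def tendsto_norm_zero_iff LIM_zero_iff)
qed

lemma bounded_on_Icc:
 fixes f :: "real \<Rightarrow> 'a::real_normed_vector"
 assumes "continuous_on I f" "{a..b} \<subseteq> I" shows "\<exists>K. \<forall>s\<in>{a..b}. norm (f s) \<le> K"
 using compact_imp_bounded[OF compact_continuous_image[OF continuous_on_subset[OF assms] compact_Icc]]
 unfolding bounded_iff by blast

lemma solutionD:
 assumes "solution lam1 lam2 \<psi>0 I \<psi>"
 shows "is_interval I" "0 \<in> I" "t \<in> I \<Longrightarrow> \<psi> t \<in> H1"
  "t \<in> I \<Longrightarrow> ((\<lambda>s. H1_norm (\<psi> s - \<psi> t)) \<longlongrightarrow> 0) (at t within I)"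
  "in_Lq_loc_Lp I (8 / 3) 4 (\<lambda>t. weak_deriv j (\<psi> t))"
  "t \<in> I \<Longrightarrow> \<psi> t = S t \<psi>0 - J (LBINT s=0..ereal t. S (t - s) (nonlinearity lam1 lam2 (\<psi> s)))"
 using assms unfolding solution_def by blast+

context dipolar
begin

text \<open>Cut off to 0 outside a compact window, an arbitrary solution obeys global bounds; 0 is
  \<open>good\<close> with nonlinearity 0, so the cut-off is harmless. The L^(8/3) L^4 condition on
  the weak derivatives enters through \<open>dq_lp\<close>, which turns it into the bounds on
  quotients that \<open>good_AE\<close> asks for.\<close>

lemma solution_window:
 assumes sol: "solution lam1 lam2 \<psi>0 I \<psi>" and ab: "{a..b} \<subseteq> I"
 defines "\<psi>' \<equiv> \<lambda>s. if s \<in> {a..b} then \<psi> s else 0"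
 shows "\<exists>K. \<forall>t. L4 (\<psi>' t) \<and> n4 (\<psi>' t) \<le> K" "\<psi>' \<in> borel_measurable borel" "AE t in lborel. good (\<psi>' t)" "locint (\<lambda>t. N (\<psi>' t))"
proof -
 note H = solutionD(3)[OF sol] and c = solutionD(4)[OF sol] and wL = solutionD(5)[OF sol]
 note cont = H1_continuousD[OF H c]
 obtain K0 where K0: "\<And>s. s \<in> {a..b} \<Longrightarrow> norm (\<psi> s) \<le> K0" using bounded_on_Icc[OF cont(1) ab] by blast
 have "\<exists>K. \<forall>s\<in>{a..b}. norm (weak_deriv j (\<psi> s)) \<le> K" for j
  by (rule bounded_on_Icc[OF cont(2) ab])
 then obtain K1 where K1: "\<And>j s. s \<in> {a..b} \<Longrightarrow> norm (weak_deriv j (\<psi> s)) \<le> K1 j" by metis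
 define K where "K = \<bar>K0\<bar> + (\<Sum>j\<in>UNIV. \<bar>K1 j\<bar>)"
 have K: "0 \<le> K" by (simp add: K_def sum_nonneg)
 have d0: "dq j h 0 = 0" for j h by (rule dq_zero)
 have lpK: "lp 4 (\<psi>' t) (CS * K)" for t
 proof (rule CS_dq)
  have "\<bar>K0\<bar> \<le> K" by (simp add: K_def sum_nonneg)
  thus "norm (\<psi>' t) \<le> K" using K0[of t] K by (auto simp: \<psi>'_def)
  fix j h
  have "\<bar>K1 j\<bar> \<le> (\<Sum>j\<in>UNIV. \<bar>K1 j\<bar>)" by (rule member_le_sum) auto
  hence "\<bar>K1 j\<bar> \<le> K" by (simp add: K_def)
  moreover have "norm (dq j h (\<psi> t)) \<le> \<bar>K1 j\<bar>" if "t \<in> {a..b}"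
  proof -
   have "norm (dq j h (\<psi> t)) \<le> norm (weak_deriv j (\<psi> t))" by (rule H1_dq_le[OF H]) (use that ab in blast)
   with K1[OF that, of j] show ?thesis by linarith
  qed
  ultimately show "norm (dq j h (\<psi>' t)) \<le> K" using K by (auto simp: \<psi>'_def d0)
 qed
 hence L: "L4 (\<psi>' t)" "n4 (\<psi>' t) \<le> CS * K" for t by (auto intro: L4I n4_le)
 thus "\<exists>K. \<forall>t. L4 (\<psi>' t) \<and> n4 (\<psi>' t) \<le> K" by blast
 show m [measurable]: "\<psi>' \<in> borel_measurable borel"
  unfolding \<psi>'_def
  by (rule borel_measurable_continuous_on_if[OF _ continuous_on_subset[OF cont(1) ab] continuous_on_const]) simp
 define E where "E j = (\<integral>\<^sup>+t. ennreal (indicator {a..b} t *\<^sub>R (n4 (weak_deriv j (\<psi> t)) powr (8 / 3))) \<partial>lborel)" for j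
 have si: "set_integrable lborel {a..b} (\<lambda>t. n4 (weak_deriv j (\<psi> t)) powr (8 / 3))"
  and wp: "AE t in lborel. t \<in> {a..b} \<longrightarrow> in_Lp 4 (rep_L2 (weak_deriv j (\<psi> t)))" for j
  using in_Lq_loc_Lp_def[THEN iffD1, OF wL, THEN spec, THEN spec, THEN mp, OF ab, of j] unfolding n4_def by (rule conjunct2, rule conjunct1)
 have Ef: "E j < \<infinity>" for j
  using integrableD(2)[OF si[of j, unfolded set_integrable_def]] by (simp add: E_def less_top)
 define D where "D = enn2real (emeasure lborel {a..b} + (\<Sum>j\<in>UNIV. E j))"
 have sf: "emeasure lborel {a..b} + (\<Sum>j\<in>UNIV. E j) < \<infinity>"
  using Ef by (simp add: ennreal_add_less_top emeasure_lborel_Icc_eq less_top)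
 have Db: "(\<integral>\<^sup>+t. ennreal (n4 (dq j (inverse (real (Suc n))) (\<psi>' t))) * indicator {a..b} t \<partial>lborel) \<le> ennreal D" for j n
 proof -
  let ?w = "\<lambda>t. indicator {a..b} t *\<^sub>R (n4 (weak_deriv j (\<psi> t)) powr (8 / 3))"
  have [measurable]: "?w \<in> borel_measurable borel"
   using borel_measurable_integrable[OF si[unfolded set_integrable_def]] by simp
  have "(\<integral>\<^sup>+t. ennreal (n4 (dq j (inverse (real (Suc n))) (\<psi>' t))) * indicator {a..b} t \<partial>lborel)
   \<le> (\<integral>\<^sup>+t. indicator {a..b} t + ennreal (?w t) \<partial>lborel)"
  proof (rule nn_integral_mono_AE, use wp[of j] in eventually_elim)
   case (elim t)
   show ?case
   proof (cases "t \<in> {a..b}")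
    case True
    let ?x = "n4 (weak_deriv j (\<psi> t))"
    have "L4 (weak_deriv j (\<psi> t))" using elim True by (auto intro: in_Lp_L4)
    from dq_lp[OF H1_dq_tendsto[OF H] L4_n4[OF this] _ inverse_Suc_ne] True ab
    have "n4 (dq j (inverse (real (Suc n))) (\<psi> t)) \<le> ?x" by (intro n4_le) auto
    hence "ennreal (n4 (dq j (inverse (real (Suc n))) (\<psi> t))) \<le> ennreal ?x" by (rule ennreal_leI)
    also have "\<dots> \<le> 1 + ennreal (?x powr (8 / 3))" by (rule ennreal_le_1_plus_powr)
    finally show ?thesis using True by (simp add: \<psi>'_def)
   qed simp
  qed
  also have "\<dots> = (\<integral>\<^sup>+t. indicator {a..b} t \<partial>lborel) + E j" unfolding E_def by (rule nn_integral_add) measurable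
  also have "(\<integral>\<^sup>+t. indicator {a..b} t \<partial>lborel) = emeasure lborel {a..b}" by simp
  also have "emeasure lborel {a..b} + E j \<le> emeasure lborel {a..b} + (\<Sum>j\<in>UNIV. E j)" by (intro add_mono member_le_sum) auto
  also have "\<dots> = ennreal D" using sf by (simp add: D_def)
  finally show ?thesis .
 qed
 note g = good_AE[OF m L Db]
 show "AE t in lborel. good (\<psi>' t)" using g(1) by eventually_elim (auto simp: \<psi>'_def good_zero)
 have i: "integrable lborel (\<lambda>t. N (\<psi>' t))"
 proof -
  have "(\<lambda>t. indicator {a..b} t *\<^sub>R N (\<psi>' t)) = (\<lambda>t. N (\<psi>' t))"
   by (auto simp: \<psi>'_def N_zero fun_eq_iff)
  with g(2) show ?thesis by (simp add: set_integrable_def)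
 qed
 thus "locint (\<lambda>t. N (\<psi>' t))"
  unfolding locint_def set_integrable_def by (auto intro: integrable_mult_indicator)
qed

text \<open>The competing solution need not be small: on a compact window both solutions are bounded
  in L^4, so the difference of the nonlinearities is controlled linearly by \<open>d\<close> and
  only the singular kernel remains. The two agree on the whole interval of the competitor.\<close>

lemma solution_unique:
 assumes X: "X R \<phi>" and fp: "\<And>t. \<phi> t = Phi \<psi>0 \<phi> t" and sol: "solution lam1 lam2 \<psi>0 I \<psi>" and t: "t \<in> I"
 shows "\<psi> t = \<phi> t"
proof -
 \<comment> \<open>Reflecting time by \<sigma> reduces t < 0 to the forward Gronwall lemma.\<close>
 define \<sigma> :: real where "\<sigma> = (if 0 \<le> t then 1 else -1)"
 define T where "T = \<bar>t\<bar>"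
 have \<sigma>: "\<sigma> = 1 \<or> \<sigma> = -1" "\<sigma> * T = t" "0 \<le> T" by (auto simp: \<sigma>_def T_def)
 have I: "{min 0 t..max 0 t} \<subseteq> I"
 proof
  fix s assume s: "s \<in> {min 0 t..max 0 t}"
  note mem = mem_is_interval_1_I[OF solutionD(1)[OF sol]]
  show "s \<in> I"
   using mem[OF solutionD(2)[OF sol] t, of s] mem[OF t solutionD(2)[OF sol], of s] s by (cases "0 \<le> t") auto
 qed
 define \<psi>' where "\<psi>' s = (if s \<in> {min 0 t..max 0 t} then \<psi> s else 0)" for s
 note win = solution_window[OF sol I, folded \<psi>'_def]
 obtain K where K: "\<And>t. L4 (\<psi>' t)" "\<And>t. n4 (\<psi>' t) \<le> K" using win(1) by blast
 note [measurable] = win(2) XD(2)[OF X]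
 let ?H = "\<lambda>s. N (\<psi>' s) - N (\<phi> s)"
 note G1 = win(4) and G2 = X_good(2)[OF X]
 note H = locint_diff[OF G1 G2]
 define d where "d s = n4 (\<psi>' s - \<phi> s)" for s
 have d0: "0 \<le> d s" for s by (simp add: d_def n4_nonneg)
 have [measurable]: "d \<in> borel_measurable borel" unfolding d_def by measurable
 have L4d: "L4 (\<psi>' s - \<phi> s)" for s by (intro L4_diff K XD(7)[OF X])
 define m where "m = max K (CS * R)"
 define \<gamma> where "\<gamma> s = 3 * CW * m\<^sup>2 * d s" for s
 have \<gamma>0: "0 \<le> \<gamma> s" for s using CW_nonneg d0 by (simp add: \<gamma>_def)
 have lpH: "AE s in lborel. lp (4 / 3) (?H s) (\<gamma> s)"
  using win(3) X_good(1)[OF X]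
 proof eventually_elim
  case (elim s)
  show ?case unfolding \<gamma>_def d_def
   by (rule N_diff_lp[OF elim]) (use K(2)[of s] XD(8)[OF X, of s] in \<open>auto simp: m_def\<close>)
 qed
 have e: "\<psi>' s - \<phi> s = - J (S s (Duh ?H s))" if s: "s \<in> {min 0 t..max 0 t}" for s
 proof -
  have "(LBINT r=0..ereal s. S (s - r) (N (\<psi> r))) = S s (Duh (\<lambda>r. N (\<psi>' r)) s)"
   by (rule interval_Duh(2)[OF G1]) (use s in \<open>auto simp: \<psi>'_def\<close>)
  moreover have "s \<in> I" using s I by auto
  ultimately have "\<psi> s = S s \<psi>0 - J (S s (Duh (\<lambda>r. N (\<psi>' r)) s))" using solutionD(6)[OF sol, of s] by simp
  moreover have "\<phi> s = S s \<psi>0 - J (S s (Duh (\<lambda>r. N (\<phi> r)) s))"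
   using fp[of s] by (simp add: Phi_def S_diff S_const_mult)
  moreover have "\<psi>' s = \<psi> s" using s unfolding \<psi>'_def by (rule if_P)
  ultimately show ?thesis unfolding Duh_diff[OF G1 G2, symmetric] by (simp add: S_diff J_diff)
 qed
 have main: "ennreal (d s) \<le> ennreal (3 * CW * m\<^sup>2) * (\<integral>\<^sup>+r. ennreal (\<bar>ort s r\<bar> * d r * ker (s - r)) \<partial>lborel)"
  if s: "s \<in> {min 0 t..max 0 t}" for s
 proof -
  let ?x = "S s (Duh ?H s)"
  \<comment> \<open>Solving \<open>e\<close> for the Duhamel term exhibits it as an element of L^4,
    which \<open>n4_Duh\<close> takes as a hypothesis.\<close>
  have "J (J ?x) = - ?x" by (simp add: L2_mult_mult[OF bdd_mult_const bdd_mult_const] L2_mult_minus_one)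
  hence x: "?x = J (\<psi>' s - \<phi> s)"
   unfolding e[OF s] linear_neg[OF bounded_linear.linear[OF bounded_linear_J]] by simp
  hence L4x: "L4 ?x" using L4_J[OF L4d] by simp
  have "d s \<le> n4 ?x" unfolding d_def e[OF s] using n4_add_J[OF L4_zero L4x] by simp
  hence "ennreal (d s) \<le> ennreal (n4 ?x)" by (rule ennreal_leI)
  also have "\<dots> \<le> (\<integral>\<^sup>+r. ennreal (\<bar>ort s r\<bar> * \<gamma> r * ker (s - r)) \<partial>lborel)"
   by (rule n4_Duh[OF H _ \<gamma>0 lpH L4x]) (simp add: \<gamma>_def)
  also have "\<dots> = (\<integral>\<^sup>+r. ennreal (3 * CW * m\<^sup>2) * ennreal (\<bar>ort s r\<bar> * d r * ker (s - r)) \<partial>lborel)"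
  proof (rule nn_integral_cong)
   fix r
   have "\<bar>ort s r\<bar> * \<gamma> r * ker (s - r) = (3 * CW * m\<^sup>2) * (\<bar>ort s r\<bar> * d r * ker (s - r))" by (simp add: \<gamma>_def)
   thus "ennreal (\<bar>ort s r\<bar> * \<gamma> r * ker (s - r)) = ennreal (3 * CW * m\<^sup>2) * ennreal (\<bar>ort s r\<bar> * d r * ker (s - r))"
    using CW_nonneg by (simp only: ennreal_mult' mult_nonneg_nonneg zero_le_numeral zero_le_power2)
  qed
  also have "\<dots> = ennreal (3 * CW * m\<^sup>2) * (\<integral>\<^sup>+r. ennreal (\<bar>ort s r\<bar> * d r * ker (s - r)) \<partial>lborel)"
   by (rule nn_integral_cmult) measurable
  finally show ?thesis .
 qed
 have "d (\<sigma> * T) = 0"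
 proof (rule singular_gronwall[of "\<lambda>s. d (\<sigma> * s)" T "K + CS * R" "3 * CW * m\<^sup>2" T])
  show "d (\<sigma> * s) \<le> K + CS * R" for s
   unfolding d_def using n4_diff[OF K(1) XD(7)[OF X]] K(2)[of "\<sigma> * s"] XD(8)[OF X, of "\<sigma> * s"] by (smt (verit))
  fix s assume s: "0 \<le> s" "s \<le> T"
  hence "\<sigma> * s \<in> {min 0 t..max 0 t}" by (auto simp: \<sigma>_def T_def)
  from main[OF this] have "ennreal (d (\<sigma> * s)) \<le> ennreal (3 * CW * m\<^sup>2) * (\<integral>\<^sup>+r. ennreal (\<bar>ort (\<sigma> * s) r\<bar> * d r * ker (\<sigma> * s - r)) \<partial>lborel)" .
  also have "(\<integral>\<^sup>+r. ennreal (\<bar>ort (\<sigma> * s) r\<bar> * d r * ker (\<sigma> * s - r)) \<partial>lborel)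
   = (\<integral>\<^sup>+r. ennreal (\<bar>ort (\<sigma> * s) (\<sigma> * r)\<bar> * d (\<sigma> * r) * ker (\<sigma> * s - \<sigma> * r)) \<partial>lborel)"
   by (rule nn_integral_sign[OF _ \<sigma>(1), symmetric]) measurable
  also have "\<dots> \<le> (\<integral>\<^sup>+r. ennreal (ker (s - r) * d (\<sigma> * r)) * indicator {0..s} r \<partial>lborel)"
  proof (rule nn_integral_mono)
   fix r
   have "\<bar>ort (\<sigma> * s) (\<sigma> * r)\<bar> \<le> indicator {0..s} r"
    using \<sigma>(1) s by (auto simp: ort_def split: split_indicator)
   moreover have "ker (\<sigma> * s - \<sigma> * r) = ker (s - r)" using \<sigma>(1) by (auto simp: ker_def abs_minus_commute)
   ultimately have "\<bar>ort (\<sigma> * s) (\<sigma> * r)\<bar> * d (\<sigma> * r) * ker (\<sigma> * s - \<sigma> * r) \<le> indicator {0..s} r * d (\<sigma> * r) * ker (s - r)"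
    by (simp add: mult_right_mono d0 ker_nonneg)
   hence "ennreal (\<bar>ort (\<sigma> * s) (\<sigma> * r)\<bar> * d (\<sigma> * r) * ker (\<sigma> * s - \<sigma> * r)) \<le> ennreal (indicator {0..s} r * d (\<sigma> * r) * ker (s - r))"
    by (rule ennreal_leI)
   also have "\<dots> = ennreal (ker (s - r) * d (\<sigma> * r)) * indicator {0..s} r"
    by (cases "r \<in> {0..s}") (simp_all add: mult.commute)
   finally show "ennreal (\<bar>ort (\<sigma> * s) (\<sigma> * r)\<bar> * d (\<sigma> * r) * ker (\<sigma> * s - \<sigma> * r)) \<le> ennreal (ker (s - r) * d (\<sigma> * r)) * indicator {0..s} r" .
  qed
  finally show "ennreal (d (\<sigma> * s)) \<le> ennreal (3 * CW * m\<^sup>2) * (\<integral>\<^sup>+r. ennreal (ker (s - r) * d (\<sigma> * r)) * indicator {0..s} r \<partial>lborel)"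
   by (simp add: mult_left_mono)
 qed (use d0 \<sigma> CW_nonneg in auto)
 hence "\<psi>' t - \<phi> t = 0" using L4d[of t] by (intro n4_eq_0) (simp_all add: d_def \<sigma>(2))
 thus ?thesis by (simp add: \<psi>'_def)
qed

theorem small_data_scattering:
 "\<exists>\<delta>>0. \<forall>\<psi>0\<in>H1. H1_norm \<psi>0 < \<delta> \<longrightarrow>
  (\<exists>I \<psi>. maximal_solution lam1 lam2 \<psi>0 I \<psi>) \<and>
  (\<forall>I \<psi>. maximal_solution lam1 lam2 \<psi>0 I \<psi> \<longrightarrow>
    I = UNIV \<and>
    (\<exists>\<psi>p\<in>H1. ((\<lambda>t. H1_norm (\<psi> t - S t \<psi>p)) \<longlongrightarrow> 0) at_top) \<and>
    (\<exists>\<psi>m\<in>H1. ((\<lambda>t. H1_norm (\<psi> t - S t \<psi>m)) \<longlongrightarrow> 0) at_bot))"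
proof -
 \<comment> \<open>Both R and 8 c0 R are then at most 1, hence so is 8 c0 R^2.\<close>
 define R where "R = 1 / (1 + 8 * c0)"
 have R0: "0 < R" using c0_nonneg by (simp add: R_def)
 have c: "8 * c0 * R\<^sup>2 \<le> 1"
 proof -
  have "8 * c0 * R \<le> 1" "R \<le> 1" using c0_nonneg by (auto simp: R_def divide_simps)
  hence "(8 * c0 * R) * R \<le> 1 * 1" using R0 c0_nonneg by (intro mult_mono) auto
  thus ?thesis by (simp add: power2_eq_square mult_ac)
 qed
 have "(\<exists>I \<psi>. maximal_solution lam1 lam2 \<psi>0 I \<psi>) \<and>
  (\<forall>I \<psi>. maximal_solution lam1 lam2 \<psi>0 I \<psi> \<longrightarrow>
    I = UNIV \<and>
    (\<exists>\<psi>p\<in>H1. ((\<lambda>t. H1_norm (\<psi> t - S t \<psi>p)) \<longlongrightarrow> 0) at_top) \<and>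
    (\<exists>\<psi>m\<in>H1. ((\<lambda>t. H1_norm (\<psi> t - S t \<psi>m)) \<longlongrightarrow> 0) at_bot))"
  if H: "\<psi>0 \<in> H1" and small: "H1_norm \<psi>0 < R / 20" for \<psi>0
 proof -
  have e: "norm \<psi>0 \<le> R / 20" "norm (dq j h \<psi>0) \<le> R / 20" for j h
   using H1_norm_ge(1)[of \<psi>0] H1_norm_ge(2)[of j \<psi>0] H1_dq_le[OF H, of j h] small by auto
  \<comment> \<open>Data below R/20 use half of the radius through the Strichartz constant 10; the
    Duhamel term takes at most R/8 of what is left.\<close>
  have R1: "10 * (R / 20) + c0 * R\<^sup>2 * R \<le> R" using mult_right_mono[OF c, of R] R0 by (simp only: mult.assoc) linarith
  obtain \<phi> where X: "X R \<phi>" and fp: "\<And>t. \<phi> t = Phi \<psi>0 \<phi> t"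
   using fixed_point[OF e less_imp_le[OF R0] R1 c] by blast
  note sol = fixed_point_solution[OF X fp]
  \<comment> \<open>Any solution agrees with the global one on its interval, so the global one
    extends it, and maximality leaves no other interval than the whole line.\<close>
  have max: "I = UNIV \<and> \<psi> = \<phi>" if "maximal_solution lam1 lam2 \<psi>0 I \<psi>" for I \<psi>
  proof -
   have s: "solution lam1 lam2 \<psi>0 I \<psi>" using that by (simp add: maximal_solution_def)
   have "\<forall>t\<in>I. \<phi> t = \<psi> t" using solution_unique[OF X fp s] by simp
   with that sol have "I = UNIV" unfolding maximal_solution_def by blast
   thus ?thesis using \<open>\<forall>t\<in>I. \<phi> t = \<psi> t\<close> by auto
  qed
  have "maximal_solution lam1 lam2 \<psi>0 UNIV \<phi>" using sol by (auto simp: maximal_solution_def)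
  moreover have "\<exists>\<psi>p\<in>H1. ((\<lambda>t. H1_norm (\<phi> t - S t \<psi>p)) \<longlongrightarrow> 0) at_top"
   using scattering[OF X fp, of 1] by simp
  moreover have "\<exists>\<psi>m\<in>H1. ((\<lambda>t. H1_norm (\<phi> t - S t \<psi>m)) \<longlongrightarrow> 0) at_bot"
   using scattering[OF X fp, of "-1"] by (simp add: filterlim_at_bot_mirror)
  ultimately show ?thesis using max by blast
 qed
 thus ?thesis using R0 by (intro exI[of _ "R / 20"]) simp
qed

end

theorem theorem1p4:
  fixes lam1 lam2 :: real
  assumes "lam1 \<noteq> 0" "lam2 \<noteq> 0"
  shows "\<exists>\<delta>>0. \<forall>\<psi>0\<in>H1. H1_norm \<psi>0 < \<delta> \<longrightarrow>
    (\<exists>I \<psi>. maximal_solution lam1 lam2 \<psi>0 I \<psi>) \<and>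
    (\<forall>I \<psi>. maximal_solution lam1 lam2 \<psi>0 I \<psi> \<longrightarrow>
       I = UNIV \<and>
       (\<exists>\<psi>p\<in>H1. ((\<lambda>t. H1_norm (\<psi> t - schroedinger t \<psi>p)) \<longlongrightarrow> 0) at_top) \<and>
       (\<exists>\<psi>m\<in>H1. ((\<lambda>t. H1_norm (\<psi> t - schroedinger t \<psi>m)) \<longlongrightarrow> 0) at_bot))"
  using dipolar.small_data_scattering[OF dipolar.intro[OF assms(1)]] .

end
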